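(* Let $\lambda\in C^1([0,1]\times[0,\infty))$ with $\lambda>0$. Let $T>0$, $p\in[1,\infty)$, $y_d\in L^\infty(0,T)$, and let $\rho_0\in L^\infty(0,1)$ be nonnegative almost everywhere. Let $L^\infty_+(0,T)$ denote the set of functions in $L^\infty(0,T)$ that are nonnegative almost everywhere, and define $$J_p(u):=\|u\|_{L^\infty(0,T)}^2+\|y-y_d\|_{L^p(0,T)}^2,\qquad u\in L^\infty_+(0,T),$$ where $y(t):=\rho(t,1)\lambda(1,W(t))$ is the out-flux of the weak solution $\rho$ on $[0,T]$ of the Cauchy problem with initial datum $\rho_0$ and boundary datum (in-flux) $u$, and $W(t)=\int_0^1\rho(t,x)\,dx$. Then the infimum of $J_p$ in $L^\infty_+(0,T)$ is achieved, i.e., there exists $u^\infty\in L^\infty_+(0,T)$ such that $$J_p(u^\infty)=\inf_{u\in L^\infty_+(0,T)}J_p(u).$$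
   Context: The Cauchy problem with initial datum $\rho_0$ and boundary datum $u$ is $$\rho_t(t,x)+\big(\rho(t,x)\lambda(x,W(t))\big)_x=0,\quad W(t)=\int_0^1\rho(t,x)\,dx,\qquad 0\le t\le T,\ 0\le x\le 1,$$ $$\rho(0,x)=\rho_0(x)\ (0\le x\le 1),\qquad \rho(t,0)\lambda(0,W(t))=u(t)\ (0\le t\le T).$$ A weak solution is a function $\rho\in C^0([0,T];L^1(0,1))\cap L^\infty((0,T)\times(0,1))$ such that, with $W(t):=\int_0^1\rho(t,x)\,dx$ (where $W(t)\ge 0$ for all $t$, so that $\lambda(x,W(t))$ is defined), for every $\tau\in[0,T]$ and every $\varphi\in C^1([0,\tau]\times[0,1])$ with $\varphi(\tau,x)=0$ for all $x\in[0,1]$ and $\varphi(t,1)=0$ for all $t\in[0,\tau]$, one has $$\int_0^\tau\!\int_0^1\rho(t,x)\big(\varphi_t(t,x)+\lambda(x,W(t))\varphi_x(t,x)\big)\,dx\,dt+\int_0^\tau u(t)\varphi(t,0)\,dt+\int_0^1\rho_0(x)\varphi(0,x)\,dx=0.$$ For almost everywhere nonnegative data $\rho_0\in L^\infty(0,1)$ and $u\in L^\infty(0,T)$ a weak solution on $[0,T]$ exists, is unique, is nonnegative almost everywhere, belongs to $C^0([0,T];L^p(0,1))$ for all $p\in[1,\infty)$, and has a representative in $C^0([0,1];L^p(0,T))$ for all $p\in[1,\infty)$ (continuity in $x$ with values in $L^p$ in time), so that the trace $t\mapsto\rho(t,1)\in L^p(0,T)$ is well defined; the out-flux $y$ is understood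 in this sense. *)

theory Defs
  imports "HOL-Analysis.Analysis" "HOL-Probability.Essential_Supremum"
begin

text \<open>Elements of Lebesgue spaces are rendered by (Lebesgue measurable) representatives.\<close>

definition Lp :: "'a measure \<Rightarrow> real \<Rightarrow> ('a \<Rightarrow> real) set" where
  "Lp M p = {f \<in> borel_measurable M. integrable M (\<lambda>x. \<bar>f x\<bar> powr p)}"

definition Lp_norm :: "'a measure \<Rightarrow> real \<Rightarrow> ('a \<Rightarrow> real) \<Rightarrow> real" where
  "Lp_norm M p f = (\<integral>x. \<bar>f x\<bar> powr p \<partial>M) powr (1 / p)"

definition Linf :: "'a measure \<Rightarrow> ('a \<Rightarrow> real) set" where
  "Linf M = {f \<in> borel_measurable M. \<exists>C. AE x in M. \<bar>f x\<bar> \<le> C}"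

definition Linf_plus :: "'a measure \<Rightarrow> ('a \<Rightarrow> real) set" where
  "Linf_plus M = {f \<in> Linf M. AE x in M. 0 \<le> f x}"

definition Linf_norm :: "'a measure \<Rightarrow> ('a \<Rightarrow> real) \<Rightarrow> real" where
  "Linf_norm M f = real_of_ereal (esssup M (\<lambda>x. ereal \<bar>f x\<bar>))"

definition Lp_continuous_on ::
  "real set \<Rightarrow> 'a measure \<Rightarrow> real \<Rightarrow> (real \<Rightarrow> 'a \<Rightarrow> real) \<Rightarrow> bool" where
  "Lp_continuous_on S M p f \<longleftrightarrow>
     (\<forall>s\<in>S. f s \<in> Lp M p \<and>
        ((\<lambda>r. Lp_norm M p (\<lambda>x. f r x - f s x)) \<longlongrightarrow> 0) (at s within S))"

text \<open>\<open>C1_partials S f f1 f2\<close>: \<open>f\<close> is of class \<open>C\<^sup>1\<close> on \<open>S\<close> with partial derivatives \<open>f1\<close> and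
  \<open>f2\<close>. Derivatives are taken within \<open>S\<close>, hence one-sided at the boundary of a closed rectangle.\<close>

definition C1_partials ::
  "(real \<times> real) set \<Rightarrow> (real \<Rightarrow> real \<Rightarrow> real) \<Rightarrow> (real \<Rightarrow> real \<Rightarrow> real)
     \<Rightarrow> (real \<Rightarrow> real \<Rightarrow> real) \<Rightarrow> bool" where
  "C1_partials S f f1 f2 \<longleftrightarrow>
     continuous_on S (\<lambda>(a, b). f1 a b) \<and> continuous_on S (\<lambda>(a, b). f2 a b) \<and>
     (\<forall>(a, b)\<in>S. ((\<lambda>(s, y). f s y) has_derivative (\<lambda>(h, k). f1 a b * h + f2 a b * k))
        (at (a, b) within S))"

definition C1_on :: "(real \<times> real) set \<Rightarrow> (real \<Rightarrow> real \<Rightarrow> real) \<Rightarrow> bool" where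
  "C1_on S f \<longleftrightarrow> (\<exists>f1 f2. C1_partials S f f1 f2)"

definition total_mass :: "(real \<Rightarrow> real \<Rightarrow> real) \<Rightarrow> real \<Rightarrow> real" where
  "total_mass \<rho> t = (\<integral>x. \<rho> t x \<partial>lebesgue_on {0<..<1})"

text \<open>The argument order of \<open>\<rho>\<close> is time, space; that of \<open>lam\<close> is space, total mass.
  Since \<open>lam\<close> is only meaningful for nonnegative total mass, \<open>W \<ge> 0\<close> is part of the definition.\<close>

definition weak_solution ::
  "(real \<Rightarrow> real \<Rightarrow> real) \<Rightarrow> real \<Rightarrow> (real \<Rightarrow> real) \<Rightarrow> (real \<Rightarrow> real) \<Rightarrow>
     (real \<Rightarrow> real \<Rightarrow> real) \<Rightarrow> bool" where
  "weak_solution lam T \<rho>0 u \<rho> \<longleftrightarrow>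
     Lp_continuous_on {0..T} (lebesgue_on {0<..<1}) 1 \<rho> \<and>
     (\<lambda>(t, x). \<rho> t x) \<in> Linf (lebesgue_on ({0<..<T} \<times> {0<..<1})) \<and>
     (\<forall>t\<in>{0..T}. 0 \<le> total_mass \<rho> t) \<and>
     (\<forall>\<tau>\<in>{0..T}. \<forall>\<phi> \<phi>t \<phi>x.
        C1_partials ({0..\<tau>} \<times> {0..1}) \<phi> \<phi>t \<phi>x \<and>
        (\<forall>x\<in>{0..1}. \<phi> \<tau> x = 0) \<and> (\<forall>t\<in>{0..\<tau>}. \<phi> t 1 = 0) \<longrightarrow>
        (\<integral>t. (\<integral>x. \<rho> t x * (\<phi>t t x + lam x (total_mass \<rho> t) * \<phi>x t x)
                 \<partial>lebesgue_on {0<..<1}) \<partial>lebesgue_on {0<..<\<tau>})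
        + (\<integral>t. u t * \<phi> t 0 \<partial>lebesgue_on {0<..<\<tau>})
        + (\<integral>x. \<rho>0 x * \<phi> 0 x \<partial>lebesgue_on {0<..<1}) = 0)"

text \<open>The trace at \<open>x = 1\<close> is that of a representative \<open>r\<close> of \<open>\<rho>\<close> which is continuous in \<open>x\<close>
  with values in every \<open>L\<^sup>q(0,T)\<close>, \<open>1 \<le> q < \<infinity>\<close>; it is unique almost everywhere.\<close>

definition is_outflux ::
  "(real \<Rightarrow> real \<Rightarrow> real) \<Rightarrow> real \<Rightarrow> (real \<Rightarrow> real) \<Rightarrow> (real \<Rightarrow> real) \<Rightarrow>
     (real \<Rightarrow> real) \<Rightarrow> bool" where
  "is_outflux lam T \<rho>0 u y \<longleftrightarrow>
     (\<exists>\<rho> r. weak_solution lam T \<rho>0 u \<rho> \<and>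
        (AE (t, x) in lebesgue_on ({0<..<T} \<times> {0<..<1}). r t x = \<rho> t x) \<and>
        (\<forall>q\<ge>1. Lp_continuous_on {0..1} (lebesgue_on {0<..<T}) q (\<lambda>x t. r t x)) \<and>
        y = (\<lambda>t. r t 1 * lam 1 (total_mass \<rho> t)))"

text \<open>As the weak solution is unique, all functions satisfying \<open>is_outflux\<close> agree almost
  everywhere on \<open>(0,T)\<close>, so the choice below is only that of a representative.\<close>

definition outflux ::
  "(real \<Rightarrow> real \<Rightarrow> real) \<Rightarrow> real \<Rightarrow> (real \<Rightarrow> real) \<Rightarrow> (real \<Rightarrow> real) \<Rightarrow> real \<Rightarrow> real" where
  "outflux lam T \<rho>0 u = (SOME y. is_outflux lam T \<rho>0 u y)"

definition cost ::
  "(real \<Rightarrow> real \<Rightarrow> real) \<Rightarrow> real \<Rightarrow> (real \<Rightarrow> real) \<Rightarrow> (real \<Rightarrow> real) \<Rightarrow> real \<Rightarrow>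
     (real \<Rightarrow> real) \<Rightarrow> real" where
  "cost lam T \<rho>0 yd p u =
     (Linf_norm (lebesgue_on {0<..<T}) u)\<^sup>2 +
     (Lp_norm (lebesgue_on {0<..<T}) p (\<lambda>t. outflux lam T \<rho>0 u t - yd t))\<^sup>2"

end

theory Submission
  imports Defs "HOL-Complex_Analysis.Great_Picard"
begin

text \<open>
  Let \<open>\<xi>\<close> be the characteristic leaving through \<open>x = 1\<close> at time \<open>\<tau>\<close>. All mass present at time \<open>\<tau>\<close>
  lies behind \<open>\<xi>\<close>, so \<open>W(\<tau>)\<close> is the initial mass behind \<open>\<xi>(0)\<close> plus the in-flux during the time
  where \<open>\<xi> > 0\<close>. Two solutions can therefore be compared through their characteristics alone, and
  Gronwall's inequality bounds the distance of their total masses in the supremum norm by that of the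
  primitives of their in-fluxes. By conservation of mass the same holds for the primitives of the
  out-fluxes; in particular the out-flux is unique.

  Along a minimizing sequence the in-fluxes are bounded, so by Arzela and Ascoli a subsequence of
  their primitives converges uniformly, and the limit is Lipschitz with a nonnegative density
  \<open>u\<^sub>\<infinity>\<close> bounded by the limit of the norms. The primitives of the out-fluxes then converge to that of
  the out-flux of \<open>u\<^sub>\<infinity>\<close>. As the out-fluxes are uniformly bounded, which is read off from the explicit
  solution along characteristics, they converge weakly, and the \<open>L\<^sup>p\<close> norm is weakly lower
  semicontinuous.
\<close>

subsection \<open>Gronwall inequalities and a Volterra equation\<close>

text \<open>The velocity is given only for positions in \<open>[0, 1]\<close> and nonnegative mass,
  while characteristics have to be followed backwards beyond \<open>x = 0\<close>. Hence all work on
  characteristics is done for a velocity \<open>l\<close> on the whole plane with global bounds, and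
  the a priori mass bound \<open>R0 + Lu * T\<close>, free of the constants of \<open>l\<close>,
  guarantees that solutions only see the part where \<open>l\<close> and \<open>lam\<close> agree.
  Convergence of the primitives of the in-fluxes is strong enough because the in-flux enters the
  mass only through integrals over time intervals: \<open>\<xi> > 0\<close> holds on an interval
  \<open>(r, \<tau>)\<close>, so the integral is a difference of two values of the primitive. The
  positive lower bound \<open>c\<close> of the speed makes these integrals Lipschitz in the path.
  Neither existence nor uniqueness of solutions is assumed. As \<open>outflux\<close> is a choice
  among all functions satisfying \<open>is_outflux\<close>, the estimates are proved for every weak
  solution, and boundedness, known for the explicit one, is carried over by uniqueness.\<close>

lemma within_derivative_nonneg_mono:
  fixes f f' :: "real \<Rightarrow> real"
  assumes d: "\<And>r. r \<in> {a..b} \<Longrightarrow> (f has_real_derivative f' r) (at r within {a..b})"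
    and nn: "\<And>r. r \<in> {a..b} \<Longrightarrow> 0 \<le> f' r"
    and st: "a \<le> s" "s \<le> t" "t \<le> b"
  shows "f s \<le> f t"
proof (rule DERIV_nonneg_imp_increasing_open[OF \<open>s \<le> t\<close>])
  fix x assume x: "s < x" "x < t"
  then have "x \<in> interior {a..b}" using st by (simp add: interior_atLeastAtMost_real)
  then have "at x within {a..b} = at x" by (rule at_within_interior)
  with d[of x] nn[of x] x st show "\<exists>y. DERIV f x :> y \<and> 0 \<le> y"
    by (intro exI[of _ "f' x"]) auto
next
  have "continuous_on {a..b} f" by (rule DERIV_continuous_on[OF d])
  then show "continuous_on {s..t} f" by (rule continuous_on_subset) (use st in auto)
qed

text \<open>The upper bound \<open>A + K * integral {a..s} f\<close>, multiplied by the integrating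
  factor \<open>exp (- K * (s - a))\<close>, has derivative at most zero, by the hypothesis on
  \<open>f\<close> itself.\<close>

lemma gronwall:
  fixes f :: "real \<Rightarrow> real"
  assumes f: "continuous_on {a..b} f" and K: "0 \<le> K"
    and le: "\<And>s. s \<in> {a..b} \<Longrightarrow> f s \<le> A + K * integral {a..s} f"
    and s: "s \<in> {a..b}"
  shows "f s \<le> A * exp (K * (s - a))"
proof -
  define h where "h s = exp (- K * (s - a)) * (A + K * integral {a..s} f)" for s
  have d: "(h has_real_derivative exp (- K * (r - a)) * (K * f r - K * (A + K * integral {a..r} f)))
      (at r within {a..b})" if "r \<in> {a..b}" for r
    unfolding h_def
    by (rule derivative_eq_intros integral_has_real_derivative[OF f that] refl)+
       (simp add: algebra_simps)
  have "- h a \<le> - h s"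
  proof (rule within_derivative_nonneg_mono[where f = "\<lambda>s. - h s", OF DERIV_minus[OF d]])
    show "0 \<le> - (exp (- K * (r - a)) * (K * f r - K * (A + K * integral {a..r} f)))"
      if "r \<in> {a..b}" for r
      using mult_left_mono[OF le[OF that] K]
      by (simp add: mult_nonneg_nonpos)
  qed (use s in auto)
  then have "exp (- K * (s - a)) * (A + K * integral {a..s} f) \<le> A"
    by (simp add: h_def)
  then have "exp (K * (s - a)) * (exp (- K * (s - a)) * (A + K * integral {a..s} f)) \<le> exp (K * (s - a)) * A"
    by (rule mult_left_mono) simp
  then have "A + K * integral {a..s} f \<le> A * exp (K * (s - a))"
    by (simp add: mult.assoc[symmetric] exp_add[symmetric] mult.commute[of A])
  with le[OF s] show ?thesis by linarith
qed

text \<open>Time reversal \<open>r \<mapsto> a + b - r\<close>. This version serves characteristics,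
  which are pinned at the time of exit and followed backwards.\<close>

lemma gronwall_backward:
  fixes f :: "real \<Rightarrow> real"
  assumes f: "continuous_on {a..b} f" and K: "0 \<le> K"
    and le: "\<And>s. s \<in> {a..b} \<Longrightarrow> f s \<le> A + K * integral {s..b} f"
    and s: "s \<in> {a..b}"
  shows "f s \<le> A * exp (K * (b - s))"
proof -
  have "f (a + b - (a + b - s)) \<le> A * exp (K * ((a + b - s) - a))"
  proof (rule gronwall[where a = a and b = b and f = "\<lambda>r. f (a + b - r)"])
    show "continuous_on {a..b} (\<lambda>r. f (a + b - r))"
      by (rule continuous_on_compose2[OF f]) (auto intro!: continuous_intros)
    show "f (a + b - r) \<le> A + K * integral {a..r} (\<lambda>r. f (a + b - r))" if "r \<in> {a..b}" for r
    proof -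
      have "(f has_integral integral {a + b - r..b} f) {a + b - r..b}"
        by (intro integrable_integral integrable_continuous_interval continuous_on_subset[OF f])
           (use that in auto)
      moreover have eq: "(\<lambda>x. (1 / (- 1 :: real)) *\<^sub>R x + - ((1 / - 1) *\<^sub>R (a + b))) ` {a + b - r..b} = {a..r}"
        by (auto intro!: image_eqI[of _ _ "a + b - y" for y])
      ultimately have "((\<lambda>r. f (a + b - r)) has_integral integral {a + b - r..b} f) {a..r}"
        using has_integral_affinity[where m = "- 1" and c = "a + b" and f = f and a = "a + b - r" and b = b and i = "integral {a + b - r..b} f"]
        by (simp only: eq cbox_interval) (simp add: add.commute add.left_commute diff_conv_add_uminus del: add_uminus_conv_diff)
      then show ?thesis using le[of "a + b - r"] that by (simp add: integral_unique)
    qed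
  qed (use K s in auto)
  then show ?thesis by (simp add: algebra_simps)
qed

text \<open>Picard iteration from zero. Because the increment at time \<open>t\<close> is controlled
  by an integral over the past \<open>{0..t}\<close> only, an exponential weight yields a
  contraction on the whole interval, however large \<open>C * T\<close> is. Used for the
  characteristics of a given mass and for the mass itself.\<close>

lemma volterra_fixed_point:
  fixes \<Phi> :: "(real \<Rightarrow> real) \<Rightarrow> real \<Rightarrow> real"
  assumes C: "0 \<le> C"
    and cont: "\<And>f. continuous_on {0..T} f \<Longrightarrow> continuous_on {0..T} (\<Phi> f)"
    and lip: "\<And>f g t. continuous_on {0..T} f \<Longrightarrow> continuous_on {0..T} g \<Longrightarrow> t \<in> {0..T} \<Longrightarrow>
      \<bar>\<Phi> f t - \<Phi> g t\<bar> \<le> C * integral {0..t} (\<lambda>s. \<bar>f s - g s\<bar>)"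
  obtains f where "continuous_on {0..T} f" "\<And>t. t \<in> {0..T} \<Longrightarrow> \<Phi> f t = f t"
proof -
  define f where "f n = (\<Phi> ^^ n) (\<lambda>_. 0)" for n
  have f0: "f 0 = (\<lambda>_. 0)" and fS: "f (Suc n) = \<Phi> (f n)" for n
    by (auto simp: f_def)
  have fc: "continuous_on {0..T} (f n)" for n
    by (induction n) (auto simp: f0 fS cont)
  \<comment> \<open>With the weight \<open>exp (L * t)\<close> one integration gains a factor
    \<open>C / L\<close>, at most \<open>1/2\<close> since \<open>2 * C \<le> L\<close>; the
    \<open>+ 1\<close> keeps \<open>L\<close> positive when \<open>C = 0\<close>.\<close>
  define L where "L = 2 * C + 1"
  have L: "0 < L" "2 * C \<le> L" using C by (auto simp: L_def)
  have "bounded (f 1 ` {0..T})"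
    by (intro compact_imp_bounded compact_continuous_image fc) auto
  then obtain A where A: "0 \<le> A" "\<And>t. t \<in> {0..T} \<Longrightarrow> \<bar>f 1 t\<bar> \<le> A"
    by (force simp: bounded_pos dest: less_imp_le)
  have step: "\<bar>f (Suc n) t - f n t\<bar> \<le> A * (1/2)^n * exp (L * t)" if "t \<in> {0..T}" for n t
    using that
  proof (induction n arbitrary: t)
    case 0
    have "A * 1 \<le> A * exp (L * t)" using 0 A L by (intro mult_left_mono) auto
    with A(2)[OF 0] show ?case by (simp add: f0)
  next
    case (Suc n)
    have ss: "{0..t} \<subseteq> {0..T}" using Suc.prems by auto
    have I: "((\<lambda>s. A * (1/2)^n * exp (L * s)) has_integral
        A * (1/2)^n / L * exp (L * t) - A * (1/2)^n / L * exp (L * 0)) {0..t}"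
      using Suc.prems L
      by (intro fundamental_theorem_of_calculus)
         (auto intro!: derivative_eq_intros simp: has_real_derivative_iff_has_vector_derivative[symmetric])
    have "\<bar>f (Suc (Suc n)) t - f (Suc n) t\<bar> \<le> C * integral {0..t} (\<lambda>s. \<bar>f (Suc n) s - f n s\<bar>)"
      using lip[OF fc[of "Suc n"] fc[of n] Suc.prems] by (simp only: fS)
    also have "\<dots> \<le> C * integral {0..t} (\<lambda>s. A * (1/2)^n * exp (L * s))"
    proof (intro mult_left_mono integral_le C)
      show "(\<lambda>s. \<bar>f (Suc n) s - f n s\<bar>) integrable_on {0..t}"
        by (intro integrable_continuous_interval continuous_intros continuous_on_subset[OF fc ss])
    qed (use I Suc.IH ss in auto)
    also have "\<dots> \<le> C * (A * (1/2)^n / L * exp (L * t))"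
      using A L C by (intro mult_left_mono, subst integral_unique[OF I]) auto
    also have "\<dots> = (C / L) * (A * (1/2)^n * exp (L * t))" by simp
    also have "\<dots> \<le> (1/2) * (A * (1/2)^n * exp (L * t))"
      using A L C by (intro mult_right_mono) (auto simp: field_simps)
    finally show ?case by (simp add: mult_ac)
  qed
  have "uniform_limit {0..T} (\<lambda>n t. \<Sum>i<n. f (Suc i) t - f i t) (\<lambda>t. \<Sum>i. f (Suc i) t - f i t) sequentially"
  proof (rule Weierstrass_m_test)
    show "norm (f (Suc n) t - f n t) \<le> A * exp (L * T) * (1/2)^n" if "t \<in> {0..T}" for n t
    proof -
      have "A * (1/2)^n * exp (L * t) \<le> A * (1/2)^n * exp (L * T)"
        using that A L by (intro mult_left_mono) auto
      with step[OF that, of n] show ?thesis by (simp add: mult_ac)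
    qed
  qed (intro summable_mult summable_geometric, simp)
  moreover have "(\<Sum>i<n. f (Suc i) t - f i t) = f n t" for n t
    using sum_lessThan_telescope[of "\<lambda>i. f i t" n] by (simp add: f0)
  ultimately obtain F where F: "uniform_limit {0..T} f F sequentially"
    by (auto simp: fun_eq_iff)
  have Fc: "continuous_on {0..T} F"
    by (rule uniform_limit_theorem[OF _ F]) (auto simp: fc)
  show thesis
  proof
    show "continuous_on {0..T} F" by fact
    fix t assume t: "t \<in> {0..T}"
    have 1: "(\<lambda>n. f (Suc n) t) \<longlonglongrightarrow> F t"
      using tendsto_uniform_limitI[OF F t] by (rule LIMSEQ_Suc)
    have 2: "(\<lambda>n. f (Suc n) t) \<longlonglongrightarrow> \<Phi> F t"
    proof (rule LIMSEQ_I)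
      fix e :: real assume e: "0 < e"
      \<comment> \<open>The \<open>+ 1\<close> avoids division by zero and makes the final
        inequality strict.\<close>
      define d where "d = e / (C * T + 1)"
      have CT: "0 \<le> C * T" using C t by auto
      have d: "0 < d" using e CT by (simp add: d_def)
      obtain N where N: "\<forall>n\<ge>N. \<forall>s\<in>{0..T}. \<bar>f n s - F s\<bar> < d"
        using uniform_limitD[OF F d] unfolding eventually_sequentially dist_real_def by blast
      have ss: "{0..t} \<subseteq> {0..T}" using t by auto
      have "norm (f (Suc n) t - \<Phi> F t) < e" if n: "n \<ge> N" for n
      proof -
        have "\<bar>f (Suc n) t - \<Phi> F t\<bar> \<le> C * integral {0..t} (\<lambda>s. \<bar>f n s - F s\<bar>)"
          using lip[OF fc[of n] Fc t] by (simp only: fS)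
        also have "\<dots> \<le> C * integral {0..t} (\<lambda>s. d)"
        proof (intro mult_left_mono integral_le C)
          show "(\<lambda>s. \<bar>f n s - F s\<bar>) integrable_on {0..t}"
            by (intro integrable_continuous_interval continuous_intros
                continuous_on_subset[OF fc ss] continuous_on_subset[OF Fc ss])
        qed (use N n ss in \<open>auto intro!: less_imp_le\<close>)
        also have "\<dots> = C * t * d" using t by simp
        also have "\<dots> \<le> C * T * d" using t C d by (intro mult_right_mono mult_left_mono) auto
        also have "\<dots> < (C * T + 1) * d" using d by (simp add: algebra_simps)
        also have "\<dots> = e" using CT by (simp add: d_def)
        finally show ?thesis by simp
      qed
      then show "\<exists>no. \<forall>n\<ge>no. norm (f (Suc n) t - \<Phi> F t) < e" by blast
    qed
    show "\<Phi> F t = F t" using LIMSEQ_unique[OF 2 1] .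
  qed
qed

subsection \<open>Lebesgue integrals on intervals\<close>

lemma lebesgue_on_integral_Ioo:
  fixes f :: "real \<Rightarrow> real"
  assumes "integrable (lebesgue_on {a<..<b}) f"
  shows "f integrable_on {a..b}" "integral\<^sup>L (lebesgue_on {a<..<b}) f = integral {a..b} f"
proof -
  have "f integrable_on {a<..<b}"
    by (rule integrable_on_lebesgue_on[OF assms]) simp
  then show "f integrable_on {a..b}"
    by (simp add: integrable_on_open_interval_real)
  show "integral\<^sup>L (lebesgue_on {a<..<b}) f = integral {a..b} f"
    using lebesgue_integral_eq_integral[OF assms] by (simp add: integral_open_interval_real)
qed

lemma integrable_lebesgue_on_mono:
  fixes f :: "'a::euclidean_space \<Rightarrow> real"
  assumes "integrable (lebesgue_on S) f" "U \<subseteq> S" "U \<in> sets lebesgue" "S \<in> sets lebesgue"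
  shows "integrable (lebesgue_on U) f"
  using set_integrable_subset[of lebesgue S f U] assms
  by (simp add: set_integrable_def integrable_restrict_space)

lemma borel_imp_measurable_lebesgue_on:
  "f \<in> borel_measurable borel \<Longrightarrow> f \<in> borel_measurable (lebesgue_on S)"
  by (intro measurable_restrict_space1 measurable_completion) simp

lemma integrable_lebesgue_on_Ioo_mono:
  fixes f :: "real \<Rightarrow> real"
  assumes "integrable (lebesgue_on {a<..<b}) f" "a \<le> c" "d \<le> b"
  shows "integrable (lebesgue_on {c<..<d}) f"
  using assms by (intro integrable_lebesgue_on_mono[OF assms(1)]) auto

lemma finite_measure_lebesgue_on_Ioo: "finite_measure (lebesgue_on {a<..<b::real})"
  by (intro finite_measure_lebesgue_on lmeasurable_interval)

lemma integrable_lebesgue_on_Ioo_bounded: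
  fixes f :: "real \<Rightarrow> real"
  assumes "f \<in> borel_measurable (lebesgue_on {a<..<b})" "AE x in lebesgue_on {a<..<b}. \<bar>f x\<bar> \<le> C"
  shows "integrable (lebesgue_on {a<..<b}) f"
  by (rule finite_measure.integrable_const_bound[OF finite_measure_lebesgue_on_Ioo _ assms(1), where B = C])
     (use assms(2) in simp)

text \<open>Test functions must vanish at the final time, so they carry a factor
  \<open>\<tau> - t\<close> and yield balance laws only after integration in time. Here both sides
  are differentiated in \<open>\<tau>\<close>. Although \<open>c\<close> is merely integrable, the
  weighted integral is a second primitive and so differentiable everywhere; the conclusion therefore
  holds for every \<open>\<tau>\<close>, not just almost every one.\<close>

lemma primitive_of_second_primitive:
  fixes B c :: "real \<Rightarrow> real"
  assumes B: "continuous_on {0..T} B"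
    and c: "integrable (lebesgue_on {0<..<T}) c"
    and eq: "\<And>\<tau>. \<tau> \<in> {0..T} \<Longrightarrow> integral\<^sup>L (lebesgue_on {0<..<\<tau>}) B
        = integral\<^sup>L (lebesgue_on {0<..<\<tau>}) (\<lambda>t. (\<tau> - t) * c t) + \<tau> * k"
    and T: "0 < T" and \<tau>: "\<tau> \<in> {0..T}"
  shows "B \<tau> = integral\<^sup>L (lebesgue_on {0<..<\<tau>}) c + k"
proof -
  have ci: "c integrable_on {0..T}" and cabs: "(\<lambda>t. \<bar>c t\<bar>) integrable_on {0..T}"
    using lebesgue_on_integral_Ioo(1)[OF c] lebesgue_on_integral_Ioo(1)[OF integrable_abs[OF c]] by auto
  have cL: "integral\<^sup>L (lebesgue_on {0<..<s}) c = integral {0..s} c" if "s \<in> {0..T}" for s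
    using that by (intro lebesgue_on_integral_Ioo integrable_lebesgue_on_Ioo_mono[OF c]) auto
  have tc: "integrable (lebesgue_on {0<..<T}) (\<lambda>t. (s - t) * c t)" for s
  proof (rule Bochner_Integration.integrable_bound[OF integrable_mult_right[OF integrable_abs[OF c], of "\<bar>s\<bar> + T"]])
    show "(\<lambda>t. (s - t) * c t) \<in> borel_measurable (lebesgue_on {0<..<T})"
      by (rule borel_measurable_times[OF borel_imp_measurable_lebesgue_on borel_measurable_integrable[OF c]]) simp
    show "AE x in lebesgue_on {0<..<T}. norm ((s - x) * c x) \<le> norm ((\<bar>s\<bar> + T) * \<bar>c x\<bar>)"
    proof (intro AE_I2)
      fix x assume "x \<in> space (lebesgue_on {0<..<T})"
      then have "\<bar>s - x\<bar> \<le> \<bar>s\<bar> + T" by auto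
      then show "norm ((s - x) * c x) \<le> norm ((\<bar>s\<bar> + T) * \<bar>c x\<bar>)"
        using T by (auto simp: abs_mult intro!: mult_right_mono)
    qed
  qed
  have tci: "(\<lambda>t. (s - t) * c t) integrable_on {0..T}" for s
    by (rule lebesgue_on_integral_Ioo(1)[OF tc])
  have tcL: "integral\<^sup>L (lebesgue_on {0<..<s}) (\<lambda>t. (s - t) * c t) = integral {0..s} (\<lambda>t. (s - t) * c t)"
    if "s \<in> {0..T}" for s
    using that by (intro lebesgue_on_integral_Ioo integrable_lebesgue_on_Ioo_mono[OF tc]) auto
  have BL: "integral\<^sup>L (lebesgue_on {0<..<s}) B = integral {0..s} B" if "s \<in> {0..T}" for s
  proof -
    have "integrable (lebesgue_on {0..T}) B"
      by (rule continuous_imp_integrable_real[OF B])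
    then have "integrable (lebesgue_on {0<..<s}) B"
      by (rule integrable_lebesgue_on_mono) (use that in auto)
    then show ?thesis by (rule lebesgue_on_integral_Ioo)
  qed
  define \<Psi> where "\<Psi> s = integral {0..s} (\<lambda>t. (s - t) * c t)" for s
  have \<Psi>: "\<Psi> s = integral {0..s} B - s * k" if "s \<in> {0..T}" for s
    using eq[OF that] unfolding BL[OF that] tcL[OF that] \<Psi>_def by linarith
  have d1: "(\<Psi> has_real_derivative (B \<tau> - k)) (at \<tau> within {0..T})"
  proof -
    have "((\<lambda>s. integral {0..s} B - s * k) has_real_derivative (B \<tau> - 1 * k)) (at \<tau> within {0..T})"
      by (intro DERIV_diff DERIV_cmult_right integral_has_real_derivative[OF B \<tau>] DERIV_ident)
    then show ?thesis
      using \<Psi> \<tau> by (auto intro: has_field_derivative_transform_within[OF _ zero_less_one])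
  qed
  define I where "I = (\<lambda>s. integral {0..s} (\<lambda>t. \<bar>c t\<bar>))"
  have Icont: "continuous_on {0..T} I"
    unfolding I_def by (rule indefinite_integral_continuous_1[OF cabs])
  have split: "integral {0..b} f = integral {0..a} f + integral {a..b} f"
    if "f integrable_on {0..T}" "0 \<le> a" "a \<le> b" "b \<le> T" for f :: "real \<Rightarrow> real" and a b
    using that by (intro Henstock_Kurzweil_Integration.integral_combine[symmetric]
        integrable_subinterval_real[OF that(1)]) auto
  \<comment> \<open>Increments of \<open>\<Psi>\<close> are compared with the slopes at the left and
    at the right end; the first serves difference quotients from the right, the second those from
    the left. The factor \<open>I b - I a\<close> tends to zero by continuity of the primitive of
    \<open>\<bar>c t\<bar>\<close>.\<close>
  have key: "\<bar>\<Psi> b - \<Psi> a - (b - a) * integral {0..a} c\<bar> \<le> (b - a) * (I b - I a)"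
    "\<bar>\<Psi> b - \<Psi> a - (b - a) * integral {0..b} c\<bar> \<le> (b - a) * (I b - I a)"
    if ab: "0 \<le> a" "a \<le> b" "b \<le> T" for a b
  proof -
    have sub: "{0..a} \<subseteq> {0..T}" "{a..b} \<subseteq> {0..T}" using ab by auto
    have i1: "c integrable_on {0..a}" "c integrable_on {a..b}" "(\<lambda>t. \<bar>c t\<bar>) integrable_on {a..b}"
      using sub by (blast intro: integrable_subinterval_real[OF ci] integrable_subinterval_real[OF cabs])+
    have i2: "(\<lambda>t. (s - t) * c t) integrable_on {0..a}" "(\<lambda>t. (s - t) * c t) integrable_on {a..b}" for s
      using sub by (blast intro: integrable_subinterval_real[OF tci])+
    have e0: "\<Psi> b = integral {0..a} (\<lambda>t. (b - t) * c t) + integral {a..b} (\<lambda>t. (b - t) * c t)"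
      unfolding \<Psi>_def by (rule split[OF tci ab])
    have "integral {0..a} (\<lambda>t. (b - t) * c t) = integral {0..a} (\<lambda>t. (b - a) * c t + (a - t) * c t)"
      by (rule integral_cong) (simp add: algebra_simps)
    also have "\<dots> = (b - a) * integral {0..a} c + \<Psi> a"
      using Henstock_Kurzweil_Integration.integral_add[OF integrable_on_mult_right[OF i1(1)] i2(1), of "b - a" a]
      by (simp add: \<Psi>_def)
    finally have e1: "\<Psi> b - \<Psi> a - (b - a) * integral {0..a} c = integral {a..b} (\<lambda>t. (b - t) * c t)"
      using e0 by simp
    have Iab: "I b - I a = integral {a..b} (\<lambda>t. \<bar>c t\<bar>)"
      unfolding I_def using split[OF cabs ab] by simp
    have b1: "\<bar>integral {a..b} (\<lambda>t. (b - t) * c t)\<bar> \<le> (b - a) * (I b - I a)"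
    proof -
      have "norm (integral {a..b} (\<lambda>t. (b - t) * c t)) \<le> integral {a..b} (\<lambda>t. (b - a) * \<bar>c t\<bar>)"
        by (intro integral_norm_bound_integral i2 integrable_on_mult_right i1)
           (simp add: abs_mult mult_right_mono)
      then show ?thesis by (simp add: Iab)
    qed
    then show "\<bar>\<Psi> b - \<Psi> a - (b - a) * integral {0..a} c\<bar> \<le> (b - a) * (I b - I a)"
      by (simp add: e1)
    have "integral {0..b} c = integral {0..a} c + integral {a..b} c"
      by (rule split[OF ci ab])
    then have "(b - a) * integral {0..b} c = (b - a) * integral {0..a} c + (b - a) * integral {a..b} c"
      by (simp only: distrib_left)
    with e1 have "\<Psi> b - \<Psi> a - (b - a) * integral {0..b} c
        = integral {a..b} (\<lambda>t. (b - t) * c t) - integral {a..b} (\<lambda>t. (b - a) * c t)"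
      by simp
    also have "\<dots> = integral {a..b} (\<lambda>t. (b - t) * c t - (b - a) * c t)"
      by (rule Henstock_Kurzweil_Integration.integral_diff[OF i2(2) integrable_on_mult_right[OF i1(2)], symmetric])
    also have "\<dots> = integral {a..b} (\<lambda>t. (a - t) * c t)"
      by (rule integral_cong) (simp add: algebra_simps)
    finally have e2: "\<Psi> b - \<Psi> a - (b - a) * integral {0..b} c = \<dots>" .
    have "norm (integral {a..b} (\<lambda>t. (a - t) * c t)) \<le> integral {a..b} (\<lambda>t. (b - a) * \<bar>c t\<bar>)"
      by (intro integral_norm_bound_integral i2 integrable_on_mult_right i1)
         (simp add: abs_mult mult_right_mono)
    then show "\<bar>\<Psi> b - \<Psi> a - (b - a) * integral {0..b} c\<bar> \<le> (b - a) * (I b - I a)"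
      by (simp add: e2 Iab)
  qed
  have d2: "(\<Psi> has_real_derivative integral {0..\<tau>} c) (at \<tau> within {0..T})"
    unfolding has_field_derivative_iff
  proof (rule LIM_zero_cancel, rule Lim_null_comparison)
    show "((\<lambda>s. \<bar>I s - I \<tau>\<bar>) \<longlongrightarrow> 0) (at \<tau> within {0..T})"
      using Icont \<tau> by (auto simp: continuous_on_def intro!: tendsto_eq_intros)
    have "norm ((\<Psi> s - \<Psi> \<tau>) / (s - \<tau>) - integral {0..\<tau>} c) \<le> \<bar>I s - I \<tau>\<bar>"
      if s: "s \<in> {0..T}" "s \<noteq> \<tau>" for s
    proof -
      have "\<bar>\<Psi> s - \<Psi> \<tau> - (s - \<tau>) * integral {0..\<tau>} c\<bar> \<le> (s - \<tau>) * (I s - I \<tau>)"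
      proof (cases "\<tau> \<le> s")
        case True
        then show ?thesis using key(1)[of \<tau> s] s \<tau> by simp
      next
        case False
        then have "\<bar>\<Psi> \<tau> - \<Psi> s - (\<tau> - s) * integral {0..\<tau>} c\<bar> \<le> (\<tau> - s) * (I \<tau> - I s)"
          using key(2)[of s \<tau>] s \<tau> by simp
        moreover have "\<Psi> s - \<Psi> \<tau> - (s - \<tau>) * integral {0..\<tau>} c
            = - (\<Psi> \<tau> - \<Psi> s - (\<tau> - s) * integral {0..\<tau>} c)"
          by (simp add: left_diff_distrib)
        moreover have "(s - \<tau>) * (I s - I \<tau>) = (\<tau> - s) * (I \<tau> - I s)"
          by (metis minus_diff_eq minus_mult_minus)
        ultimately show ?thesis by (simp only: abs_minus_cancel)
      qed
      also have "\<dots> \<le> \<bar>I s - I \<tau>\<bar> * \<bar>s - \<tau>\<bar>"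
        by (metis abs_ge_self abs_mult mult.commute)
      finally have "\<bar>\<Psi> s - \<Psi> \<tau> - (s - \<tau>) * integral {0..\<tau>} c\<bar> / \<bar>s - \<tau>\<bar> \<le> \<bar>I s - I \<tau>\<bar>"
        using s by (simp add: pos_divide_le_eq)
      moreover have "(\<Psi> s - \<Psi> \<tau>) / (s - \<tau>) - integral {0..\<tau>} c
          = (\<Psi> s - \<Psi> \<tau> - (s - \<tau>) * integral {0..\<tau>} c) / (s - \<tau>)"
        using s by (simp add: diff_divide_distrib)
      ultimately show ?thesis by (simp only: real_norm_def abs_divide)
    qed
    then show "\<forall>\<^sub>F s in at \<tau> within {0..T}.
        norm ((\<Psi> s - \<Psi> \<tau>) / (s - \<tau>) - integral {0..\<tau>} c) \<le> \<bar>I s - I \<tau>\<bar>"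
      by (auto simp: eventually_at_filter)
  qed
  have "B \<tau> - k = integral {0..\<tau>} c"
    by (rule vector_derivative_unique_within_closed_interval[OF T, unfolded cbox_interval,
          OF \<tau> d1[unfolded has_real_derivative_iff_has_vector_derivative]
             d2[unfolded has_real_derivative_iff_has_vector_derivative]])
  then show ?thesis using cL[OF \<tau>] by simp
qed

subsection \<open>Weak convergence and lower semicontinuity\<close>

text \<open>Later arguments compose with flow maps, and a Lebesgue measurable function composed with
  a continuous one may fail to be measurable; Borel versions are safe.\<close>

lemma lebesgue_on_Borel_version:
  fixes f :: "'a::euclidean_space \<Rightarrow> real"
  assumes "f \<in> borel_measurable (lebesgue_on S)" "S \<in> sets lebesgue"
  obtains g where "g \<in> borel_measurable borel" "AE x in lebesgue. x \<in> S \<longrightarrow> f x = g x"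
proof -
  have "(\<lambda>x. if x \<in> S then f x else 0) \<in> borel_measurable (completion lborel)"
    using assms by (simp add: borel_measurable_if_I)
  from completion_ex_borel_measurable_real[OF this]
  obtain g where g: "g \<in> borel_measurable lborel"
    and ae: "AE x in lborel. (if x \<in> S then f x else 0) = g x" by blast
  show thesis
  proof (rule that)
    show "g \<in> borel_measurable borel" using g by simp
    show "AE x in lebesgue. x \<in> S \<longrightarrow> f x = g x"
      using AE_completion[OF ae] by eventually_elim auto
  qed
qed

text \<open>The sets \<open>A\<close> with \<open>\<integral>\<^sub>A f\<^sub>n \<longrightarrow> 0\<close> form a Dynkin system containing the half-lines.\<close>

lemma primitives_tendsto_imp_weakly_tendsto:
  fixes f :: "nat \<Rightarrow> real \<Rightarrow> real"
  assumes f: "\<And>n. f n \<in> borel_measurable (lebesgue_on {0<..<T})"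
    and bd: "\<And>n. AE x in lebesgue_on {0<..<T}. \<bar>f n x\<bar> \<le> B"
    and prim: "\<And>s. s \<in> {0..T} \<Longrightarrow> (\<lambda>n. integral\<^sup>L (lebesgue_on {0<..<s}) (f n)) \<longlonglongrightarrow> 0"
    and T: "0 < T"
    and g: "integrable (lebesgue_on {0<..<T}) g"
  shows "(\<lambda>n. \<integral>x. g x * f n x \<partial>lebesgue_on {0<..<T}) \<longlonglongrightarrow> 0"
proof -
  define h where "h n x = indicator {0<..<T} x * f n x" for n x
  have hm: "h n \<in> borel_measurable lebesgue" for n
    using borel_measurable_if_I[OF f, of n]
    by (auto simp: h_def indicator_def of_bool_def if_distrib cong: if_cong
        elim!: measurable_cong[THEN iffD1, rotated])
  have hb: "AE x in lebesgue. \<bar>h n x\<bar> \<le> B * indicator {0<..<T} x" for n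
    using bd[of n] by (auto simp: AE_restrict_space_iff h_def elim!: eventually_mono split: split_indicator)
  have hi: "integrable lebesgue (h n)" for n
  proof (rule Bochner_Integration.integrable_bound[OF _ hm])
    show "integrable lebesgue (\<lambda>x. B * indicat_real {0<..<T} x)"
      using lmeasurable_interval(2)[of 0 T] by (intro integrable_mult_right) (simp add: fmeasurable_def)
    show "AE x in lebesgue. norm (h n x) \<le> norm (B * indicat_real {0<..<T} x)"
      using hb[of n] by eventually_elim auto
  qed
  \<comment> \<open>The sign of \<open>B\<close> follows from the bound on \<open>f 0\<close>,
    because the interval has positive measure.\<close>
  have B: "0 \<le> B"
  proof (rule ccontr)
    assume "\<not> 0 \<le> B"
    then have "AE x in lebesgue_on {0<..<T}. False"
      using bd[of 0] by (auto elim!: eventually_mono)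
    then have "emeasure (lebesgue_on {0<..<T}) (space (lebesgue_on {0<..<T})) = 0"
      by (metis ae_filter_eq_bot_iff trivial_limit_def)
    then show False using T by (simp add: emeasure_restrict_space)
  qed
  have prodi: "integrable lebesgue (\<lambda>x. k x * h n x)"
    and prodb: "\<bar>\<integral>x. k x * h n x \<partial>lebesgue\<bar> \<le> B * (\<integral>x. \<bar>k x\<bar> \<partial>lebesgue)"
    if k: "integrable lebesgue k" for k n
  proof -
    have ae: "AE x in lebesgue. \<bar>k x * h n x\<bar> \<le> B * \<bar>k x\<bar>"
      using hb[of n]
    proof eventually_elim
      case (elim x)
      then have "\<bar>h n x\<bar> \<le> B" using B by (auto split: split_indicator_asm)
      then show ?case using mult_left_mono[of "\<bar>h n x\<bar>" B "\<bar>k x\<bar>"] by (simp add: abs_mult mult.commute)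
    qed
    show 1: "integrable lebesgue (\<lambda>x. k x * h n x)"
    proof (rule Bochner_Integration.integrable_bound)
      show "integrable lebesgue (\<lambda>x. B * \<bar>k x\<bar>)" using k by simp
      show "(\<lambda>x. k x * h n x) \<in> borel_measurable lebesgue"
        using k hm by (intro borel_measurable_times) auto
      show "AE x in lebesgue. norm (k x * h n x) \<le> norm (B * \<bar>k x\<bar>)"
        using ae by eventually_elim (use B in auto)
    qed
    have "\<bar>\<integral>x. k x * h n x \<partial>lebesgue\<bar> \<le> (\<integral>x. \<bar>k x * h n x\<bar> \<partial>lebesgue)"
      by (rule integral_abs_bound)
    also have "\<dots> \<le> (\<integral>x. B * \<bar>k x\<bar> \<partial>lebesgue)"
      by (intro integral_mono_AE ae) (use k 1 in auto)
    finally show "\<bar>\<integral>x. k x * h n x \<partial>lebesgue\<bar> \<le> B * (\<integral>x. \<bar>k x\<bar> \<partial>lebesgue)" by simp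
  qed
  define P where "P A \<longleftrightarrow> (\<lambda>n. \<integral>x. indicat_real A x * h n x \<partial>lebesgue) \<longlonglongrightarrow> 0" for A
  have primh: "(\<lambda>n. \<integral>x. indicat_real {..<s} x * h n x \<partial>lebesgue) \<longlonglongrightarrow> 0" for s
  proof -
    \<comment> \<open>Half-lines are cut down to the interval on which the primitives are known to
      converge.\<close>
    define r where "r = max 0 (min s T)"
    have "(\<integral>x. indicat_real {..<s} x * h n x \<partial>lebesgue) = integral\<^sup>L (lebesgue_on {0<..<r}) (f n)" for n
    proof -
      have "integral\<^sup>L (lebesgue_on {0<..<r}) (f n) = (\<integral>x. indicat_real {0<..<r} x *\<^sub>R f n x \<partial>lebesgue)"
        by (rule integral_restrict_space) simp
      also have "\<dots> = (\<integral>x. indicat_real {..<s} x * h n x \<partial>lebesgue)"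
        by (intro Bochner_Integration.integral_cong) (auto simp: h_def r_def split: split_indicator)
      finally show ?thesis ..
    qed
    then show ?thesis using prim[of r] T by (simp add: r_def)
  qed
  have set_case: "P A" if "A \<in> sets borel" for A
  proof -
    have A: "A \<in> sigma_sets UNIV (range lessThan)"
      using that by (simp add: borel_eq_lessThan sets_measure_of eucl_lessThan lessThan_def[symmetric])
    have "Int_stable (range (lessThan :: real \<Rightarrow> real set))"
    proof (rule Int_stableI_image)
      fix a b :: real show "\<exists>c\<in>UNIV. {..<a} \<inter> {..<b} = {..<c}"
        by (intro bexI[of _ "min a b"]) auto
    qed
    moreover have "range (lessThan :: real \<Rightarrow> real set) \<subseteq> Pow UNIV" by simp
    ultimately show ?thesis using A
    proof (induction rule: sigma_sets_induct_disjoint)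
      case (basic A)
      then show ?case using primh by (auto simp: P_def)
    next
      \<comment> \<open>As \<open>h n\<close> vanishes outside \<open>(0, T)\<close>, the half-line
        below \<open>T\<close> plays the role of the whole space, and its case is already
        known.\<close>
      case (compl A)
      have A: "A \<in> sets lebesgue"
        using compl.hyps by (intro sets_completionI_sets)
          (simp add: borel_eq_lessThan sets_measure_of eucl_lessThan lessThan_def[symmetric])
      have eq: "(\<integral>x. indicat_real (UNIV - A) x * h n x \<partial>lebesgue)
          = (\<integral>x. indicat_real {..<T} x * h n x \<partial>lebesgue) - (\<integral>x. indicat_real A x * h n x \<partial>lebesgue)" for n
      proof -
        have "(\<integral>x. indicat_real {..<T} x * h n x \<partial>lebesgue) - (\<integral>x. indicat_real A x * h n x \<partial>lebesgue)
           = (\<integral>x. indicat_real {..<T} x * h n x - indicat_real A x * h n x \<partial>lebesgue)"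
          using integrable_mult_indicator[OF A hi[of n]] integrable_mult_indicator[of "{..<T}", OF _ hi[of n]]
          by (intro Bochner_Integration.integral_diff[symmetric]) auto
        also have "\<dots> = (\<integral>x. indicat_real (UNIV - A) x * h n x \<partial>lebesgue)"
          by (intro Bochner_Integration.integral_cong) (auto simp: h_def split: split_indicator)
        finally show ?thesis ..
      qed
      show ?case
        using tendsto_diff[OF primh[of T] compl.IH[unfolded P_def]] by (simp add: P_def eq)
    next
      case (union A)
      have A: "A i \<in> sets borel" for i
        using union.hyps by (auto simp: borel_eq_lessThan sets_measure_of eucl_lessThan lessThan_def[symmetric])
      then have AL: "A i \<in> sets lebesgue" for i by (intro sets_completionI_sets) simp
      let ?M = "lebesgue_on {0<..<T}"
      interpret finite_measure ?M by (rule finite_measure_lebesgue_on_Ioo)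
      have "(\<lambda>i. measure ?M (A i \<inter> {0<..<T})) sums measure ?M (\<Union>i. A i \<inter> {0<..<T})"
        using union.hyps(1) AL
        by (intro finite_measure_UNION) (auto simp: sets_restrict_space disjoint_family_on_def)
      \<comment> \<open>The masses of the pieces dominate the terms of the series uniformly in
        \<open>n\<close> and are summable, so Tannery's theorem exchanges limit and sum.\<close>
      then have sm: "summable (\<lambda>i. B * measure ?M (A i \<inter> {0<..<T}))"
        by (intro summable_mult) (rule sums_summable)
      have bound: "\<bar>\<integral>x. indicat_real (A i) x * h n x \<partial>lebesgue\<bar> \<le> B * measure ?M (A i \<inter> {0<..<T})" for i n
      proof -
        have fm: "A i \<inter> {0<..<T} \<in> fmeasurable lebesgue"
          by (subst Int_commute) (intro fmeasurable_Int_fmeasurable lmeasurable_interval AL)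
        have "(\<integral>x. indicat_real (A i) x * h n x \<partial>lebesgue) = (\<integral>x. indicat_real (A i \<inter> {0<..<T}) x * h n x \<partial>lebesgue)"
          by (intro Bochner_Integration.integral_cong) (auto simp: h_def split: split_indicator)
        also have "\<bar>\<dots>\<bar> \<le> B * (\<integral>x. \<bar>indicat_real (A i \<inter> {0<..<T}) x\<bar> \<partial>lebesgue)"
          using fm by (intro prodb) (auto simp: fmeasurable_def)
        also have "\<dots> = B * measure lebesgue (A i \<inter> {0<..<T})"
          using AL by simp
        also have "\<dots> = B * measure ?M (A i \<inter> {0<..<T})"
          using AL by (subst measure_restrict_space) auto
        finally show ?thesis .
      qed
      have eq: "(\<integral>x. indicat_real (\<Union>i. A i) x * h n x \<partial>lebesgue)
          = (\<Sum>i. \<integral>x. indicat_real (A i) x * h n x \<partial>lebesgue)" for n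
        using lebesgue_integral_countable_add[of A lebesgue "h n"] union.hyps(1) AL
          integrable_mult_indicator[of "\<Union>i. A i", OF _ hi[of n]]
        by (auto simp: set_lebesgue_integral_def set_integrable_def disjoint_family_on_def)
      have "((\<lambda>n. \<Sum>i. \<integral>x. indicat_real (A i) x * h n x \<partial>lebesgue) \<longlongrightarrow> (\<Sum>i. 0)) sequentially"
      proof (rule conjunct2[OF conjunct2[OF tannerys_theorem[OF _ _ sm]]])
        show "((\<lambda>n. \<integral>x. indicat_real (A i) x * h n x \<partial>lebesgue) \<longlongrightarrow> 0) sequentially" for i
          using union.IH[of i] by (simp add: P_def)
        show "\<forall>\<^sub>F (i, n) in at_top \<times>\<^sub>F sequentially.
            norm (\<integral>x. indicat_real (A i) x * h n x \<partial>lebesgue) \<le> B * measure ?M (A i \<inter> {0<..<T})"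
          using bound by (intro always_eventually) auto
      qed simp
      then show ?case by (simp add: P_def eq)
    qed (auto simp: P_def)
  qed
  \<comment> \<open>From sets to integrable functions: in the limit case the error is
    \<open>B\<close> times an L1 distance and thus uniform in \<open>n\<close>.\<close>
  have fun_case: "(\<lambda>n. \<integral>x. k x * h n x \<partial>lebesgue) \<longlonglongrightarrow> 0" if "integrable lborel k" for k
    using that
  proof (induction rule: integrable_induct)
    case (base A c)
    have "(\<lambda>n. c * (\<integral>x. indicat_real A x * h n x \<partial>lebesgue)) \<longlonglongrightarrow> c * 0"
      using set_case[of A] base by (intro tendsto_mult_left) (simp add: P_def)
    then show ?case by (simp add: mult.assoc mult.left_commute[of _ c])
  next
    case (add k1 k2)
    have "(\<integral>x. (k1 x + k2 x) * h n x \<partial>lebesgue)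
        = (\<integral>x. k1 x * h n x \<partial>lebesgue) + (\<integral>x. k2 x * h n x \<partial>lebesgue)" for n
      unfolding distrib_right using add
      by (intro Bochner_Integration.integral_add prodi) (auto simp: integrable_completion)
    then show ?case using tendsto_add[OF add.IH] by simp
  next
    case (lim k s)
    have kl: "integrable lebesgue k" "\<And>i. integrable lebesgue (s i)"
      using lim by (auto simp: integrable_completion)
    define e where "e i = B * (\<integral>x. \<bar>k x - s i x\<bar> \<partial>lebesgue)" for i
    have "(\<lambda>i. \<integral>x. \<bar>k x - s i x\<bar> \<partial>lebesgue) \<longlonglongrightarrow> (\<integral>x. 0 \<partial>(lebesgue :: real measure))"
    proof (rule integral_dominated_convergence[where w = "\<lambda>x. 3 * \<bar>k x\<bar>"])
      show "AE x in lebesgue. (\<lambda>i. \<bar>k x - s i x\<bar>) \<longlonglongrightarrow> 0"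
        using lim.hyps(2) by (intro AE_I2) (auto intro!: tendsto_eq_intros)
      show "AE x in lebesgue. norm \<bar>k x - s i x\<bar> \<le> 3 * \<bar>k x\<bar>" for i
      proof (intro AE_I2)
        fix x
        have "\<bar>k x - s i x\<bar> \<le> \<bar>k x\<bar> + \<bar>s i x\<bar>" by (rule abs_triangle_ineq4)
        then show "norm \<bar>k x - s i x\<bar> \<le> 3 * \<bar>k x\<bar>" using lim.hyps(3)[of x i] by simp
      qed
    qed (use kl in auto)
    then have e: "e \<longlonglongrightarrow> 0" unfolding e_def by (auto intro!: tendsto_eq_intros)
    have le: "\<bar>\<integral>x. k x * h n x \<partial>lebesgue\<bar> \<le> e i + \<bar>\<integral>x. s i x * h n x \<partial>lebesgue\<bar>" for n i
    proof -
      have "(\<integral>x. k x * h n x \<partial>lebesgue) - (\<integral>x. s i x * h n x \<partial>lebesgue) = (\<integral>x. (k x - s i x) * h n x \<partial>lebesgue)"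
        unfolding left_diff_distrib
        by (intro Bochner_Integration.integral_diff[symmetric] prodi kl)
      moreover have "\<bar>\<integral>x. (k x - s i x) * h n x \<partial>lebesgue\<bar> \<le> e i"
        unfolding e_def by (intro prodb Bochner_Integration.integrable_diff kl)
      ultimately show ?thesis by linarith
    qed
    show ?case
    proof (rule LIMSEQ_I)
      fix r :: real assume r: "0 < r"
      then have "\<forall>\<^sub>F i in sequentially. e i < r / 2" by (intro order_tendstoD(2)[OF e]) auto
      then obtain i where i: "e i < r / 2" by (auto simp: eventually_sequentially)
      obtain N where N: "\<And>n. n \<ge> N \<Longrightarrow> norm (\<integral>x. s i x * h n x \<partial>lebesgue) < r / 2"
        using LIMSEQ_D[OF lim.IH[of i], of "r/2"] r by auto
      have "norm ((\<integral>x. k x * h n x \<partial>lebesgue) - 0) < r" if "n \<ge> N" for n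
        using le[of n i] N[OF that] i by simp
      then show "\<exists>N. \<forall>n\<ge>N. norm ((\<integral>x. k x * h n x \<partial>lebesgue) - 0) < r" by blast
    qed
  qed
  \<comment> \<open>The induction above runs over functions integrable for \<open>lborel\<close>, so
    \<open>g\<close> is replaced by a Borel version cut off outside the interval.\<close>
  obtain k where k: "k \<in> borel_measurable borel" "AE x in lebesgue. x \<in> {0<..<T} \<longrightarrow> g x = k x"
    using lebesgue_on_Borel_version[OF borel_measurable_integrable[OF g]] by auto
  define k' where "k' x = indicat_real {0<..<T} x * k x" for x
  have k': "k' \<in> borel_measurable borel" unfolding k'_def by (intro borel_measurable_times borel_measurable_indicator k) auto
  have aek: "AE x in lebesgue. indicat_real {0<..<T} x * g x = k' x"
    using k(2) by eventually_elim (auto simp: k'_def split: split_indicator)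
  have gi: "integrable lebesgue (\<lambda>x. indicat_real {0<..<T} x * g x)"
    using g by (simp add: integrable_restrict_space)
  then have "integrable lebesgue k'"
    by (rule Bochner_Integration.integrable_cong_AE_imp[OF _ _ aek])
       (use k' in \<open>auto simp: measurable_completion\<close>)
  then have "integrable lborel k'" using k' by (simp add: integrable_completion)
  moreover have "(\<integral>x. g x * f n x \<partial>lebesgue_on {0<..<T}) = (\<integral>x. k' x * h n x \<partial>lebesgue)" for n
  proof -
    have "(\<integral>x. g x * f n x \<partial>lebesgue_on {0<..<T}) = (\<integral>x. (indicat_real {0<..<T} x * g x) * h n x \<partial>lebesgue)"
      by (subst integral_restrict_space) (auto simp: h_def split: split_indicator intro!: Bochner_Integration.integral_cong)
    also have "\<dots> = (\<integral>x. k' x * h n x \<partial>lebesgue)"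
    proof (rule integral_cong_AE)
      show "(\<lambda>x. (indicat_real {0<..<T} x * g x) * h n x) \<in> borel_measurable lebesgue"
        by (rule borel_measurable_times[OF borel_measurable_integrable[OF gi] hm])
      show "(\<lambda>x. k' x * h n x) \<in> borel_measurable lebesgue"
        by (intro borel_measurable_times hm measurable_completion) (use k' in simp)
      show "AE x in lebesgue. (indicat_real {0<..<T} x * g x) * h n x = k' x * h n x"
        using aek by eventually_elim simp
    qed
    finally show ?thesis .
  qed
  ultimately show ?thesis using fun_case by simp
qed

text \<open>The density comes from Radon-Nikodym rather than from almost everywhere differentiation.
  The bound \<open>u x \<le> a\<close> comes from the complementary function
  \<open>a * t - U t\<close>, which is monotone too: the two Stieltjes measures add up to
  \<open>a\<close> times Lebesgue measure on the interval, so their nonnegative densities add up to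
  \<open>a\<close>.\<close>

lemma Lipschitz_mono_density:
  fixes U :: "real \<Rightarrow> real"
  assumes U: "\<And>s t. 0 \<le> s \<Longrightarrow> s \<le> t \<Longrightarrow> t \<le> T \<Longrightarrow> U s \<le> U t \<and> U t - U s \<le> a * (t - s)"
    and U0: "U 0 = 0" and T: "0 < T"
  obtains u where "u \<in> borel_measurable borel" "\<And>x. 0 \<le> u x \<and> u x \<le> a"
    "\<And>t. t \<in> {0..T} \<Longrightarrow> integral\<^sup>L (lebesgue_on {0<..<t}) u = U t"
proof -
  have a: "0 \<le> a" using U[of 0 T] T by (simp add: zero_le_mult_iff) (smt (verit) mult_neg_pos)
  \<comment> \<open>Clamping extends \<open>U\<close> by constants, so that monotone functions on
    the whole line are available for the Stieltjes measures.\<close>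
  define cl where "cl x = max 0 (min T x)" for x :: real
  define F where "F x = U (cl x)" for x
  define G where "G x = a * cl x - U (cl x)" for x
  have cl: "0 \<le> cl x" "cl x \<le> T" "x \<le> y \<Longrightarrow> cl x \<le> cl y" "x \<le> y \<Longrightarrow> cl y - cl x \<le> y - x" for x y
    using T by (auto simp: cl_def)
  have FG: "F x \<le> F y" "G x \<le> G y" "F y - F x \<le> a * (y - x)" "G y - G x \<le> a * (y - x)" if "x \<le> y" for x y
  proof -
    have 1: "F x \<le> F y" "F y - F x \<le> a * (cl y - cl x)"
      using U[of "cl x" "cl y"] cl[of x] cl[of y] cl(3)[OF that] by (auto simp: F_def)
    moreover have 2: "a * (cl y - cl x) \<le> a * (y - x)"
      using cl(4)[OF that] a by (intro mult_left_mono)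
    ultimately show "F x \<le> F y" "G x \<le> G y" "F y - F x \<le> a * (y - x)" "G y - G x \<le> a * (y - x)"
      by (auto simp: F_def G_def algebra_simps)
  qed
  have cont: "continuous (at_right x) f"
    if f: "\<And>x y. x \<le> y \<Longrightarrow> f x \<le> f y" "\<And>x y. x \<le> y \<Longrightarrow> f y - f x \<le> a * (y - x)" for f :: "real \<Rightarrow> real" and x
  proof -
    have "a-lipschitz_on UNIV f"
    proof (rule lipschitz_onI)
      fix x y show "dist (f x) (f y) \<le> a * dist x y"
        using f[of x y] f[of y x] by (cases "x \<le> y") (auto simp: dist_real_def abs_if)
    qed (rule a)
    then have "isCont f x"
      using lipschitz_on_continuous_on continuous_on_eq_continuous_at[OF open_UNIV] by blast
    then show ?thesis using continuous_at_imp_continuous_within by blast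
  qed
  define I where "I = {0<..T}"
  define N1 where "N1 = interval_measure F"
  define N2 where "N2 = interval_measure G"
  have [simp]: "sets N1 = sets borel" "sets N2 = sets borel" by (auto simp: N1_def N2_def)
  have em1: "emeasure N1 {s<..t} = ennreal (F t - F s)" if "s \<le> t" for s t
    unfolding N1_def by (rule emeasure_interval_measure_Ioc[OF that]) (auto intro: FG cont)
  have em2: "emeasure N2 {s<..t} = ennreal (G t - G s)" if "s \<le> t" for s t
    unfolding N2_def by (rule emeasure_interval_measure_Ioc[OF that]) (auto intro: FG cont)
  have ioc: "emeasure N1 ({s<..t} \<inter> I) + emeasure N2 ({s<..t} \<inter> I) = a * emeasure lborel ({s<..t} \<inter> I)" for s t
  proof (cases "max s 0 \<le> min t T")
    case True
    have "{s<..t} \<inter> I = {max s 0<..min t T}" by (auto simp: I_def)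
    moreover have "F (min t T) - F (max s 0) + (G (min t T) - G (max s 0)) = a * (min t T - max s 0)"
      using True by (simp add: F_def G_def cl_def algebra_simps)
    ultimately show ?thesis using True a FG[OF True]
      by (simp add: em1 em2 ennreal_plus[symmetric] ennreal_mult del: ennreal_plus)
  next
    case False
    then have "{s<..t} \<inter> I = {}" by (auto simp: I_def)
    then show ?thesis by simp
  qed
  have fin: "emeasure N1 (A \<inter> I) < top" "emeasure N2 (A \<inter> I) < top" "emeasure lborel (A \<inter> I) < top"
    if "A \<in> sets borel" for A
  proof -
    have m: "emeasure N (A \<inter> I) \<le> emeasure N I" if "sets N = sets borel" for N :: "real measure"
      using that by (intro emeasure_mono) (auto simp: I_def)
    have "emeasure N1 I < top" "emeasure N2 I < top" "emeasure lborel I < top"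
      using T by (auto simp: I_def em1 em2)
    then show "emeasure N1 (A \<inter> I) < top" "emeasure N2 (A \<inter> I) < top" "emeasure lborel (A \<inter> I) < top"
      using m[of N1] m[of N2] m[of lborel] by (simp_all add: le_less_trans)
  qed
  \<comment> \<open>Equality on half-open intervals extends to Borel sets by a Dynkin argument;
    intersecting with \<open>I\<close> keeps every measure finite, so that complements can be
    subtracted.\<close>
  have sum: "emeasure N1 (A \<inter> I) + emeasure N2 (A \<inter> I) = a * emeasure lborel (A \<inter> I)"
    if "A \<in> sets borel" for A
  proof -
    let ?G = "range (\<lambda>(a, b). {a <.. b::real})"
    have bs: "sigma_sets UNIV ?G = sets borel"
      by (subst borel_sigma_sets_Ioc) (simp add: sets_measure_of)
    have "Int_stable ?G"
    proof (rule Int_stableI, safe)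
      fix a b c d :: real
      have "{a<..b} \<inter> {c<..d} = {max a c<..min b d}" by auto
      then show "{a<..b} \<inter> {c<..d} \<in> ?G" by auto
    qed
    moreover have "?G \<subseteq> Pow UNIV" by simp
    moreover have "A \<in> sigma_sets UNIV ?G" using that bs by simp
    ultimately show ?thesis
    proof (induction rule: sigma_sets_induct_disjoint)
      case (basic A)
      then show ?case using ioc by auto
    next
      case empty
      show ?case by simp
    next
      case (compl A)
      have A: "A \<in> sets borel" using compl bs by simp
      have eq: "(UNIV - A) \<inter> I = I - A \<inter> I" by auto
      have "I = {0<..T} \<inter> I" by (auto simp: I_def)
      then have Isum: "emeasure N1 I + emeasure N2 I = a * emeasure lborel I" using ioc[of 0 T] by simp
      have d: "emeasure N (I - A \<inter> I) = emeasure N I - emeasure N (A \<inter> I)"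
        if "sets N = sets borel" "emeasure N (A \<inter> I) < top" for N :: "real measure"
        using that A by (intro emeasure_Diff) (auto simp: I_def)
      have r: "emeasure N (A \<inter> I) \<le> emeasure N I" if "sets N = sets borel" for N :: "real measure"
        using that by (intro emeasure_mono) (auto simp: I_def)
      obtain x1 where x1: "emeasure N1 (A \<inter> I) = ennreal x1" "0 \<le> x1" using fin(1)[OF A] by (cases "emeasure N1 (A \<inter> I)") auto
      obtain x2 where x2: "emeasure N2 (A \<inter> I) = ennreal x2" "0 \<le> x2" using fin(2)[OF A] by (cases "emeasure N2 (A \<inter> I)") auto
      obtain x3 where x3: "emeasure lborel (A \<inter> I) = ennreal x3" "0 \<le> x3" using fin(3)[OF A] by (cases "emeasure lborel (A \<inter> I)") auto
      obtain y1 where y1: "emeasure N1 I = ennreal y1" "0 \<le> y1" using fin(1)[of UNIV] by (cases "emeasure N1 I") auto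
      obtain y2 where y2: "emeasure N2 I = ennreal y2" "0 \<le> y2" using fin(2)[of UNIV] by (cases "emeasure N2 I") auto
      obtain y3 where y3: "emeasure lborel I = ennreal y3" "0 \<le> y3" using fin(3)[of UNIV] by (cases "emeasure lborel I") auto
      have le: "x1 \<le> y1" "x2 \<le> y2" "x3 \<le> y3"
        using r[of N1] r[of N2] r[of lborel] x1 x2 x3 y1 y2 y3 by auto
      have "x1 + x2 = a * x3" "y1 + y2 = a * y3"
        using compl.IH Isum x1 x2 x3 y1 y2 y3 a
        by (auto simp: ennreal_plus[symmetric] ennreal_mult[symmetric] simp del: ennreal_plus)
      then have "(y1 - x1) + (y2 - x2) = a * (y3 - x3)" by (simp add: algebra_simps)
      then show ?case
        using d[of N1] d[of N2] d[of lborel] fin[OF A] x1 x2 x3 y1 y2 y3 a le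
        by (simp add: eq ennreal_minus ennreal_plus[symmetric] ennreal_mult[symmetric] del: ennreal_plus)
    next
      case (union A)
      have A: "A i \<in> sets borel" for i using union.hyps bs by auto
      have dis: "disjoint_family (\<lambda>i. A i \<inter> I)" using union.hyps(1) by (auto simp: disjoint_family_on_def)
      have s: "emeasure N ((\<Union>i. A i) \<inter> I) = (\<Sum>i. emeasure N (A i \<inter> I))" if N: "sets N = sets borel" for N :: "real measure"
      proof -
        have "range (\<lambda>i. A i \<inter> I) \<subseteq> sets N" using N A by (auto simp: I_def)
        from suminf_emeasure[OF this dis] show ?thesis
          by (simp only: Int_UN_distrib2[symmetric] UN_simps)
      qed
      have "emeasure N1 ((\<Union>i. A i) \<inter> I) + emeasure N2 ((\<Union>i. A i) \<inter> I)
          = (\<Sum>i. emeasure N1 (A i \<inter> I)) + (\<Sum>i. emeasure N2 (A i \<inter> I))"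
        by (simp only: s \<open>sets N1 = sets borel\<close> \<open>sets N2 = sets borel\<close>)
      also have "\<dots> = (\<Sum>i. emeasure N1 (A i \<inter> I) + emeasure N2 (A i \<inter> I))"
        by (intro suminf_add summableI)
      also have "\<dots> = (\<Sum>i. ennreal a * emeasure lborel (A i \<inter> I))"
        by (simp only: union.IH)
      also have "\<dots> = ennreal a * (\<Sum>i. emeasure lborel (A i \<inter> I))"
        by (rule ennreal_suminf_cmult)
      also have "\<dots> = ennreal a * emeasure lborel ((\<Union>i. A i) \<inter> I)"
        by (simp only: s sets_lborel)
      finally show ?case .
    qed
  qed
  have ac: "\<exists>f\<in>borel_measurable lborel. density lborel f = density N (indicator I)"
    if N: "sets N = sets borel" and le: "\<And>A. A \<in> sets borel \<Longrightarrow> emeasure N (A \<inter> I) \<le> a * emeasure lborel (A \<inter> I)" for N :: "real measure"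
  proof (rule sigma_finite_measure.Radon_Nikodym[OF sigma_finite_lborel])
    show "absolutely_continuous lborel (density N (indicator I))"
      unfolding absolutely_continuous_def
    proof
      fix A :: "real set" assume "A \<in> null_sets lborel"
      then have A: "A \<in> sets borel" "emeasure lborel A = 0" by auto
      have "emeasure lborel (A \<inter> I) \<le> emeasure lborel A" by (rule emeasure_mono) (use A in auto)
      then have "emeasure N (A \<inter> I) = 0" using le[OF A(1)] A(2) by simp
      then show "A \<in> null_sets (density N (indicator I))"
        using A N by (auto simp: null_sets_def emeasure_restricted I_def Int_commute)
    qed
    show "sets (density N (indicator I)) = sets lborel" using N by simp
  qed
  have le1: "emeasure N1 (A \<inter> I) \<le> ennreal a * emeasure lborel (A \<inter> I)"
    and le2: "emeasure N2 (A \<inter> I) \<le> ennreal a * emeasure lborel (A \<inter> I)" if "A \<in> sets borel" for A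
    unfolding sum[OF that, symmetric] by simp_all
  obtain f1 where f1: "f1 \<in> borel_measurable lborel" "density lborel f1 = density N1 (indicator I)"
    using ac[OF \<open>sets N1 = sets borel\<close> le1] by blast
  obtain f2 where f2: "f2 \<in> borel_measurable lborel" "density lborel f2 = density N2 (indicator I)"
    using ac[OF \<open>sets N2 = sets borel\<close> le2] by blast
  have e1: "(\<integral>\<^sup>+x. f1 x * indicator A x \<partial>lborel) = emeasure N1 (A \<inter> I)" if "A \<in> sets borel" for A
    using arg_cong[OF f1(2), of "\<lambda>M. emeasure M A"] that f1(1)
    by (simp add: emeasure_density emeasure_restricted I_def Int_commute)
  have e2: "(\<integral>\<^sup>+x. f2 x * indicator A x \<partial>lborel) = emeasure N2 (A \<inter> I)" if "A \<in> sets borel" for A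
    using arg_cong[OF f2(2), of "\<lambda>M. emeasure M A"] that f2(1)
    by (simp add: emeasure_density emeasure_restricted I_def Int_commute)
  have "density lborel (\<lambda>x. f1 x + f2 x) = density lborel (\<lambda>x. ennreal a * indicator I x)"
  proof (rule measure_eqI)
    fix A assume "A \<in> sets (density lborel (\<lambda>x. f1 x + f2 x))"
    then have A: "A \<in> sets borel" by simp
    have "emeasure (density lborel (\<lambda>x. f1 x + f2 x)) A = (\<integral>\<^sup>+x. (f1 x + f2 x) * indicator A x \<partial>lborel)"
      using A f1 f2 by (intro emeasure_density) auto
    also have "\<dots> = (\<integral>\<^sup>+x. f1 x * indicator A x + f2 x * indicator A x \<partial>lborel)"
      by (simp add: distrib_right)
    also have "\<dots> = emeasure N1 (A \<inter> I) + emeasure N2 (A \<inter> I)"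
      using A f1 f2 by (subst nn_integral_add) (auto simp: e1 e2)
    also have "\<dots> = a * emeasure lborel (A \<inter> I)" by (rule sum[OF A])
    also have "\<dots> = (\<integral>\<^sup>+x. ennreal a * indicator (A \<inter> I) x \<partial>lborel)"
      using A by (subst nn_integral_cmult_indicator) (auto simp: I_def)
    also have "\<dots> = (\<integral>\<^sup>+x. (ennreal a * indicator I x) * indicator A x \<partial>lborel)"
      by (intro nn_integral_cong) (auto split: split_indicator)
    also have "\<dots> = emeasure (density lborel (\<lambda>x. ennreal a * indicator I x)) A"
      using A by (intro emeasure_density[symmetric]) (auto simp: I_def)
    finally show "emeasure (density lborel (\<lambda>x. f1 x + f2 x)) A
        = emeasure (density lborel (\<lambda>x. ennreal a * indicator I x)) A" .
  qed simp
  then have "AE x in lborel. f1 x + f2 x = ennreal a * indicator I x"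
    using f1 f2 by (intro sigma_finite_measure.density_unique[OF sigma_finite_lborel]) (auto simp: I_def)
  then have f1a: "AE x in lborel. f1 x \<le> ennreal a"
  proof eventually_elim
    case (elim x)
    have "f1 x \<le> f1 x + f2 x" by simp
    also have "\<dots> \<le> ennreal a" using elim by (auto split: split_indicator)
    finally show ?case .
  qed
  \<comment> \<open>The minimum turns the almost everywhere bound into one at every point and
    changes the density only on a null set.\<close>
  define u where "u x = min a (enn2real (f1 x))" for x
  have um: "u \<in> borel_measurable borel" using f1(1) unfolding u_def[abs_def] by simp
  have ub: "0 \<le> u x \<and> u x \<le> a" for x using a by (simp add: u_def)
  have uf: "AE x in lborel. ennreal (u x) = f1 x"
    using f1a
  proof eventually_elim
    case (elim x)
    then have "f1 x < top" by (rule le_less_trans) simp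
    then have "ennreal (enn2real (f1 x)) = f1 x" by simp
    moreover have "enn2real (f1 x) \<le> a" using elim a by (metis enn2real_leI)
    ultimately show ?case by (simp add: u_def min_def)
  qed
  show thesis
  proof (rule that[OF um ub])
    fix t assume t: "t \<in> {0..T}"
    have "integral\<^sup>L (lebesgue_on {0<..<t}) u = (\<integral>x. indicat_real {0<..<t} x *\<^sub>R u x \<partial>lebesgue)"
      by (rule integral_restrict_space) simp
    also have "\<dots> = (\<integral>x. indicat_real {0<..<t} x * u x \<partial>lborel)"
      using um by (subst integral_completion) auto
    also have "\<dots> = enn2real (\<integral>\<^sup>+x. ennreal (indicat_real {0<..<t} x * u x) \<partial>lborel)"
      using um ub by (intro integral_eq_nn_integral) auto
    also have "(\<integral>\<^sup>+x. ennreal (indicat_real {0<..<t} x * u x) \<partial>lborel)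
        = (\<integral>\<^sup>+x. f1 x * indicator {0<..t} x \<partial>lborel)"
    proof (rule nn_integral_cong_AE)
      show "AE x in lborel. ennreal (indicat_real {0<..<t} x * u x) = f1 x * indicator {0<..t} x"
        using uf AE_lborel_singleton[of t]
        by eventually_elim (auto split: split_indicator)
    qed
    also have "\<dots> = emeasure N1 ({0<..t} \<inter> I)" by (rule e1) simp
    also have "{0<..t} \<inter> I = {0<..t}" using t by (auto simp: I_def)
    also have "emeasure N1 {0<..t} = ennreal (U t)"
      using t T U0 by (subst em1) (auto simp: F_def cl_def)
    finally show "integral\<^sup>L (lebesgue_on {0<..<t}) u = U t"
      using U[of 0 t] t U0 by simp
  qed
qed

text \<open>The factor of \<open>a - b\<close> is a subgradient of
  \<open>\<bar>x\<bar> powr p\<close> at \<open>b\<close>; with \<open>sgn 0 = 0\<close> it also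
  covers the kink at \<open>b = 0\<close> for \<open>p = 1\<close>. The tangent inequality is taken
  on the open half-line, hence the separate case \<open>a = 0\<close>.\<close>

lemma abs_powr_above_tangent:
  fixes a b p :: real
  assumes "1 \<le> p"
  shows "\<bar>b\<bar> powr p + p * (\<bar>b\<bar> powr (p - 1) * sgn b) * (a - b) \<le> \<bar>a\<bar> powr p"
proof (cases "b = 0")
  case False
  have "\<bar>a\<bar> powr p - \<bar>b\<bar> powr p \<ge> (p * \<bar>b\<bar> powr (p - 1)) * (\<bar>a\<bar> - \<bar>b\<bar>)"
  proof (cases "a = 0")
    case True
    have "\<bar>b\<bar> powr (p - 1) * \<bar>b\<bar> = \<bar>b\<bar> powr p"
      using powr_add[of "\<bar>b\<bar>" "p - 1" 1] by simp
    then have "(p * \<bar>b\<bar> powr (p - 1)) * (\<bar>a\<bar> - \<bar>b\<bar>) = - (p * \<bar>b\<bar> powr p)"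
      using True by (simp add: mult.assoc)
    moreover have "1 * \<bar>b\<bar> powr p \<le> p * \<bar>b\<bar> powr p"
      using assms by (intro mult_right_mono) auto
    moreover have "\<bar>a\<bar> powr p = 0" using True by simp
    ultimately show ?thesis by linarith
  next
    case a: False
    show ?thesis
    proof (rule convex_on_imp_above_tangent[OF powr_convex[OF assms]])
      show "((\<lambda>x. x powr p) has_real_derivative p * \<bar>b\<bar> powr (p - 1)) (at \<bar>b\<bar> within {0<..})"
        by (rule has_field_derivative_at_within[OF has_real_derivative_powr]) (use False in simp)
    qed (use False a in \<open>auto simp: interior_open\<close>)
  qed
  moreover have "sgn b * (a - b) \<le> \<bar>a\<bar> - \<bar>b\<bar>"
    by (auto simp: sgn_if abs_if)
  then have "(p * \<bar>b\<bar> powr (p - 1)) * (sgn b * (a - b)) \<le> (p * \<bar>b\<bar> powr (p - 1)) * (\<bar>a\<bar> - \<bar>b\<bar>)"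
    using assms by (intro mult_left_mono) auto
  ultimately show ?thesis by (simp add: mult_ac)
qed simp

text \<open>Integrating the tangent inequality at \<open>g\<close> bounds the p-th power integral of
  \<open>f n\<close> below by that of \<open>g\<close> plus the pairing of \<open>f n - g\<close>
  with the subgradient \<open>k\<close>. Since \<open>k\<close> is one fixed integrable function,
  weak convergence removes the pairing in the limit.\<close>

lemma Lp_norm_weak_lsc:
  assumes M: "finite_measure M" and p: "1 \<le> p"
    and fn: "\<And>n. f n \<in> borel_measurable M" "\<And>n. AE x in M. \<bar>f n x\<bar> \<le> B"
    and f: "g \<in> borel_measurable M" "AE x in M. \<bar>g x\<bar> \<le> B"
    and weak: "\<And>k. integrable M k \<Longrightarrow> (\<lambda>n. \<integral>x. k x * (f n x - g x) \<partial>M) \<longlonglongrightarrow> 0"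
    and L: "(\<lambda>n. Lp_norm M p (f n)) \<longlonglongrightarrow> L"
  shows "Lp_norm M p g \<le> L"
proof -
  interpret finite_measure M by (rule M)
  have pint: "integrable M (\<lambda>x. \<bar>h x\<bar> powr q)"
    if "h \<in> borel_measurable M" "AE x in M. \<bar>h x\<bar> \<le> B" "0 \<le> q" for h q
  proof (rule integrable_const_bound[where B = "B powr q"])
    show "AE x in M. norm (\<bar>h x\<bar> powr q) \<le> B powr q"
      using that(2) by eventually_elim (auto intro!: powr_mono2 that)
  qed (use that in auto)
  define k where "k x = p * (\<bar>g x\<bar> powr (p - 1) * sgn (g x))" for x
  have ki: "integrable M k"
  proof -
    have "integrable M (\<lambda>x. \<bar>g x\<bar> powr (p - 1) * sgn (g x))"
      by (rule Bochner_Integration.integrable_bound[OF pint[OF f, of "p - 1"]])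
         (use p f in \<open>auto simp: abs_mult sgn_if\<close>)
    then show ?thesis unfolding k_def by simp
  qed
  have kfi: "integrable M (\<lambda>x. k x * (f n x - g x))" for n
  proof (rule Bochner_Integration.integrable_bound[where f = "\<lambda>x. (2 * B) * k x"])
    show "AE x in M. norm (k x * (f n x - g x)) \<le> norm (2 * B * k x)"
      using fn(2)[of n] f(2)
    proof eventually_elim
      case (elim x)
      then have "\<bar>f n x - g x\<bar> \<le> \<bar>2 * B\<bar>" by (auto simp: abs_le_iff)
      then show ?case
        using mult_left_mono[of "\<bar>f n x - g x\<bar>" "\<bar>2 * B\<bar>" "\<bar>k x\<bar>"] by (simp add: abs_mult mult_ac)
    qed
    show "(\<lambda>x. k x * (f n x - g x)) \<in> borel_measurable M"
      using ki fn(1)[of n] f(1) by (intro borel_measurable_times borel_measurable_diff) auto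
  qed (use ki in simp)
  define I where "I n = (\<integral>x. \<bar>f n x\<bar> powr p \<partial>M)" for n
  define J where "J = (\<integral>x. \<bar>g x\<bar> powr p \<partial>M)"
  have IJ0: "0 \<le> I n" "0 \<le> J" for n by (auto simp: I_def J_def)
  have le: "J + (\<integral>x. k x * (f n x - g x) \<partial>M) \<le> I n" for n
  proof -
    have "J + (\<integral>x. k x * (f n x - g x) \<partial>M) = (\<integral>x. \<bar>g x\<bar> powr p + k x * (f n x - g x) \<partial>M)"
      unfolding J_def using p by (intro Bochner_Integration.integral_add[symmetric] pint f kfi) auto
    also have "\<dots> \<le> I n"
      unfolding I_def
    proof (rule integral_mono)
      show "integrable M (\<lambda>x. \<bar>g x\<bar> powr p + k x * (f n x - g x))"
        using p by (intro Bochner_Integration.integrable_add pint f kfi) auto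
      show "integrable M (\<lambda>x. \<bar>f n x\<bar> powr p)"
        using p by (intro pint fn) auto
      show "\<bar>g x\<bar> powr p + k x * (f n x - g x) \<le> \<bar>f n x\<bar> powr p" for x
        using abs_powr_above_tangent[OF p, of "g x" "f n x"] by (simp add: k_def)
    qed
    finally show ?thesis .
  qed
  have "I = (\<lambda>n. Lp_norm M p (f n) powr p)"
    using p IJ0(1) by (simp add: Lp_norm_def I_def powr_powr fun_eq_iff)
  moreover have "(\<lambda>n. Lp_norm M p (f n) powr p) \<longlonglongrightarrow> L powr p"
    using p by (intro tendsto_powr' L tendsto_const) (auto simp: Lp_norm_def)
  ultimately have "I \<longlonglongrightarrow> L powr p" by simp
  moreover have "(\<lambda>n. J + (\<integral>x. k x * (f n x - g x) \<partial>M)) \<longlonglongrightarrow> J + 0"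
    by (intro tendsto_add tendsto_const weak ki)
  ultimately have "J + 0 \<le> L powr p"
    using le by (intro tendsto_le[OF sequentially_bot]) (auto intro: always_eventually)
  moreover have "0 \<le> L" using L by (rule LIMSEQ_le_const) (auto simp: Lp_norm_def)
  ultimately have "J powr (1 / p) \<le> (L powr p) powr (1 / p)"
    using p IJ0(2) by (intro powr_mono2) auto
  then show ?thesis using p \<open>0 \<le> L\<close> by (simp add: Lp_norm_def J_def powr_powr)
qed

text \<open>On a space of nonzero measure the constant zero has essential supremum zero; so that of
  \<open>\<bar>u x\<bar>\<close> is nonnegative and finite, and the conversion to a real number in
  \<open>Linf_norm\<close> loses nothing.\<close>

lemma Linf_norm_bounds:
  assumes u: "u \<in> Linf M" and M: "emeasure M (space M) \<noteq> 0"
  shows "0 \<le> Linf_norm M u" "AE x in M. \<bar>u x\<bar> \<le> Linf_norm M u"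
    "\<And>a. AE x in M. \<bar>u x\<bar> \<le> a \<Longrightarrow> Linf_norm M u \<le> a"
proof -
  have um: "u \<in> borel_measurable M" using u by (simp add: Linf_def)
  then have m: "(\<lambda>x. ereal \<bar>u x\<bar>) \<in> borel_measurable M" by simp
  define E where "E = esssup M (\<lambda>x. ereal \<bar>u x\<bar>)"
  have le: "E \<le> ereal a" if "AE x in M. \<bar>u x\<bar> \<le> a" for a
    unfolding E_def using that by (intro esssup_I[OF m]) auto
  have "esssup M (\<lambda>x. 0 :: ereal) \<le> E"
    unfolding E_def by (intro esssup_mono) auto
  then have E0: "0 \<le> E" using M by (simp add: esssup_const)
  obtain C where "AE x in M. \<bar>u x\<bar> \<le> C" using u by (auto simp: Linf_def)
  from le[OF this] E0 have "\<bar>E\<bar> \<noteq> \<infinity>" by (cases E) auto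
  then have E: "E = ereal (Linf_norm M u)" by (simp add: Linf_norm_def E_def[symmetric] ereal_real)
  show "0 \<le> Linf_norm M u" using E0 E by simp
  show "AE x in M. \<bar>u x\<bar> \<le> Linf_norm M u"
    using esssup_AE[of "\<lambda>x. ereal \<bar>u x\<bar>" M] by (simp add: E_def[symmetric] E)
  show "\<And>a. AE x in M. \<bar>u x\<bar> \<le> a \<Longrightarrow> Linf_norm M u \<le> a"
    using le E by simp
qed

subsection \<open>Characteristics\<close>

text \<open>A velocity on the whole plane with global bounds, so that characteristics exist on all
  of \<open>[0, T]\<close> even where they lie outside \<open>[0, 1]\<close>. Differentiability is
  asked for in the position only; in the mass, a Lipschitz bound with the same constant
  \<open>K\<close> is what Gronwall requires.\<close>

locale speed =
  fixes l lx :: "real \<Rightarrow> real \<Rightarrow> real" and K c C T :: real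
  assumes l_deriv: "\<And>x w. ((\<lambda>x. l x w) has_real_derivative lx x w) (at x)"
    and lx_cont: "continuous_on UNIV (\<lambda>(x, w). lx x w)"
    and lx_bound: "\<And>x w. \<bar>lx x w\<bar> \<le> K"
    and l_Lip: "\<And>x w w'. \<bar>l x w - l x w'\<bar> \<le> K * \<bar>w - w'\<bar>"
    and l_lo: "\<And>x w. c \<le> l x w" and l_hi: "\<And>x w. l x w \<le> C"
    and c_pos: "0 < c" and T_pos: "0 < T"
begin

lemma K_nonneg: "0 \<le> K" and C_pos: "0 < C"
  using lx_bound[of 0 0] l_lo[of 0 0] l_hi[of 0 0] c_pos by linarith+

text \<open>The Gronwall factor over the full time \<open>T\<close>: it bounds how much the flow
  stretches distances, and its inverse how much it shrinks them.\<close>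

definition E :: real where "E = exp (K * T)"

lemma E_pos: "0 < E"
  by (simp add: E_def)

text \<open>The mean of \<open>lx\<close> over a segment, i.e. the difference quotient of \<open>l\<close>, extended continuously
  to the diagonal.\<close>

definition mean_slope :: "real \<Rightarrow> real \<Rightarrow> real \<Rightarrow> real" where
  "mean_slope x y w = integral {0..1} (\<lambda>\<theta>. lx (x + \<theta> * (y - x)) w)"

lemma lx_cont_compose:
  assumes "continuous_on S f" "continuous_on S g"
  shows "continuous_on S (\<lambda>z. lx (f z) (g z))"
  using continuous_on_compose2[OF lx_cont continuous_on_Pair[OF assms]] by simp

lemma l_diff: "l y w - l x w = (y - x) * mean_slope x y w"
proof -
  have "((\<lambda>\<theta>. (y - x) * lx (x + \<theta> * (y - x)) w) has_integral
      l (x + 1 * (y - x)) w - l (x + 0 * (y - x)) w) {0..1}"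
  proof (rule fundamental_theorem_of_calculus)
    fix \<theta> :: real
    have "((\<lambda>\<theta>. l (x + \<theta> * (y - x)) w) has_real_derivative lx (x + \<theta> * (y - x)) w * (y - x)) (at \<theta>)"
      by (rule DERIV_chain2[OF l_deriv]) (auto intro!: derivative_eq_intros)
    then show "((\<lambda>\<theta>. l (x + \<theta> * (y - x)) w) has_vector_derivative (y - x) * lx (x + \<theta> * (y - x)) w)
        (at \<theta> within {0..1})"
      by (metis has_field_derivative_at_within has_real_derivative_iff_has_vector_derivative mult.commute)
  qed simp
  from integral_unique[OF this] show ?thesis by (simp add: mean_slope_def)
qed

lemma mean_slope_bound: "\<bar>mean_slope x y w\<bar> \<le> K"
proof -
  have "norm (integral {0..1} (\<lambda>\<theta>. lx (x + \<theta> * (y - x)) w)) \<le> integral {0..1} (\<lambda>\<theta>::real. K)"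
    by (intro integral_norm_bound_integral integrable_continuous_interval lx_cont_compose continuous_intros)
       (use lx_bound in auto)
  then show ?thesis by (simp add: mean_slope_def)
qed

lemma mean_slope_cont:
  assumes "continuous_on S f" "continuous_on S g" "continuous_on S h"
  shows "continuous_on S (\<lambda>z. mean_slope (f z) (g z) (h z))"
proof -
  have "continuous_on UNIV (\<lambda>p. integral (cbox 0 1)
      (\<lambda>\<theta>. lx (fst p + \<theta> * (fst (snd p) - fst p)) (snd (snd p :: real \<times> real))))"
    by (rule integral_continuous_on_param)
       (auto intro!: lx_cont_compose continuous_intros simp: split_beta)
  from continuous_on_compose2[OF this continuous_on_Pair[OF assms(1) continuous_on_Pair[OF assms(2,3)]]]
  show ?thesis by (simp add: mean_slope_def)
qed

lemma l_Lip_x: "\<bar>l x w - l y w\<bar> \<le> K * \<bar>x - y\<bar>"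
  using mult_left_mono[OF mean_slope_bound[of y x w], of "\<bar>x - y\<bar>"]
  by (simp add: l_diff abs_mult mult.commute)

lemma l_Lip2: "\<bar>l x w - l y w'\<bar> \<le> K * \<bar>x - y\<bar> + K * \<bar>w - w'\<bar>"
  using l_Lip_x[of x w y] l_Lip[of y w w'] by linarith

lemma l_cont:
  assumes f: "continuous_on S f" and g: "continuous_on S g"
  shows "continuous_on S (\<lambda>z. l (f z) (g z))"
  unfolding continuous_on_def
proof
  fix z assume z: "z \<in> S"
  have "((\<lambda>y. K * \<bar>f y - f z\<bar> + K * \<bar>g y - g z\<bar>) \<longlongrightarrow> K * \<bar>f z - f z\<bar> + K * \<bar>g z - g z\<bar>) (at z within S)"
    using f g z by (intro tendsto_intros) (auto simp: continuous_on_def)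
  then have "((\<lambda>y. K * \<bar>f y - f z\<bar> + K * \<bar>g y - g z\<bar>) \<longlongrightarrow> 0) (at z within S)" by simp
  then have "((\<lambda>y. l (f y) (g y) - l (f z) (g z)) \<longlongrightarrow> 0) (at z within S)"
    by (rule Lim_null_comparison[rotated]) (auto intro: always_eventually l_Lip2)
  then show "((\<lambda>y. l (f y) (g y)) \<longlongrightarrow> l (f z) (g z)) (at z within S)"
    by (rule LIM_zero_cancel)
qed

text \<open>Derivatives are taken within \<open>{0..\<tau>}\<close>, so only \<open>W\<close> on
  this interval matters and a path remains one when the interval is shortened.\<close>

definition path :: "(real \<Rightarrow> real) \<Rightarrow> real \<Rightarrow> (real \<Rightarrow> real) \<Rightarrow> bool" where
  "path W \<tau> \<xi> \<longleftrightarrow> (\<forall>s\<in>{0..\<tau>}. (\<xi> has_real_derivative l (\<xi> s) (W s)) (at s within {0..\<tau>}))"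

lemma path_cont: "path W \<tau> \<xi> \<Longrightarrow> continuous_on {0..\<tau>} \<xi>"
  unfolding path_def by (rule DERIV_continuous_on) auto

lemma path_subset:
  assumes "path W \<tau> \<xi>" "\<tau>' \<le> \<tau>"
  shows "path W \<tau>' \<xi>"
  unfolding path_def
proof
  fix s assume "s \<in> {0..\<tau>'}"
  then have "(\<xi> has_real_derivative l (\<xi> s) (W s)) (at s within {0..\<tau>})"
    using assms by (auto simp: path_def)
  then show "(\<xi> has_real_derivative l (\<xi> s) (W s)) (at s within {0..\<tau>'})"
    by (rule has_field_derivative_subset) (use assms in auto)
qed

lemma path_integral:
  assumes "path W \<tau> \<xi>" "0 \<le> s" "s \<le> t" "t \<le> \<tau>"
  shows "((\<lambda>r. l (\<xi> r) (W r)) has_integral \<xi> t - \<xi> s) {s..t}"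
proof (rule fundamental_theorem_of_calculus)
  fix r assume "r \<in> {s..t}"
  then have "(\<xi> has_real_derivative l (\<xi> r) (W r)) (at r within {0..\<tau>})"
    using assms by (auto simp: path_def)
  then have "(\<xi> has_real_derivative l (\<xi> r) (W r)) (at r within {s..t})"
    by (rule has_field_derivative_subset) (use assms in auto)
  then show "(\<xi> has_vector_derivative l (\<xi> r) (W r)) (at r within {s..t})"
    by (simp add: has_real_derivative_iff_has_vector_derivative)
qed (use assms in auto)

lemma path_growth:
  assumes "path W \<tau> \<xi>" "0 \<le> s" "s \<le> t" "t \<le> \<tau>"
  shows "c * (t - s) \<le> \<xi> t - \<xi> s" "\<xi> t - \<xi> s \<le> C * (t - s)"
proof -
  have "((\<lambda>r. c) has_integral c * (t - s)) {s..t}" "((\<lambda>r. C) has_integral C * (t - s)) {s..t}"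
    using has_integral_const_real[of c s t] has_integral_const_real[of C s t] assms by (auto simp: mult.commute)
  then show "c * (t - s) \<le> \<xi> t - \<xi> s" "\<xi> t - \<xi> s \<le> C * (t - s)"
    using path_integral[OF assms] l_lo l_hi by (auto intro: has_integral_le)
qed

text \<open>Both paths are pinned at the final time, so Gronwall runs backwards, with the integrated
  mass difference as its constant. That the bound is an integral over the past is what later makes
  the mass a Volterra problem.\<close>

lemma path_compare:
  assumes p: "path W1 \<tau> \<xi>1" "path W2 \<tau> \<xi>2" and e: "\<xi>1 \<tau> = \<xi>2 \<tau>"
    and W: "continuous_on {0..\<tau>} W1" "continuous_on {0..\<tau>} W2"
    and s: "0 \<le> s" "s \<le> \<tau>" and \<tau>: "\<tau> \<le> T"
  shows "\<bar>\<xi>1 s - \<xi>2 s\<bar> \<le> E * K * integral {0..\<tau>} (\<lambda>r. \<bar>W1 r - W2 r\<bar>)"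
proof -
  define A where "A = K * integral {0..\<tau>} (\<lambda>r. \<bar>W1 r - W2 r\<bar>)"
  note pc = path_cont[OF p(1)] path_cont[OF p(2)]
  have A: "0 \<le> A" unfolding A_def
    by (intro mult_nonneg_nonneg K_nonneg integral_nonneg integrable_continuous_interval continuous_intros W) auto
  have "\<bar>\<xi>1 s - \<xi>2 s\<bar> \<le> A * exp (K * (\<tau> - s))"
  proof (rule gronwall_backward[where f = "\<lambda>s. \<bar>\<xi>1 s - \<xi>2 s\<bar>" and a = 0])
    show "continuous_on {0..\<tau>} (\<lambda>s. \<bar>\<xi>1 s - \<xi>2 s\<bar>)"
      by (intro continuous_intros pc)
    fix r assume r: "r \<in> {0..\<tau>}"
    have sub: "{r..\<tau>} \<subseteq> {0..\<tau>}" using r by auto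
    note cs = continuous_on_subset[OF pc(1) sub] continuous_on_subset[OF pc(2) sub]
      continuous_on_subset[OF W(1) sub] continuous_on_subset[OF W(2) sub]
    have d: "((\<lambda>q. l (\<xi>1 q) (W1 q) - l (\<xi>2 q) (W2 q)) has_integral (\<xi>1 \<tau> - \<xi>1 r) - (\<xi>2 \<tau> - \<xi>2 r)) {r..\<tau>}"
      by (intro has_integral_diff path_integral[OF p(1)] path_integral[OF p(2)]) (use r in auto)
    have "norm (integral {r..\<tau>} (\<lambda>q. l (\<xi>1 q) (W1 q) - l (\<xi>2 q) (W2 q)))
        \<le> integral {r..\<tau>} (\<lambda>q. K * \<bar>\<xi>1 q - \<xi>2 q\<bar> + K * \<bar>W1 q - W2 q\<bar>)"
      by (intro integral_norm_bound_integral integrable_continuous_interval continuous_intros cs l_cont)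
         (use l_Lip2 in auto)
    also have "\<dots> = K * integral {r..\<tau>} (\<lambda>q. \<bar>\<xi>1 q - \<xi>2 q\<bar>) + K * integral {r..\<tau>} (\<lambda>q. \<bar>W1 q - W2 q\<bar>)"
      by (subst Henstock_Kurzweil_Integration.integral_add)
         (auto intro!: integrable_continuous_interval continuous_intros cs)
    also have "K * integral {r..\<tau>} (\<lambda>q. \<bar>W1 q - W2 q\<bar>) \<le> A"
      unfolding A_def using sub
      by (intro mult_left_mono K_nonneg integral_subset_le integrable_continuous_interval continuous_intros cs W) auto
    finally show "\<bar>\<xi>1 r - \<xi>2 r\<bar> \<le> A + K * integral {r..\<tau>} (\<lambda>q. \<bar>\<xi>1 q - \<xi>2 q\<bar>)"
      using integral_unique[OF d] e by simp
  qed (use K_nonneg s in auto)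
  also have "exp (K * (\<tau> - s)) \<le> E"
    unfolding E_def using K_nonneg s \<tau> by (auto intro: mult_left_mono)
  then have "A * exp (K * (\<tau> - s)) \<le> A * E" using A by (intro mult_left_mono)
  finally show ?thesis by (simp add: A_def mult_ac)
qed

text \<open>The difference of two paths solves a linear equation with coefficient
  \<open>mean_slope\<close>, so it is an explicit exponential. The difference quotient of the flow
  is thus known in closed form, and its limit on the diagonal comes from continuity rather than from
  a variational equation.\<close>

lemma path_diff:
  assumes p: "path W \<tau> \<xi>" "path W \<tau> \<eta>" and W: "continuous_on {0..\<tau>} W"
    and t: "t \<in> {0..\<tau>}"
  shows "\<eta> t - \<xi> t = (\<eta> 0 - \<xi> 0) * exp (integral {0..t} (\<lambda>s. mean_slope (\<xi> s) (\<eta> s) (W s)))"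
proof -
  define m where "m s = mean_slope (\<xi> s) (\<eta> s) (W s)" for s
  have m: "continuous_on {0..\<tau>} m"
    unfolding m_def by (intro mean_slope_cont path_cont[OF p(1)] path_cont[OF p(2)] W)
  define h where "h s = (\<eta> s - \<xi> s) * exp (- integral {0..s} m)" for s
  have "(h has_real_derivative 0) (at s within {0..\<tau>})" if s: "s \<in> {0..\<tau>}" for s
  proof -
    have "(\<xi> has_real_derivative l (\<xi> s) (W s)) (at s within {0..\<tau>})"
      "(\<eta> has_real_derivative l (\<eta> s) (W s)) (at s within {0..\<tau>})"
      using p s by (auto simp: path_def)
    note [derivative_intros] = this integral_has_real_derivative[OF m s]
    have "(h has_real_derivative (\<eta> s - \<xi> s) * (exp (- integral {0..s} m) * - m s)
        + (l (\<eta> s) (W s) - l (\<xi> s) (W s)) * exp (- integral {0..s} m)) (at s within {0..\<tau>})"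
      unfolding h_def[abs_def] by (rule derivative_eq_intros refl)+ (simp add: algebra_simps)
    then show ?thesis by (simp add: l_diff m_def algebra_simps)
  qed
  then have "\<exists>k. \<forall>s\<in>{0..\<tau>}. h s = k"
    by (intro has_field_derivative_zero_constant) auto
  then have "h t = h 0" using t by force
  then have "(\<eta> t - \<xi> t) * exp (- integral {0..t} m) = \<eta> 0 - \<xi> 0"
    by (simp add: h_def)
  then have "(\<eta> t - \<xi> t) * (exp (- integral {0..t} m) * exp (integral {0..t} m))
      = (\<eta> 0 - \<xi> 0) * exp (integral {0..t} m)"
    by (simp only: mult.assoc[symmetric])
  then show ?thesis by (simp add: exp_minus_inverse mult.commute[of "exp (- _)"] m_def[abs_def])
qed

end

section \<open>The flow of the characteristic equation for a given mass \<open>W\<close>\<close>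

locale flow = speed +
  fixes W :: "real \<Rightarrow> real"
  assumes W_cont: "continuous_on {0..T} W"
begin

lemma path_exists: "\<exists>\<xi>. path W T \<xi> \<and> \<xi> 0 = z"
proof -
  obtain \<xi> where \<xi>: "continuous_on {0..T} \<xi>"
    "\<And>t. t \<in> {0..T} \<Longrightarrow> z + integral {0..t} (\<lambda>s. l (\<xi> s) (W s)) = \<xi> t"
  proof (rule volterra_fixed_point[of K T "\<lambda>\<xi> t. z + integral {0..t} (\<lambda>s. l (\<xi> s) (W s))"])
    show "continuous_on {0..T} (\<lambda>t. z + integral {0..t} (\<lambda>s. l (f s) (W s)))" if "continuous_on {0..T} f" for f
      by (intro continuous_intros indefinite_integral_continuous_1 integrable_continuous_interval l_cont that W_cont)
    show "\<bar>z + integral {0..t} (\<lambda>s. l (f s) (W s)) - (z + integral {0..t} (\<lambda>s. l (g s) (W s)))\<bar>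
        \<le> K * integral {0..t} (\<lambda>s. \<bar>f s - g s\<bar>)"
      if "continuous_on {0..T} f" "continuous_on {0..T} g" "t \<in> {0..T}" for f g t
    proof -
      have sub: "{0..t} \<subseteq> {0..T}" using that by auto
      note cs = continuous_on_subset[OF that(1) sub] continuous_on_subset[OF that(2) sub]
        continuous_on_subset[OF W_cont sub]
      have "norm (integral {0..t} (\<lambda>s. l (f s) (W s) - l (g s) (W s))) \<le> integral {0..t} (\<lambda>s. K * \<bar>f s - g s\<bar>)"
        by (intro integral_norm_bound_integral integrable_continuous_interval continuous_intros cs l_cont)
           (use l_Lip_x in auto)
      moreover have "integral {0..t} (\<lambda>s. l (f s) (W s) - l (g s) (W s))
          = integral {0..t} (\<lambda>s. l (f s) (W s)) - integral {0..t} (\<lambda>s. l (g s) (W s))"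
        by (intro Henstock_Kurzweil_Integration.integral_diff integrable_continuous_interval l_cont cs)
      ultimately show ?thesis by simp
    qed
  qed (use K_nonneg in auto)
  have "path W T \<xi>"
    unfolding path_def
  proof
    fix s assume s: "s \<in> {0..T}"
    have "continuous_on {0..T} (\<lambda>s. l (\<xi> s) (W s))" by (intro l_cont \<xi> W_cont)
    from DERIV_add[OF DERIV_const integral_has_real_derivative[OF this s], of z]
    have "((\<lambda>t. z + integral {0..t} (\<lambda>s. l (\<xi> s) (W s))) has_real_derivative l (\<xi> s) (W s)) (at s within {0..T})"
      by simp
    then show "(\<xi> has_real_derivative l (\<xi> s) (W s)) (at s within {0..T})"
      by (rule has_field_derivative_transform_within[OF _ zero_less_one s]) (use \<xi> in auto)
  qed
  moreover have "\<xi> 0 = z" using \<xi>(2)[of 0] T_pos by simp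
  ultimately show ?thesis by blast
qed

definition X :: "real \<Rightarrow> real \<Rightarrow> real" where
  "X t z = (SOME \<xi>. path W T \<xi> \<and> \<xi> 0 = z) t"

lemma X_path: "path W T (\<lambda>t. X t z)" and X_0 [simp]: "X 0 z = z"
  using someI_ex[OF path_exists[of z]] by (auto simp: X_def eta_contract_eq)

text \<open>The difference quotient of \<open>X t\<close> between the labels \<open>z\<close> and
  \<open>z'\<close>, as \<open>path_diff\<close> shows; on the diagonal, the Jacobian of the
  flow.\<close>

definition D :: "real \<Rightarrow> real \<Rightarrow> real \<Rightarrow> real" where
  "D t z z' = exp (integral {0..t} (\<lambda>s. mean_slope (X s z) (X s z') (W s)))"

lemma X_diff: "t \<in> {0..T} \<Longrightarrow> X t z' - X t z = (z' - z) * D t z z'"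
  using path_diff[OF X_path X_path W_cont] by (simp add: D_def)

lemma D_bounds:
  assumes "t \<in> {0..T}"
  shows "1 / E \<le> D t z z'" "D t z z' \<le> E" "0 < D t z z'"
proof -
  have "continuous_on {0..T} (\<lambda>s. mean_slope (X s z) (X s z') (W s))"
    by (intro mean_slope_cont path_cont[OF X_path] W_cont)
  then have "continuous_on {0..t} (\<lambda>s. mean_slope (X s z) (X s z') (W s))"
    by (rule continuous_on_subset) (use assms in auto)
  then have "norm (integral {0..t} (\<lambda>s. mean_slope (X s z) (X s z') (W s))) \<le> integral {0..t} (\<lambda>s. K)"
    by (intro integral_norm_bound_integral integrable_continuous_interval continuous_on_const)
       (use mean_slope_bound in auto)
  then have "\<bar>integral {0..t} (\<lambda>s. mean_slope (X s z) (X s z') (W s))\<bar> \<le> K * t"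
    using assms by (simp add: mult.commute)
  moreover have "K * t \<le> K * T" using assms K_nonneg by (auto intro: mult_left_mono)
  ultimately have "\<bar>integral {0..t} (\<lambda>s. mean_slope (X s z) (X s z') (W s))\<bar> \<le> K * T" by linarith
  then have "exp (- (K * T)) \<le> D t z z'" "D t z z' \<le> exp (K * T)" by (auto simp: D_def)
  then show "1 / E \<le> D t z z'" "D t z z' \<le> E" by (auto simp: E_def exp_minus inverse_eq_divide)
  show "0 < D t z z'" by (simp add: D_def)
qed

lemma X_strict_mono: "t \<in> {0..T} \<Longrightarrow> z < z' \<Longrightarrow> X t z < X t z'"
proof -
  assume *: "t \<in> {0..T}" "z < z'"
  have "0 < (z' - z) * D t z z'" using * D_bounds(3)[OF *(1)] by (intro mult_pos_pos) auto
  then show ?thesis using X_diff[OF *(1), of z' z] by linarith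
qed

lemma X_less_iff: "t \<in> {0..T} \<Longrightarrow> X t z < X t z' \<longleftrightarrow> z < z'"
  using X_strict_mono[of t z z'] X_strict_mono[of t z' z] by (cases z z' rule: linorder_cases) auto

lemma X_inj: "t \<in> {0..T} \<Longrightarrow> X t z = X t z' \<longleftrightarrow> z = z'"
  using X_less_iff[of t z z'] X_less_iff[of t z' z] by (cases z z' rule: linorder_cases) auto

lemma X_Lip: 
  assumes "t \<in> {0..T}" "s \<in> {0..T}"
  shows "\<bar>X t z - X s z'\<bar> \<le> E * \<bar>z - z'\<bar> + C * \<bar>t - s\<bar>"
proof -
  have "\<bar>X t z - X t z'\<bar> \<le> E * \<bar>z - z'\<bar>"
    using X_diff[OF assms(1), of z z'] D_bounds(3)[OF assms(1), of z' z]
      mult_left_mono[OF D_bounds(2)[OF assms(1), of z' z], of "\<bar>z - z'\<bar>"]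
    by (simp add: abs_mult mult.commute)
  moreover have "\<bar>X t z' - X s z'\<bar> \<le> C * \<bar>t - s\<bar>"
  proof (cases "s \<le> t")
    case True
    then have "0 \<le> c * (t - s)" using c_pos by simp
    then show ?thesis using path_growth[OF X_path, of s t z'] assms True by simp
  next
    case False
    then have "0 \<le> c * (s - t)" using c_pos by simp
    then show ?thesis using path_growth[OF X_path, of t s z'] assms False by simp
  qed
  ultimately show ?thesis by linarith
qed

lemma X_cont2: "continuous_on ({0..T} \<times> UNIV) (\<lambda>(t, z). X t z)"
  unfolding continuous_on_def
proof safe
  fix s z' :: real assume s: "s \<in> {0..T}"
  have "((\<lambda>p. E * \<bar>snd p - z'\<bar> + C * \<bar>fst p - s\<bar>) \<longlongrightarrow> E * \<bar>snd (s, z') - z'\<bar> + C * \<bar>fst (s, z') - s\<bar>)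
      (at (s, z') within {0..T} \<times> UNIV)"
    by (intro tendsto_intros tendsto_fst tendsto_snd)
  then have "((\<lambda>p. E * \<bar>snd p - z'\<bar> + C * \<bar>fst p - s\<bar>) \<longlongrightarrow> 0) (at (s, z') within {0..T} \<times> UNIV)" by simp
  then have "((\<lambda>p. (case p of (t, z) \<Rightarrow> X t z) - X s z') \<longlongrightarrow> 0) (at (s, z') within {0..T} \<times> UNIV)"
    by (rule Lim_null_comparison[rotated]) (use s in \<open>auto simp: eventually_at_filter intro!: always_eventually X_Lip\<close>)
  then show "((\<lambda>(t, z). X t z) \<longlongrightarrow> X s z') (at (s, z') within {0..T} \<times> UNIV)"
    by (rule LIM_zero_cancel)
qed

lemma X_cont:
  assumes "continuous_on S f" "continuous_on S g" "f ` S \<subseteq> {0..T}"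
  shows "continuous_on S (\<lambda>p. X (f p) (g p))"
  using continuous_on_compose2[OF X_cont2 continuous_on_Pair[OF assms(1,2)]] assms(3) by auto

lemma W_cont_compose:
  assumes "continuous_on S f" "f ` S \<subseteq> {0..T}"
  shows "continuous_on S (\<lambda>p. W (f p))"
  using continuous_on_compose2[OF W_cont assms] by simp

text \<open>Continuity includes the diagonal, where \<open>D\<close> becomes the Jacobian; both
  derivatives of the inverse flow rest on this.\<close>

lemma D_cont:
  assumes f: "continuous_on S f" and "continuous_on S g" "continuous_on S h" and fS: "f ` S \<subseteq> {0..T}"
  shows "continuous_on S (\<lambda>p. D (f p) (g p) (h p))"
proof -
  define q where "q s z z' = mean_slope (X s z) (X s z') (W s)" for s z z'
  \<comment> \<open>Rescaling time to \<open>[0, 1]\<close> makes the domain of integration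
    independent of \<open>t\<close>, as the continuity of parameter integrals requires.\<close>
  have D_alt: "D t z z' = exp (t * integral (cbox 0 1) (\<lambda>\<theta>. q (\<theta> * t) z z'))" if t: "t \<in> {0..T}" for t z z'
  proof (cases "t = 0")
    case False
    then have t0: "0 < t" using t by simp
    have "continuous_on {0..t} (\<lambda>s. q s z z')"
      unfolding q_def using t by (intro mean_slope_cont X_cont W_cont_compose continuous_intros) auto
    then have "((\<lambda>s. q s z z') has_integral integral {0..t} (\<lambda>s. q s z z')) (cbox 0 t)"
      using integrable_continuous_interval by (auto intro: integrable_integral)
    from has_integral_affinity'[OF this t0, of 0] t0
    have "((\<lambda>\<theta>. q (\<theta> * t) z z') has_integral integral {0..t} (\<lambda>s. q s z z') / t) (cbox 0 1)"
      by (simp add: mult.commute inverse_eq_divide)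
    then show ?thesis using t0 by (simp add: D_def q_def[symmetric] integral_unique)
  qed (simp add: D_def)
  have "continuous_on ({0..T} \<times> UNIV) (\<lambda>p. integral (cbox 0 1) (\<lambda>\<theta>. q (\<theta> * fst p) (fst (snd p)) (snd (snd p :: real \<times> real))))"
  proof (rule integral_continuous_on_param)
    have "\<theta> * t \<in> {0..T}" if "\<theta> \<in> {0..1}" "t \<in> {0..T}" for \<theta> t
      using that mult_mono[of \<theta> 1 t T] by auto
    then show "continuous_on (({0..T} \<times> UNIV) \<times> cbox 0 1)
        (\<lambda>(p, \<theta>). q (\<theta> * fst p) (fst (snd p)) (snd (snd p :: real \<times> real)))"
      unfolding q_def split_beta
      by (intro mean_slope_cont X_cont W_cont_compose continuous_intros) auto
  qed
  from continuous_on_compose2[OF this continuous_on_Pair[OF f continuous_on_Pair[OF assms(2,3)]]] fS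
  have "continuous_on S (\<lambda>p. exp (f p * integral (cbox 0 1) (\<lambda>\<theta>. q (\<theta> * f p) (g p) (h p))))"
    by (intro continuous_intros f) (auto simp: image_subset_iff)
  then show ?thesis
    by (rule continuous_on_cong[THEN iffD1, rotated 2]) (use fS D_alt in auto)
qed

text \<open>What reaches \<open>x\<close> at time \<open>t\<close> started between
  \<open>x - C * t\<close> and \<open>x\<close>, since the speed lies between \<open>0\<close> and
  \<open>C\<close>; on this interval the intermediate value theorem applies.\<close>

lemma X_surj:
  assumes t: "t \<in> {0..T}"
  shows "\<exists>z. X t z = x"
proof -
  have g: "X t z \<le> z + C * t" "z \<le> X t z" for z
  proof -
    have "0 \<le> c * t" using t c_pos by simp
    then show "X t z \<le> z + C * t" "z \<le> X t z"
      using path_growth[OF X_path, of 0 t z] t by auto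
  qed
  have "\<exists>z. x - C * t \<le> z \<and> z \<le> x \<and> X t z = x"
    using g[of "x - C * t"] g[of x] C_pos t
    by (intro IVT' X_cont continuous_intros) auto
  then show ?thesis by blast
qed

section \<open>Labels: the inverse flow and its derivatives\<close>

definition Z :: "real \<Rightarrow> real \<Rightarrow> real" where
  "Z t x = (SOME z. X t z = x)"

lemma X_Z [simp]: "t \<in> {0..T} \<Longrightarrow> X t (Z t x) = x"
  unfolding Z_def by (rule someI_ex[OF X_surj])

lemma Z_X [simp]: "t \<in> {0..T} \<Longrightarrow> Z t (X t z) = z"
  using X_Z[of t "X t z"] X_inj by blast

lemma Z_0 [simp]: "Z 0 x = x"
  using X_Z[of 0 x] T_pos by simp

lemma Z_diff: "t \<in> {0..T} \<Longrightarrow> Z t x' - Z t x = (x' - x) / D t (Z t x) (Z t x')"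
  using X_diff[of t "Z t x'" "Z t x"] D_bounds(3)[of t "Z t x" "Z t x'"] by (simp add: field_simps)

lemma Z_Lip:
  assumes "t \<in> {0..T}" "s \<in> {0..T}"
  shows "\<bar>Z t x - Z s x'\<bar> \<le> E * \<bar>x - x'\<bar> + E * C * \<bar>t - s\<bar>"
proof -
  let ?z = "Z t x" and ?z' = "Z s x'"
  have "\<bar>X t ?z' - X s ?z'\<bar> \<le> C * \<bar>t - s\<bar>" using X_Lip[OF assms, of ?z' ?z'] by simp
  then have 1: "\<bar>x - X t ?z'\<bar> \<le> \<bar>x - x'\<bar> + C * \<bar>t - s\<bar>" using assms by simp
  have "x - X t ?z' = (?z - ?z') * D t ?z' ?z" using X_diff[OF assms(1), of ?z ?z'] assms by simp
  then have "\<bar>?z - ?z'\<bar> * D t ?z' ?z = \<bar>x - X t ?z'\<bar>"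
    using D_bounds(3)[OF assms(1), of ?z' ?z] by (simp add: abs_mult)
  moreover have "\<bar>?z - ?z'\<bar> * (1 / E) \<le> \<bar>?z - ?z'\<bar> * D t ?z' ?z"
    by (intro mult_left_mono D_bounds assms) simp
  ultimately have "\<bar>?z - ?z'\<bar> / E \<le> \<bar>x - x'\<bar> + C * \<bar>t - s\<bar>" using 1 by simp
  then show ?thesis using E_pos by (simp add: field_simps)
qed

lemma Z_cont2: "continuous_on ({0..T} \<times> UNIV) (\<lambda>(t, z). Z t z)"
  unfolding continuous_on_def
proof safe
  fix s z' :: real assume s: "s \<in> {0..T}"
  have "((\<lambda>p. E * \<bar>snd p - z'\<bar> + E * C * \<bar>fst p - s\<bar>) \<longlongrightarrow> E * \<bar>snd (s, z') - z'\<bar> + E * C * \<bar>fst (s, z') - s\<bar>)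
      (at (s, z') within {0..T} \<times> UNIV)"
    by (intro tendsto_intros tendsto_fst tendsto_snd)
  then have "((\<lambda>p. E * \<bar>snd p - z'\<bar> + E * C * \<bar>fst p - s\<bar>) \<longlongrightarrow> 0) (at (s, z') within {0..T} \<times> UNIV)" by simp
  then have "((\<lambda>p. (case p of (t, z) \<Rightarrow> Z t z) - Z s z') \<longlongrightarrow> 0) (at (s, z') within {0..T} \<times> UNIV)"
    by (rule Lim_null_comparison[rotated]) (use s in \<open>auto simp: eventually_at_filter intro!: always_eventually Z_Lip\<close>)
  then show "((\<lambda>(t, z). Z t z) \<longlongrightarrow> Z s z') (at (s, z') within {0..T} \<times> UNIV)"
    by (rule LIM_zero_cancel)
qed

lemma Z_cont:
  assumes "continuous_on S f" "continuous_on S g" "f ` S \<subseteq> {0..T}"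
  shows "continuous_on S (\<lambda>p. Z (f p) (g p))"
  using continuous_on_compose2[OF Z_cont2 continuous_on_Pair[OF assms(1,2)]] assms(3) by auto

text \<open>The derivative of \<open>Z t\<close> at \<open>x\<close>, written through the diagonal
  of \<open>D\<close> so that positivity, bounds and continuity are inherited.\<close>

definition J :: "real \<Rightarrow> real \<Rightarrow> real" where
  "J t x = 1 / D t (Z t x) (Z t x)"

lemma J_bounds:
  assumes "t \<in> {0..T}"
  shows "1 / E \<le> J t x" "J t x \<le> E" "0 < J t x"
  using D_bounds[OF assms, of "Z t x" "Z t x"] E_pos by (auto simp: J_def field_simps)

lemma J_cont:
  assumes "continuous_on S f" "continuous_on S g" "f ` S \<subseteq> {0..T}"
  shows "continuous_on S (\<lambda>p. J (f p) (g p))"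
  unfolding J_def using assms D_bounds(3)
  by (intro continuous_intros D_cont Z_cont assms) (auto simp: image_subset_iff less_imp_neq[symmetric])

text \<open>Caratheodory's criterion fits because the difference quotient of \<open>Z t\<close> is
  \<open>1 / D\<close> in closed form, continuous up to the diagonal.\<close>

lemma Z_deriv_x:
  assumes t: "t \<in> {0..T}"
  shows "(Z t has_real_derivative J t x) (at x)"
  unfolding CARAT_DERIV
proof (intro exI conjI allI)
  show "Z t x' - Z t x = (1 / D t (Z t x) (Z t x')) * (x' - x)" for x'
    using Z_diff[OF t, of x' x] by simp
  have "continuous_on UNIV (\<lambda>x'. 1 / D t (Z t x) (Z t x'))"
    using t D_bounds(3)[OF t] by (intro continuous_intros D_cont Z_cont) (auto simp: less_imp_neq[symmetric])
  then show "isCont (\<lambda>x'. 1 / D t (Z t x) (Z t x')) x" by (simp add: continuous_on_eq_continuous_at)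
qed (simp add: J_def)

text \<open>Labels are constant along characteristics: the time quotient of \<open>Z\<close> at
  fixed \<open>x\<close> is minus that of \<open>X\<close> at the fixed label \<open>Z t x\<close>,
  divided by \<open>D\<close> between the labels \<open>Z t x\<close> and \<open>Z s x\<close>,
  which tends to the diagonal value.\<close>

lemma Z_deriv_t:
  assumes t: "t \<in> {0..T}"
  shows "((\<lambda>t. Z t x) has_real_derivative - (l x (W t) * J t x)) (at t within {0..T})"
  unfolding has_field_derivative_iff
proof -
  let ?z = "Z t x"
  have 1: "((\<lambda>s. (X s ?z - X t ?z) / (s - t)) \<longlongrightarrow> l x (W t)) (at t within {0..T})"
    using bspec[OF X_path[of ?z, unfolded path_def] t] t by (simp add: has_field_derivative_iff)
  have "continuous_on {0..T} (\<lambda>s. D s ?z (Z s x))"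
    by (intro D_cont Z_cont continuous_intros) auto
  then have 2: "((\<lambda>s. D s ?z (Z s x)) \<longlongrightarrow> D t ?z ?z) (at t within {0..T})"
    using t by (auto simp: continuous_on_def)
  have "((\<lambda>s. - ((X s ?z - X t ?z) / (s - t) / D s ?z (Z s x))) \<longlongrightarrow> - (l x (W t) / D t ?z ?z)) (at t within {0..T})"
    using D_bounds(3)[OF t, of ?z ?z] by (intro tendsto_intros 1 2) auto
  note 3 = this
  have 4: "- ((X s ?z - X t ?z) / (s - t) / D s ?z (Z s x)) = (Z s x - Z t x) / (s - t)"
    if "s \<in> {0..T}" for s
  proof -
    have "X s (Z s x) - X s ?z = (Z s x - ?z) * D s ?z (Z s x)"
      by (rule X_diff[OF that])
    then have "X s ?z - X t ?z = - ((Z s x - ?z) * D s ?z (Z s x))"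
      using that t by simp
    then show ?thesis using D_bounds(3)[OF that, of ?z "Z s x"] by simp
  qed
  have "((\<lambda>s. (Z s x - Z t x) / (s - t)) \<longlongrightarrow> - (l x (W t) / D t ?z ?z)) (at t within {0..T})"
    by (rule Lim_transform_eventually[OF 3]) (auto simp only: eventually_at_filter intro!: always_eventually 4)
  then show "((\<lambda>s. (Z s x - Z t x) / (s - t)) \<longlongrightarrow> - (l x (W t) * J t x)) (at t within {0..T})"
    by (simp add: J_def)
qed

end

subsection \<open>Integrals against functions continuous with values in \<open>L\<^sup>1\<close>\<close>

lemma Lp1_continuousD:
  assumes "Lp_continuous_on S M 1 f" "s \<in> S"
  shows "integrable M (f s)" "((\<lambda>r. \<integral>x. \<bar>f r x - f s x\<bar> \<partial>M) \<longlongrightarrow> 0) (at s within S)"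
proof -
  have m: "f s \<in> borel_measurable M" and i: "integrable M (\<lambda>x. \<bar>f s x\<bar>)"
    using assms by (auto simp: Lp_continuous_on_def Lp_def)
  then show "integrable M (f s)" by (simp add: integrable_abs_iff)
  have "((\<lambda>r. Lp_norm M 1 (\<lambda>x. f r x - f s x)) \<longlongrightarrow> 0) (at s within S)"
    using assms by (auto simp: Lp_continuous_on_def)
  then show "((\<lambda>r. \<integral>x. \<bar>f r x - f s x\<bar> \<partial>M) \<longlongrightarrow> 0) (at s within S)"
    by (simp add: Lp_norm_def)
qed

lemma integrable_mult_bounded:
  fixes f \<psi> :: "'a \<Rightarrow> real"
  assumes "integrable M f" "\<psi> \<in> borel_measurable M" "\<And>x. x \<in> space M \<Longrightarrow> \<bar>\<psi> x\<bar> \<le> B"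
  shows "integrable M (\<lambda>x. f x * \<psi> x)" "\<bar>\<integral>x. f x * \<psi> x \<partial>M\<bar> \<le> B * (\<integral>x. \<bar>f x\<bar> \<partial>M)"
proof -
  have le: "\<bar>f x * \<psi> x\<bar> \<le> B * \<bar>f x\<bar>" if "x \<in> space M" for x
    using mult_left_mono[OF assms(3)[OF that], of "\<bar>f x\<bar>"] by (simp add: abs_mult mult.commute)
  show 1: "integrable M (\<lambda>x. f x * \<psi> x)"
  proof (rule Bochner_Integration.integrable_bound)
    show "integrable M (\<lambda>x. B * \<bar>f x\<bar>)" using assms by simp
    show "(\<lambda>x. f x * \<psi> x) \<in> borel_measurable M" using assms by simp
    show "AE x in M. norm (f x * \<psi> x) \<le> norm (B * \<bar>f x\<bar>)"
      using le by (intro AE_I2) (auto intro: order_trans[OF _ abs_ge_self])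
  qed
  have "\<bar>\<integral>x. f x * \<psi> x \<partial>M\<bar> \<le> (\<integral>x. \<bar>f x * \<psi> x\<bar> \<partial>M)" by (rule integral_abs_bound)
  also have "\<dots> \<le> (\<integral>x. B * \<bar>f x\<bar> \<partial>M)"
    using 1 assms le by (intro integral_mono) auto
  finally show "\<bar>\<integral>x. f x * \<psi> x \<partial>M\<bar> \<le> B * (\<integral>x. \<bar>f x\<bar> \<partial>M)" by simp
qed

text \<open>Split off \<open>f r - f s\<close>, small in L1 and paired with bounded weights, from
  the fixed function \<open>f s\<close>, where dominated convergence applies. The weights converge
  only almost everywhere because they will be indicators of half-lines with a moving end
  point.\<close>

lemma Lp1_mult_tendsto:
  fixes f \<psi> :: "real \<Rightarrow> 'a \<Rightarrow> real"
  assumes f: "Lp_continuous_on S M 1 f" and s: "s \<in> S"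
    and \<psi>: "\<And>r. r \<in> S \<Longrightarrow> \<psi> r \<in> borel_measurable M"
      "\<And>r x. r \<in> S \<Longrightarrow> x \<in> space M \<Longrightarrow> \<bar>\<psi> r x\<bar> \<le> B"
    and lim: "AE x in M. ((\<lambda>r. \<psi> r x) \<longlongrightarrow> \<psi> s x) (at s within S)"
  shows "((\<lambda>r. \<integral>x. f r x * \<psi> r x \<partial>M) \<longlongrightarrow> (\<integral>x. f s x * \<psi> s x \<partial>M)) (at s within S)"
  unfolding tendsto_at_iff_sequentially comp_def
proof safe
  fix Y :: "nat \<Rightarrow> real" assume Y: "\<forall>i. Y i \<in> S - {s}" "Y \<longlonglongrightarrow> s"
  then have YS: "Y i \<in> S" for i by auto
  note fi = Lp1_continuousD(1)[OF f]
  have 1: "(\<lambda>i. \<integral>x. f s x * \<psi> (Y i) x \<partial>M) \<longlonglongrightarrow> (\<integral>x. f s x * \<psi> s x \<partial>M)"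
  proof (rule integral_dominated_convergence[where w = "\<lambda>x. B * \<bar>f s x\<bar>"])
    show "(\<lambda>x. f s x * \<psi> s x) \<in> borel_measurable M"
      "\<And>i. (\<lambda>x. f s x * \<psi> (Y i) x) \<in> borel_measurable M"
      using fi[OF s] \<psi>(1) YS s by auto
    show "AE x in M. (\<lambda>i. f s x * \<psi> (Y i) x) \<longlonglongrightarrow> f s x * \<psi> s x"
      using lim
    proof eventually_elim
      case (elim x)
      then have "(\<lambda>i. \<psi> (Y i) x) \<longlonglongrightarrow> \<psi> s x"
        using Y unfolding tendsto_at_iff_sequentially comp_def by blast
      then show ?case by (intro tendsto_mult_left)
    qed
    show "AE x in M. norm (f s x * \<psi> (Y i) x) \<le> B * \<bar>f s x\<bar>" for i
      using \<psi>(2)[OF YS] by (intro AE_I2) (auto simp: abs_mult mult.commute[of B] intro!: mult_left_mono)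
  qed (use fi[OF s] in simp)
  have "(\<lambda>i. \<integral>x. \<bar>f (Y i) x - f s x\<bar> \<partial>M) \<longlonglongrightarrow> 0"
    using Lp1_continuousD(2)[OF f s] Y unfolding tendsto_at_iff_sequentially comp_def by blast
  then have "(\<lambda>i. B * (\<integral>x. \<bar>f (Y i) x - f s x\<bar> \<partial>M)) \<longlonglongrightarrow> 0"
    by (auto intro!: tendsto_eq_intros)
  then have 2: "(\<lambda>i. \<integral>x. (f (Y i) x - f s x) * \<psi> (Y i) x \<partial>M) \<longlonglongrightarrow> 0"
    by (rule Lim_null_comparison[rotated])
       (auto intro!: always_eventually integrable_mult_bounded(2) Bochner_Integration.integrable_diff fi YS s \<psi>)
  have "(\<integral>x. f (Y i) x * \<psi> (Y i) x \<partial>M)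
      = (\<integral>x. (f (Y i) x - f s x) * \<psi> (Y i) x \<partial>M) + (\<integral>x. f s x * \<psi> (Y i) x \<partial>M)" for i
    by (subst Bochner_Integration.integral_add[symmetric])
       (auto simp: left_diff_distrib intro!: Bochner_Integration.integrable_diff integrable_mult_bounded(1)[where B = B]
          fi YS s \<psi>)
  then show "(\<lambda>i. \<integral>x. f (Y i) x * \<psi> (Y i) x \<partial>M) \<longlonglongrightarrow> (\<integral>x. f s x * \<psi> s x \<partial>M)"
    using tendsto_add[OF 2 1] by simp
qed

lemma continuous_on_imp_measurable_lebesgue_on:
  fixes f :: "real \<Rightarrow> real"
  assumes "continuous_on S f" "U \<subseteq> S" "U \<in> sets lebesgue"
  shows "f \<in> borel_measurable (lebesgue_on U)"
  using continuous_on_subset[OF assms(1,2)] assms(3)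
  by (rule continuous_imp_measurable_on_sets_lebesgue)

lemma Lp_continuous_on_subset:
  assumes "Lp_continuous_on S M q f" "U \<subseteq> S"
  shows "Lp_continuous_on U M q f"
  unfolding Lp_continuous_on_def
proof (intro ballI conjI)
  fix s assume s: "s \<in> U"
  then show "f s \<in> Lp M q" using assms by (auto simp: Lp_continuous_on_def)
  have "((\<lambda>r. Lp_norm M q (\<lambda>x. f r x - f s x)) \<longlongrightarrow> 0) (at s within S)"
    using assms s by (auto simp: Lp_continuous_on_def)
  then show "((\<lambda>r. Lp_norm M q (\<lambda>x. f r x - f s x)) \<longlongrightarrow> 0) (at s within U)"
    by (rule tendsto_within_subset) (rule assms)
qed

lemma continuous_on_pair_slices:
  fixes f :: "real \<Rightarrow> real \<Rightarrow> real"
  assumes "continuous_on (A \<times> B) (\<lambda>(t, x). f t x)"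
  shows "t \<in> A \<Longrightarrow> continuous_on B (\<lambda>x. f t x)" "x \<in> B \<Longrightarrow> continuous_on A (\<lambda>t. f t x)"
proof -
  assume t: "t \<in> A"
  have "continuous_on B (\<lambda>x. (t, x))" by (intro continuous_intros)
  from continuous_on_compose2[OF assms this] t show "continuous_on B (\<lambda>x. f t x)" by (simp add: image_subset_iff)
next
  assume x: "x \<in> B"
  have "continuous_on A (\<lambda>t. (t, x))" by (intro continuous_intros)
  from continuous_on_compose2[OF assms this] x show "continuous_on A (\<lambda>t. f t x)" by (simp add: image_subset_iff)
qed

lemma continuous_on_integral_mult:
  fixes \<rho> f :: "real \<Rightarrow> real \<Rightarrow> real"
  assumes \<rho>: "Lp_continuous_on S (lebesgue_on {a<..<b}) 1 \<rho>" and S: "compact S"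
    and f: "continuous_on (S \<times> {a..b}) (\<lambda>(s, x). f s x)"
  shows "continuous_on S (\<lambda>s. \<integral>x. \<rho> s x * f s x \<partial>lebesgue_on {a<..<b})"
    "s \<in> S \<Longrightarrow> integrable (lebesgue_on {a<..<b}) (\<lambda>x. \<rho> s x * f s x)"
proof -
  let ?L = "lebesgue_on {a<..<b}"
  have "bounded ((\<lambda>(s, x). f s x) ` (S \<times> {a..b}))"
    by (intro compact_imp_bounded compact_continuous_image f compact_Times S) auto
  then obtain B where B: "\<And>s x. s \<in> S \<Longrightarrow> x \<in> {a..b} \<Longrightarrow> \<bar>f s x\<bar> \<le> B" by (fastforce simp: bounded_pos)
  have fm: "f s \<in> borel_measurable ?L" if "s \<in> S" for s
    by (rule continuous_on_imp_measurable_lebesgue_on[OF continuous_on_pair_slices(1)[OF f that]]) auto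
  show "continuous_on S (\<lambda>s. \<integral>x. \<rho> s x * f s x \<partial>?L)"
    unfolding continuous_on_def
  proof
    fix s assume s: "s \<in> S"
    show "((\<lambda>t. \<integral>x. \<rho> t x * f t x \<partial>?L) \<longlongrightarrow> (\<integral>x. \<rho> s x * f s x \<partial>?L)) (at s within S)"
    proof (rule Lp1_mult_tendsto[where B = B, OF \<rho> s])
      show "AE x in ?L. ((\<lambda>t. f t x) \<longlongrightarrow> f s x) (at s within S)"
        using continuous_on_pair_slices(2)[OF f] s by (intro AE_I2) (auto simp: continuous_on_def)
    qed (use fm B in auto)
  qed
  show "integrable ?L (\<lambda>x. \<rho> s x * f s x)" if s: "s \<in> S"
    by (rule integrable_mult_bounded(1)[OF Lp1_continuousD(1)[OF \<rho> s] fm[OF s], where B = B]) (use B s in auto)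
qed

abbreviation (input) I01 :: "real measure" where "I01 \<equiv> lebesgue_on {0<..<1}"

text \<open>Dominated convergence slice by slice, in \<open>x\<close> and then in \<open>t\<close>.
  Continuity of \<open>\<rho>\<close> in time with values in L1 makes the inner integrals and the
  dominating function continuous, hence measurable, in \<open>t\<close>.\<close>

lemma iterated_integral_tendsto:
  assumes \<rho>: "Lp_continuous_on {0..\<sigma>} I01 1 \<rho>"
    and c: "\<And>k. continuous_on ({0..\<sigma>} \<times> {0..1}) (\<lambda>(t, x). \<psi> k t x)"
    and B: "\<And>k t x. t \<in> {0..\<sigma>} \<Longrightarrow> x \<in> {0..1} \<Longrightarrow> \<bar>\<psi> k t x\<bar> \<le> B"
    and lim: "\<And>t x. t \<in> {0<..<\<sigma>} \<Longrightarrow> x \<in> {0<..<1} \<Longrightarrow> (\<lambda>k. \<psi> k t x) \<longlonglongrightarrow> \<psi>' t x"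
  shows "(\<lambda>k::nat. \<integral>t. (\<integral>x. \<rho> t x * \<psi> k t x \<partial>I01) \<partial>lebesgue_on {0<..<\<sigma>})
      \<longlonglongrightarrow> (\<integral>t. (\<integral>x. \<rho> t x * \<psi>' t x \<partial>I01) \<partial>lebesgue_on {0<..<\<sigma>})"
proof -
  have \<psi>m: "\<psi> k t \<in> borel_measurable I01" if "t \<in> {0..\<sigma>}" for k t
    by (rule continuous_on_imp_measurable_lebesgue_on[OF continuous_on_pair_slices(1)[OF c that]]) auto
  note \<rho>i = Lp1_continuousD(1)[OF \<rho>]
  have inner: "(\<lambda>k. \<integral>x. \<rho> t x * \<psi> k t x \<partial>I01) \<longlonglongrightarrow> (\<integral>x. \<rho> t x * \<psi>' t x \<partial>I01)"
    if t: "t \<in> {0<..<\<sigma>}" for t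
  proof (rule integral_dominated_convergence[where w = "\<lambda>x. B * \<bar>\<rho> t x\<bar>"])
    have t': "t \<in> {0..\<sigma>}" using t by auto
    have "\<psi>' t \<in> borel_measurable I01"
      by (rule borel_measurable_LIMSEQ_real[OF _ \<psi>m[OF t']]) (use lim[OF t] in simp)
    then show "(\<lambda>x. \<rho> t x * \<psi>' t x) \<in> borel_measurable I01"
      using \<rho>i[OF t'] by simp
    show "(\<lambda>x. \<rho> t x * \<psi> k t x) \<in> borel_measurable I01" for k
      using \<rho>i[OF t'] \<psi>m[OF t'] by simp
    show "integrable I01 (\<lambda>x. B * \<bar>\<rho> t x\<bar>)" using \<rho>i[OF t'] by simp
    show "AE x in I01. (\<lambda>k. \<rho> t x * \<psi> k t x) \<longlonglongrightarrow> \<rho> t x * \<psi>' t x"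
      using lim[OF t] by (intro AE_I2 tendsto_mult_left) simp
    show "AE x in I01. norm (\<rho> t x * \<psi> k t x) \<le> B * \<bar>\<rho> t x\<bar>" for k
      using B[OF t', of _ k] by (intro AE_I2) (auto simp: abs_mult mult.commute[of B] intro!: mult_left_mono)
  qed
  have cont: "continuous_on {0..\<sigma>} (\<lambda>t. \<integral>x. \<rho> t x * \<psi> k t x \<partial>I01)" for k
    by (rule continuous_on_integral_mult(1)[OF \<rho> compact_Icc c])
  have absc: "continuous_on {0..\<sigma>} (\<lambda>t. \<integral>x. \<bar>\<rho> t x\<bar> \<partial>I01)"
    unfolding continuous_on_def
  proof
    fix s assume s: "s \<in> {0..\<sigma>}"
    have "\<bar>(\<integral>x. \<bar>\<rho> r x\<bar> \<partial>I01) - (\<integral>x. \<bar>\<rho> s x\<bar> \<partial>I01)\<bar> \<le> (\<integral>x. \<bar>\<rho> r x - \<rho> s x\<bar> \<partial>I01)" if r: "r \<in> {0..\<sigma>}" for r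
    proof -
      have "(\<integral>x. \<bar>\<rho> r x\<bar> \<partial>I01) - (\<integral>x. \<bar>\<rho> s x\<bar> \<partial>I01) = (\<integral>x. \<bar>\<rho> r x\<bar> - \<bar>\<rho> s x\<bar> \<partial>I01)"
        using \<rho>i[OF r] \<rho>i[OF s] by simp
      also have "\<bar>\<dots>\<bar> \<le> (\<integral>x. \<bar>\<bar>\<rho> r x\<bar> - \<bar>\<rho> s x\<bar>\<bar> \<partial>I01)" by (rule integral_abs_bound)
      also have "\<dots> \<le> (\<integral>x. \<bar>\<rho> r x - \<rho> s x\<bar> \<partial>I01)"
        using \<rho>i[OF r] \<rho>i[OF s] by (intro integral_mono) auto
      finally show ?thesis .
    qed
    then have "((\<lambda>r. (\<integral>x. \<bar>\<rho> r x\<bar> \<partial>I01) - (\<integral>x. \<bar>\<rho> s x\<bar> \<partial>I01)) \<longlongrightarrow> 0) (at s within {0..\<sigma>})"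
      by (intro Lim_null_comparison[OF _ Lp1_continuousD(2)[OF \<rho> s]]) (auto simp: eventually_at_filter)
    then show "((\<lambda>t. \<integral>x. \<bar>\<rho> t x\<bar> \<partial>I01) \<longlongrightarrow> (\<integral>x. \<bar>\<rho> s x\<bar> \<partial>I01)) (at s within {0..\<sigma>})"
      by (rule LIM_zero_cancel)
  qed
  have meas: "(\<lambda>t. \<integral>x. \<rho> t x * \<psi> k t x \<partial>I01) \<in> borel_measurable (lebesgue_on {0<..<\<sigma>})" for k
    by (rule continuous_on_imp_measurable_lebesgue_on[OF cont]) auto
  show ?thesis
  proof (rule integral_dominated_convergence[where w = "\<lambda>t. B * (\<integral>x. \<bar>\<rho> t x\<bar> \<partial>I01)"])
    show "(\<lambda>t. \<integral>x. \<rho> t x * \<psi>' t x \<partial>I01) \<in> borel_measurable (lebesgue_on {0<..<\<sigma>})"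
      by (rule borel_measurable_LIMSEQ_real[OF _ meas]) (use inner in simp)
    have "integrable (lebesgue_on {0..\<sigma>}) (\<lambda>t. \<integral>x. \<bar>\<rho> t x\<bar> \<partial>I01)"
      by (rule continuous_imp_integrable_real[OF absc])
    then have "integrable (lebesgue_on {0<..<\<sigma>}) (\<lambda>t. \<integral>x. \<bar>\<rho> t x\<bar> \<partial>I01)"
      by (rule integrable_lebesgue_on_mono) auto
    then show "integrable (lebesgue_on {0<..<\<sigma>}) (\<lambda>t. B * (\<integral>x. \<bar>\<rho> t x\<bar> \<partial>I01))" by simp
    show "AE t in lebesgue_on {0<..<\<sigma>}. (\<lambda>k. \<integral>x. \<rho> t x * \<psi> k t x \<partial>I01) \<longlonglongrightarrow> (\<integral>x. \<rho> t x * \<psi>' t x \<partial>I01)"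
      using inner by (intro AE_I2) simp
    show "AE t in lebesgue_on {0<..<\<sigma>}. norm (\<integral>x. \<rho> t x * \<psi> k t x \<partial>I01) \<le> B * (\<integral>x. \<bar>\<rho> t x\<bar> \<partial>I01)" for k
    proof (intro AE_I2)
      fix t assume "t \<in> space (lebesgue_on {0<..<\<sigma>})"
      then have t: "t \<in> {0..\<sigma>}" by auto
      have "\<bar>\<integral>x. \<rho> t x * \<psi> k t x \<partial>I01\<bar> \<le> B * (\<integral>x. \<bar>\<rho> t x\<bar> \<partial>I01)"
        by (rule integrable_mult_bounded(2)[OF \<rho>i[OF t] \<psi>m[OF t]]) (use B[OF t] in auto)
      then show "norm (\<integral>x. \<rho> t x * \<psi> k t x \<partial>I01) \<le> B * (\<integral>x. \<bar>\<rho> t x\<bar> \<partial>I01)" by simp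
    qed
  qed (rule meas)
qed

text \<open>\<open>C\<^sup>1\<close> approximations of the indicator of the negative half-line.\<close>

definition eta :: "nat \<Rightarrow> real \<Rightarrow> real" where
  "eta k y = (real k * min y 0)\<^sup>2 / (1 + (real k * min y 0)\<^sup>2)"

definition eta' :: "nat \<Rightarrow> real \<Rightarrow> real" where
  "eta' k y = 2 * (real k)\<^sup>2 * min y 0 / (1 + (real k * min y 0)\<^sup>2)\<^sup>2"

lemma one_plus_square_pos: "0 < 1 + (a::real)\<^sup>2"
  by (simp add: add_pos_nonneg)

lemma eta_deriv: "(eta k has_real_derivative eta' k y) (at y)"
proof -
  \<comment> \<open>Squaring removes the kink of \<open>min y 0\<close> at zero; this is why
    \<open>eta\<close> is built from squares.\<close>
  have sq: "((\<lambda>y. (min y 0)\<^sup>2) has_real_derivative 2 * min y 0) (at (y::real))" for y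
  proof (cases "y = 0")
    case True
    have "((\<lambda>h::real. ((min h 0)\<^sup>2 - (min 0 0)\<^sup>2) / (h - 0)) \<longlongrightarrow> 0) (at 0)"
    proof (rule Lim_null_comparison)
      show "((\<lambda>h::real. \<bar>h\<bar>) \<longlongrightarrow> 0) (at 0)" by (intro tendsto_rabs_zero tendsto_ident_at)
      have "norm (((min h 0)\<^sup>2 - (min 0 0)\<^sup>2) / (h - 0)) \<le> \<bar>h\<bar>" for h :: real
        by (cases "h < 0") (auto simp: power2_eq_square abs_mult)
      then show "\<forall>\<^sub>F h in at 0. norm (((min h 0)\<^sup>2 - (min 0 0)\<^sup>2) / (h - 0 :: real)) \<le> \<bar>h\<bar>"
        by (intro always_eventually allI)
    qed
    then show ?thesis using True by (simp add: has_field_derivative_iff)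
  next
    case False
    then consider "y < 0" | "0 < y" by linarith
    then show ?thesis
    proof cases
      case 1
      have "((\<lambda>y. y\<^sup>2) has_real_derivative 2 * min y 0) (at y)"
        using 1 by (auto intro!: derivative_eq_intros)
      then show ?thesis
        by (rule has_field_derivative_transform_within_open[where S = "{..<0}"]) (use 1 in auto)
    next
      case 2
      have "((\<lambda>y. 0) has_real_derivative 2 * min y 0) (at y)" using 2 by simp
      then show ?thesis
        by (rule has_field_derivative_transform_within_open[where S = "{0<..}"]) (use 2 in auto)
    qed
  qed
  define G where "G v = (real k)\<^sup>2 * v / (1 + (real k)\<^sup>2 * v)" for v
  have eq: "eta k = (\<lambda>y. G ((min y 0)\<^sup>2))"
    by (simp add: eta_def G_def fun_eq_iff power_mult_distrib)
  have pos: "0 < 1 + (real k)\<^sup>2 * (min y 0)\<^sup>2"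
    using one_plus_square_pos[of "real k * min y 0"] by (simp add: power_mult_distrib)
  have "(G has_real_derivative (real k)\<^sup>2 / (1 + (real k)\<^sup>2 * v)\<^sup>2) (at v)" if "0 < 1 + (real k)\<^sup>2 * v" for v
    unfolding G_def[abs_def] using that
    by (intro derivative_eq_intros refl) (auto simp: field_simps power2_eq_square)
  from DERIV_chain2[OF this[OF pos] sq]
  show ?thesis by (simp add: eq eta'_def power_mult_distrib mult_ac)
qed

lemma eta'_cont: "continuous_on S f \<Longrightarrow> continuous_on S (\<lambda>p. eta' k (f p))"
  unfolding eta'_def
  by (intro continuous_intros) (auto simp: less_imp_neq[OF one_plus_square_pos, symmetric])

lemma eta_cont: "continuous_on S f \<Longrightarrow> continuous_on S (\<lambda>p. eta k (f p))"
  unfolding eta_def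
  by (intro continuous_intros) (auto simp: less_imp_neq[OF one_plus_square_pos, symmetric])

lemma eta_bounds: "0 \<le> eta k y" "eta k y \<le> 1" "0 \<le> y \<Longrightarrow> eta k y = 0"
  by (auto simp: eta_def divide_le_eq_1 one_plus_square_pos)

text \<open>With \<open>q = (real k * min y 0)\<^sup>2\<close> the product is
  \<open>2 * q / (1 + q)\<^sup>2\<close>: the growth of \<open>eta'\<close> in \<open>k\<close> is
  compensated by the distance \<open>y\<close> to the front. The third bound gives the limit zero,
  as \<open>eta k y\<close> tends to one for negative \<open>y\<close>.\<close>

lemma mult_eta'_bounds: "0 \<le> y * eta' k y" "y * eta' k y \<le> 1" "y * eta' k y \<le> 2 * (1 - eta k y)"
proof -
  define q where "q = (real k * min y 0)\<^sup>2"
  have q: "0 \<le> q" by (simp add: q_def)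
  have "y * min y 0 = (min y 0)\<^sup>2" by (auto simp: power2_eq_square min_def)
  then have eq: "y * eta' k y = 2 * q / (1 + q)\<^sup>2"
    by (simp add: eta'_def q_def power_mult_distrib mult_ac)
  show "0 \<le> y * eta' k y" using q by (simp add: eq)
  have "2 * q \<le> (1 + q)\<^sup>2" by (simp add: power2_sum)
  then show "y * eta' k y \<le> 1" using q by (simp add: eq divide_le_eq)
  have "2 * q / (1 + q)\<^sup>2 \<le> 2 * (1 + q) / (1 + q)\<^sup>2" using q by (intro divide_right_mono) auto
  also have "\<dots> = 2 / (1 + q)" using q unfolding power2_eq_square
    by (intro nonzero_mult_divide_mult_cancel_right) auto
  also have "\<dots> = 2 * (1 - q / (1 + q))" using q by (simp add: field_simps)
  finally show "y * eta' k y \<le> 2 * (1 - eta k y)" unfolding eq by (simp add: eta_def q_def)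
qed

lemma eta_tendsto: "(\<lambda>k. eta k y) \<longlonglongrightarrow> (if y < 0 then 1 else 0)"
proof (cases "y < 0")
  case True
  have "filterlim (\<lambda>k. - y * real k) at_top sequentially"
    using True by (intro filterlim_tendsto_pos_mult_at_top[OF tendsto_const _ filterlim_real_sequentially]) auto
  then have "filterlim (\<lambda>k. real k * (- y)) at_top sequentially"
    by (simp only: mult.commute)
  then have "filterlim (\<lambda>k. 1 + (real k * (- y))\<^sup>2) at_top sequentially"
    by (intro filterlim_tendsto_add_at_top[OF tendsto_const] filterlim_pow_at_top) auto
  from tendsto_diff[OF tendsto_const tendsto_inverse_0_at_top[OF this], of 1]
  have "(\<lambda>k. 1 - inverse (1 + (real k * (- y))\<^sup>2)) \<longlonglongrightarrow> 1" by simp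
  moreover have "1 - inverse (1 + (real k * (- y))\<^sup>2) = eta k y" for k
    using True one_plus_square_pos[of "real k * y"]
    by (simp add: eta_def field_simps min_def)
  ultimately show ?thesis using True by simp
qed (simp add: eta_bounds)

lemma mult_eta'_tendsto: "(\<lambda>k. y * eta' k y) \<longlonglongrightarrow> 0"
proof (cases "y < 0")
  case True
  have "(\<lambda>k. 2 * (1 - eta k y)) \<longlonglongrightarrow> 2 * (1 - 1)"
    using eta_tendsto[of y] True by (intro tendsto_intros) simp
  then have "(\<lambda>k. 2 * (1 - eta k y)) \<longlonglongrightarrow> 0" by simp
  then show ?thesis
    by (rule Lim_null_comparison[rotated])
       (simp add: mult_eta'_bounds(1) mult_eta'_bounds(3)[simplified])
qed (simp add: eta'_def)

subsection \<open>Mass and out-flux of weak solutions\<close>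

lemma has_derivative_fst_compose:
  fixes f :: "real \<Rightarrow> real"
  assumes d: "\<And>s. s \<in> A \<Longrightarrow> (f has_real_derivative f' s) (at s within A)" and p: "(a, b) \<in> A \<times> B"
  shows "((\<lambda>p. f (fst p)) has_derivative (\<lambda>h. f' a * fst h)) (at (a, b) within A \<times> B)"
proof -
  have "((\<lambda>p. f (fst p)) has_derivative (\<lambda>h. f' (fst (a, b)) * fst h)) (at (a, b) within A \<times> B)"
  proof (rule has_derivative_in_compose2[where g = f and g' = "\<lambda>s h. f' s * h" and t = A])
    show "(f has_derivative (\<lambda>h. f' s * h)) (at s within A)" if "s \<in> A" for s
      using d[OF that] by (simp add: has_field_derivative_def)
    show "(fst has_derivative fst) (at (a, b) within A \<times> B)"
      by (rule bounded_linear_imp_has_derivative[OF bounded_linear_fst])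
  qed (use p in auto)
  then show ?thesis by simp
qed

lemma total_mass_continuous_on:
  assumes "Lp_continuous_on S I01 1 \<rho>"
  shows "continuous_on S (total_mass \<rho>)"
  unfolding continuous_on_def total_mass_def
proof
  fix s assume s: "s \<in> S"
  have "((\<lambda>r. \<integral>x. \<rho> r x * 1 \<partial>I01) \<longlongrightarrow> (\<integral>x. \<rho> s x * 1 \<partial>I01)) (at s within S)"
    by (rule Lp1_mult_tendsto[OF assms s, where B = 1]) auto
  then show "((\<lambda>r. \<integral>x. \<rho> r x \<partial>I01) \<longlongrightarrow> (\<integral>x. \<rho> s x \<partial>I01)) (at s within S)" by simp
qed

lemma LinfD:
  assumes "u \<in> Linf (lebesgue_on {a<..<b::real})"
  shows "integrable (lebesgue_on {a<..<b}) u" "u \<in> borel_measurable (lebesgue_on {a<..<b})"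
proof -
  obtain C where "AE x in lebesgue_on {a<..<b}. \<bar>u x\<bar> \<le> C" and m: "u \<in> borel_measurable (lebesgue_on {a<..<b})"
    using assms by (auto simp: Linf_def)
  then show "integrable (lebesgue_on {a<..<b}) u" by (intro integrable_lebesgue_on_Ioo_bounded)
  show "u \<in> borel_measurable (lebesgue_on {a<..<b})" by (rule m)
qed

lemma integral_tendsto_bounded:
  fixes f :: "'a \<Rightarrow> real"
  assumes "integrable M f" "\<And>k. \<psi> k \<in> borel_measurable M"
    "\<And>k x. x \<in> space M \<Longrightarrow> \<bar>\<psi> k x\<bar> \<le> B" "\<And>x. x \<in> space M \<Longrightarrow> (\<lambda>k. \<psi> k x) \<longlonglongrightarrow> \<psi>' x"
  shows "(\<lambda>k::nat. \<integral>x. f x * \<psi> k x \<partial>M) \<longlonglongrightarrow> (\<integral>x. f x * \<psi>' x \<partial>M)"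
proof (rule integral_dominated_convergence[where w = "\<lambda>x. B * \<bar>f x\<bar>"])
  have "\<psi>' \<in> borel_measurable M" by (rule borel_measurable_LIMSEQ_real[OF assms(4,2)])
  then show "(\<lambda>x. f x * \<psi>' x) \<in> borel_measurable M" using assms by simp
  show "AE x in M. norm (f x * \<psi> k x) \<le> B * \<bar>f x\<bar>" for k
    using assms(3) by (intro AE_I2) (auto simp: abs_mult mult.commute[of B] intro!: mult_left_mono)
qed (use assms in \<open>auto intro!: tendsto_mult_left\<close>)

lemma weak_solutionD:
  assumes "weak_solution lam T \<rho>0 u \<rho>" and "\<tau> \<in> {0..T}"
    and "C1_partials ({0..\<tau>} \<times> {0..1}) \<phi> \<phi>t \<phi>x"
    and "\<And>x. x \<in> {0..1} \<Longrightarrow> \<phi> \<tau> x = 0" "\<And>t. t \<in> {0..\<tau>} \<Longrightarrow> \<phi> t 1 = 0"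
  shows "(\<integral>t. (\<integral>x. \<rho> t x * (\<phi>t t x + lam x (total_mass \<rho> t) * \<phi>x t x) \<partial>I01) \<partial>lebesgue_on {0<..<\<tau>})
        + (\<integral>t. u t * \<phi> t 0 \<partial>lebesgue_on {0<..<\<tau>}) + (\<integral>x. \<rho>0 x * \<phi> 0 x \<partial>I01) = 0"
proof -
  have "\<forall>\<phi> \<phi>t \<phi>x. C1_partials ({0..\<tau>} \<times> {0..1}) \<phi> \<phi>t \<phi>x \<and>
        (\<forall>x\<in>{0..1}. \<phi> \<tau> x = 0) \<and> (\<forall>t\<in>{0..\<tau>}. \<phi> t 1 = 0) \<longrightarrow>
        (\<integral>t. (\<integral>x. \<rho> t x * (\<phi>t t x + lam x (total_mass \<rho> t) * \<phi>x t x) \<partial>I01) \<partial>lebesgue_on {0<..<\<tau>})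
        + (\<integral>t. u t * \<phi> t 0 \<partial>lebesgue_on {0<..<\<tau>}) + (\<integral>x. \<rho>0 x * \<phi> 0 x \<partial>I01) = 0"
    using assms(1,2) unfolding weak_solution_def by blast
  from this[rule_format, of \<phi> \<phi>t \<phi>x] assms(3-5) show ?thesis by blast
qed

text \<open>Test the equation with
  \<open>\<phi>(t, x) = (\<sigma> - t) \<eta>\<^sub>k(x - \<xi>(t))\<close>, for which \<open>\<phi>\<^sub>t + \<lambda> \<phi>\<^sub>x\<close> contains
  \<open>\<eta>\<^sub>k'(x - \<xi>(t)) (\<lambda>(x, W) - \<lambda>(\<xi>(t), W))\<close>, which is bounded and tends to \<open>0\<close>.\<close>

lemma (in speed) mass_behind_path:
  assumes ws: "weak_solution lam T \<rho>0 u \<rho>"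
    and agree: "\<And>x t. x \<in> {0..1} \<Longrightarrow> t \<in> {0..T} \<Longrightarrow> lam x (total_mass \<rho> t) = l x (total_mass \<rho> t)"
    and u: "u \<in> Linf (lebesgue_on {0<..<T})" and \<rho>0: "\<rho>0 \<in> Linf I01"
    and \<xi>: "path (total_mass \<rho>) \<tau> \<xi>" and \<tau>: "0 < \<tau>" "\<tau> \<le> T" and \<xi>\<tau>: "\<xi> \<tau> = 1"
  shows "total_mass \<rho> \<tau> = (\<integral>t. u t * (if 0 < \<xi> t then 1 else 0) \<partial>lebesgue_on {0<..<\<tau>})
      + (\<integral>x. \<rho>0 x * (if x < \<xi> 0 then 1 else 0) \<partial>I01)"
proof -
  define W where "W = total_mass \<rho>"
  have \<rho>c: "Lp_continuous_on {0..T} I01 1 \<rho>" using ws by (simp add: weak_solution_def)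
  have Wc: "continuous_on {0..T} W" unfolding W_def by (rule total_mass_continuous_on[OF \<rho>c])
  have \<xi>': "path W \<tau> \<xi>" using \<xi> by (simp add: W_def)
  have \<xi>c: "continuous_on {0..\<tau>} \<xi>" by (rule path_cont[OF \<xi>'])
  have \<xi>1: "\<xi> t \<le> 1" if "t \<in> {0..\<tau>}" for t
  proof -
    have "0 \<le> c * (\<tau> - t)" using that c_pos by simp
    then show ?thesis using path_growth(1)[OF \<xi>', of t \<tau>] that \<xi>\<tau> by simp
  qed
  \<comment> \<open>The mass behind the path at time \<open>t\<close>; at time
    \<open>\<tau>\<close>, when the path is at \<open>1\<close>, it is the total mass.\<close>
  define F where "F t = (\<integral>x. \<rho> t x * (if x < \<xi> t then 1 else 0) \<partial>I01)" for t
  define R where "R = (\<integral>x. \<rho>0 x * (if x < \<xi> 0 then 1 else 0) \<partial>I01)"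
  have ui: "integrable (lebesgue_on {0<..<\<tau>}) u"
    by (rule integrable_lebesgue_on_Ioo_mono[OF LinfD(1)[OF u]]) (use \<tau> in auto)
  have \<rho>0i: "integrable I01 \<rho>0" by (rule LinfD[OF \<rho>0])
  \<comment> \<open>The balance of \<open>F\<close> in integrated form, owing to the factor
    \<open>\<sigma> - t\<close>; it is proved for every \<open>\<sigma>\<close> so that it can be
    differentiated afterwards.\<close>
  have step: "(\<integral>t. F t \<partial>lebesgue_on {0<..<\<sigma>})
      = (\<integral>t. (\<sigma> - t) * (u t * (if 0 < \<xi> t then 1 else 0)) \<partial>lebesgue_on {0<..<\<sigma>}) + \<sigma> * R"
    if \<sigma>: "\<sigma> \<in> {0..\<tau>}" for \<sigma>
  proof -
    have sub: "{0..\<sigma>} \<subseteq> {0..\<tau>}" "{0..\<sigma>} \<subseteq> {0..T}" using \<sigma> \<tau> by auto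
    note \<xi>c\<sigma> = continuous_on_subset[OF \<xi>c sub(1)]
    note Wc\<sigma> = continuous_on_subset[OF Wc sub(2)]
    define \<phi> where "\<phi> k t x = (\<sigma> - t) * eta k (x - \<xi> t)" for k t x
    define \<phi>x where "\<phi>x k t x = (\<sigma> - t) * eta' k (x - \<xi> t)" for k t x
    define \<phi>t where "\<phi>t k t x = - eta k (x - \<xi> t) - (\<sigma> - t) * eta' k (x - \<xi> t) * l (\<xi> t) (W t)" for k t x
    \<comment> \<open>This is \<open>\<phi>t + l * \<phi>x\<close>: the motion of the front cancels
      the velocity up to the difference of the velocities at \<open>x\<close> and on the path, which
      is of the order of the distance to the front and so compensates \<open>eta'\<close>.\<close>
    define g where "g k t x = - eta k (x - \<xi> t)
        + (\<sigma> - t) * (eta' k (x - \<xi> t) * (l x (W t) - l (\<xi> t) (W t)))" for k t x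
    let ?S = "{0..\<sigma>} \<times> {0..1::real}"
    have fstc: "continuous_on ?S (\<lambda>p. f (fst p))" if "continuous_on {0..\<sigma>} f" for f :: "real \<Rightarrow> real"
      by (rule continuous_on_compose2[OF that]) (auto intro: continuous_intros)
    note cint = continuous_intros fstc[OF \<xi>c\<sigma>] fstc[OF Wc\<sigma>] eta_cont eta'_cont l_cont
    have C1: "C1_partials ?S (\<phi> k) (\<phi>t k) (\<phi>x k)" for k
      unfolding C1_partials_def
    proof (intro conjI)
      show "continuous_on ?S (\<lambda>(a, b). \<phi>t k a b)"
        unfolding \<phi>t_def split_beta by (intro cint)
      show "continuous_on ?S (\<lambda>(a, b). \<phi>x k a b)"
        unfolding \<phi>x_def split_beta by (intro cint)
      show "\<forall>(a, b)\<in>?S. ((\<lambda>(s, y). \<phi> k s y) has_derivative (\<lambda>(h, j). \<phi>t k a b * h + \<phi>x k a b * j)) (at (a, b) within ?S)"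
      proof safe
        fix a b :: real assume a: "a \<in> {0..\<sigma>}" and b: "b \<in> {0..1}"
        have "path W \<sigma> \<xi>" using path_subset[OF \<xi>'] \<sigma> by auto
        then have "((\<lambda>p. \<xi> (fst p)) has_derivative (\<lambda>h. l (\<xi> a) (W a) * fst h)) (at (a, b) within ?S)"
          using a b unfolding path_def by (intro has_derivative_fst_compose) auto
        from has_derivative_diff[OF bounded_linear_imp_has_derivative[OF bounded_linear_snd] this]
        have inner: "((\<lambda>p. snd p - \<xi> (fst p)) has_derivative (\<lambda>h. snd h - l (\<xi> a) (W a) * fst h)) (at (a, b) within ?S)" .
        have "(eta k has_derivative (\<lambda>h. eta' k (b - \<xi> a) * h)) (at ((\<lambda>p. snd p - \<xi> (fst p)) (a, b)))"
          using eta_deriv[of k "b - \<xi> a"] by (simp add: has_field_derivative_def)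
        from has_derivative_compose[OF inner this]
        have e: "((\<lambda>p. eta k (snd p - \<xi> (fst p))) has_derivative
            (\<lambda>h. eta' k (b - \<xi> a) * (snd h - l (\<xi> a) (W a) * fst h))) (at (a, b) within ?S)" .
        have "((\<lambda>p. \<sigma> - fst p) has_derivative (\<lambda>h. 0 - fst h)) (at (a, b) within ?S)"
          by (intro has_derivative_diff has_derivative_const bounded_linear_imp_has_derivative bounded_linear_fst)
        from has_derivative_mult[OF this e]
        show "((\<lambda>(s, y). \<phi> k s y) has_derivative (\<lambda>(h, j). \<phi>t k a b * h + \<phi>x k a b * j)) (at (a, b) within ?S)"
          by (rule back_subst[where P = "\<lambda>f. (f has_derivative _) _", OF has_derivative_eq_rhs])
             (auto simp: \<phi>_def \<phi>t_def \<phi>x_def fun_eq_iff algebra_simps)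
      qed
    qed
    have g: "\<phi>t k t x + lam x (total_mass \<rho> t) * \<phi>x k t x = g k t x" if "t \<in> {0..\<sigma>}" "x \<in> {0..1}" for k t x
      using agree[of x t] that sub by (auto simp: \<phi>t_def \<phi>x_def g_def W_def[symmetric] algebra_simps)
    have weak: "(\<integral>t. (\<integral>x. \<rho> t x * g k t x \<partial>I01) \<partial>lebesgue_on {0<..<\<sigma>})
        + (\<integral>t. u t * \<phi> k t 0 \<partial>lebesgue_on {0<..<\<sigma>}) + (\<integral>x. \<rho>0 x * \<phi> k 0 x \<partial>I01) = 0" for k
    proof -
      \<comment> \<open>The condition at \<open>x = 1\<close> holds because the path does not pass
        \<open>1\<close> up to time \<open>\<tau>\<close> and \<open>eta\<close> vanishes on
        nonnegative arguments.\<close>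
      have bc: "(\<forall>x\<in>{0..1}. \<phi> k \<sigma> x = 0) \<and> (\<forall>t\<in>{0..\<sigma>}. \<phi> k t 1 = 0)"
        using \<xi>1 sub by (auto simp: \<phi>_def eta_bounds(3))
      have "(\<integral>t. (\<integral>x. \<rho> t x * g k t x \<partial>I01) \<partial>lebesgue_on {0<..<\<sigma>})
        = (\<integral>t. (\<integral>x. \<rho> t x * (\<phi>t k t x + lam x (total_mass \<rho> t) * \<phi>x k t x) \<partial>I01) \<partial>lebesgue_on {0<..<\<sigma>})"
        by (intro Bochner_Integration.integral_cong refl) (simp_all add: g)
      moreover have "\<sigma> \<in> {0..T}" using \<sigma> \<tau> by auto
      ultimately show ?thesis
        using weak_solutionD[OF ws _ C1[of k]] bc by simp
    qed
    define B where "B = 1 + T * K"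
    have gB: "\<bar>g k t x\<bar> \<le> B" and glim: "(\<lambda>k. g k t x) \<longlonglongrightarrow> - (if x < \<xi> t then 1 else 0)"
      if t: "t \<in> {0..\<sigma>}" for k t x
    proof -
      define y where "y = x - \<xi> t"
      have *: "\<bar>eta' k y * (l x (W t) - l (\<xi> t) (W t))\<bar> \<le> K * (y * eta' k y)" for k
      proof -
        have "\<bar>eta' k y * (l x (W t) - l (\<xi> t) (W t))\<bar> \<le> \<bar>eta' k y\<bar> * (K * \<bar>y\<bar>)"
          unfolding abs_mult y_def by (intro mult_left_mono l_Lip_x) simp
        also have "\<dots> = K * \<bar>y * eta' k y\<bar>" by (simp add: abs_mult)
        finally show ?thesis using mult_eta'_bounds(1)[of y k] by simp
      qed
      also have "K * (y * eta' k y) \<le> K * 1"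
        by (intro mult_left_mono mult_eta'_bounds K_nonneg)
      finally have "(\<sigma> - t) * \<bar>eta' k y * (l x (W t) - l (\<xi> t) (W t))\<bar> \<le> T * K"
        using t sub K_nonneg T_pos \<sigma> \<tau> by (intro mult_mono) auto
      then have "\<bar>(\<sigma> - t) * (eta' k y * (l x (W t) - l (\<xi> t) (W t)))\<bar> \<le> T * K"
        using t by (simp add: abs_mult)
      then show "\<bar>g k t x\<bar> \<le> B"
        using eta_bounds(1,2)[of k y] by (auto simp: g_def B_def y_def[symmetric] abs_le_iff)
      have "(\<lambda>k. K * (y * eta' k y)) \<longlonglongrightarrow> K * 0"
        by (intro tendsto_mult_left mult_eta'_tendsto)
      then have "(\<lambda>k. K * (y * eta' k y)) \<longlonglongrightarrow> 0" by simp
      then have "(\<lambda>k. eta' k y * (l x (W t) - l (\<xi> t) (W t))) \<longlonglongrightarrow> 0"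
        by (rule Lim_null_comparison[rotated]) (use * in \<open>simp add: always_eventually\<close>)
      then have "(\<lambda>k. - eta k y + (\<sigma> - t) * (eta' k y * (l x (W t) - l (\<xi> t) (W t))))
          \<longlonglongrightarrow> - (if y < 0 then 1 else 0) + (\<sigma> - t) * 0"
        by (intro tendsto_intros eta_tendsto)
      then show "(\<lambda>k. g k t x) \<longlonglongrightarrow> - (if x < \<xi> t then 1 else 0)"
        by (simp add: g_def y_def cong: if_cong)
    qed
    have L1: "(\<lambda>k. \<integral>t. (\<integral>x. \<rho> t x * g k t x \<partial>I01) \<partial>lebesgue_on {0<..<\<sigma>})
        \<longlonglongrightarrow> (\<integral>t. (\<integral>x. \<rho> t x * - (if x < \<xi> t then 1 else 0) \<partial>I01) \<partial>lebesgue_on {0<..<\<sigma>})"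
    proof (rule iterated_integral_tendsto[OF Lp_continuous_on_subset[OF \<rho>c sub(2)]])
      show "continuous_on ?S (\<lambda>(t, x). g k t x)" for k
        unfolding g_def split_beta by (intro cint)
    qed (use gB glim in auto)
    have L2: "(\<lambda>k. \<integral>t. u t * \<phi> k t 0 \<partial>lebesgue_on {0<..<\<sigma>})
        \<longlonglongrightarrow> (\<integral>t. u t * ((\<sigma> - t) * (if 0 < \<xi> t then 1 else 0)) \<partial>lebesgue_on {0<..<\<sigma>})"
    proof (rule integral_tendsto_bounded)
      show "integrable (lebesgue_on {0<..<\<sigma>}) u"
        by (rule integrable_lebesgue_on_Ioo_mono[OF ui]) (use \<sigma> in auto)
      show "(\<lambda>t. \<phi> k t 0) \<in> borel_measurable (lebesgue_on {0<..<\<sigma>})" for k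
        by (rule continuous_on_imp_measurable_lebesgue_on[where S = "{0..\<sigma>}"])
           (auto simp: \<phi>_def intro!: continuous_intros eta_cont \<xi>c\<sigma>)
      show "\<bar>\<phi> k t 0\<bar> \<le> \<sigma> * 1" if "t \<in> space (lebesgue_on {0<..<\<sigma>})" for k t
        unfolding \<phi>_def abs_mult using that eta_bounds(1,2)[of k "0 - \<xi> t"] by (intro mult_mono) auto
      show "(\<lambda>k. \<phi> k t 0) \<longlonglongrightarrow> (\<sigma> - t) * (if 0 < \<xi> t then 1 else 0)" for t
        using tendsto_mult_left[OF eta_tendsto[of "0 - \<xi> t"], of "\<sigma> - t"] by (simp add: \<phi>_def cong: if_cong)
    qed
    have L3: "(\<lambda>k. \<integral>x. \<rho>0 x * \<phi> k 0 x \<partial>I01) \<longlonglongrightarrow> (\<integral>x. \<rho>0 x * (\<sigma> * (if x < \<xi> 0 then 1 else 0)) \<partial>I01)"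
    proof (rule integral_tendsto_bounded[OF \<rho>0i])
      show "\<phi> k 0 \<in> borel_measurable I01" for k
        by (rule continuous_on_imp_measurable_lebesgue_on[where S = UNIV])
           (auto simp: \<phi>_def[abs_def] intro!: continuous_intros eta_cont)
      show "\<bar>\<phi> k 0 x\<bar> \<le> \<sigma> * 1" for k x
        unfolding \<phi>_def abs_mult using \<sigma> eta_bounds(1,2)[of k "x - \<xi> 0"] by (intro mult_mono) auto
      show "(\<lambda>k. \<phi> k 0 x) \<longlonglongrightarrow> \<sigma> * (if x < \<xi> 0 then 1 else 0)" for x
        using tendsto_mult_left[OF eta_tendsto[of "x - \<xi> 0"], of \<sigma>] by (simp add: \<phi>_def cong: if_cong)
    qed
    have "(\<integral>t. (\<integral>x. \<rho> t x * - (if x < \<xi> t then 1 else 0) \<partial>I01) \<partial>lebesgue_on {0<..<\<sigma>})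
        + (\<integral>t. u t * ((\<sigma> - t) * (if 0 < \<xi> t then 1 else 0)) \<partial>lebesgue_on {0<..<\<sigma>})
        + (\<integral>x. \<rho>0 x * (\<sigma> * (if x < \<xi> 0 then 1 else 0)) \<partial>I01) = 0"
      using tendsto_add[OF tendsto_add[OF L1 L2] L3] unfolding weak by (simp add: LIMSEQ_const_iff)
    moreover have "(\<integral>t. (\<integral>x. \<rho> t x * - (if x < \<xi> t then 1 else 0) \<partial>I01) \<partial>lebesgue_on {0<..<\<sigma>})
        = - (\<integral>t. F t \<partial>lebesgue_on {0<..<\<sigma>})"
      by (simp add: F_def)
    moreover have "(\<integral>x. \<rho>0 x * (\<sigma> * (if x < \<xi> 0 then 1 else 0)) \<partial>I01) = \<sigma> * R"
      by (simp add: R_def mult.left_commute[of _ \<sigma>])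
    moreover have "(\<integral>t. u t * ((\<sigma> - t) * (if 0 < \<xi> t then 1 else 0)) \<partial>lebesgue_on {0<..<\<sigma>})
        = (\<integral>t. (\<sigma> - t) * (u t * (if 0 < \<xi> t then 1 else 0)) \<partial>lebesgue_on {0<..<\<sigma>})"
      by (simp add: mult.left_commute)
    ultimately show ?thesis by linarith
  qed
  have "F \<tau> = (\<integral>t. u t * (if 0 < \<xi> t then 1 else 0) \<partial>lebesgue_on {0<..<\<tau>}) + R"
  proof (rule primitive_of_second_primitive[OF _ _ step])
    show "continuous_on {0..\<tau>} F"
      unfolding continuous_on_def F_def
    proof
      fix s assume s: "s \<in> {0..\<tau>}"
      show "((\<lambda>t. \<integral>x. \<rho> t x * (if x < \<xi> t then 1 else 0) \<partial>I01)
          \<longlongrightarrow> (\<integral>x. \<rho> s x * (if x < \<xi> s then 1 else 0) \<partial>I01)) (at s within {0..\<tau>})"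
      proof (rule Lp1_mult_tendsto[where B = 1, OF Lp_continuous_on_subset[OF \<rho>c] s])
        show "{0..\<tau>} \<subseteq> {0..T}" using \<tau> by auto
        show "(\<lambda>x. if x < \<xi> r then 1 else (0::real)) \<in> borel_measurable I01" for r
          by (rule borel_imp_measurable_lebesgue_on) simp
        have \<xi>s: "(\<xi> \<longlongrightarrow> \<xi> s) (at s within {0..\<tau>})" using \<xi>c s by (auto simp: continuous_on_def)
        \<comment> \<open>Indicators of the moving half-lines converge at every \<open>x\<close>
          except possibly the limiting end point, a null set.\<close>
        have ae: "AE x in I01. x \<noteq> \<xi> s"
          using AE_completion[OF AE_lborel_singleton[of "\<xi> s"]]
          by (subst AE_restrict_space_iff) (auto elim: eventually_mono)
        show "AE x in I01. ((\<lambda>r. if x < \<xi> r then 1 else 0) \<longlongrightarrow> (if x < \<xi> s then 1 else (0::real))) (at s within {0..\<tau>})"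
          using ae
        proof eventually_elim
          case (elim x)
          then have "\<forall>\<^sub>F r in at s within {0..\<tau>}. (if x < \<xi> s then 1 else 0) = (if x < \<xi> r then 1 else (0::real))"
          proof (cases "x < \<xi> s")
            case True
            show ?thesis using order_tendstoD(1)[OF \<xi>s True] by eventually_elim (use True in auto)
          next
            case False
            with elim have lt: "\<xi> s < x" by simp
            show ?thesis using order_tendstoD(2)[OF \<xi>s lt] by eventually_elim (use lt in auto)
          qed
          then show ?case by (rule Lim_transform_eventually[OF tendsto_const])
        qed
      qed auto
    qed
    show "integrable (lebesgue_on {0<..<\<tau>}) (\<lambda>t. u t * (if 0 < \<xi> t then 1 else 0))"
    proof (rule integrable_mult_bounded(1)[OF ui, where B = 1])
      have "\<xi> \<in> borel_measurable (lebesgue_on {0<..<\<tau>})"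
        by (rule continuous_on_imp_measurable_lebesgue_on[OF \<xi>c]) auto
      then show "(\<lambda>t. if 0 < \<xi> t then 1 else (0::real)) \<in> borel_measurable (lebesgue_on {0<..<\<tau>})"
        by simp
    qed auto
  qed (use \<tau> in auto)
  moreover have "F \<tau> = total_mass \<rho> \<tau>"
    unfolding F_def total_mass_def by (intro Bochner_Integration.integral_cong) (auto simp: \<xi>\<tau>)
  ultimately show ?thesis by (simp add: R_def)
qed

lemma integral_lebesgue_on_eq_lborel:
  fixes w k :: "'a::euclidean_space \<Rightarrow> real"
  assumes "w \<in> borel_measurable (lebesgue_on S)" "S \<in> sets lebesgue" "k \<in> borel_measurable borel"
    and ae: "AE x in lborel. x \<in> S \<longrightarrow> w x = k x" and k0: "\<And>x. x \<notin> S \<Longrightarrow> k x = 0"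
  shows "integral\<^sup>L (lebesgue_on S) w = integral\<^sup>L lborel k"
proof -
  have "integral\<^sup>L (lebesgue_on S) w = (\<integral>x. (if x \<in> S then w x else 0) \<partial>lebesgue)"
    using assms(2) by (subst integral_restrict_space)
      (auto intro!: Bochner_Integration.integral_cong split: split_indicator)
  also have "\<dots> = integral\<^sup>L lebesgue k"
  proof (rule integral_cong_AE)
    show "(\<lambda>x. if x \<in> S then w x else 0) \<in> borel_measurable lebesgue"
      using assms by (simp add: borel_measurable_if_I)
    show "k \<in> borel_measurable lebesgue" using assms(3) by (simp add: measurable_completion)
    show "AE x in lebesgue. (if x \<in> S then w x else 0) = k x"
      using AE_completion[OF ae] by eventually_elim (auto simp: k0)
  qed
  also have "\<dots> = integral\<^sup>L lborel k"
    using assms(3) by (intro integral_completion) simp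
  finally show ?thesis .
qed

section \<open>Order of integration and the trace at \<open>x = 1\<close>\<close>

lemma AE_lborel_slices:
  fixes Q :: "real \<times> real \<Rightarrow> bool"
  assumes "AE p in lborel. Q p"
  shows "AE t in lborel. AE x in lborel. Q (t, x)" "AE x in lborel. AE t in lborel. Q (t, x)"
proof -
  have 1: "AE p in lborel \<Otimes>\<^sub>M lborel. Q p" using assms by (subst lborel_prod)
  show "AE t in lborel. AE x in lborel. Q (t, x)"
    by (rule lborel_pair.AE_pair[OF 1])
  have "AE p in lborel \<Otimes>\<^sub>M lborel. Q (case p of (x, y) \<Rightarrow> (y, x))"
    using 1 by (subst (asm) lborel_pair.distr_pair_swap) (rule AE_distrD[OF measurable_pair_swap'])
  then have "AE p in lborel \<Otimes>\<^sub>M lborel. Q (snd p, fst p)" by (simp add: split_beta)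
  from lborel_pair.AE_pair[OF this]
  show "AE x in lborel. AE t in lborel. Q (t, x)" by simp
qed

text \<open>The left side involves \<open>\<rho>\<close>, well behaved on time slices, the right
  side \<open>r\<close>, well behaved on space slices, and the two agree only almost everywhere on
  the rectangle. Both are compared with one bounded Borel function \<open>h\<close>, to which Fubini
  applies; a null set of the rectangle has null slices for almost every parameter, and the outer
  integrands are measurable because they are continuous.\<close>

lemma Fubini_slices:
  assumes \<rho>L: "(\<lambda>(t, x). \<rho> t x) \<in> Linf (lebesgue_on ({0<..<T} \<times> {0<..<1}))"
    and ae: "AE (t, x) in lebesgue_on ({0<..<T} \<times> {0<..<1}). r t x = \<rho> t x"
    and \<rho>: "Lp_continuous_on {0..T} I01 1 \<rho>"
    and r: "Lp_continuous_on {0..1} (lebesgue_on {0<..<T}) 1 (\<lambda>x t. r t x)"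
    and \<psi>: "continuous_on ({0..\<sigma>} \<times> {0..1}) (\<lambda>(t, x). \<psi> t x)" and \<sigma>: "0 \<le> \<sigma>" "\<sigma> \<le> T"
  shows "(\<integral>t. (\<integral>x. \<rho> t x * \<psi> t x \<partial>I01) \<partial>lebesgue_on {0<..<\<sigma>})
      = (\<integral>x. (\<integral>t. r t x * \<psi> t x \<partial>lebesgue_on {0<..<\<sigma>}) \<partial>I01)"
    "continuous_on {0..1} (\<lambda>x. \<integral>t. r t x * \<psi> t x \<partial>lebesgue_on {0<..<\<sigma>})"
proof -
  let ?S = "{0<..<T} \<times> {0<..<1::real}"
  let ?R = "{0<..<\<sigma>} \<times> {0<..<1::real}"
  have SL: "?S \<in> sets lebesgue" "?R \<in> sets borel"
    by (intro borel_open open_Times sets_completionI_sets; simp add: open_Times borel_open)+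
  obtain C where C: "AE p in lebesgue_on ?S. \<bar>case p of (t, x) \<Rightarrow> \<rho> t x\<bar> \<le> C"
    and \<rho>m: "(\<lambda>(t, x). \<rho> t x) \<in> borel_measurable (lebesgue_on ?S)"
    using \<rho>L by (auto simp: Linf_def)
  obtain g where g: "g \<in> borel_measurable borel"
    and gae: "AE p in lebesgue. p \<in> ?S \<longrightarrow> (case p of (t, x) \<Rightarrow> \<rho> t x) = g p"
    using lebesgue_on_Borel_version[OF \<rho>m SL(1)] by blast
  have cont\<psi>: "compact ({0..\<sigma>} \<times> {0..1::real})" by (intro compact_Times) auto
  have "bounded ((\<lambda>(t, x). \<psi> t x) ` ({0..\<sigma>} \<times> {0..1}))"
    by (intro compact_imp_bounded compact_continuous_image \<psi> cont\<psi>)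
  then obtain B where B: "\<And>t x. t \<in> {0..\<sigma>} \<Longrightarrow> x \<in> {0..1} \<Longrightarrow> \<bar>\<psi> t x\<bar> \<le> B" and B0: "0 < B"
    by (fastforce simp: bounded_pos)
  define \<psi>I where "\<psi>I p = indicat_real ?R p *\<^sub>R (case p of (t, x) \<Rightarrow> \<psi> t x)" for p
  \<comment> \<open>Truncating \<open>g\<close> at the essential bound makes \<open>h\<close>
    bounded at every point, while \<open>\<rho>\<close> is changed only on a null set.\<close>
  define h where "h p = indicat_real ?R p * (max (- \<bar>C\<bar>) (min \<bar>C\<bar> (g p)) * \<psi>I p)" for p
  have "continuous_on ?R (\<lambda>(t, x). \<psi> t x)" by (rule continuous_on_subset[OF \<psi>]) auto
  then have \<psi>Im: "\<psi>I \<in> borel_measurable borel"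
    unfolding \<psi>I_def[abs_def] by (rule borel_measurable_continuous_on_indicator[OF SL(2)])
  then have hm: "h \<in> borel_measurable borel"
    unfolding h_def[abs_def] using g SL(2)
    by (intro borel_measurable_times borel_measurable_max borel_measurable_min
        borel_measurable_const borel_measurable_indicator)
  have hb: "\<bar>h p\<bar> \<le> \<bar>C\<bar> * B * indicat_real ?R p" for p
  proof (cases "p \<in> ?R")
    case True
    obtain t x where p: "p = (t, x)" by (cases p)
    have "\<bar>max (- \<bar>C\<bar>) (min \<bar>C\<bar> (g p))\<bar> * \<bar>\<psi> t x\<bar> \<le> \<bar>C\<bar> * B"
      using True p B[of t x] by (intro mult_mono) auto
    then show ?thesis using True p by (simp add: h_def \<psi>I_def abs_mult)
  qed (simp add: h_def \<psi>I_def)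
  have hi: "integrable lborel h"
  proof (rule Bochner_Integration.integrable_bound)
    have "emeasure lborel ?R \<le> emeasure lborel (cbox (0 :: real, 0 :: real) (\<sigma>, 1))"
      by (intro emeasure_mono) (auto simp: cbox_Pair_eq intro!: borel_closed closed_Times)
    then have "emeasure lborel ?R < \<infinity>"
      by (rule le_less_trans) (rule emeasure_lborel_cbox_finite)
    then show "integrable lborel (\<lambda>p. \<bar>C\<bar> * B * indicat_real ?R p)"
      using SL(2) by (intro integrable_mult_right) simp
    show "h \<in> borel_measurable lborel" using hm by simp
    show "AE p in lborel. norm (h p) \<le> norm (\<bar>C\<bar> * B * indicat_real ?R p)"
      using hb by (intro AE_I2) (auto intro: order_trans[OF _ abs_ge_self])
  qed
  have all: "AE p in lborel. p \<in> ?S \<longrightarrow> (case p of (t, x) \<Rightarrow> \<rho> t x) = max (- \<bar>C\<bar>) (min \<bar>C\<bar> (g p))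
      \<and> (case p of (t, x) \<Rightarrow> r t x) = (case p of (t, x) \<Rightarrow> \<rho> t x)"
  proof -
    have "AE p in lebesgue. p \<in> ?S \<longrightarrow> \<bar>case p of (t, x) \<Rightarrow> \<rho> t x\<bar> \<le> C"
      using C SL(1) by (simp add: AE_restrict_space_iff)
    moreover have "AE p in lebesgue. p \<in> ?S \<longrightarrow> (case p of (t, x) \<Rightarrow> r t x) = (case p of (t, x) \<Rightarrow> \<rho> t x)"
      using ae SL(1) by (simp add: AE_restrict_space_iff split_beta)
    ultimately have "AE p in lebesgue. p \<in> ?S \<longrightarrow> (case p of (t, x) \<Rightarrow> \<rho> t x) = max (- \<bar>C\<bar>) (min \<bar>C\<bar> (g p))
      \<and> (case p of (t, x) \<Rightarrow> r t x) = (case p of (t, x) \<Rightarrow> \<rho> t x)"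
      using gae by eventually_elim auto
    then show ?thesis by (simp add: AE_completion_iff)
  qed
  have hslice: "(\<lambda>x. h (t, x)) \<in> borel_measurable borel" "(\<lambda>t. h (t, x)) \<in> borel_measurable borel" for t x
    by (rule measurable_compose[OF _ hm]; simp add: borel_prod[symmetric])+
  have \<psi>tm: "(\<lambda>x. \<psi> t x) \<in> borel_measurable I01" if "t \<in> {0..\<sigma>}" for t
    by (rule continuous_on_imp_measurable_lebesgue_on[OF continuous_on_pair_slices(1)[OF \<psi> that]]) auto
  have \<psi>xm: "(\<lambda>t. \<psi> t x) \<in> borel_measurable (lebesgue_on {0<..<\<sigma>})" if "x \<in> {0..1}" for x
    by (rule continuous_on_imp_measurable_lebesgue_on[OF continuous_on_pair_slices(2)[OF \<psi> that]]) auto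
  have rL: "Lp_continuous_on {0..1} (lebesgue_on {0<..<\<sigma>}) 1 (\<lambda>x t. r t x)"
    unfolding Lp_continuous_on_def
  proof (intro ballI conjI)
    fix s :: real assume s: "s \<in> {0..1}"
    have i: "integrable (lebesgue_on {0<..<T}) (\<lambda>t. r t s)" if "s \<in> {0..1}" for s
      using Lp1_continuousD(1)[OF r that] .
    have i': "integrable (lebesgue_on {0<..<\<sigma>}) (\<lambda>t. r t s)" if "s \<in> {0..1}" for s
      by (rule integrable_lebesgue_on_Ioo_mono[OF i[OF that]]) (use \<sigma> in auto)
    then show "(\<lambda>t. r t s) \<in> Lp (lebesgue_on {0<..<\<sigma>}) 1" using s by (auto simp: Lp_def)
    have le: "(\<integral>t. \<bar>r t y - r t s\<bar> \<partial>lebesgue_on {0<..<\<sigma>}) \<le> (\<integral>t. \<bar>r t y - r t s\<bar> \<partial>lebesgue_on {0<..<T})"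
      if "y \<in> {0..1}" for y
      using i[OF that] i[OF s] \<sigma>
      by (intro integral_mono_lebesgue_on_AE) auto
    have "((\<lambda>y. \<integral>t. \<bar>r t y - r t s\<bar> \<partial>lebesgue_on {0<..<\<sigma>}) \<longlongrightarrow> 0) (at s within {0..1})"
      by (rule Lim_null_comparison[OF _ Lp1_continuousD(2)[OF r s]])
         (use le in \<open>auto simp: eventually_at_filter\<close>)
    then show "((\<lambda>y. Lp_norm (lebesgue_on {0<..<\<sigma>}) 1 (\<lambda>t. r t y - r t s)) \<longlongrightarrow> 0) (at s within {0..1})"
      by (simp add: Lp_norm_def)
  qed
  have \<rho>L': "Lp_continuous_on {0..\<sigma>} I01 1 \<rho>"
    by (rule Lp_continuous_on_subset[OF \<rho>]) (use \<sigma> in auto)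
  have "continuous_on ({0..1} \<times> {0..\<sigma>}) (\<lambda>(x, t). \<psi> t x)"
    using continuous_on_compose2[OF \<psi> continuous_on_swap, of "{0..1} \<times> {0..\<sigma>}"]
    by (simp add: split_beta image_subset_iff)
  then show cH: "continuous_on {0..1} (\<lambda>x. \<integral>t. r t x * \<psi> t x \<partial>lebesgue_on {0<..<\<sigma>})"
    by (rule continuous_on_integral_mult(1)[OF rL compact_Icc])
  have cG: "continuous_on {0..\<sigma>} (\<lambda>t. \<integral>x. \<rho> t x * \<psi> t x \<partial>I01)"
    by (rule continuous_on_integral_mult(1)[OF \<rho>L' compact_Icc \<psi>])
  have hI: "integrable (lborel \<Otimes>\<^sub>M lborel) (case_prod (\<lambda>t x. h (t, x)))"
    using hi by (simp add: lborel_prod split_beta)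
  have hout: "t \<notin> {0<..<\<sigma>} \<or> x \<notin> {0<..<1} \<Longrightarrow> h (t, x) = 0" for t x by (auto simp: h_def \<psi>I_def)
  have "(\<integral>t. (\<integral>x. \<rho> t x * \<psi> t x \<partial>I01) \<partial>lebesgue_on {0<..<\<sigma>}) = (\<integral>t. (\<integral>x. h (t, x) \<partial>lborel) \<partial>lborel)"
  proof (rule integral_lebesgue_on_eq_lborel)
    show "(\<lambda>t. \<integral>x. \<rho> t x * \<psi> t x \<partial>I01) \<in> borel_measurable (lebesgue_on {0<..<\<sigma>})"
      by (rule continuous_on_imp_measurable_lebesgue_on[OF cG]) auto
    show "(\<lambda>t. \<integral>x. h (t, x) \<partial>lborel) \<in> borel_measurable borel"
      using borel_measurable_integrable[OF lborel_pair.integrable_fst[OF hI]] by simp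
    show "AE t in lborel. t \<in> {0<..<\<sigma>} \<longrightarrow> (\<integral>x. \<rho> t x * \<psi> t x \<partial>I01) = (\<integral>x. h (t, x) \<partial>lborel)"
      using AE_lborel_slices(1)[OF all]
    proof eventually_elim
      case (elim t)
      show ?case
      proof
        assume t: "t \<in> {0<..<\<sigma>}"
        then have t': "t \<in> {0..\<sigma>}" "t \<in> {0<..<T}" using \<sigma> by auto
        show "(\<integral>x. \<rho> t x * \<psi> t x \<partial>I01) = (\<integral>x. h (t, x) \<partial>lborel)"
        proof (rule integral_lebesgue_on_eq_lborel)
          show "(\<lambda>x. \<rho> t x * \<psi> t x) \<in> borel_measurable I01"
            using Lp1_continuousD(1)[OF \<rho>L' t'(1)] \<psi>tm[OF t'(1)] by (intro borel_measurable_times) auto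
          show "AE x in lborel. x \<in> {0<..<1} \<longrightarrow> \<rho> t x * \<psi> t x = h (t, x)"
            using elim by eventually_elim (use t t' in \<open>auto simp: h_def \<psi>I_def\<close>)
        qed (use hslice hout in auto)
      qed
    qed
  qed (use hout in auto)
  also have "\<dots> = (\<integral>x. (\<integral>t. h (t, x) \<partial>lborel) \<partial>lborel)"
    by (rule lborel_pair.Fubini_integral[OF hI, symmetric])
  also have "\<dots> = (\<integral>x. (\<integral>t. r t x * \<psi> t x \<partial>lebesgue_on {0<..<\<sigma>}) \<partial>I01)"
  proof (rule integral_lebesgue_on_eq_lborel[symmetric])
    show "(\<lambda>x. \<integral>t. r t x * \<psi> t x \<partial>lebesgue_on {0<..<\<sigma>}) \<in> borel_measurable I01"
      by (rule continuous_on_imp_measurable_lebesgue_on[OF cH]) auto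
    show "(\<lambda>x. \<integral>t. h (t, x) \<partial>lborel) \<in> borel_measurable borel"
      using borel_measurable_integrable[OF lborel_pair.integrable_snd[OF hI]] by simp
    show "AE x in lborel. x \<in> {0<..<1} \<longrightarrow> (\<integral>t. r t x * \<psi> t x \<partial>lebesgue_on {0<..<\<sigma>}) = (\<integral>t. h (t, x) \<partial>lborel)"
      using AE_lborel_slices(2)[OF all]
    proof eventually_elim
      case (elim x)
      show ?case
      proof
        assume x: "x \<in> {0<..<1}"
        then have x': "x \<in> {0..1}" by auto
        show "(\<integral>t. r t x * \<psi> t x \<partial>lebesgue_on {0<..<\<sigma>}) = (\<integral>t. h (t, x) \<partial>lborel)"
        proof (rule integral_lebesgue_on_eq_lborel)
          show "(\<lambda>t. r t x * \<psi> t x) \<in> borel_measurable (lebesgue_on {0<..<\<sigma>})"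
            using Lp1_continuousD(1)[OF rL x'] \<psi>xm[OF x'] by (intro borel_measurable_times) auto
          show "AE t in lborel. t \<in> {0<..<\<sigma>} \<longrightarrow> r t x * \<psi> t x = h (t, x)"
            using elim by eventually_elim (use x \<sigma> in \<open>auto simp: h_def \<psi>I_def\<close>)
        qed (use hslice hout in auto)
      qed
    qed
  qed (use hout in auto)
  finally show "(\<integral>t. (\<integral>x. \<rho> t x * \<psi> t x \<partial>I01) \<partial>lebesgue_on {0<..<\<sigma>})
      = (\<integral>x. (\<integral>t. r t x * \<psi> t x \<partial>lebesgue_on {0<..<\<sigma>}) \<partial>I01)" .
qed

text \<open>The weights are an approximate identity at \<open>x = 1\<close>: their integral is one,
  and their first moment in \<open>1 - x\<close> is \<open>1 / (k + 2)\<close>, which tends to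
  zero.\<close>

lemma power_weights_tendsto:
  fixes H :: "real \<Rightarrow> real"
  assumes H: "continuous_on {0..1} H"
  shows "(\<lambda>k. \<integral>x. H x * (real (Suc k) * x ^ k) \<partial>I01) \<longlonglongrightarrow> H 1"
proof -
  have w1: "((\<lambda>x. real (Suc k) * x ^ k) has_integral 1) {0..1}" for k
  proof -
    have "((\<lambda>x. real (Suc k) * x ^ k) has_integral 1 ^ Suc k - 0 ^ Suc k) {0..1::real}"
    proof (rule fundamental_theorem_of_calculus)
      fix x :: real
      show "((\<lambda>x. x ^ Suc k) has_vector_derivative real (Suc k) * x ^ k) (at x within {0..1})"
        using DERIV_pow[of "Suc k" x] by (simp add: has_real_derivative_iff_has_vector_derivative[symmetric])
    qed simp
    then show ?thesis by simp
  qed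
  have w2: "((\<lambda>x. (1 - x) * (real (Suc k) * x ^ k)) has_integral 1 / real (k + 2)) {0..1}" for k
  proof -
    let ?P = "\<lambda>x::real. x ^ Suc k - real (Suc k) / real (k + 2) * x ^ (k + 2)"
    have "((\<lambda>x. (1 - x) * (real (Suc k) * x ^ k)) has_integral ?P 1 - ?P 0) {0..1::real}"
    proof (rule fundamental_theorem_of_calculus)
      fix x :: real
      have "(?P has_real_derivative real (Suc k) * x ^ k - real (Suc k) / real (k + 2) * (real (k + 2) * x ^ (k + 1))) (at x within {0..1})"
        by (rule derivative_eq_intros refl)+ auto
      moreover have "real (Suc k) * x ^ k - real (Suc k) / real (k + 2) * (real (k + 2) * x ^ (k + 1)) = (1 - x) * (real (Suc k) * x ^ k)"
        by (simp add: field_simps)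
      ultimately show "(?P has_vector_derivative (1 - x) * (real (Suc k) * x ^ k)) (at x within {0..1})"
        by (simp add: has_real_derivative_iff_has_vector_derivative)
    qed simp
    moreover have "?P 1 - ?P 0 = 1 / real (k + 2)" by (simp add: field_simps)
    ultimately show ?thesis by simp
  qed
  have eq: "(\<integral>x. H x * (real (Suc k) * x ^ k) \<partial>I01) = integral {0..1} (\<lambda>x. H x * (real (Suc k) * x ^ k))" for k
  proof -
    have "integrable (lebesgue_on {0..1}) (\<lambda>x. H x * (real (Suc k) * x ^ k))"
      by (intro continuous_imp_integrable_real continuous_intros H)
    then have "integrable I01 (\<lambda>x. H x * (real (Suc k) * x ^ k))"
      by (rule integrable_lebesgue_on_mono) auto
    then show ?thesis by (rule lebesgue_on_integral_Ioo)
  qed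
  show ?thesis
  proof (rule LIMSEQ_I)
    fix e :: real assume e: "0 < e"
    then obtain d where d: "0 < d" "\<And>x. x \<in> {0..1} \<Longrightarrow> \<bar>x - 1\<bar> < d \<Longrightarrow> \<bar>H x - H 1\<bar> < e / 2"
      using H[unfolded continuous_on_iff, rule_format, of 1 "e/2"] by (auto simp: dist_real_def)
    have "bounded (H ` {0..1})" by (intro compact_imp_bounded compact_continuous_image H) auto
    then obtain A where A: "\<And>x. x \<in> {0..1} \<Longrightarrow> \<bar>H x\<bar> \<le> A" "0 < A" by (fastforce simp: bounded_pos)
    \<comment> \<open>Near \<open>1\<close> continuity gives \<open>e / 2\<close>; at distance at
      least \<open>d\<close> the crude bound \<open>2 * A\<close> is at most
      \<open>M * (1 - x)\<close>, to be controlled by the first moment of the weights.\<close>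
    define M where "M = 2 * A / d"
    have M: "0 \<le> M" using A d by (simp add: M_def)
    have pt: "\<bar>H x - H 1\<bar> \<le> e / 2 + M * (1 - x)" if x: "x \<in> {0..1}" for x
    proof (cases "\<bar>x - 1\<bar> < d")
      case True
      have "0 \<le> M * (1 - x)" using M x by simp
      with d(2)[OF x True] show ?thesis by linarith
    next
      case False
      then have "M * d \<le> M * (1 - x)" using x M by (intro mult_left_mono) auto
      moreover have "M * d = 2 * A" using d by (simp add: M_def)
      moreover have "\<bar>H x - H 1\<bar> \<le> 2 * A" using A(1)[OF x] A(1)[of 1] by auto
      ultimately show ?thesis using e by linarith
    qed
    have est: "\<bar>integral {0..1} (\<lambda>x. H x * (real (Suc k) * x ^ k)) - H 1\<bar> \<le> e / 2 + M / real (k + 2)" for k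
    proof -
      have i1: "(\<lambda>x. H x * (real (Suc k) * x ^ k)) integrable_on {0..1}"
        by (intro integrable_continuous_interval continuous_intros H)
      have "((\<lambda>x. H x * (real (Suc k) * x ^ k) - H 1 * (real (Suc k) * x ^ k)) has_integral
          integral {0..1} (\<lambda>x. H x * (real (Suc k) * x ^ k)) - H 1 * 1) {0..1}"
        by (intro has_integral_diff integrable_integral i1 has_integral_mult_right w1)
      moreover have "((\<lambda>x. e / 2 * (real (Suc k) * x ^ k) + M * ((1 - x) * (real (Suc k) * x ^ k))) has_integral
          e / 2 * 1 + M * (1 / real (k + 2))) {0..1}"
        by (intro has_integral_add has_integral_mult_right w1 w2)
      moreover have "norm (H x * (real (Suc k) * x ^ k) - H 1 * (real (Suc k) * x ^ k))
          \<le> e / 2 * (real (Suc k) * x ^ k) + M * ((1 - x) * (real (Suc k) * x ^ k))" if x: "x \<in> {0..1}" for x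
      proof -
        have "\<bar>H x - H 1\<bar> * (real (Suc k) * x ^ k) \<le> (e / 2 + M * (1 - x)) * (real (Suc k) * x ^ k)"
          using pt[OF x] x by (intro mult_right_mono) auto
        moreover have "norm (H x * (real (Suc k) * x ^ k) - H 1 * (real (Suc k) * x ^ k)) = \<bar>H x - H 1\<bar> * (real (Suc k) * x ^ k)"
          unfolding left_diff_distrib[symmetric] using x by (simp only: real_norm_def abs_mult) simp
        ultimately show ?thesis by (simp add: distrib_right mult.assoc)
      qed
      ultimately have "norm (integral {0..1} (\<lambda>x. H x * (real (Suc k) * x ^ k)) - H 1 * 1) \<le> e / 2 * 1 + M * (1 / real (k + 2))"
        by (metis (no_types, lifting) integral_unique has_integral_integrable integral_norm_bound_integral)
      then show ?thesis by simp
    qed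
    obtain N :: nat where N: "2 * M / e < real N" using reals_Archimedean2 by blast
    have "norm ((\<integral>x. H x * (real (Suc k) * x ^ k) \<partial>I01) - H 1) < e" if k: "k \<ge> N" for k
    proof -
      have "2 * M < e * real N" using N e by (simp add: pos_divide_less_eq mult.commute)
      also have "\<dots> \<le> e * real (k + 2)" using k e by (intro mult_left_mono) auto
      finally have "M / real (k + 2) < e / 2" by (simp add: field_simps)
      then have "\<bar>integral {0..1} (\<lambda>x. H x * (real (Suc k) * x ^ k)) - H 1\<bar> < e"
        using est[of k] by linarith
      then show ?thesis by (simp only: eq real_norm_def)
    qed
    then show "\<exists>N. \<forall>k\<ge>N. norm ((\<integral>x. H x * (real (Suc k) * x ^ k) \<partial>I01) - H 1) < e" by blast
  qed
qed

text \<open>Test the equation with \<open>(\<sigma> - t) (1 - x\<^sup>k\<^sup>+\<^sup>1)\<close>, whose derivative in \<open>x\<close> concentrates at \<open>x = 1\<close>.\<close>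

lemma outflux_balance:
  assumes ws: "weak_solution lam T \<rho>0 u \<rho>"
    and lam: "continuous_on ({0..1} \<times> {0..}) (\<lambda>(x, w). lam x w)"
    and u: "u \<in> Linf (lebesgue_on {0<..<T})" and \<rho>0: "\<rho>0 \<in> Linf I01" and T: "0 < T"
    and ae: "AE (t, x) in lebesgue_on ({0<..<T} \<times> {0<..<1}). r t x = \<rho> t x"
    and r: "Lp_continuous_on {0..1} (lebesgue_on {0<..<T}) 1 (\<lambda>x t. r t x)"
  shows "integrable (lebesgue_on {0<..<T}) (\<lambda>t. r t 1 * lam 1 (total_mass \<rho> t))"
    "\<tau> \<in> {0..T} \<Longrightarrow> total_mass \<rho> \<tau> = (\<integral>x. \<rho>0 x \<partial>I01) + (\<integral>t. u t \<partial>lebesgue_on {0<..<\<tau>})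
      - (\<integral>t. r t 1 * lam 1 (total_mass \<rho> t) \<partial>lebesgue_on {0<..<\<tau>})"
proof -
  define W where "W = total_mass \<rho>"
  have \<rho>c: "Lp_continuous_on {0..T} I01 1 \<rho>" and \<rho>L: "(\<lambda>(t, x). \<rho> t x) \<in> Linf (lebesgue_on ({0<..<T} \<times> {0<..<1}))"
    and W0: "\<And>t. t \<in> {0..T} \<Longrightarrow> 0 \<le> W t"
    using ws by (auto simp: weak_solution_def W_def)
  have Wc: "continuous_on {0..T} W" unfolding W_def by (rule total_mass_continuous_on[OF \<rho>c])
  \<comment> \<open>Here \<open>lam\<close> appears without extension: the mass of a weak solution
    is nonnegative by definition, and only positions in \<open>[0, 1]\<close> occur.\<close>
  define m where "m t x = lam x (W t)" for t x
  have mc: "continuous_on ({0..T} \<times> {0..1}) (\<lambda>(t, x). m t x)"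
  proof -
    have "continuous_on ({0..T} \<times> {0..1::real}) (\<lambda>p. W (fst p))"
      by (rule continuous_on_compose2[OF Wc]) (auto intro: continuous_intros)
    then have "continuous_on ({0..T} \<times> {0..1::real}) (\<lambda>p. (snd p, W (fst p)))"
      by (intro continuous_intros)
    moreover have "(\<lambda>p. (snd p, W (fst p))) ` ({0..T} \<times> {0..1}) \<subseteq> {0..1} \<times> {0..}"
      using W0 by auto
    ultimately have "continuous_on ({0..T} \<times> {0..1}) (\<lambda>p. case (snd p, W (fst p)) of (x, w) \<Rightarrow> lam x w)"
      by (rule continuous_on_compose2[OF lam])
    then show ?thesis by (simp add: m_def split_beta)
  qed
  have m1c: "continuous_on {0..T} (\<lambda>t. m t 1)"
    by (rule continuous_on_pair_slices(2)[OF mc]) simp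
  have "bounded ((\<lambda>t. m t 1) ` {0..T})" by (intro compact_imp_bounded compact_continuous_image m1c) auto
  then obtain A where A: "\<And>t. t \<in> {0..T} \<Longrightarrow> \<bar>m t 1\<bar> \<le> A" by (fastforce simp: bounded_pos)
  define y where "y t = r t 1 * m t 1" for t
  have ri: "integrable (lebesgue_on {0<..<T}) (\<lambda>t. r t 1)" using Lp1_continuousD(1)[OF r, of 1] by simp
  have yi: "integrable (lebesgue_on {0<..<T}) y"
    unfolding y_def[abs_def]
    by (rule integrable_mult_bounded(1)[OF ri continuous_on_imp_measurable_lebesgue_on[OF m1c], where B = A]) (use A in auto)
  then show "integrable (lebesgue_on {0<..<T}) (\<lambda>t. r t 1 * lam 1 (total_mass \<rho> t))"
    by (simp add: y_def[abs_def] m_def W_def)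
  define R where "R = (\<integral>x. \<rho>0 x \<partial>I01)"
  note ui = LinfD(1)[OF u]
  note \<rho>0i = LinfD(1)[OF \<rho>0]
  have step: "(\<integral>t. W t \<partial>lebesgue_on {0<..<\<sigma>}) = (\<integral>t. (\<sigma> - t) * (u t - y t) \<partial>lebesgue_on {0<..<\<sigma>}) + \<sigma> * R"
    if \<sigma>: "\<sigma> \<in> {0..T}" for \<sigma>
  proof -
    let ?S = "{0..\<sigma>} \<times> {0..1::real}"
    let ?N = "lebesgue_on {0<..<\<sigma>}"
    have sub: "{0..\<sigma>} \<subseteq> {0..T}" using \<sigma> by auto
    have mcS: "continuous_on ?S (\<lambda>p. m (fst p) (snd p))"
    proof -
      have "?S \<subseteq> {0..T} \<times> {0..1}" using sub by auto
      from continuous_on_subset[OF mc this] show ?thesis by (simp add: split_beta)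
    qed
    define \<phi> where "\<phi> k t x = (\<sigma> - t) * (1 - x ^ Suc k)" for k :: nat and t x :: real
    define \<phi>t where "\<phi>t k t x = - (1 - x ^ Suc k)" for k :: nat and t x :: real
    define \<phi>x where "\<phi>x k t x = - ((\<sigma> - t) * (real (Suc k) * x ^ k))" for k :: nat and t x :: real
    \<comment> \<open>Multiplied by the weight \<open>real (Suc k) * x ^ k\<close>, this is
      \<open>lam * \<phi>x\<close>, the term that will isolate the flux at
      \<open>x = 1\<close>.\<close>
    define \<psi> where "\<psi> t x = - ((\<sigma> - t) * m t x)" for t x
    have \<psi>c: "continuous_on ?S (\<lambda>(t, x). \<psi> t x)" unfolding \<psi>_def split_beta by (intro continuous_intros mcS)
    have gc: "continuous_on ?S (\<lambda>(t, x). \<phi>t k t x)" for k unfolding \<phi>t_def split_beta by (intro continuous_intros)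
    have C1: "C1_partials ?S (\<phi> k) (\<phi>t k) (\<phi>x k)" for k
      unfolding C1_partials_def
    proof (intro conjI)
      show "continuous_on ?S (\<lambda>(a, b). \<phi>t k a b)" by (rule gc)
      show "continuous_on ?S (\<lambda>(a, b). \<phi>x k a b)" unfolding \<phi>x_def split_beta by (intro continuous_intros)
      show "\<forall>(a, b)\<in>?S. ((\<lambda>(s, y). \<phi> k s y) has_derivative (\<lambda>(h, j). \<phi>t k a b * h + \<phi>x k a b * j)) (at (a, b) within ?S)"
      proof safe
        fix a b :: real
        have "((\<lambda>x. 1 - x ^ Suc k) has_real_derivative - (real (Suc k) * b ^ k)) (at b)"
          using DERIV_diff[OF DERIV_const[of 1] DERIV_pow[of "Suc k" b]]
          by (simp del: power_Suc of_nat_Suc)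
        then have "((\<lambda>x. 1 - x ^ Suc k) has_derivative (\<lambda>h. - (real (Suc k) * b ^ k) * h)) (at (snd (a, b)))"
          by (simp only: has_field_derivative_def snd_conv)
        from has_derivative_compose[OF bounded_linear_imp_has_derivative[OF bounded_linear_snd] this]
        have e: "((\<lambda>p. 1 - snd p ^ Suc k) has_derivative (\<lambda>h. - (real (Suc k) * b ^ k) * snd h)) (at (a, b) within ?S)" .
        have "((\<lambda>p. \<sigma> - fst p) has_derivative (\<lambda>h. 0 - fst h)) (at (a, b) within ?S)"
          by (intro has_derivative_diff has_derivative_const bounded_linear_imp_has_derivative bounded_linear_fst)
        from has_derivative_mult[OF this e]
        have d: "((\<lambda>p. (\<sigma> - fst p) * (1 - snd p ^ Suc k)) has_derivative
            (\<lambda>h. (\<sigma> - a) * (- (real (Suc k) * b ^ k) * snd h) + (0 - fst h) * (1 - b ^ Suc k))) (at (a, b) within ?S)"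
          by (simp del: power_Suc)
        show "((\<lambda>(s, y). \<phi> k s y) has_derivative (\<lambda>(h, j). \<phi>t k a b * h + \<phi>x k a b * j)) (at (a, b) within ?S)"
          using d by (rule back_subst[where P = "\<lambda>f. (f has_derivative _) _", OF has_derivative_eq_rhs])
             (auto simp: \<phi>_def \<phi>t_def \<phi>x_def fun_eq_iff algebra_simps)
      qed
    qed
    have xk: "0 \<le> x ^ n" "x ^ n \<le> 1" if "x \<in> {0..1}" for x :: real and n
      using that by (auto simp: power_le_one)
    have c\<psi>: "continuous_on ?S (\<lambda>(t, x). \<psi> t x * (real (Suc k) * x ^ k))" for k
      using \<psi>c by (auto simp: split_beta intro!: continuous_intros)
    have \<rho>c\<sigma>: "Lp_continuous_on {0..\<sigma>} I01 1 \<rho>" by (rule Lp_continuous_on_subset[OF \<rho>c sub])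
    define G where "G f t = (\<integral>x. \<rho> t x * f t x \<partial>I01)" for f and t
    have Gi: "integrable ?N (G f) \<and> (\<forall>t\<in>{0..\<sigma>}. integrable I01 (\<lambda>x. \<rho> t x * f t x))"
      if f: "continuous_on ?S (\<lambda>(t, x). f t x)" for f
    proof (intro conjI ballI)
      have "integrable (lebesgue_on {0..\<sigma>}) (G f)"
        unfolding G_def by (rule continuous_imp_integrable_real[OF continuous_on_integral_mult(1)[OF \<rho>c\<sigma> compact_Icc f]])
      then show "integrable ?N (G f)" by (rule integrable_lebesgue_on_mono) auto
    qed (rule continuous_on_integral_mult(2)[OF \<rho>c\<sigma> compact_Icc f])
    have weak: "(\<integral>t. G (\<phi>t k) t \<partial>?N) + (\<integral>t. G (\<lambda>t x. \<psi> t x * (real (Suc k) * x ^ k)) t \<partial>?N)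
        + (\<integral>t. u t * (\<sigma> - t) \<partial>?N) + (\<integral>x. \<rho>0 x * (\<sigma> * (1 - x ^ Suc k)) \<partial>I01) = 0" for k
    proof -
      have "(\<integral>t. (\<integral>x. \<rho> t x * (\<phi>t k t x + lam x (total_mass \<rho> t) * \<phi>x k t x) \<partial>I01) \<partial>?N)
        + (\<integral>t. u t * \<phi> k t 0 \<partial>?N) + (\<integral>x. \<rho>0 x * \<phi> k 0 x \<partial>I01) = 0"
        by (rule weak_solutionD[OF ws \<sigma> C1]) (auto simp: \<phi>_def)
      moreover have "(\<integral>t. (\<integral>x. \<rho> t x * (\<phi>t k t x + lam x (total_mass \<rho> t) * \<phi>x k t x) \<partial>I01) \<partial>?N)
         = (\<integral>t. G (\<phi>t k) t + G (\<lambda>t x. \<psi> t x * (real (Suc k) * x ^ k)) t \<partial>?N)"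
      proof (rule Bochner_Integration.integral_cong[OF refl])
        fix t assume "t \<in> space ?N"
        then have t: "t \<in> {0..\<sigma>}" by auto
        have "(\<integral>x. \<rho> t x * (\<phi>t k t x + lam x (total_mass \<rho> t) * \<phi>x k t x) \<partial>I01)
            = (\<integral>x. \<rho> t x * \<phi>t k t x + \<rho> t x * (\<psi> t x * (real (Suc k) * x ^ k)) \<partial>I01)"
          by (intro Bochner_Integration.integral_cong refl)
             (simp add: \<phi>t_def \<phi>x_def \<psi>_def m_def W_def algebra_simps)
        also have "\<dots> = G (\<phi>t k) t + G (\<lambda>t x. \<psi> t x * (real (Suc k) * x ^ k)) t"
          unfolding G_def using Gi[OF gc] Gi[OF c\<psi>] t by (intro Bochner_Integration.integral_add) auto
        finally show "(\<integral>x. \<rho> t x * (\<phi>t k t x + lam x (total_mass \<rho> t) * \<phi>x k t x) \<partial>I01)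
            = G (\<phi>t k) t + G (\<lambda>t x. \<psi> t x * (real (Suc k) * x ^ k)) t" .
      qed
      moreover have "\<dots> = (\<integral>t. G (\<phi>t k) t \<partial>?N) + (\<integral>t. G (\<lambda>t x. \<psi> t x * (real (Suc k) * x ^ k)) t \<partial>?N)"
        using Gi[OF gc] Gi[OF c\<psi>] by (intro Bochner_Integration.integral_add) auto
      ultimately show ?thesis by (simp add: \<phi>_def)
    qed
    have L1: "(\<lambda>k. \<integral>t. G (\<phi>t k) t \<partial>?N) \<longlonglongrightarrow> (\<integral>t. (\<integral>x. \<rho> t x * (- 1) \<partial>I01) \<partial>?N)"
      unfolding G_def
    proof (rule iterated_integral_tendsto[OF \<rho>c\<sigma> gc])
      show "\<bar>\<phi>t k t x\<bar> \<le> 1" if "x \<in> {0..1}" for k t x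
        using xk[OF that, of "Suc k"] unfolding \<phi>t_def by linarith
      show "(\<lambda>k. \<phi>t k t x) \<longlonglongrightarrow> - 1" if "x \<in> {0<..<1}" for t x
      proof -
        have "(\<lambda>k. x ^ Suc k) \<longlonglongrightarrow> 0"
          using that by (intro LIMSEQ_Suc LIMSEQ_realpow_zero) auto
        then have "(\<lambda>k. - (1 - x ^ Suc k)) \<longlonglongrightarrow> - (1 - 0)" by (intro tendsto_intros)
        then show ?thesis by (simp add: \<phi>t_def)
      qed
    qed
    define H where "H x = (\<integral>t. r t x * \<psi> t x \<partial>?N)" for x
    have Hc: "continuous_on {0..1} H"
      unfolding H_def by (rule Fubini_slices(2)[OF \<rho>L ae \<rho>c r \<psi>c]) (use \<sigma> in auto)
    \<comment> \<open>Swapping the integrals replaces \<open>\<rho>\<close> by \<open>r\<close>, for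
      which \<open>H\<close> is continuous in \<open>x\<close>; the concentrating weights then pick
      out \<open>H 1\<close>, the trace.\<close>
    have "(\<integral>t. G (\<lambda>t x. \<psi> t x * (real (Suc k) * x ^ k)) t \<partial>?N) = (\<integral>x. H x * (real (Suc k) * x ^ k) \<partial>I01)" for k
    proof -
      have "(\<integral>t. G (\<lambda>t x. \<psi> t x * (real (Suc k) * x ^ k)) t \<partial>?N)
        = (\<integral>x. (\<integral>t. r t x * (\<psi> t x * (real (Suc k) * x ^ k)) \<partial>?N) \<partial>I01)"
        unfolding G_def by (rule Fubini_slices(1)[OF \<rho>L ae \<rho>c r c\<psi>]) (use \<sigma> in auto)
      then show ?thesis unfolding H_def by (simp only: mult.assoc[symmetric] Bochner_Integration.integral_mult_left_zero)
    qed
    then have L2: "(\<lambda>k. \<integral>t. G (\<lambda>t x. \<psi> t x * (real (Suc k) * x ^ k)) t \<partial>?N) \<longlonglongrightarrow> H 1"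
      using power_weights_tendsto[OF Hc] by simp
    have L3: "(\<lambda>k. \<integral>x. \<rho>0 x * (\<sigma> * (1 - x ^ Suc k)) \<partial>I01) \<longlonglongrightarrow> (\<integral>x. \<rho>0 x * (\<sigma> * (1 - 0)) \<partial>I01)"
    proof (rule integral_tendsto_bounded[OF \<rho>0i])
      show "(\<lambda>x. \<sigma> * (1 - x ^ Suc k)) \<in> borel_measurable I01" for k
        by (rule borel_imp_measurable_lebesgue_on) simp
      show "\<bar>\<sigma> * (1 - x ^ Suc k)\<bar> \<le> \<sigma> * 1" if "x \<in> space I01" for k x
        unfolding abs_mult using \<sigma> xk[of x "Suc k"] that by (intro mult_mono) auto
      show "(\<lambda>k. \<sigma> * (1 - x ^ Suc k)) \<longlonglongrightarrow> \<sigma> * (1 - 0)" if "x \<in> space I01" for x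
        using that by (intro tendsto_intros LIMSEQ_Suc LIMSEQ_realpow_zero) auto
    qed
    have "(\<integral>t. (\<integral>x. \<rho> t x * (- 1) \<partial>I01) \<partial>?N) + H 1 + (\<integral>t. u t * (\<sigma> - t) \<partial>?N) + (\<integral>x. \<rho>0 x * (\<sigma> * (1 - 0)) \<partial>I01) = 0"
      using tendsto_add[OF tendsto_add[OF tendsto_add[OF L1 L2] tendsto_const[of "\<integral>t. u t * (\<sigma> - t) \<partial>?N"]] L3]
      unfolding weak
      by (simp only: LIMSEQ_const_iff)
    moreover have "(\<integral>t. (\<integral>x. \<rho> t x * (- 1) \<partial>I01) \<partial>?N) = - (\<integral>t. W t \<partial>?N)"
      by (simp add: W_def total_mass_def)
    moreover have "(\<integral>x. \<rho>0 x * (\<sigma> * (1 - 0)) \<partial>I01) = \<sigma> * R"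
      by (simp add: R_def mult.commute)
    moreover have "H 1 + (\<integral>t. u t * (\<sigma> - t) \<partial>?N) = (\<integral>t. (\<sigma> - t) * (u t - y t) \<partial>?N)"
    proof -
      have i: "integrable ?N (\<lambda>t. f t * (\<sigma> - t))" if "integrable (lebesgue_on {0<..<T}) f" for f
      proof (rule integrable_mult_bounded(1)[where B = \<sigma>])
        show "integrable ?N f" by (rule integrable_lebesgue_on_Ioo_mono[OF that]) (use \<sigma> in auto)
        show "(\<lambda>t. \<sigma> - t) \<in> borel_measurable ?N" by (rule borel_imp_measurable_lebesgue_on) simp
      qed auto
      have "H 1 = (\<integral>t. - (y t * (\<sigma> - t)) \<partial>?N)"
        unfolding H_def by (intro Bochner_Integration.integral_cong refl) (simp add: \<psi>_def y_def algebra_simps)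
      then have "H 1 + (\<integral>t. u t * (\<sigma> - t) \<partial>?N) = (\<integral>t. u t * (\<sigma> - t) - y t * (\<sigma> - t) \<partial>?N)"
        using i[OF ui] i[OF yi] by simp
      then show ?thesis by (simp add: algebra_simps)
    qed
    ultimately show ?thesis by linarith
  qed
  show "total_mass \<rho> \<tau> = (\<integral>x. \<rho>0 x \<partial>I01) + (\<integral>t. u t \<partial>lebesgue_on {0<..<\<tau>})
      - (\<integral>t. r t 1 * lam 1 (total_mass \<rho> t) \<partial>lebesgue_on {0<..<\<tau>})" if \<tau>: "\<tau> \<in> {0..T}"
  proof -
    have i: "integrable (lebesgue_on {0<..<\<tau>}) u" "integrable (lebesgue_on {0<..<\<tau>}) y"
      using \<tau> integrable_lebesgue_on_Ioo_mono[OF ui, of 0 \<tau>] integrable_lebesgue_on_Ioo_mono[OF yi, of 0 \<tau>] by auto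
    have "W \<tau> = (\<integral>t. u t - y t \<partial>lebesgue_on {0<..<\<tau>}) + R"
      by (rule primitive_of_second_primitive[OF Wc _ step T \<tau>])
         (auto intro: Bochner_Integration.integrable_diff ui yi)
    then show ?thesis
      unfolding Bochner_Integration.integral_diff[OF i] by (simp add: W_def R_def y_def[abs_def] m_def)
  qed
qed

subsection \<open>The solution given by characteristics\<close>

text \<open>Change of variables with \<open>\<bar>Z' x\<bar>\<close> bounded below: composing with
  \<open>Z\<close> enlarges L1 norms at most by \<open>1 / \<kappa>\<close>. Smallness of
  \<open>h\<close> therefore survives composition, uniformly over all such \<open>Z\<close> with
  range in \<open>{-N..N}\<close>.\<close>

lemma integral_compose_le:
  fixes Z Z' h :: "real \<Rightarrow> real"
  assumes d: "\<And>x. x \<in> {a<..<b} \<Longrightarrow> (Z has_real_derivative Z' x) (at x)"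
    and \<kappa>: "\<And>x. x \<in> {a<..<b} \<Longrightarrow> \<kappa> \<le> \<bar>Z' x\<bar>"
    and inj: "inj_on Z {a<..<b}" and N: "\<And>x. x \<in> {a<..<b} \<Longrightarrow> \<bar>Z x\<bar> \<le> N"
    and h: "h \<in> borel_measurable borel" "\<And>z. 0 \<le> h z" "\<And>z. h z \<le> M"
  shows "\<kappa> * integral\<^sup>L (lebesgue_on {a<..<b}) (\<lambda>x. h (Z x)) \<le> integral\<^sup>L (lebesgue_on {-N..N}) h"
    "(\<lambda>x. h (Z x)) \<in> borel_measurable (lebesgue_on {a<..<b})"
proof -
  let ?I = "{a<..<b}"
  have Zc: "continuous_on ?I Z"
    by (rule DERIV_continuous_on[OF has_field_derivative_at_within[OF d]]) simp
  then have "Z \<in> borel_measurable (lebesgue_on ?I)"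
    by (rule continuous_on_imp_measurable_lebesgue_on) auto
  then show hZ: "(\<lambda>x. h (Z x)) \<in> borel_measurable (lebesgue_on ?I)"
    using h(1) by (rule measurable_compose)
  have hZi: "integrable (lebesgue_on ?I) (\<lambda>x. h (Z x))"
    by (rule integrable_lebesgue_on_Ioo_bounded[OF hZ, where C = M]) (use h in auto)
  have hi: "integrable (lebesgue_on {-N..N}) h"
    by (rule finite_measure.integrable_const_bound[OF finite_measure_lebesgue_on[OF lmeasurable_interval(1)], where B = M])
       (use h in \<open>auto intro!: borel_imp_measurable_lebesgue_on\<close>)
  have im: "Z ` ?I \<in> sets lebesgue" "Z ` ?I \<subseteq> {-N..N}"
  proof -
    show sub: "Z ` ?I \<subseteq> {-N..N}" using N by (force simp: abs_le_iff)
    have "is_interval (Z ` ?I)"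
      unfolding is_interval_connected_1 by (intro connected_continuous_image Zc connected_Ioo)
    then have "Z ` ?I \<in> sets borel" by (rule real_interval_borel_measurable)
    then show "Z ` ?I \<in> sets lebesgue" by (intro sets_completionI_sets) simp
  qed
  have hI: "integrable (lebesgue_on (Z ` ?I)) h"
    by (rule integrable_lebesgue_on_mono[OF hi im(2,1)]) simp
  then have "h absolutely_integrable_on Z ` ?I"
    using im(1) by (simp add: set_integrable_def integrable_restrict_space)
  moreover have "(Z has_field_derivative Z' x) (at x within ?I)" if "x \<in> ?I" for x
    by (rule has_field_derivative_at_within[OF d[OF that]])
  ultimately have cv: "(\<lambda>x. \<bar>Z' x\<bar> * h (Z x)) absolutely_integrable_on ?I"
      "integral ?I (\<lambda>x. \<bar>Z' x\<bar> * h (Z x)) = integral (Z ` ?I) h"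
    using has_absolute_integral_change_of_variables_1'[of ?I Z Z' h "integral (Z ` ?I) h"] inj by auto
  have "\<kappa> * integral\<^sup>L (lebesgue_on ?I) (\<lambda>x. h (Z x)) = integral ?I (\<lambda>x. \<kappa> * h (Z x))"
    using lebesgue_integral_eq_integral[OF hZi] by simp
  also have "\<dots> \<le> integral ?I (\<lambda>x. \<bar>Z' x\<bar> * h (Z x))"
  proof (rule integral_le)
    show "(\<lambda>x. \<kappa> * h (Z x)) integrable_on ?I"
      using integrable_on_lebesgue_on[OF hZi] by (intro integrable_on_mult_right) simp
    show "(\<lambda>x. \<bar>Z' x\<bar> * h (Z x)) integrable_on ?I"
      using cv(1) by (rule set_lebesgue_integral_eq_integral(1))
    show "\<kappa> * h (Z x) \<le> \<bar>Z' x\<bar> * h (Z x)" if "x \<in> ?I" for x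
      using \<kappa>[OF that] h(2) by (intro mult_right_mono)
  qed
  also have "\<dots> = integral (Z ` ?I) h" by (rule cv)
  also have "\<dots> \<le> integral {-N..N} h"
    by (intro integral_subset_le im(2) integrable_on_lebesgue_on[OF hI im(1)] integrable_on_lebesgue_on[OF hi])
       (use h in auto)
  also have "\<dots> = integral\<^sup>L (lebesgue_on {-N..N}) h"
    by (rule lebesgue_integral_eq_integral[OF hi, symmetric]) simp
  finally show "\<kappa> * integral\<^sup>L (lebesgue_on ?I) (\<lambda>x. h (Z x)) \<le> integral\<^sup>L (lebesgue_on {-N..N}) h" .
qed

text \<open>Measurability gives continuous functions converging to \<open>g\<close> almost
  everywhere; clamping keeps the bound \<open>M\<close>, and dominated convergence makes them close
  in L1.\<close>

lemma bounded_approx_continuous: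
  fixes g :: "real \<Rightarrow> real"
  assumes g: "g \<in> borel_measurable borel" "\<And>z. \<bar>g z\<bar> \<le> M" and e: "0 < e"
  obtains h where "continuous_on UNIV h" "\<And>z. \<bar>h z\<bar> \<le> M"
    "integral\<^sup>L (lebesgue_on {-N..N}) (\<lambda>z. \<bar>g z - h z\<bar>) < e"
proof -
  have "g \<in> borel_measurable lebesgue" using g(1) by (simp add: measurable_completion)
  then have "g measurable_on UNIV" by (intro lebesgue_measurable_imp_measurable_on_real) auto
  then obtain A h where A: "negligible A" and h: "\<And>n. continuous_on UNIV (h n)"
    and lim: "\<And>x. x \<notin> A \<Longrightarrow> (\<lambda>n. h n x) \<longlonglongrightarrow> g x"
    unfolding measurable_on_def by auto
  define h' where "h' n z = max (- M) (min M (h n z))" for n :: nat and z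
  have M: "0 \<le> M" using g(2)[of 0] by linarith
  have h'c: "continuous_on UNIV (h' n)" for n unfolding h'_def by (intro continuous_intros h)
  have h'b: "\<bar>h' n z\<bar> \<le> M" for n z using M by (auto simp: h'_def)
  have h'l: "(\<lambda>n. h' n x) \<longlonglongrightarrow> g x" if "x \<notin> A" for x
  proof -
    have "(\<lambda>n. h' n x) \<longlonglongrightarrow> max (- M) (min M (g x))"
      unfolding h'_def by (intro tendsto_intros lim that)
    then show ?thesis using g(2)[of x] by (simp add: abs_le_iff max_def min_def split: if_splits)
  qed
  have "(\<lambda>n. integral\<^sup>L (lebesgue_on {-N..N}) (\<lambda>z. \<bar>g z - h' n z\<bar>)) \<longlonglongrightarrow> integral\<^sup>L (lebesgue_on {-N..N}) (\<lambda>z. 0)"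
  proof (rule integral_dominated_convergence[where w = "\<lambda>_. 2 * M"])
    interpret finite_measure "lebesgue_on {-N..N}" by (rule finite_measure_lebesgue_on) simp
    show "integrable (lebesgue_on {-N..N}) (\<lambda>_. 2 * M)" by simp
    show "(\<lambda>z. \<bar>g z - h' n z\<bar>) \<in> borel_measurable (lebesgue_on {-N..N})" for n
      using g(1) borel_measurable_continuous_onI[OF h'c[of n]]
      by (intro borel_imp_measurable_lebesgue_on borel_measurable_abs borel_measurable_diff)
    have "A \<in> null_sets lebesgue" using A by (simp add: negligible_iff_null_sets)
    then have "AE z in lebesgue. z \<notin> A" by (rule AE_not_in)
    then have "AE z in lebesgue_on {-N..N}. z \<notin> A"
      by (subst AE_restrict_space_iff) (auto elim: eventually_mono)
    then show "AE z in lebesgue_on {-N..N}. (\<lambda>n. \<bar>g z - h' n z\<bar>) \<longlonglongrightarrow> 0"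
    proof eventually_elim
      case (elim z)
      from tendsto_diff[OF tendsto_const h'l[OF elim], of "g z"]
      show ?case by (simp add: tendsto_rabs_zero)
    qed
    show "AE z in lebesgue_on {-N..N}. norm \<bar>g z - h' n z\<bar> \<le> 2 * M" for n
    proof (rule AE_I2)
      fix z show "norm \<bar>g z - h' n z\<bar> \<le> 2 * M" using g(2)[of z] h'b[of n z] by (simp add: abs_le_iff)
    qed
  qed simp
  then have "(\<lambda>n. integral\<^sup>L (lebesgue_on {-N..N}) (\<lambda>z. \<bar>g z - h' n z\<bar>)) \<longlonglongrightarrow> 0" by simp
  from order_tendstoD(2)[OF this e] obtain n where "integral\<^sup>L (lebesgue_on {-N..N}) (\<lambda>z. \<bar>g z - h' n z\<bar>) < e"
    by (auto simp: eventually_sequentially)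
  with that[of "h' n"] h'c h'b show thesis by blast
qed

text \<open>Continuity of translations, with \<open>Z s\<close> as the translation: for continuous
  \<open>h\<close> in place of \<open>g\<close> the map is uniformly continuous, and the error of
  the replacement is uniform in \<open>s\<close> by \<open>integral_compose_le\<close>. Reading
  \<open>s\<close> as time and as position gives the two continuity properties of the explicit
  solution.\<close>

lemma Lp_continuous_on_compose:
  fixes Z Z' j :: "real \<Rightarrow> real \<Rightarrow> real" and g :: "real \<Rightarrow> real"
  assumes S: "compact S" and ab: "a < b"
    and Zc: "continuous_on (S \<times> {a..b}) (\<lambda>(s, x). Z s x)"
    and jc: "continuous_on (S \<times> {a..b}) (\<lambda>(s, x). j s x)"
    and d: "\<And>s x. s \<in> S \<Longrightarrow> x \<in> {a<..<b} \<Longrightarrow> (Z s has_real_derivative Z' s x) (at x)"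
    and \<kappa>: "\<And>s x. s \<in> S \<Longrightarrow> x \<in> {a<..<b} \<Longrightarrow> \<kappa> \<le> \<bar>Z' s x\<bar>" "0 < \<kappa>"
    and inj: "\<And>s. s \<in> S \<Longrightarrow> inj_on (Z s) {a<..<b}"
    and g: "g \<in> borel_measurable borel" "\<And>z. \<bar>g z\<bar> \<le> M" and q: "1 \<le> q"
  shows "Lp_continuous_on S (lebesgue_on {a<..<b}) q (\<lambda>s x. g (Z s x) * j s x)"
proof -
  let ?I = "{a<..<b}" and ?Q = "S \<times> {a..b}"
  let ?L = "lebesgue_on {a<..<b}"
  interpret L: finite_measure ?L by (rule finite_measure_lebesgue_on_Ioo)
  have Q: "compact ?Q" by (intro compact_Times S) simp
  have "bounded ((\<lambda>(s, x). Z s x) ` ?Q)" by (intro compact_imp_bounded compact_continuous_image Zc Q)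
  then obtain N where N: "\<And>s x. s \<in> S \<Longrightarrow> x \<in> {a..b} \<Longrightarrow> \<bar>Z s x\<bar> \<le> N" by (fastforce simp: bounded_pos)
  have "bounded ((\<lambda>(s, x). j s x) ` ?Q)" by (intro compact_imp_bounded compact_continuous_image jc Q)
  then obtain Jb where Jb: "\<And>s x. s \<in> S \<Longrightarrow> x \<in> {a..b} \<Longrightarrow> \<bar>j s x\<bar> \<le> Jb" "0 < Jb" by (fastforce simp: bounded_pos)
  have M: "0 \<le> M" using g(2)[of 0] by linarith
  have slice: "continuous_on {a..b} (\<lambda>x. f s x)" if "continuous_on ?Q (\<lambda>(s, x). f s x)" "s \<in> S" for f :: "real \<Rightarrow> real \<Rightarrow> real" and s
  proof -
    have "continuous_on {a..b} (\<lambda>x. (s, x))" by (intro continuous_intros)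
    from continuous_on_compose2[OF that(1) this] that(2) show ?thesis by (simp add: image_subset_iff)
  qed
  have meas: "(\<lambda>x. f s x) \<in> borel_measurable ?L" if "continuous_on ?Q (\<lambda>(s, x). f s x)" "s \<in> S" for f :: "real \<Rightarrow> real \<Rightarrow> real" and s
    by (rule continuous_on_imp_measurable_lebesgue_on[OF slice[OF that]]) auto
  define f where "f s x = g (Z s x) * j s x" for s x
  have fm: "f s \<in> borel_measurable ?L" if "s \<in> S" for s
    unfolding f_def[abs_def]
    by (intro borel_measurable_times measurable_compose[OF meas[OF Zc that] g(1)] meas[OF jc that])
  have fb: "\<bar>f s x\<bar> \<le> M * Jb" if "s \<in> S" "x \<in> ?I" for s x
    unfolding f_def abs_mult using Jb(1)[of s x] that g(2)[of "Z s x"] M by (intro mult_mono) auto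
  have fi: "integrable ?L (f s)" if "s \<in> S" for s
    by (rule integrable_lebesgue_on_Ioo_bounded[OF fm[OF that], where C = "M * Jb"]) (use fb[OF that] in auto)
  have L1: "((\<lambda>r. \<integral>x. \<bar>f r x - f s x\<bar> \<partial>?L) \<longlongrightarrow> 0) (at s within S)" if s: "s \<in> S" for s
  proof (rule tendstoI)
    fix e :: real assume e: "0 < e"
    \<comment> \<open>Composition costs a factor \<open>1 / \<kappa>\<close> and the weight a factor
      \<open>Jb\<close>, so this leaves an error below \<open>e / 4\<close> at each of the two
      parameters; \<open>e2\<close> contributes a further \<open>e / 4\<close>.\<close>
    define e1 where "e1 = e * \<kappa> / (4 * Jb)"
    have e1: "0 < e1" using e \<kappa> Jb by (simp add: e1_def)
    obtain h where h: "continuous_on UNIV h" "\<And>z. \<bar>h z\<bar> \<le> M"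
      and he: "integral\<^sup>L (lebesgue_on {-N..N}) (\<lambda>z. \<bar>g z - h z\<bar>) < e1"
      using bounded_approx_continuous[OF g e1] by blast
    have hm: "h \<in> borel_measurable borel" by (rule borel_measurable_continuous_onI[OF h(1)])
    define d1 where "d1 r = (\<integral>x. \<bar>g (Z r x) - h (Z r x)\<bar> \<partial>?L)" for r
    have dm: "(\<lambda>x. \<bar>g (Z r x) - h (Z r x)\<bar>) \<in> borel_measurable ?L"
      and d1: "Jb * d1 r < e / 4" if r: "r \<in> S" for r
    proof -
      have pm: "(\<lambda>z. \<bar>g z - h z\<bar>) \<in> borel_measurable borel" using g(1) hm by simp
      have pb: "\<bar>g z - h z\<bar> \<le> 2 * M" for z using g(2)[of z] h(2)[of z] by (simp add: abs_le_iff)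
      note cl = integral_compose_le[of a b "Z r" "Z' r" \<kappa> N "\<lambda>z. \<bar>g z - h z\<bar>" "2 * M",
          OF d[OF r] \<kappa>(1)[OF r] inj[OF r] N[OF r] pm _ pb]
      show "(\<lambda>x. \<bar>g (Z r x) - h (Z r x)\<bar>) \<in> borel_measurable ?L" by (rule cl(2)) auto
      have "\<kappa> * d1 r \<le> integral\<^sup>L (lebesgue_on {-N..N}) (\<lambda>z. \<bar>g z - h z\<bar>)"
        unfolding d1_def by (rule cl(1)) auto
      also have "\<dots> < e1" by (rule he)
      finally show "Jb * d1 r < e / 4"
        using \<kappa>(2) Jb(2) by (simp add: e1_def field_simps)
    qed
    have di: "integrable ?L (\<lambda>x. \<bar>g (Z r x) - h (Z r x)\<bar>)" if r: "r \<in> S" for r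
    proof (rule integrable_lebesgue_on_Ioo_bounded[OF dm[OF r], where C = "2 * M"], rule AE_I2)
      fix x show "\<bar>\<bar>g (Z r x) - h (Z r x)\<bar>\<bar> \<le> 2 * M"
        using g(2)[of "Z r x"] h(2)[of "Z r x"] by (simp add: abs_le_iff)
    qed
    define e2 where "e2 = e / (4 * (b - a))"
    have e2: "0 < e2" using e ab by (simp add: e2_def)
    have kc: "continuous_on ?Q (\<lambda>(s, x). h (Z s x) * j s x)"
      using continuous_on_compose2[OF h(1) Zc] jc
      by (auto simp: split_beta intro!: continuous_intros)
    from compact_uniformly_continuous[OF kc Q] e2
    obtain dl where dl: "0 < dl" "\<And>p p'. p \<in> ?Q \<Longrightarrow> p' \<in> ?Q \<Longrightarrow> dist p' p < dl \<Longrightarrow>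
        dist (case p' of (s, x) \<Rightarrow> h (Z s x) * j s x) (case p of (s, x) \<Rightarrow> h (Z s x) * j s x) < e2"
      unfolding uniformly_continuous_on_def by meson
    have "(\<integral>x. \<bar>f r x - f s x\<bar> \<partial>?L) < e" if r: "r \<in> S" and rs: "dist r s < dl" for r
    proof -
      have pt: "\<bar>f r x - f s x\<bar> \<le> Jb * \<bar>g (Z r x) - h (Z r x)\<bar> + Jb * \<bar>g (Z s x) - h (Z s x)\<bar> + e2" if x: "x \<in> ?I" for x
      proof -
        have eq: "f r x - f s x = (g (Z r x) - h (Z r x)) * j r x - (g (Z s x) - h (Z s x)) * j s x
            + (h (Z r x) * j r x - h (Z s x) * j s x)"
          by (simp add: f_def algebra_simps)
        have "dist (r, x) (s, x) = dist r s" by (simp add: dist_Pair_Pair)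
        then have "\<bar>h (Z r x) * j r x - h (Z s x) * j s x\<bar> < e2"
          using dl(2)[of "(s, x)" "(r, x)"] r s x rs by (simp add: dist_real_def)
        moreover have "\<bar>(g (Z t x) - h (Z t x)) * j t x\<bar> \<le> Jb * \<bar>g (Z t x) - h (Z t x)\<bar>" if "t \<in> S" for t
          unfolding abs_mult using Jb(1)[OF that, of x] x
          by (simp add: mult.commute[of Jb] mult_left_mono)
        from this[OF r] this[OF s] have "\<bar>(g (Z r x) - h (Z r x)) * j r x\<bar> \<le> Jb * \<bar>g (Z r x) - h (Z r x)\<bar>"
          "\<bar>(g (Z s x) - h (Z s x)) * j s x\<bar> \<le> Jb * \<bar>g (Z s x) - h (Z s x)\<bar>" .
        ultimately show ?thesis unfolding eq by linarith
      qed
      have "(\<integral>x. \<bar>f r x - f s x\<bar> \<partial>?L)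
          \<le> (\<integral>x. Jb * \<bar>g (Z r x) - h (Z r x)\<bar> + Jb * \<bar>g (Z s x) - h (Z s x)\<bar> + e2 \<partial>?L)"
        using fi[OF r] fi[OF s] di[OF r] di[OF s] pt by (intro integral_mono) auto
      also have "\<dots> = Jb * d1 r + Jb * d1 s + e2 * (b - a)"
        unfolding d1_def using di[OF r] di[OF s] ab
        by (simp add: measure_restrict_space)
      also have "e2 * (b - a) = e / 4" using ab by (auto simp: e2_def divide_simps algebra_simps)
      also have "Jb * d1 r + Jb * d1 s + e / 4 < e" using d1[OF r] d1[OF s] e by linarith
      finally show ?thesis .
    qed
    then show "\<forall>\<^sub>F r in at s within S. dist (\<integral>x. \<bar>f r x - f s x\<bar> \<partial>?L) 0 < e"
      unfolding eventually_at using dl(1) by (auto intro!: exI[of _ dl])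
  qed
  have qi: "integrable ?L (\<lambda>x. \<bar>k x\<bar> powr q)" if "k \<in> borel_measurable ?L" "\<And>x. x \<in> ?I \<Longrightarrow> \<bar>k x\<bar> \<le> B" for k B
  proof (rule integrable_lebesgue_on_Ioo_bounded[where C = "B powr q"])
    show "AE x in ?L. \<bar>\<bar>k x\<bar> powr q\<bar> \<le> B powr q"
      using that(2) q by (intro AE_I2) (auto intro!: powr_mono2)
  qed (use that in simp)
  show ?thesis
    unfolding Lp_continuous_on_def f_def[symmetric]
  proof (intro ballI conjI)
    fix s assume s: "s \<in> S"
    show "f s \<in> Lp ?L q" unfolding Lp_def using fm[OF s] qi[OF fm[OF s] fb[OF s]] by simp
    \<comment> \<open>For a difference \<open>d\<close> bounded by \<open>B\<close>,
      \<open>\<bar>d\<bar> powr q \<le> B powr (q - 1) * \<bar>d\<bar>\<close>, which reduces Lq to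
      L1; the \<open>+ 1\<close> keeps \<open>B\<close> positive.\<close>
    define B where "B = 2 * (M * Jb) + 1"
    have B: "0 < B" using M Jb by (simp add: B_def add_nonneg_pos)
    have le: "(\<integral>x. \<bar>f r x - f s x\<bar> powr q \<partial>?L) \<le> B powr (q - 1) * (\<integral>x. \<bar>f r x - f s x\<bar> \<partial>?L)" if r: "r \<in> S" for r
    proof -
      have b: "\<bar>f r x - f s x\<bar> \<le> B" if "x \<in> ?I" for x
        using fb[OF r that] fb[OF s that] by (simp add: B_def abs_le_iff)
      have "(\<integral>x. \<bar>f r x - f s x\<bar> powr q \<partial>?L) \<le> (\<integral>x. B powr (q - 1) * \<bar>f r x - f s x\<bar> \<partial>?L)"
      proof (rule integral_mono)
        show "integrable ?L (\<lambda>x. \<bar>f r x - f s x\<bar> powr q)"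
          by (rule qi[of _ B]) (use fm[OF r] fm[OF s] b in auto)
        show "integrable ?L (\<lambda>x. B powr (q - 1) * \<bar>f r x - f s x\<bar>)" using fi[OF r] fi[OF s] by simp
        fix x assume "x \<in> space ?L"
        then have x: "\<bar>f r x - f s x\<bar> \<le> B" using b by simp
        have "\<bar>f r x - f s x\<bar> powr (q - 1) * \<bar>f r x - f s x\<bar> \<le> B powr (q - 1) * \<bar>f r x - f s x\<bar>"
          using x q by (intro mult_right_mono powr_mono2) auto
        moreover have "\<bar>f r x - f s x\<bar> powr (q - 1) * \<bar>f r x - f s x\<bar> = \<bar>f r x - f s x\<bar> powr q"
          using powr_add[of "\<bar>f r x - f s x\<bar>" "q - 1" 1] by (cases "f r x = f s x") simp_all
        ultimately show "\<bar>f r x - f s x\<bar> powr q \<le> B powr (q - 1) * \<bar>f r x - f s x\<bar>" by simp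
      qed
      then show ?thesis by simp
    qed
    have "((\<lambda>r. B powr (q - 1) * (\<integral>x. \<bar>f r x - f s x\<bar> \<partial>?L)) \<longlongrightarrow> B powr (q - 1) * 0) (at s within S)"
      by (intro tendsto_mult_left L1 s)
    then have "((\<lambda>r. B powr (q - 1) * (\<integral>x. \<bar>f r x - f s x\<bar> \<partial>?L)) \<longlongrightarrow> 0) (at s within S)" by simp
    then have z: "((\<lambda>r. \<integral>x. \<bar>f r x - f s x\<bar> powr q \<partial>?L) \<longlongrightarrow> 0) (at s within S)"
      by (rule Lim_null_comparison[rotated]) (use le in \<open>auto simp: eventually_at_filter\<close>)
    have "((\<lambda>r. (\<integral>x. \<bar>f r x - f s x\<bar> powr q \<partial>?L) powr (1 / q)) \<longlongrightarrow> 0 powr (1 / q)) (at s within S)"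
      using q by (intro tendsto_powr' z tendsto_const) auto
    then show "((\<lambda>r. Lp_norm ?L q (\<lambda>x. f r x - f s x)) \<longlongrightarrow> 0) (at s within S)"
      by (simp add: Lp_norm_def)
  qed
qed

text \<open>Here \<open>W\<close> is an arbitrary continuous function; that it equals the mass of
  the solution is arranged later by a fixed point. The data are Borel with bounds at every point, so
  that compositions with the flow stay measurable and bounded.\<close>

locale transport = flow +
  fixes u \<rho>0 :: "real \<Rightarrow> real" and Lu R0 :: real
  assumes u_borel: "u \<in> borel_measurable borel" and u_bounds: "\<And>t. 0 \<le> u t" "\<And>t. u t \<le> Lu"
    and \<rho>0_borel: "\<rho>0 \<in> borel_measurable borel" and \<rho>0_bounds: "\<And>x. 0 \<le> \<rho>0 x" "\<And>x. \<rho>0 x \<le> R0"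
begin

lemma X_strict_mono_time: "0 \<le> s \<Longrightarrow> s < t \<Longrightarrow> t \<le> T \<Longrightarrow> X s z < X t z"
proof -
  assume *: "0 \<le> s" "s < t" "t \<le> T"
  have "0 < c * (t - s)" using * c_pos by simp
  then show ?thesis using path_growth(1)[OF X_path, of s t z] * by simp
qed

lemma Z_strict_antimono_time:
  assumes "0 \<le> s" "s < t" "t \<le> T"
  shows "Z t x < Z s x"
proof -
  have "X s (Z s x) < X t (Z s x)" by (rule X_strict_mono_time[OF assms])
  then have "X t (Z t x) < X t (Z s x)" using assms by simp
  then show ?thesis by (rule X_less_iff[THEN iffD1, rotated]) (use assms in simp)
qed

lemma Z_inj_time: "inj_on (\<lambda>t. Z t x) {0..T}"
proof (rule inj_onI)
  fix s t assume "s \<in> {0..T}" "t \<in> {0..T}" "Z s x = Z t x"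
  then show "s = t"
    using Z_strict_antimono_time[of s t x] Z_strict_antimono_time[of t s x] by (cases s t rule: linorder_cases) auto
qed

lemma X_less_iff_Z: "t \<in> {0..T} \<Longrightarrow> X t z < x \<longleftrightarrow> z < Z t x"
  and X_greater_iff_Z: "t \<in> {0..T} \<Longrightarrow> x < X t z \<longleftrightarrow> Z t x < z"
  using X_less_iff[of t z "Z t x"] X_less_iff[of t "Z t x" z] by simp_all

lemma X_cont_x: "t \<in> {0..T} \<Longrightarrow> continuous_on S (X t)"
  by (intro X_cont continuous_intros) auto

lemma Z_cont_t: "S \<subseteq> {0..T} \<Longrightarrow> continuous_on S (\<lambda>t. Z t x)"
  by (intro Z_cont continuous_intros) auto

text \<open>Labels of the characteristics that cross \<open>x = 0\<close> during
  \<open>[0, T]\<close>; apart from \<open>Z 0 0 = 0\<close> they are negative.\<close>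

definition entries :: "real set" where "entries = (\<lambda>t. Z t 0) ` {0..T}"

definition entry :: "real \<Rightarrow> real" where "entry = inv_into {0..T} (\<lambda>t. Z t 0)"

lemma entry_Z [simp]: "t \<in> {0..T} \<Longrightarrow> entry (Z t 0) = t"
  unfolding entry_def by (rule inv_into_f_f[OF Z_inj_time])

lemma entry_cont: "continuous_on entries entry"
  unfolding entries_def by (rule continuous_on_inv[OF Z_cont_t]) auto

lemma entry_range: "entry ` entries \<subseteq> {0..T}"
  by (auto simp: entries_def)

lemma entries_borel: "entries \<in> sets borel"
  unfolding entries_def by (intro borel_compact compact_continuous_image Z_cont_t) auto

text \<open>Minus the time derivative of \<open>Z t 0\<close>: the rate at which new labels
  enter.\<close>

definition inflow_rate :: "real \<Rightarrow> real" where "inflow_rate t = l 0 (W t) * J t 0"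

lemma inflow_rate_bounds:
  assumes t: "t \<in> {0..T}"
  shows "c / E \<le> inflow_rate t" "0 < inflow_rate t"
proof -
  show 1: "c / E \<le> inflow_rate t"
    using mult_mono[OF l_lo[of 0 "W t"] J_bounds(1)[OF t, of 0]] c_pos E_pos l_lo[of 0 "W t"]
    by (simp add: inflow_rate_def)
  then show "0 < inflow_rate t" using c_pos E_pos by (auto intro: less_le_trans[OF divide_pos_pos])
qed

text \<open>Labelling characteristics by their position at time \<open>0\<close> turns the boundary datum into an
  initial datum on the negative half-line.\<close>

definition g :: "real \<Rightarrow> real" where
  "g z = (if 0 < z \<and> z < 1 then \<rho>0 z else if z \<in> entries \<and> z < 0 then u (entry z) / inflow_rate (entry z) else 0)"

text \<open>The second entry bounds the in-flux divided by the rate of entering labels, which is at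
  least \<open>c / E\<close>.\<close>

definition Mg :: real where "Mg = max R0 (Lu * E / c)"

lemma g_borel: "g \<in> borel_measurable borel"
proof -
  have "continuous_on entries (\<lambda>z. inflow_rate (entry z))"
    unfolding inflow_rate_def
    by (intro continuous_intros l_cont J_cont W_cont_compose entry_cont entry_range)
  note m1 = borel_measurable_continuous_on_indicator[OF entries_borel this]
  note m2 = borel_measurable_continuous_on_indicator[OF entries_borel entry_cont]
  have m3: "(\<lambda>z. u (indicat_real entries z *\<^sub>R entry z)) \<in> borel_measurable borel"
    by (rule measurable_compose[OF m2 u_borel])
  \<comment> \<open>The inner indicators extend \<open>entry\<close> and the rate to Borel functions
    on the line; on \<open>entries\<close> they are one.\<close>
  have "(\<lambda>z. indicat_real {0<..<1} z * \<rho>0 z + indicat_real (entries \<inter> {..<0}) z *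
      (u (indicat_real entries z *\<^sub>R entry z) / (indicat_real entries z *\<^sub>R inflow_rate (entry z)))) \<in> borel_measurable borel"
    using entries_borel
    by (intro borel_measurable_add borel_measurable_times borel_measurable_divide m1 m3 \<rho>0_borel borel_measurable_indicator) auto
  also have "(\<lambda>z. indicat_real {0<..<1} z * \<rho>0 z + indicat_real (entries \<inter> {..<0}) z *
      (u (indicat_real entries z *\<^sub>R entry z) / (indicat_real entries z *\<^sub>R inflow_rate (entry z)))) = g"
    by (auto simp: g_def fun_eq_iff split: split_indicator)
  finally show ?thesis .
qed

lemma g_bounds: "0 \<le> g z" "g z \<le> Mg" "\<bar>g z\<bar> \<le> Mg"
proof -
  have 0: "0 \<le> Lu" using u_bounds[of 0] by linarith
  have "0 \<le> g z \<and> g z \<le> Mg"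
  proof (cases "0 < z \<and> z < 1")
    case True
    then show ?thesis using \<rho>0_bounds[of z] by (simp add: g_def Mg_def max_def)
  next
    case False
    have "0 \<le> Lu * E / c" using 0 E_pos c_pos by simp
    moreover have "0 \<le> u (entry z) / inflow_rate (entry z) \<and> u (entry z) / inflow_rate (entry z) \<le> Lu * E / c"
      if "z \<in> entries"
    proof -
      have t: "entry z \<in> {0..T}" using that entry_range by auto
      have "u (entry z) / inflow_rate (entry z) \<le> Lu / (c / E)"
        using u_bounds[of "entry z"] inflow_rate_bounds[OF t] c_pos E_pos by (intro frac_le) auto
      then show ?thesis using u_bounds(1)[of "entry z"] inflow_rate_bounds[OF t] by simp
    qed
    ultimately show ?thesis using False by (auto simp: g_def Mg_def le_max_iff_disj)
  qed
  then show "0 \<le> g z" "g z \<le> Mg" "\<bar>g z\<bar> \<le> Mg" by auto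
qed

lemma Mg_nonneg: "0 \<le> Mg" using g_bounds[of 0] by linarith

text \<open>The boundary condition in label coordinates. Time zero is excluded because
  \<open>g\<close> is set to zero at the label \<open>0\<close>.\<close>

lemma g_entry: "0 < t \<Longrightarrow> t \<le> T \<Longrightarrow> inflow_rate t * g (Z t 0) = u t"
  using Z_strict_antimono_time[of 0 t 0] inflow_rate_bounds[of t]
  by (auto simp: g_def entries_def)

text \<open>The push-forward of the label density under the flow; \<open>J\<close> is the Jacobian
  that conserves mass.\<close>

definition rho :: "real \<Rightarrow> real \<Rightarrow> real" where "rho t x = g (Z t x) * J t x"

lemma rho_bounds:
  assumes "t \<in> {0..T}"
  shows "0 \<le> rho t x" "rho t x \<le> Mg * E"
  using g_bounds[of "Z t x"] J_bounds[OF assms, of x] Mg_nonneg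
  by (auto simp: rho_def intro!: mult_mono)

lemma rho_Lp_space: "1 \<le> q \<Longrightarrow> Lp_continuous_on {0..T} I01 q rho"
  unfolding rho_def[abs_def]
proof (rule Lp_continuous_on_compose[where Z = Z and j = J and Z' = J and \<kappa> = "1 / E" and M = Mg])
  show "continuous_on ({0..T} \<times> {0..1}) (\<lambda>(s, x). Z s x)" "continuous_on ({0..T} \<times> {0..1}) (\<lambda>(s, x). J s x)"
    unfolding split_beta by (intro Z_cont J_cont continuous_intros; auto)+
  show "inj_on (Z s) {0<..<1}" if "s \<in> {0..T}" for s
    using that by (metis X_Z inj_onI)
  show "1 / E \<le> \<bar>J s x\<bar>" if "s \<in> {0..T}" for s x
    using J_bounds[OF that, of x] by simp
qed (use Z_deriv_x g_borel g_bounds E_pos in auto)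

lemma Z_deriv_t_interior:
  assumes "t \<in> {0<..<T}"
  shows "((\<lambda>t. Z t x) has_real_derivative - (l x (W t) * J t x)) (at t)"
proof -
  have "t \<in> interior {0..T}" using assms by simp
  from at_within_interior[OF this] show ?thesis
    using Z_deriv_t[of t x] assms by simp
qed

text \<open>The positive lower bound of the speed enters here: \<open>t \<mapsto> Z t x\<close> has
  slope at least \<open>c / E\<close> in absolute value, so varying \<open>t\<close> at fixed
  \<open>x\<close> is as good a change of variables as the one in space, and the trace at
  \<open>x = 1\<close> exists.\<close>

lemma rho_Lp_time: "1 \<le> q \<Longrightarrow> Lp_continuous_on {0..1} (lebesgue_on {0<..<T}) q (\<lambda>x t. rho t x)"
  unfolding rho_def[abs_def]
proof (rule Lp_continuous_on_compose[where Z = "\<lambda>x t. Z t x" and j = "\<lambda>x t. J t x"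
      and Z' = "\<lambda>x t. - (l x (W t) * J t x)" and \<kappa> = "c / E" and M = Mg])
  show "continuous_on ({0..1} \<times> {0..T}) (\<lambda>(s, x). Z x s)" "continuous_on ({0..1} \<times> {0..T}) (\<lambda>(s, x). J x s)"
    unfolding split_beta by (intro Z_cont J_cont continuous_intros; auto)+
  show "inj_on (\<lambda>t. Z t s) {0<..<T}" for s
    by (rule inj_on_subset[OF Z_inj_time]) auto
  show "c / E \<le> \<bar>- (l s (W x) * J x s)\<bar>" if "x \<in> {0<..<T}" for s x
  proof -
    have x: "x \<in> {0..T}" using that by auto
    have "c * (1 / E) \<le> l s (W x) * J x s"
      using l_lo[of s "W x"] c_pos E_pos J_bounds[OF x, of s] by (intro mult_mono) auto
    then show ?thesis by simp
  qed
qed (use Z_deriv_t_interior g_borel g_bounds E_pos c_pos T_pos in auto)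

lemma rho_Linf: "(\<lambda>(t, x). rho t x) \<in> Linf (lebesgue_on ({0<..<T} \<times> {0<..<1}))"
proof -
  let ?S = "{0<..<T} \<times> {0<..<1::real}"
  have S: "?S \<in> sets lebesgue"
    by (intro sets_completionI_sets) (simp add: open_Times borel_open)
  have "continuous_on ?S (\<lambda>p. Z (fst p) (snd p))" "continuous_on ?S (\<lambda>p. J (fst p) (snd p))"
    by (intro Z_cont J_cont continuous_intros; auto)+
  then have m: "(\<lambda>p. Z (fst p) (snd p)) \<in> borel_measurable (lebesgue_on ?S)"
    "(\<lambda>p. J (fst p) (snd p)) \<in> borel_measurable (lebesgue_on ?S)"
    using S by (auto intro: continuous_imp_measurable_on_sets_lebesgue)
  have "(\<lambda>p. g (Z (fst p) (snd p)) * J (fst p) (snd p)) \<in> borel_measurable (lebesgue_on ?S)"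
    by (intro borel_measurable_times m measurable_compose[OF m(1) g_borel])
  moreover have "AE p in lebesgue_on ?S. \<bar>rho (fst p) (snd p)\<bar> \<le> Mg * E"
  proof (rule AE_I2)
    fix p assume "p \<in> space (lebesgue_on ?S)"
    then have "fst p \<in> {0..T}" by auto
    from rho_bounds[OF this, of "snd p"] show "\<bar>rho (fst p) (snd p)\<bar> \<le> Mg * E" by simp
  qed
  ultimately show ?thesis by (auto simp: Linf_def rho_def split_beta)
qed

text \<open>Substituting \<open>z = Z t x\<close> absorbs the Jacobian in \<open>rho\<close> and
  leaves the label density, which does not depend on time.\<close>

lemma rho_integral_labels:
  assumes t: "t \<in> {0..T}" and \<psi>: "continuous_on {0..1} \<psi>"
  shows "(\<integral>x. rho t x * \<psi> x \<partial>I01) = (\<integral>z. g z * (if 0 < X t z \<and> X t z < 1 then \<psi> (X t z) else 0) \<partial>lborel)"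
proof -
  let ?I = "{0<..<1::real}"
  define A where "A = {z. 0 < X t z \<and> X t z < 1}"
  have im: "Z t ` ?I = A"
  proof
    show "Z t ` ?I \<subseteq> A" using t by (auto simp: A_def)
    show "A \<subseteq> Z t ` ?I"
    proof
      fix z assume "z \<in> A"
      then show "z \<in> Z t ` ?I" using t by (intro image_eqI[of _ _ "X t z"]) (auto simp: A_def)
    qed
  qed
  have Aop: "open A"
    unfolding A_def by (intro open_Collect_conj open_Collect_less continuous_on_const X_cont_x t)
  define f where "f z = g z * \<psi> (X t z)" for z
  obtain B where B: "\<And>x. x \<in> {0..1} \<Longrightarrow> \<bar>\<psi> x\<bar> \<le> B"
  proof -
    have "bounded (\<psi> ` {0..1})" by (intro compact_imp_bounded compact_continuous_image \<psi>) auto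
    with that show thesis by (fastforce simp: bounded_pos)
  qed
  have ri: "integrable I01 (rho t)" by (rule Lp1_continuousD(1)[OF rho_Lp_space t]) simp
  have \<psi>m: "\<psi> \<in> borel_measurable I01" by (rule continuous_on_imp_measurable_lebesgue_on[OF \<psi>]) auto
  have i: "integrable I01 (\<lambda>x. rho t x * \<psi> x)"
    by (rule integrable_mult_bounded(1)[OF ri \<psi>m, where B = B]) (use B in auto)
  have eq: "\<bar>J t x\<bar> * f (Z t x) = rho t x * \<psi> x" for x
    using J_bounds(3)[OF t, of x] t by (simp add: f_def rho_def)
  have "(\<lambda>x. \<bar>J t x\<bar> * f (Z t x)) absolutely_integrable_on ?I"
    unfolding eq using i by (simp add: set_integrable_def integrable_restrict_space)
  moreover have "integral ?I (\<lambda>x. \<bar>J t x\<bar> * f (Z t x)) = (\<integral>x. rho t x * \<psi> x \<partial>I01)"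
    unfolding eq by (rule lebesgue_integral_eq_integral[OF i, symmetric]) simp
  moreover have "inj_on (Z t) ?I" using t by (metis X_Z inj_onI)
  moreover have "(Z t has_field_derivative J t x) (at x within ?I)" for x
    by (rule has_field_derivative_at_within[OF Z_deriv_x[OF t]])
  ultimately have fA: "f absolutely_integrable_on A" "integral A f = (\<integral>x. rho t x * \<psi> x \<partial>I01)"
    using has_absolute_integral_change_of_variables_1'[of ?I "Z t" "J t" f] unfolding im by auto
  have \<psi>X: "(\<lambda>z. indicat_real A z *\<^sub>R \<psi> (X t z)) \<in> borel_measurable borel"
    by (intro borel_measurable_continuous_on_indicator continuous_on_compose2[OF \<psi> X_cont_x[OF t]] borel_open Aop)
       (auto simp: A_def)
  have "(\<integral>x. rho t x * \<psi> x \<partial>I01) = (\<integral>z. indicat_real A z *\<^sub>R f z \<partial>lebesgue)"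
    using set_lebesgue_integral_eq_integral(2)[OF fA(1)] fA(2) by (simp add: set_lebesgue_integral_def)
  also have "\<dots> = (\<integral>z. g z * (indicat_real A z *\<^sub>R \<psi> (X t z)) \<partial>lebesgue)"
    by (intro Bochner_Integration.integral_cong refl) (simp add: f_def)
  also have "\<dots> = (\<integral>z. g z * (indicat_real A z *\<^sub>R \<psi> (X t z)) \<partial>lborel)"
    using borel_measurable_times[OF g_borel \<psi>X] by (intro integral_completion) simp
  also have "\<dots> = (\<integral>z. g z * (if 0 < X t z \<and> X t z < 1 then \<psi> (X t z) else 0) \<partial>lborel)"
    by (intro Bochner_Integration.integral_cong refl) (auto simp: A_def)
  finally show ?thesis .
qed

lemma image_Z_0: "t \<in> {0..T} \<Longrightarrow> (\<lambda>s. Z s 0) ` {0<..<t} = {Z t 0<..<0}"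
proof
  assume t: "t \<in> {0..T}"
  show "(\<lambda>s. Z s 0) ` {0<..<t} \<subseteq> {Z t 0<..<0}"
  proof
    fix z assume "z \<in> (\<lambda>s. Z s 0) ` {0<..<t}"
    then obtain s where "z = Z s 0" "0 < s" "s < t" by auto
    then show "z \<in> {Z t 0<..<0}"
      using Z_strict_antimono_time[of 0 s 0] Z_strict_antimono_time[of s t 0] t by auto
  qed
  show "{Z t 0<..<0} \<subseteq> (\<lambda>s. Z s 0) ` {0<..<t}"
  proof
    fix z assume z: "z \<in> {Z t 0<..<0}"
    have "\<exists>s\<ge>0. s \<le> t \<and> Z s 0 = z"
      using z t by (intro IVT2' Z_cont_t) auto
    then obtain s where s: "0 \<le> s" "s \<le> t" "Z s 0 = z" by blast
    moreover have "s \<noteq> 0" "s \<noteq> t" using s z by auto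
    ultimately show "z \<in> (\<lambda>s. Z s 0) ` {0<..<t}" by auto
  qed
qed

text \<open>Positive labels carry the initial datum; on negative ones the substitution
  \<open>z = Z s 0\<close> turns \<open>g\<close> back into the in-flux by \<open>g_entry\<close>.
  The support conditions on \<open>k\<close> restrict to labels that enter before time
  \<open>t\<close> or start to the left of \<open>1\<close>.\<close>

lemma label_integral_split:
  assumes t: "t \<in> {0..T}" and k: "k \<in> borel_measurable borel" "\<And>z. \<bar>k z\<bar> \<le> B"
    and k0: "\<And>z. 1 \<le> z \<Longrightarrow> k z = 0" "\<And>z. z \<le> Z t 0 \<Longrightarrow> k z = 0"
  shows "(\<integral>z. g z * k z \<partial>lborel)
      = (\<integral>x. \<rho>0 x * k x \<partial>I01) + (\<integral>s. u s * k (Z s 0) \<partial>lebesgue_on {0<..<t})"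
proof -
  let ?N = "{Z t 0<..<0}"
  have gk: "(\<lambda>z. g z * k z) \<in> borel_measurable borel"
    by (intro borel_measurable_times g_borel k)
  have gkb: "\<bar>g z * k z\<bar> \<le> Mg * B" for z
    unfolding abs_mult using g_bounds(3)[of z] k(2)[of z] Mg_nonneg by (intro mult_mono) auto
  have i: "integrable lborel (\<lambda>z. indicat_real {a<..<b} z * (g z * k z))" for a b
  proof -
    have "integrable (lebesgue_on {a<..<b}) (\<lambda>z. g z * k z)"
      by (rule integrable_lebesgue_on_Ioo_bounded[OF borel_imp_measurable_lebesgue_on[OF gk], where C = "Mg * B"])
         (use gkb in simp)
    then have "integrable lebesgue (\<lambda>z. indicat_real {a<..<b} z * (g z * k z))"
      by (simp add: integrable_restrict_space)
    then show ?thesis using gk by (subst (asm) integrable_completion) auto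
  qed
  have "(\<integral>z. g z * k z \<partial>lborel)
      = (\<integral>z. indicat_real {0<..<1} z * (g z * k z) + indicat_real ?N z * (g z * k z) \<partial>lborel)"
  proof (rule integral_cong_AE)
    show "AE z in lborel. g z * k z = indicat_real {0<..<1} z * (g z * k z) + indicat_real ?N z * (g z * k z)"
      using AE_lborel_singleton[of 0]
    proof eventually_elim
      case (elim z)
      then show ?case using k0[of z] by (auto simp: not_less split: split_indicator)
    qed
  qed (use gk in auto)
  also have "\<dots> = (\<integral>z. indicat_real {0<..<1} z * (g z * k z) \<partial>lborel) + (\<integral>z. indicat_real ?N z * (g z * k z) \<partial>lborel)"
    by (intro Bochner_Integration.integral_add i)
  also have "(\<integral>z. indicat_real {0<..<1} z * (g z * k z) \<partial>lborel) = (\<integral>x. \<rho>0 x * k x \<partial>I01)"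
    by (rule integral_lebesgue_on_eq_lborel[symmetric])
       (use gk \<rho>0_borel k in \<open>auto simp: g_def intro!: borel_imp_measurable_lebesgue_on\<close>)
  also have "(\<integral>z. indicat_real ?N z * (g z * k z) \<partial>lborel) = (\<integral>s. u s * k (Z s 0) \<partial>lebesgue_on {0<..<t})"
  proof -
    let ?f = "\<lambda>z. g z * k z" and ?I = "{0<..<t}"
    have fi: "integrable (lebesgue_on ?N) ?f"
      by (rule integrable_lebesgue_on_Ioo_bounded[OF borel_imp_measurable_lebesgue_on[OF gk], where C = "Mg * B"])
         (use gkb in simp)
    then have "?f absolutely_integrable_on (\<lambda>s. Z s 0) ` ?I"
      unfolding image_Z_0[OF t] by (simp add: set_integrable_def integrable_restrict_space)
    moreover have "((\<lambda>s. Z s 0) has_field_derivative - inflow_rate s) (at s within ?I)" if "s \<in> ?I" for s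
      unfolding inflow_rate_def
      by (rule has_field_derivative_at_within[OF Z_deriv_t_interior]) (use that t in auto)
    moreover have "inj_on (\<lambda>s. Z s 0) ?I"
      by (rule inj_on_subset[OF Z_inj_time]) (use t in auto)
    ultimately have cv: "(\<lambda>s. \<bar>- inflow_rate s\<bar> * ?f (Z s 0)) absolutely_integrable_on ?I"
      "integral ?I (\<lambda>s. \<bar>- inflow_rate s\<bar> * ?f (Z s 0)) = integral ((\<lambda>s. Z s 0) ` ?I) ?f"
      using has_absolute_integral_change_of_variables_1'[of ?I "\<lambda>s. Z s 0" "\<lambda>s. - inflow_rate s" ?f
          "integral ((\<lambda>s. Z s 0) ` ?I) ?f"] by auto
    have eq: "\<bar>- inflow_rate s\<bar> * ?f (Z s 0) = u s * k (Z s 0)" if "s \<in> ?I" for s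
      using that t g_entry[of s] inflow_rate_bounds(2)[of s] by (simp add: mult.assoc[symmetric])
    have "integrable (lebesgue_on ?I) (\<lambda>s. \<bar>- inflow_rate s\<bar> * ?f (Z s 0))"
      using cv(1) by (simp add: set_integrable_def integrable_restrict_space)
    then have "(\<integral>s. \<bar>- inflow_rate s\<bar> * ?f (Z s 0) \<partial>lebesgue_on ?I)
        = integral ?I (\<lambda>s. \<bar>- inflow_rate s\<bar> * ?f (Z s 0))"
      by (rule lebesgue_integral_eq_integral) simp
    also have "\<dots> = integral ?N ?f" using cv(2) unfolding image_Z_0[OF t] .
    finally have "(\<integral>s. \<bar>- inflow_rate s\<bar> * ?f (Z s 0) \<partial>lebesgue_on ?I) = integral ?N ?f" .
    moreover have "(\<integral>s. \<bar>- inflow_rate s\<bar> * ?f (Z s 0) \<partial>lebesgue_on ?I) = (\<integral>s. u s * k (Z s 0) \<partial>lebesgue_on ?I)"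
      by (intro Bochner_Integration.integral_cong refl eq) simp
    moreover have "integral ?N ?f = integral\<^sup>L (lebesgue_on ?N) ?f"
      by (rule lebesgue_integral_eq_integral[OF fi, symmetric]) simp
    moreover have "\<dots> = (\<integral>z. indicat_real ?N z * (g z * k z) \<partial>lborel)"
      by (rule integral_lebesgue_on_eq_lborel) (use gk in \<open>auto intro!: borel_imp_measurable_lebesgue_on\<close>)
    ultimately show ?thesis by simp
  qed
  finally show ?thesis .
qed

text \<open>The right side is the functional of the exit path found in
  \<open>mass_behind_path\<close>, with \<open>Z t 1\<close> as its starting point. So one Lipschitz
  estimate serves both the construction and the comparison of solutions.\<close>

lemma total_mass_rho:
  assumes t: "t \<in> {0..T}"
  shows "total_mass rho t = (\<integral>s. u s * (if 0 < X s (Z t 1) then 1 else 0) \<partial>lebesgue_on {0<..<t})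
      + (\<integral>x. \<rho>0 x * (if x < Z t 1 then 1 else 0) \<partial>I01)"
proof -
  define k where "k z = (if 0 < X t z \<and> X t z < 1 then 1 else 0 :: real)" for z
  have "0 \<le> c * t" using t c_pos by simp
  then have gt: "z \<le> X t z" for z
    using path_growth(1)[OF X_path, of 0 t z] t by simp
  have "total_mass rho t = (\<integral>z. g z * k z \<partial>lborel)"
    using rho_integral_labels[OF t, of "\<lambda>_. 1"] by (simp add: total_mass_def k_def)
  also have "\<dots> = (\<integral>x. \<rho>0 x * k x \<partial>I01) + (\<integral>s. u s * k (Z s 0) \<partial>lebesgue_on {0<..<t})"
  proof (rule label_integral_split[OF t, where B = 1])
    have "open {z. 0 < X t z \<and> X t z < 1}"
      by (intro open_Collect_conj open_Collect_less continuous_on_const X_cont_x t)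
    then have "{z. 0 < X t z \<and> X t z < 1} \<in> sets borel" by (rule borel_open)
    then have "indicat_real {z. 0 < X t z \<and> X t z < 1} \<in> borel_measurable borel" by simp
    also have "indicat_real {z. 0 < X t z \<and> X t z < 1} = k" by (auto simp: k_def fun_eq_iff)
    finally show "k \<in> borel_measurable borel" .
    show "k z = 0" if "1 \<le> z" for z using gt[of z] that by (simp add: k_def)
    show "k z = 0" if "z \<le> Z t 0" for z
      using that X_greater_iff_Z[OF t, of 0 z] by (simp add: k_def)
  qed (simp add: k_def)
  also have "(\<integral>x. \<rho>0 x * k x \<partial>I01) = (\<integral>x. \<rho>0 x * (if x < Z t 1 then 1 else 0) \<partial>I01)"
  proof (intro Bochner_Integration.integral_cong refl)
    fix x assume "x \<in> space I01"
    then have "0 < X t x" using gt[of x] by simp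
    then show "\<rho>0 x * k x = \<rho>0 x * (if x < Z t 1 then 1 else 0)"
      using X_less_iff_Z[OF t, of x 1] by (simp add: k_def)
  qed
  also have "(\<integral>s. u s * k (Z s 0) \<partial>lebesgue_on {0<..<t})
      = (\<integral>s. u s * (if 0 < X s (Z t 1) then 1 else 0) \<partial>lebesgue_on {0<..<t})"
  proof (intro Bochner_Integration.integral_cong refl)
    fix s assume "s \<in> space (lebesgue_on {0<..<t})"
    then have s: "0 < s" "s < t" "s \<in> {0..T}" using t by auto
    have "0 < X t (Z s 0)"
      using X_strict_mono_time[of s t "Z s 0"] s t by simp
    \<comment> \<open>Order preservation: what enters at time \<open>s\<close> has not left by time
      \<open>t\<close> exactly if the path leaving at time \<open>t\<close> was already inside at
      time \<open>s\<close>.\<close>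
    moreover have "X t (Z s 0) < 1 \<longleftrightarrow> 0 < X s (Z t 1)"
      using X_less_iff_Z[OF t, of "Z s 0" 1] X_greater_iff_Z[OF s(3), of 0 "Z t 1"] by simp
    ultimately show "u s * k (Z s 0) = u s * (if 0 < X s (Z t 1) then 1 else 0)" by (simp add: k_def)
  qed
  finally show ?thesis by simp
qed

end

section \<open>The weak equation for the explicit density\<close>

context transport
begin

text \<open>The chain rule turns the integrand of the weak equation into a total derivative along a
  characteristic. The path has to stay in \<open>[0, 1]\<close>, where \<open>\<phi>\<close> is
  differentiable; by monotonicity in time the two end points decide this.\<close>

lemma test_function_along_path:
  assumes \<phi>: "C1_partials ({0..\<sigma>} \<times> {0..1}) \<phi> \<phi>t \<phi>x" and \<sigma>: "\<sigma> \<le> T"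
    and \<alpha>\<beta>: "0 \<le> \<alpha>" "\<alpha> \<le> \<beta>" "\<beta> \<le> \<sigma>" and X: "0 \<le> X \<alpha> z" "X \<beta> z \<le> 1"
  shows "((\<lambda>t. \<phi>t t (X t z) + l (X t z) (W t) * \<phi>x t (X t z)) has_integral \<phi> \<beta> (X \<beta> z) - \<phi> \<alpha> (X \<alpha> z)) {\<alpha>..\<beta>}"
    "t \<in> {\<alpha>..\<beta>} \<Longrightarrow> X t z \<in> {0..1}"
proof -
  have Xmono: "X s z \<le> X t z" if "0 \<le> s" "s \<le> t" "t \<le> T" for s t
    using X_strict_mono_time[of s t z] that by (cases "s = t") auto
  show X01: "X t z \<in> {0..1}" if "t \<in> {\<alpha>..\<beta>}" for t
    using Xmono[of \<alpha> t] Xmono[of t \<beta>] that \<alpha>\<beta> \<sigma> X by auto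
  show "((\<lambda>t. \<phi>t t (X t z) + l (X t z) (W t) * \<phi>x t (X t z)) has_integral \<phi> \<beta> (X \<beta> z) - \<phi> \<alpha> (X \<alpha> z)) {\<alpha>..\<beta>}"
  proof (rule fundamental_theorem_of_calculus[OF \<alpha>\<beta>(2)])
    fix t assume t: "t \<in> {\<alpha>..\<beta>}"
    let ?\<gamma> = "\<lambda>t. (t, X t z)" and ?S = "{0..\<sigma>} \<times> {0..1::real}"
    have "((\<lambda>t. X t z) has_real_derivative l (X t z) (W t)) (at t within {0..T})"
      using X_path[of z] t \<alpha>\<beta> \<sigma> by (auto simp: path_def)
    then have "((\<lambda>t. X t z) has_real_derivative l (X t z) (W t)) (at t within {\<alpha>..\<beta>})"
      by (rule has_field_derivative_subset) (use \<alpha>\<beta> \<sigma> in auto)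
    then have \<gamma>: "(?\<gamma> has_derivative (\<lambda>h. (h, l (X t z) (W t) * h))) (at t within {\<alpha>..\<beta>})"
      unfolding has_field_derivative_def by (intro has_derivative_Pair has_derivative_ident)
    have sub: "?\<gamma> ` {\<alpha>..\<beta>} \<subseteq> ?S" using X01 \<alpha>\<beta> by auto
    have "(t, X t z) \<in> ?S" using X01[OF t] t \<alpha>\<beta> by auto
    then have "((\<lambda>(s, y). \<phi> s y) has_derivative (\<lambda>(h, k). \<phi>t t (X t z) * h + \<phi>x t (X t z) * k)) (at (?\<gamma> t) within ?S)"
      using \<phi> by (auto simp: C1_partials_def)
    then have "((\<lambda>(s, y). \<phi> s y) has_derivative (\<lambda>(h, k). \<phi>t t (X t z) * h + \<phi>x t (X t z) * k)) (at (?\<gamma> t) within ?\<gamma> ` {\<alpha>..\<beta>})"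
      by (rule has_derivative_subset[OF _ sub])
    from has_derivative_in_compose[OF \<gamma> this]
    have "((\<lambda>t. \<phi> t (X t z)) has_derivative (\<lambda>h. \<phi>t t (X t z) * h + \<phi>x t (X t z) * (l (X t z) (W t) * h))) (at t within {\<alpha>..\<beta>})"
      by simp
    then show "((\<lambda>t. \<phi> t (X t z)) has_vector_derivative \<phi>t t (X t z) + l (X t z) (W t) * \<phi>x t (X t z)) (at t within {\<alpha>..\<beta>})"
      unfolding has_vector_derivative_def by (rule has_derivative_eq_rhs) (simp add: fun_eq_iff algebra_simps)
  qed
qed

text \<open>In label coordinates the double integral is taken in time first. Each label contributes
  the increment of \<open>\<phi>\<close> along its path; since \<open>\<phi>\<close> vanishes where
  the path ends, at \<open>x = 1\<close> or at time \<open>\<sigma>\<close>, minus the value at the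
  point of entry remains, and the boundary and initial terms cancel it.\<close>

lemma rho_weak_equation:
  assumes \<sigma>: "\<sigma> \<in> {0..T}" and \<phi>: "C1_partials ({0..\<sigma>} \<times> {0..1}) \<phi> \<phi>t \<phi>x"
    and \<phi>0: "\<And>x. x \<in> {0..1} \<Longrightarrow> \<phi> \<sigma> x = 0" "\<And>t. t \<in> {0..\<sigma>} \<Longrightarrow> \<phi> t 1 = 0"
  shows "(\<integral>t. (\<integral>x. rho t x * (\<phi>t t x + l x (W t) * \<phi>x t x) \<partial>I01) \<partial>lebesgue_on {0<..<\<sigma>})
        + (\<integral>t. u t * \<phi> t 0 \<partial>lebesgue_on {0<..<\<sigma>}) + (\<integral>x. \<rho>0 x * \<phi> 0 x \<partial>I01) = 0"
proof -
  have \<sigma>T: "0 \<le> \<sigma>" "\<sigma> \<le> T" "{0..\<sigma>} \<subseteq> {0..T}" using \<sigma> by auto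
  let ?S = "{0..\<sigma>} \<times> {0..1::real}"
  define \<psi> where "\<psi> t x = \<phi>t t x + l x (W t) * \<phi>x t x" for t x
  have \<psi>c: "continuous_on ?S (\<lambda>(t, x). \<psi> t x)"
  proof -
    have "continuous_on ?S (\<lambda>p. W (fst p))"
      by (intro W_cont_compose continuous_intros) (use \<sigma>T in auto)
    then show ?thesis
      using \<phi> unfolding \<psi>_def C1_partials_def split_beta
      by (intro continuous_intros l_cont) auto
  qed
  have "bounded ((\<lambda>(s, x). \<psi> s x) ` ?S)"
    by (intro compact_imp_bounded compact_continuous_image \<psi>c compact_Times) auto
  then obtain B where B: "\<And>s x. s \<in> {0..\<sigma>} \<Longrightarrow> x \<in> {0..1} \<Longrightarrow> \<bar>\<psi> s x\<bar> \<le> B" "0 < B" by (fastforce simp: bounded_pos)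
  \<comment> \<open>Pairs of time and label whose characteristic lies strictly inside the space
    interval at that time.\<close>
  define R where "R = {p :: real \<times> real. 0 < fst p \<and> fst p < \<sigma> \<and> 0 < X (fst p) (snd p) \<and> X (fst p) (snd p) < 1}"
  define \<kappa> where "\<kappa> p = indicat_real R p *\<^sub>R \<psi> (fst p) (X (fst p) (snd p))" for p
  have "open R"
  proof -
    let ?U = "{0<..<\<sigma>} \<times> (UNIV :: real set)"
    have "continuous_on ?U (\<lambda>p. X (fst p) (snd p))"
      by (intro X_cont continuous_intros) (use \<sigma>T in auto)
    then have "open (?U \<inter> (\<lambda>p. X (fst p) (snd p)) -` {0<..<1})"
      by (rule continuous_open_preimage) (auto intro: open_Times)
    also have "?U \<inter> (\<lambda>p. X (fst p) (snd p)) -` {0<..<1} = R" by (auto simp: R_def)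
    finally show ?thesis .
  qed
  then have Rb: "R \<in> sets borel" by (rule borel_open)
  have "continuous_on R (\<lambda>p. \<psi> (fst p) (X (fst p) (snd p)))"
  proof -
    have "continuous_on R (\<lambda>p. (fst p, X (fst p) (snd p)))"
      by (intro continuous_intros X_cont) (use \<sigma>T in \<open>auto simp: R_def\<close>)
    moreover have "(\<lambda>p. (fst p, X (fst p) (snd p))) ` R \<subseteq> ?S" by (auto simp: R_def)
    ultimately have "continuous_on R (\<lambda>p. case (fst p, X (fst p) (snd p)) of (t, x) \<Rightarrow> \<psi> t x)"
      by (rule continuous_on_compose2[OF \<psi>c])
    then show ?thesis by simp
  qed
  then have \<kappa>m: "\<kappa> \<in> borel_measurable borel"
    unfolding \<kappa>_def[abs_def] by (rule borel_measurable_continuous_on_indicator[OF Rb])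
  have \<kappa>b: "\<bar>\<kappa> p\<bar> \<le> B" for p
    using B(1)[of "fst p" "X (fst p) (snd p)"] B(2) by (auto simp: \<kappa>_def R_def split: split_indicator)
  have \<kappa>t: "(\<lambda>t. \<kappa> (t, z)) \<in> borel_measurable borel" for z
    by (rule measurable_compose[OF _ \<kappa>m]) (simp add: borel_prod[symmetric])
  \<comment> \<open>Labels occurring in \<open>R\<close> are bounded: a label differs from its
    current position, which is in \<open>(0, 1)\<close>, by at most \<open>E * C * T\<close>. This
    makes the integrand of Fubini integrable.\<close>
  define N where "N = 1 + E * C * T"
  have RN: "p \<in> cbox (0, - N) (\<sigma>, N)" if "p \<in> R" for p
  proof -
    obtain t z where p: "p = (t, z)" by (cases p)
    with that have tz: "0 < t" "t < \<sigma>" "0 < X t z" "X t z < 1" by (auto simp: R_def)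
    have "\<bar>Z t (X t z) - Z 0 (X t z)\<bar> \<le> E * \<bar>X t z - X t z\<bar> + E * C * \<bar>t - 0\<bar>"
      using tz \<sigma>T by (intro Z_Lip) auto
    then have "\<bar>z - X t z\<bar> \<le> E * C * t" using tz \<sigma>T by simp
    also have "\<dots> \<le> E * C * T" using tz \<sigma>T E_pos C_pos by (intro mult_left_mono) auto
    finally show ?thesis using tz p by (auto simp: cbox_Pair_eq N_def)
  qed
  define h where "h t z = g z * \<kappa> (t, z)" for t z
  have hI: "integrable (lborel \<Otimes>\<^sub>M lborel) (case_prod h)"
  proof -
    have gm: "(\<lambda>p :: real \<times> real. g (snd p)) \<in> borel_measurable borel"
      by (rule measurable_compose[OF _ g_borel]) (simp add: borel_prod[symmetric])
    have "integrable lborel (case_prod h)"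
    proof (rule Bochner_Integration.integrable_bound)
      show "integrable lborel (\<lambda>p. Mg * B * indicat_real (cbox (0 :: real, - N) (\<sigma>, N)) p)"
        by (intro integrable_mult_right integrable_real_indicator emeasure_lborel_cbox_finite) simp
      show "case_prod h \<in> borel_measurable lborel"
      proof -
        have "case_prod h = (\<lambda>p. g (snd p) * \<kappa> p)" by (auto simp: h_def fun_eq_iff)
        then show ?thesis using borel_measurable_times[OF gm \<kappa>m] by simp
      qed
      show "AE p in lborel. norm (case_prod h p) \<le> norm (Mg * B * indicat_real (cbox (0, - N) (\<sigma>, N)) p)"
      proof (rule AE_I2)
        fix p :: "real \<times> real"
        show "norm (case_prod h p) \<le> norm (Mg * B * indicat_real (cbox (0, - N) (\<sigma>, N)) p)"
        proof (cases "p \<in> R")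
          case True
          have "\<bar>g (snd p)\<bar> * \<bar>\<kappa> p\<bar> \<le> Mg * B" using g_bounds(3) \<kappa>b Mg_nonneg by (intro mult_mono) auto
          then show ?thesis using RN[OF True] Mg_nonneg B(2) by (simp add: h_def split_beta abs_mult)
        next
          case False
          then show ?thesis by (simp add: h_def \<kappa>_def split_beta)
        qed
      qed
    qed
    then show ?thesis by (simp add: lborel_prod)
  qed
  define P where "P z = (\<integral>t. \<kappa> (t, z) \<partial>lborel)" for z
  \<comment> \<open>\<open>\<alpha>\<close> is the time of entry of the path with label
    \<open>z\<close>: zero for labels of the initial mass, the crossing time of \<open>x = 0\<close>
    for the others.\<close>
  have P_path: "P z = - \<phi> \<alpha> (X \<alpha> z)"
    if \<alpha>: "0 \<le> \<alpha>" "\<alpha> < \<sigma>" and X0: "0 \<le> X \<alpha> z" "X \<alpha> z < 1" and or: "X \<alpha> z = 0 \<or> \<alpha> = 0" for \<alpha> z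
  proof -
    \<comment> \<open>The end of the path, by leaving through \<open>x = 1\<close> or by reaching
      time \<open>\<sigma>\<close>; \<open>\<phi>\<close> vanishes in both cases.\<close>
    obtain \<beta> where \<beta>: "\<alpha> \<le> \<beta>" "\<beta> \<le> \<sigma>" "X \<beta> z \<le> 1" "\<beta> = \<sigma> \<or> X \<beta> z = 1"
    proof (cases "X \<sigma> z \<le> 1")
      case True
      then show thesis using that[of \<sigma>] \<alpha> by simp
    next
      case False
      have "continuous_on {\<alpha>..\<sigma>} (\<lambda>t. X t z)"
        by (intro X_cont continuous_intros) (use \<alpha> \<sigma>T in auto)
      then have "\<exists>\<beta>\<ge>\<alpha>. \<beta> \<le> \<sigma> \<and> X \<beta> z = 1"
        using X0 False \<alpha> by (intro IVT') auto
      then show thesis using that by force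
    qed
    have \<beta>0: "\<phi> \<beta> (X \<beta> z) = 0"
    proof -
      have "X \<beta> z \<in> {0..1}"
        by (rule test_function_along_path(2)[OF \<phi> \<sigma>T(2) \<alpha>(1) \<beta>(1,2) X0(1) \<beta>(3)]) (use \<beta> in auto)
      then show ?thesis using \<beta>(4) \<phi>0 \<beta> \<alpha> by auto
    qed
    note ftc = test_function_along_path[OF \<phi> \<sigma>T(2) \<alpha>(1) \<beta>(1,2) X0(1) \<beta>(3)]
    have iff: "(t, z) \<in> R \<longleftrightarrow> t \<in> {\<alpha><..<\<beta>}" if t: "0 < t" "t < \<sigma>" for t
    proof -
      have "0 < X t z \<longleftrightarrow> \<alpha> < t"
      proof
        assume "0 < X t z"
        then show "\<alpha> < t"
          using X_strict_mono_time[of t \<alpha> z] or t \<alpha> \<sigma>T by (cases t \<alpha> rule: linorder_cases) auto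
      next
        assume "\<alpha> < t"
        then show "0 < X t z" using X_strict_mono_time[of \<alpha> t z] X0 \<alpha> t \<sigma>T by auto
      qed
      moreover have "X t z < 1 \<longleftrightarrow> t < \<beta>"
      proof
        assume "X t z < 1"
        then show "t < \<beta>"
          using X_strict_mono_time[of \<beta> t z] \<beta> t \<alpha> \<sigma>T by (cases t \<beta> rule: linorder_cases) auto
      next
        assume "t < \<beta>"
        then show "X t z < 1" using X_strict_mono_time[of t \<beta> z] \<beta> t \<sigma>T by auto
      qed
      ultimately show ?thesis using t by (auto simp: R_def)
    qed
    have Rsub: "t \<in> {0<..<\<sigma>}" if "(t, z) \<in> R" for t using that by (auto simp: R_def)
    have \<psi>X: "continuous_on {\<alpha>..\<beta>} (\<lambda>t. \<psi> t (X t z))"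
    proof -
      have "continuous_on {\<alpha>..\<beta>} (\<lambda>t. (t, X t z))"
        by (intro continuous_intros X_cont) (use \<alpha> \<beta> \<sigma>T in auto)
      moreover have "(\<lambda>t. (t, X t z)) ` {\<alpha>..\<beta>} \<subseteq> ?S" using ftc(2) \<alpha> \<beta> by auto
      ultimately have "continuous_on {\<alpha>..\<beta>} (\<lambda>t. case (t, X t z) of (t, x) \<Rightarrow> \<psi> t x)"
        by (rule continuous_on_compose2[OF \<psi>c])
      then show ?thesis by simp
    qed
    have i: "integrable (lebesgue_on {\<alpha><..<\<beta>}) (\<lambda>t. \<psi> t (X t z))"
      by (rule integrable_lebesgue_on_mono[OF continuous_imp_integrable_real[OF \<psi>X]]) auto
    have "P z = integral\<^sup>L (lebesgue_on {\<alpha><..<\<beta>}) (\<lambda>t. \<psi> t (X t z))"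
      unfolding P_def
    proof (rule integral_lebesgue_on_eq_lborel[symmetric])
      show "AE t in lborel. t \<in> {\<alpha><..<\<beta>} \<longrightarrow> \<psi> t (X t z) = \<kappa> (t, z)"
        using iff \<alpha> \<beta> by (intro AE_I2) (auto simp: \<kappa>_def)
      show "\<kappa> (t, z) = 0" if "t \<notin> {\<alpha><..<\<beta>}" for t
        using iff[of t] Rsub[of t] that by (auto simp: \<kappa>_def split: split_indicator)
    qed (use \<kappa>t i in auto)
    also have "\<dots> = integral {\<alpha>..\<beta>} (\<lambda>t. \<psi> t (X t z))" by (rule lebesgue_on_integral_Ioo(2)[OF i])
    also have "\<dots> = \<phi> \<beta> (X \<beta> z) - \<phi> \<alpha> (X \<alpha> z)"
      unfolding \<psi>_def by (rule integral_unique[OF ftc(1)])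
    finally show ?thesis using \<beta>0 by simp
  qed
  have Pm: "P \<in> borel_measurable borel"
  proof -
    have "(\<lambda>(z, t). \<kappa> (t, z)) \<in> borel_measurable (lborel \<Otimes>\<^sub>M lborel)"
      using measurable_compose[OF measurable_pair_swap' \<kappa>m[unfolded borel_prod[symmetric]]]
      by (simp add: split_beta lborel_prod borel_prod)
    from lborel.borel_measurable_lebesgue_integral[OF this] show ?thesis
      by (simp add: P_def[abs_def])
  qed
  have Pb: "\<bar>P z\<bar> \<le> B * \<sigma>" for z
  proof -
    have b: "norm (\<kappa> (t, z)) \<le> B * indicat_real {0..\<sigma>} t" for t
      using \<kappa>b[of "(t, z)"] by (auto simp: \<kappa>_def R_def split: split_indicator)
    have i: "integrable lborel (\<lambda>t. B * indicat_real {0..\<sigma>} t)"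
      using \<sigma>T by (intro integrable_mult_right integrable_real_indicator) simp_all
    have "integrable lborel (\<lambda>t. \<kappa> (t, z))"
      by (rule Bochner_Integration.integrable_bound[OF i])
         (use \<kappa>t b in \<open>auto intro!: AE_I2 order_trans[OF _ abs_ge_self]\<close>)
    then have "(\<integral>t. norm (\<kappa> (t, z)) \<partial>lborel) \<le> (\<integral>t. B * indicat_real {0..\<sigma>} t \<partial>lborel)"
      by (intro integral_mono i b integrable_norm)
    then have "norm (P z) \<le> (\<integral>t. B * indicat_real {0..\<sigma>} t \<partial>lborel)"
      unfolding P_def by (rule order_trans[OF integral_norm_bound])
    then show ?thesis using \<sigma>T by simp
  qed
  have P0: "P z = 0" if "1 \<le> z \<or> z \<le> Z \<sigma> 0" for z
  proof -
    have "(t, z) \<notin> R" for t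
    proof
      assume "(t, z) \<in> R"
      then have t: "0 < t" "t < \<sigma>" "0 < X t z" "X t z < 1" by (auto simp: R_def)
      from that show False
      proof
        assume "1 \<le> z"
        then show False using X_strict_mono_time[of 0 t z] t \<sigma>T by auto
      next
        assume "z \<le> Z \<sigma> 0"
        then have "X \<sigma> z \<le> 0" using X_greater_iff_Z[OF \<sigma>, of 0 z] by auto
        then show False using X_strict_mono_time[of t \<sigma> z] t \<sigma>T by auto
      qed
    qed
    then have "\<kappa> (t, z) = 0" for t by (simp add: \<kappa>_def)
    then show ?thesis by (simp add: P_def)
  qed
  have "(\<integral>t. (\<integral>x. rho t x * \<psi> t x \<partial>I01) \<partial>lebesgue_on {0<..<\<sigma>}) = (\<integral>t. (\<integral>z. h t z \<partial>lborel) \<partial>lborel)"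
  proof (rule integral_lebesgue_on_eq_lborel)
    have "Lp_continuous_on {0..\<sigma>} I01 1 rho"
      by (rule Lp_continuous_on_subset[OF rho_Lp_space]) (use \<sigma>T in auto)
    from continuous_on_integral_mult(1)[OF this _ \<psi>c]
    have "continuous_on {0..\<sigma>} (\<lambda>t. \<integral>x. rho t x * \<psi> t x \<partial>I01)" by simp
    then show "(\<lambda>t. \<integral>x. rho t x * \<psi> t x \<partial>I01) \<in> borel_measurable (lebesgue_on {0<..<\<sigma>})"
      by (rule continuous_on_imp_measurable_lebesgue_on) auto
    show "(\<lambda>t. \<integral>z. h t z \<partial>lborel) \<in> borel_measurable borel"
      using borel_measurable_integrable[OF lborel_pair.integrable_fst[OF hI]] by simp
    show "AE t in lborel. t \<in> {0<..<\<sigma>} \<longrightarrow> (\<integral>x. rho t x * \<psi> t x \<partial>I01) = (\<integral>z. h t z \<partial>lborel)"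
    proof (intro AE_I2 impI)
      fix t assume t: "t \<in> {0<..<\<sigma>}"
      then have t': "t \<in> {0..T}" "t \<in> {0..\<sigma>}" using \<sigma>T by auto
      have "(\<integral>x. rho t x * \<psi> t x \<partial>I01) = (\<integral>z. g z * (if 0 < X t z \<and> X t z < 1 then \<psi> t (X t z) else 0) \<partial>lborel)"
        by (rule rho_integral_labels[OF t'(1) continuous_on_pair_slices(1)[OF \<psi>c t'(2)]])
      also have "\<dots> = (\<integral>z. h t z \<partial>lborel)"
        using t by (intro Bochner_Integration.integral_cong refl) (auto simp: h_def \<kappa>_def R_def)
      finally show "(\<integral>x. rho t x * \<psi> t x \<partial>I01) = (\<integral>z. h t z \<partial>lborel)" .
    qed
    show "(\<integral>z. h t z \<partial>lborel) = 0" if "t \<notin> {0<..<\<sigma>}" for t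
    proof -
      have "h t z = 0" for z using that by (auto simp: h_def \<kappa>_def R_def)
      then show ?thesis by simp
    qed
  qed simp
  also have "\<dots> = (\<integral>z. (\<integral>t. h t z \<partial>lborel) \<partial>lborel)"
    by (rule lborel_pair.Fubini_integral[OF hI, symmetric])
  also have "\<dots> = (\<integral>z. g z * P z \<partial>lborel)"
    by (simp add: h_def P_def)
  also have "\<dots> = (\<integral>x. \<rho>0 x * P x \<partial>I01) + (\<integral>s. u s * P (Z s 0) \<partial>lebesgue_on {0<..<\<sigma>})"
    by (rule label_integral_split[OF \<sigma> Pm Pb]) (use P0 in auto)
  also have "(\<integral>x. \<rho>0 x * P x \<partial>I01) = - (\<integral>x. \<rho>0 x * \<phi> 0 x \<partial>I01)"
  proof -
    have "P x = - \<phi> 0 x" if "x \<in> {0<..<1}" for x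
    proof (cases "\<sigma> = 0")
      case True
      then show ?thesis using that \<phi>0(1)[of x] by (simp add: P_def \<kappa>_def R_def)
    next
      case False
      then show ?thesis using P_path[of 0 x] that \<sigma>T by auto
    qed
    then have "(\<integral>x. \<rho>0 x * P x \<partial>I01) = (\<integral>x. - (\<rho>0 x * \<phi> 0 x) \<partial>I01)"
      by (intro Bochner_Integration.integral_cong refl) simp
    then show ?thesis by simp
  qed
  also have "(\<integral>s. u s * P (Z s 0) \<partial>lebesgue_on {0<..<\<sigma>}) = - (\<integral>s. u s * \<phi> s 0 \<partial>lebesgue_on {0<..<\<sigma>})"
  proof -
    have "P (Z s 0) = - \<phi> s 0" if "s \<in> {0<..<\<sigma>}" for s
      using P_path[of s "Z s 0"] that \<sigma>T by auto
    then have "(\<integral>s. u s * P (Z s 0) \<partial>lebesgue_on {0<..<\<sigma>}) = (\<integral>s. - (u s * \<phi> s 0) \<partial>lebesgue_on {0<..<\<sigma>})"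
      by (intro Bochner_Integration.integral_cong refl) simp
    then show ?thesis by simp
  qed
  finally show ?thesis by (simp add: \<psi>_def)
qed

end

subsection \<open>Stability of the total mass\<close>

text \<open>Applied in space to the initial datum and in time to the in-flux, with weights that are
  indicators determined by two nearby paths.\<close>

lemma integral_diff_le_interval:
  fixes v p1 p2 :: "real \<Rightarrow> real"
  assumes v: "v \<in> borel_measurable (lebesgue_on {a<..<b})" "AE x in lebesgue_on {a<..<b}. \<bar>v x\<bar> \<le> L" and L: "0 \<le> L"
    and p: "p1 \<in> borel_measurable (lebesgue_on {a<..<b})" "p2 \<in> borel_measurable (lebesgue_on {a<..<b})"
    and p01: "\<And>x. p1 x \<in> {0..1}" "\<And>x. p2 x \<in> {0..1}"
    and ne: "\<And>x. x \<in> {a<..<b} \<Longrightarrow> p1 x \<noteq> p2 x \<Longrightarrow> x \<in> {m..m + d}" and d: "0 \<le> d"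
  shows "\<bar>(\<integral>x. v x * p1 x \<partial>lebesgue_on {a<..<b}) - (\<integral>x. v x * p2 x \<partial>lebesgue_on {a<..<b})\<bar> \<le> L * d"
proof -
  let ?M = "lebesgue_on {a<..<b}"
  interpret finite_measure ?M by (rule finite_measure_lebesgue_on_Ioo)
  have vi: "integrable ?M v" by (rule integrable_lebesgue_on_Ioo_bounded[OF v])
  have i1: "integrable ?M (\<lambda>x. v x * p1 x)"
    by (rule integrable_mult_bounded(1)[OF vi p(1), where B = 1]) (use p01(1) in auto)
  have i2: "integrable ?M (\<lambda>x. v x * p2 x)"
    by (rule integrable_mult_bounded(1)[OF vi p(2), where B = 1]) (use p01(2) in auto)
  have J: "{m..m + d} \<inter> {a<..<b} \<in> sets ?M" by (auto simp: sets_restrict_space)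
  have "\<bar>(\<integral>x. v x * p1 x \<partial>?M) - (\<integral>x. v x * p2 x \<partial>?M)\<bar> = \<bar>\<integral>x. v x * p1 x - v x * p2 x \<partial>?M\<bar>"
    using i1 i2 by simp
  also have "\<dots> \<le> (\<integral>x. \<bar>v x * p1 x - v x * p2 x\<bar> \<partial>?M)" by (rule integral_abs_bound)
  also have "\<dots> \<le> (\<integral>x. L * indicat_real ({m..m + d} \<inter> {a<..<b}) x \<partial>?M)"
  proof (rule integral_mono_AE)
    show "integrable ?M (\<lambda>x. \<bar>v x * p1 x - v x * p2 x\<bar>)" using i1 i2 by simp
    show "integrable ?M (\<lambda>x. L * indicat_real ({m..m + d} \<inter> {a<..<b}) x)"
      using J by (intro integrable_mult_right integrable_real_indicator) (auto simp: less_top[symmetric])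
    have "AE x in ?M. x \<in> space ?M" by (rule AE_space)
    then show "AE x in ?M. \<bar>v x * p1 x - v x * p2 x\<bar> \<le> L * indicat_real ({m..m + d} \<inter> {a<..<b}) x"
      using v(2)
    proof eventually_elim
      case (elim x)
      show ?case
      proof (cases "p1 x = p2 x")
        case False
        have "\<bar>p1 x - p2 x\<bar> \<le> 1" using p01[of x] by (auto simp: abs_le_iff)
        then have "\<bar>v x\<bar> * \<bar>p1 x - p2 x\<bar> \<le> L * 1" using elim L by (intro mult_mono) auto
        then show ?thesis using ne[of x] elim False
          by (simp add: right_diff_distrib[symmetric] abs_mult)
      qed (use L in simp)
    qed
  qed
  also have "\<dots> = L * measure ?M ({m..m + d} \<inter> {a<..<b})"
    using J by simp
  also have "measure ?M ({m..m + d} \<inter> {a<..<b}) = measure lebesgue ({m..m + d} \<inter> {a<..<b})"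
    by (rule measure_restrict_space) auto
  also have "\<dots> \<le> measure lebesgue {m..m + d}"
    by (rule measure_mono_fmeasurable) (auto intro: lmeasurable_interval)
  also have "\<dots> = d" using d by simp
  finally show ?thesis using L by (auto intro: mult_left_mono)
qed

lemma initial_mass_compare:
  assumes v: "v \<in> borel_measurable I01" "AE x in I01. \<bar>v x\<bar> \<le> R" and R: "0 \<le> R"
  shows "\<bar>(\<integral>x. v x * (if x < a then 1 else 0) \<partial>I01) - (\<integral>x. v x * (if x < b then 1 else 0) \<partial>I01)\<bar> \<le> R * \<bar>a - b\<bar>"
  by (rule integral_diff_le_interval[OF v R, where m = "min a b"])
     (auto intro!: borel_imp_measurable_lebesgue_on split: if_splits)

context speed
begin

text \<open>The two indicators can differ only while \<open>\<xi>2\<close> is within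
  \<open>\<delta>\<close> of zero. As \<open>\<xi>2\<close> moves with speed at least
  \<open>c\<close>, those times span at most \<open>2 * \<delta> / c\<close>.\<close>

lemma influx_compare:
  assumes v: "v \<in> borel_measurable (lebesgue_on {0<..<\<tau>})" "AE x in lebesgue_on {0<..<\<tau>}. \<bar>v x\<bar> \<le> L" and L: "0 \<le> L"
    and \<xi>: "continuous_on {0..\<tau>} \<xi>1" "path W \<tau> \<xi>2" and \<delta>: "\<And>s. s \<in> {0..\<tau>} \<Longrightarrow> \<bar>\<xi>1 s - \<xi>2 s\<bar> \<le> \<delta>" and \<delta>0: "0 \<le> \<delta>"
  shows "\<bar>(\<integral>t. v t * (if 0 < \<xi>1 t then 1 else 0) \<partial>lebesgue_on {0<..<\<tau>})
      - (\<integral>t. v t * (if 0 < \<xi>2 t then 1 else 0) \<partial>lebesgue_on {0<..<\<tau>})\<bar> \<le> L * (2 * \<delta> / c)"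
proof -
  define A where "A = {t \<in> {0<..<\<tau>}. \<bar>\<xi>2 t\<bar> \<le> \<delta>}"
  have diam: "t \<le> s + 2 * \<delta> / c" if "s \<in> A" "t \<in> A" for s t
  proof (cases "s \<le> t")
    case True
    then have "c * (t - s) \<le> \<xi>2 t - \<xi>2 s" using path_growth(1)[OF \<xi>(2), of s t] that by (simp add: A_def)
    also have "\<dots> \<le> 2 * \<delta>" using that by (simp add: A_def abs_le_iff)
    finally show ?thesis using c_pos by (simp add: field_simps)
  next
    case False
    have "0 \<le> 2 * \<delta> / c" using \<delta>0 c_pos by simp
    then show ?thesis using False by linarith
  qed
  have bb: "bdd_below A" unfolding A_def by (rule bdd_belowI[of _ 0]) auto
  have sub: "t \<in> {Inf A..Inf A + 2 * \<delta> / c}" if t: "t \<in> A" for t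
  proof -
    have "t - 2 * \<delta> / c \<le> Inf A"
      using t diam[OF _ t] by (intro cInf_greatest) (auto simp: algebra_simps)
    then show ?thesis using cInf_lower[OF t bb] by simp
  qed
  have m: "\<xi>1 \<in> borel_measurable (lebesgue_on {0<..<\<tau>})" "\<xi>2 \<in> borel_measurable (lebesgue_on {0<..<\<tau>})"
    by (rule continuous_on_imp_measurable_lebesgue_on[OF \<xi>(1)]; auto)
       (rule continuous_on_imp_measurable_lebesgue_on[OF path_cont[OF \<xi>(2)]]; auto)
  show ?thesis
  proof (rule integral_diff_le_interval[OF v L, where m = "Inf A"])
    show "t \<in> {Inf A..Inf A + 2 * \<delta> / c}"
      if "t \<in> {0<..<\<tau>}" "(if 0 < \<xi>1 t then 1 else (0::real)) \<noteq> (if 0 < \<xi>2 t then 1 else 0)" for t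
    proof (rule sub)
      show "t \<in> A" using \<delta>[of t] that by (auto simp: A_def abs_le_iff split: if_splits)
    qed
    show "(\<lambda>t. if 0 < \<xi>1 t then 1 else (0::real)) \<in> borel_measurable (lebesgue_on {0<..<\<tau>})"
      "(\<lambda>t. if 0 < \<xi>2 t then 1 else (0::real)) \<in> borel_measurable (lebesgue_on {0<..<\<tau>})"
      using m by simp_all
    show "0 \<le> 2 * \<delta> / c" using \<delta>0 c_pos by simp
  qed auto
qed

lemma flowI: "continuous_on {0..T} W \<Longrightarrow> flow l lx K c C T W"
  by (intro flow.intro flow_axioms.intro speed_axioms)

text \<open>\<open>E * K\<close> is the sensitivity of the exit path to the mass;
  \<open>Lu * (2 / c)\<close> and \<open>R0\<close> are the sensitivities of the in-flux and of the
  initial mass to that path.\<close>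

definition QC :: "real \<Rightarrow> real \<Rightarrow> real" where "QC Lu R0 = (Lu * (2 / c) + R0) * (E * K)"

lemma QC_nonneg: "0 \<le> Lu \<Longrightarrow> 0 \<le> R0 \<Longrightarrow> 0 \<le> QC Lu R0"
  using c_pos E_pos K_nonneg by (simp add: QC_def)

text \<open>The two functionals share their data and differ only in the exit paths. The bound by an
  integral over the past serves twice: for the fixed point that yields existence, and for Gronwall
  in the comparison of solutions.\<close>

lemma mass_functional_Lipschitz:
  assumes u: "u \<in> borel_measurable (lebesgue_on {0<..<\<tau>})" "AE x in lebesgue_on {0<..<\<tau>}. \<bar>u x\<bar> \<le> Lu" "0 \<le> Lu"
    and \<rho>0: "\<rho>0 \<in> borel_measurable I01" "AE x in I01. \<bar>\<rho>0 x\<bar> \<le> R0" "0 \<le> R0"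
    and p: "path W1 \<tau> \<xi>1" "path W2 \<tau> \<xi>2" "\<xi>1 \<tau> = 1" "\<xi>2 \<tau> = 1" and \<tau>: "0 \<le> \<tau>" "\<tau> \<le> T"
    and W: "continuous_on {0..T} W1" "continuous_on {0..T} W2"
  shows "\<bar>(\<integral>t. u t * (if 0 < \<xi>1 t then 1 else 0) \<partial>lebesgue_on {0<..<\<tau>}) + (\<integral>x. \<rho>0 x * (if x < \<xi>1 0 then 1 else 0) \<partial>I01)
      - ((\<integral>t. u t * (if 0 < \<xi>2 t then 1 else 0) \<partial>lebesgue_on {0<..<\<tau>}) + (\<integral>x. \<rho>0 x * (if x < \<xi>2 0 then 1 else 0) \<partial>I01))\<bar>
    \<le> QC Lu R0 * integral {0..\<tau>} (\<lambda>s. \<bar>W1 s - W2 s\<bar>)"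
proof -
  define \<delta> where "\<delta> = E * K * integral {0..\<tau>} (\<lambda>s. \<bar>W1 s - W2 s\<bar>)"
  have Ws: "continuous_on {0..\<tau>} W1" "continuous_on {0..\<tau>} W2"
    by (rule continuous_on_subset[OF W(1)], use \<tau> in auto) (rule continuous_on_subset[OF W(2)], use \<tau> in auto)
  have \<delta>: "\<bar>\<xi>1 s - \<xi>2 s\<bar> \<le> \<delta>" if "s \<in> {0..\<tau>}" for s
    unfolding \<delta>_def by (rule path_compare[OF p(1,2) _ Ws]) (use p \<tau> that in auto)
  then have \<delta>0: "0 \<le> \<delta>" using order_trans[OF abs_ge_zero \<delta>[of 0]] \<tau> by simp
  have 1: "\<bar>(\<integral>t. u t * (if 0 < \<xi>1 t then 1 else 0) \<partial>lebesgue_on {0<..<\<tau>})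
      - (\<integral>t. u t * (if 0 < \<xi>2 t then 1 else 0) \<partial>lebesgue_on {0<..<\<tau>})\<bar> \<le> Lu * (2 * \<delta> / c)"
    by (rule influx_compare[OF u path_cont[OF p(1)] p(2) \<delta> \<delta>0])
  have "\<bar>(\<integral>x. \<rho>0 x * (if x < \<xi>1 0 then 1 else 0) \<partial>I01) - (\<integral>x. \<rho>0 x * (if x < \<xi>2 0 then 1 else 0) \<partial>I01)\<bar> \<le> R0 * \<bar>\<xi>1 0 - \<xi>2 0\<bar>"
    by (rule initial_mass_compare[OF \<rho>0])
  also have "\<dots> \<le> R0 * \<delta>" using \<delta>[of 0] \<tau> \<rho>0(3) by (intro mult_left_mono) auto
  finally have 2: "\<bar>(\<integral>x. \<rho>0 x * (if x < \<xi>1 0 then 1 else 0) \<partial>I01) - (\<integral>x. \<rho>0 x * (if x < \<xi>2 0 then 1 else 0) \<partial>I01)\<bar> \<le> R0 * \<delta>" .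
  have "Lu * (2 * \<delta> / c) + R0 * \<delta> = QC Lu R0 * integral {0..\<tau>} (\<lambda>s. \<bar>W1 s - W2 s\<bar>)"
    by (simp add: QC_def \<delta>_def algebra_simps)
  then show ?thesis using 1 2 by linarith
qed

text \<open>The in-flux is exchanged along the exit path of \<open>W2\<close>, at a cost of
  \<open>2 * \<delta>\<close>; then the path is exchanged with \<open>u1\<close> kept, at the cost
  of an integral of the mass difference, and Gronwall closes the estimate. Solutions enter through
  their mass identities \<open>m1\<close> and \<open>m2\<close> alone, so densities are never
  compared.\<close>

lemma mass_stability:
  assumes u1: "u1 \<in> Linf (lebesgue_on {0<..<T})" "AE x in lebesgue_on {0<..<T}. \<bar>u1 x\<bar> \<le> Lu" "0 \<le> Lu"
    and u2: "u2 \<in> Linf (lebesgue_on {0<..<T})"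
    and \<rho>0: "\<rho>0 \<in> borel_measurable I01" "AE x in I01. \<bar>\<rho>0 x\<bar> \<le> R0" "0 \<le> R0"
    and W: "continuous_on {0..T} W1" "continuous_on {0..T} W2" and W0: "W1 0 = W2 0"
    and m1: "\<And>\<tau> \<xi>. 0 < \<tau> \<Longrightarrow> \<tau> \<le> T \<Longrightarrow> path W1 \<tau> \<xi> \<Longrightarrow> \<xi> \<tau> = 1 \<Longrightarrow>
      W1 \<tau> = (\<integral>t. u1 t * (if 0 < \<xi> t then 1 else 0) \<partial>lebesgue_on {0<..<\<tau>}) + (\<integral>x. \<rho>0 x * (if x < \<xi> 0 then 1 else 0) \<partial>I01)"
    and m2: "\<And>\<tau> \<xi>. 0 < \<tau> \<Longrightarrow> \<tau> \<le> T \<Longrightarrow> path W2 \<tau> \<xi> \<Longrightarrow> \<xi> \<tau> = 1 \<Longrightarrow>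
      W2 \<tau> = (\<integral>t. u2 t * (if 0 < \<xi> t then 1 else 0) \<partial>lebesgue_on {0<..<\<tau>}) + (\<integral>x. \<rho>0 x * (if x < \<xi> 0 then 1 else 0) \<partial>I01)"
    and \<delta>: "\<And>t. t \<in> {0..T} \<Longrightarrow> \<bar>(\<integral>s. u1 s \<partial>lebesgue_on {0<..<t}) - (\<integral>s. u2 s \<partial>lebesgue_on {0<..<t})\<bar> \<le> \<delta>"
    and t: "t \<in> {0..T}"
  shows "\<bar>W1 t - W2 t\<bar> \<le> 2 * \<delta> * exp (QC Lu R0 * T)"
proof -
  interpret F1: flow l lx K c C T W1 by (rule flowI[OF W(1)])
  interpret F2: flow l lx K c C T W2 by (rule flowI[OF W(2)])
  have \<delta>0: "0 \<le> \<delta>" using \<delta>[OF t] by linarith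
  have Q: "0 \<le> QC Lu R0" by (rule QC_nonneg[OF u1(3) \<rho>0(3)])
  have step: "\<bar>W1 \<tau> - W2 \<tau>\<bar> \<le> 2 * \<delta> + QC Lu R0 * integral {0..\<tau>} (\<lambda>s. \<bar>W1 s - W2 s\<bar>)" if \<tau>: "\<tau> \<in> {0..T}" for \<tau>
  proof (cases "\<tau> = 0")
    case True
    then show ?thesis using W0 \<delta>0 by simp
  next
    case False
    then have \<tau>0: "0 < \<tau>" "\<tau> \<le> T" using \<tau> by auto
    let ?N = "lebesgue_on {0<..<\<tau>}"
    define \<xi>1 where "\<xi>1 s = F1.X s (F1.Z \<tau> 1)" for s
    define \<xi>2 where "\<xi>2 s = F2.X s (F2.Z \<tau> 1)" for s
    have p1: "path W1 \<tau> \<xi>1" "\<xi>1 \<tau> = 1"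
      unfolding \<xi>1_def[abs_def] using path_subset[OF F1.X_path \<tau>0(2)] \<tau> by auto
    have p2: "path W2 \<tau> \<xi>2" "\<xi>2 \<tau> = 1"
      unfolding \<xi>2_def[abs_def] using path_subset[OF F2.X_path \<tau>0(2)] \<tau> by auto
    have um: "u1 \<in> borel_measurable ?N" "AE x in ?N. \<bar>u1 x\<bar> \<le> Lu"
    proof -
      have "integrable ?N u1" by (rule integrable_lebesgue_on_Ioo_mono[OF LinfD(1)[OF u1(1)]]) (use \<tau> in auto)
      then show "u1 \<in> borel_measurable ?N" by (rule borel_measurable_integrable)
      have "AE x in lebesgue. x \<in> {0<..<T} \<longrightarrow> \<bar>u1 x\<bar> \<le> Lu" using u1(2) by (simp add: AE_restrict_space_iff)
      then show "AE x in ?N. \<bar>u1 x\<bar> \<le> Lu"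
        by (subst AE_restrict_space_iff) (use \<tau> in \<open>auto elim!: eventually_mono\<close>)
    qed
    define p where "p t = (if 0 < \<xi>2 t then 1 else 0 :: real)" for t
    have ui: "integrable ?N u1" "integrable ?N u2"
      by (rule integrable_lebesgue_on_Ioo_mono[OF LinfD(1)[OF u1(1)]]; use \<tau> in simp)
         (rule integrable_lebesgue_on_Ioo_mono[OF LinfD(1)[OF u2]]; use \<tau> in simp)
    have "\<xi>2 \<in> borel_measurable ?N"
      by (rule continuous_on_imp_measurable_lebesgue_on[OF path_cont[OF p2(1)]]) auto
    then have pm: "p \<in> borel_measurable ?N" unfolding p_def by simp
    have upi: "integrable ?N (\<lambda>t. u1 t * p t)" "integrable ?N (\<lambda>t. u2 t * p t)"
      by (rule integrable_mult_bounded(1)[OF ui(1) pm, where B = 1]; simp add: p_def)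
         (rule integrable_mult_bounded(1)[OF ui(2) pm, where B = 1]; simp add: p_def)
    have "\<bar>(\<integral>t. u1 t * p t \<partial>?N) - (\<integral>t. u2 t * p t \<partial>?N)\<bar> \<le> 2 * \<delta>"
    proof -
      \<comment> \<open>\<open>r\<close> is the time at which the path crosses zero, or
        \<open>0\<close> if it starts at or above zero. Integrating against the indicator then means
        subtracting two values of the primitive, whence the factor two.\<close>
      obtain r where r: "r \<in> {0..\<tau>}" "\<And>t. t \<in> {0<..<\<tau>} \<Longrightarrow> 0 < \<xi>2 t \<longleftrightarrow> r < t"
      proof (cases "0 \<le> \<xi>2 0")
        case True
        have "0 < \<xi>2 t" if "t \<in> {0<..<\<tau>}" for t
        proof -
          have "0 < c * (t - 0)" using that c_pos by simp
          then show ?thesis using path_growth(1)[OF p2(1), of 0 t] that True by simp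
        qed
        then show thesis using that[of 0] \<tau> by auto
      next
        case False
        have "\<exists>r\<ge>0. r \<le> \<tau> \<and> \<xi>2 r = 0"
          using False p2 \<tau> by (intro IVT' path_cont) auto
        then obtain r where r: "0 \<le> r" "r \<le> \<tau>" "\<xi>2 r = 0" by blast
        have "0 < \<xi>2 t \<longleftrightarrow> r < t" if "t \<in> {0<..<\<tau>}" for t
        proof
          assume "r < t"
          then have "0 < c * (t - r)" using c_pos by simp
          then show "0 < \<xi>2 t" using path_growth(1)[OF p2(1), of r t] that r \<open>r < t\<close> by simp
        next
          assume t: "0 < \<xi>2 t"
          show "r < t"
          proof (rule ccontr)
            assume "\<not> r < t"
            then have "0 \<le> c * (r - t)" "t \<le> r" using c_pos by auto
            then show False using path_growth(1)[OF p2(1), of t r] that r t by simp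
          qed
        qed
        then show thesis using that[of r] r by auto
      qed
      have split: "(\<integral>t. w t * p t \<partial>?N) = (\<integral>t. w t \<partial>?N) - (\<integral>t. w t \<partial>lebesgue_on {0<..<r})"
        if w: "integrable ?N w" "integrable ?N (\<lambda>t. w t * p t)" for w
      proof -
        have wr: "integrable (lebesgue_on {0<..<r}) w"
          by (rule integrable_lebesgue_on_Ioo_mono[OF w(1)]) (use r in auto)
        have "(\<integral>t. w t \<partial>?N) - (\<integral>t. w t \<partial>lebesgue_on {0<..<r})
            = (\<integral>t. indicat_real {0<..<\<tau>} t * w t - indicat_real {0<..<r} t * w t \<partial>lebesgue)"
          using w(1) wr by (simp add: integral_restrict_space integrable_restrict_space)
        also have "\<dots> = (\<integral>t. indicat_real {0<..<\<tau>} t * (w t * p t) \<partial>lebesgue)"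
        proof (rule integral_cong_AE)
          show "(\<lambda>t. indicat_real {0<..<\<tau>} t * w t - indicat_real {0<..<r} t * w t) \<in> borel_measurable lebesgue"
            using w(1) wr by (intro borel_measurable_diff) (auto simp: integrable_restrict_space)
          show "(\<lambda>t. indicat_real {0<..<\<tau>} t * (w t * p t)) \<in> borel_measurable lebesgue"
            using w(2) by (auto simp: integrable_restrict_space)
          show "AE t in lebesgue. indicat_real {0<..<\<tau>} t * w t - indicat_real {0<..<r} t * w t = indicat_real {0<..<\<tau>} t * (w t * p t)"
            using AE_completion[OF AE_lborel_singleton[of r]]
            by eventually_elim (use r in \<open>auto simp: p_def split: split_indicator\<close>)
        qed
        also have "\<dots> = (\<integral>t. w t * p t \<partial>?N)"
          by (simp add: integral_restrict_space)
        finally show ?thesis ..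
      qed
      have "\<bar>(\<integral>s. u1 s \<partial>?N) - (\<integral>s. u2 s \<partial>?N)\<bar> \<le> \<delta>" by (rule \<delta>[OF \<tau>])
      moreover have "\<bar>(\<integral>s. u1 s \<partial>lebesgue_on {0<..<r}) - (\<integral>s. u2 s \<partial>lebesgue_on {0<..<r})\<bar> \<le> \<delta>"
        by (rule \<delta>) (use r \<tau> in auto)
      ultimately show ?thesis
        unfolding split[OF ui(1) upi(1)] split[OF ui(2) upi(2)] by linarith
    qed
    moreover note mass_functional_Lipschitz[OF um u1(3) \<rho>0 p1(1) p2(1) p1(2) p2(2) _ \<tau>0(2) W]
    ultimately show ?thesis
      using \<tau>0 m1[OF \<tau>0 p1] m2[OF \<tau>0 p2] unfolding p_def by linarith
  qed
  have "\<bar>W1 t - W2 t\<bar> \<le> 2 * \<delta> * exp (QC Lu R0 * (t - 0))"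
    by (rule gronwall[where f = "\<lambda>t. \<bar>W1 t - W2 t\<bar>", OF _ Q step t]) (intro continuous_intros W)
  also have "\<dots> \<le> 2 * \<delta> * exp (QC Lu R0 * T)"
    using t \<delta>0 Q by (intro mult_left_mono) (auto intro: mult_left_mono)
  finally show ?thesis .
qed

end

subsection \<open>Existence of the out-flux\<close>

lemma measurable_lebesgue_on_Ioo_mono:
  fixes f :: "real \<Rightarrow> real"
  assumes "f \<in> borel_measurable (lebesgue_on {a<..<b})" "a \<le> c" "d \<le> b"
  shows "f \<in> borel_measurable (lebesgue_on {c<..<d})"
proof -
  have "f \<in> borel_measurable (restrict_space (lebesgue_on {a<..<b}) {c<..<d})"
    by (rule measurable_restrict_space1[OF assms(1)])
  moreover have "{a<..<b} \<inter> {c<..<d} = {c<..<d}" using assms(2,3) by auto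
  ultimately show ?thesis by (simp add: restrict_restrict_space)
qed

lemma AE_lebesgue_on_Ioo_mono:
  fixes a b c d :: real
  assumes "AE x in lebesgue_on {a<..<b}. P x" "a \<le> c" "d \<le> b"
  shows "AE x in lebesgue_on {c<..<d}. P x"
proof -
  have "AE x in lebesgue. x \<in> {a<..<b} \<longrightarrow> P x" using assms(1) by (simp add: AE_restrict_space_iff)
  then show ?thesis by (subst AE_restrict_space_iff) (use assms(2,3) in \<open>auto elim!: eventually_mono\<close>)
qed

text \<open>Once \<open>W\<close> is the mass of \<open>rho\<close>, the equation with prescribed
  \<open>W\<close> is the nonlocal one. The data \<open>v\<close> and \<open>r\<close> may differ
  from the Borel data on null sets; \<open>rho\<close> is its own representative for the
  trace.\<close>

lemma (in transport) rho_weak_solution: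
  assumes W: "\<And>t. t \<in> {0..T} \<Longrightarrow> total_mass rho t = W t"
    and agree: "\<And>x t. x \<in> {0..1} \<Longrightarrow> t \<in> {0..T} \<Longrightarrow> lam x (W t) = l x (W t)"
    and v: "AE t in lebesgue_on {0<..<T}. v t = u t" "v \<in> borel_measurable (lebesgue_on {0<..<T})"
    and r: "AE x in I01. r x = \<rho>0 x" "r \<in> borel_measurable I01"
  shows "weak_solution lam T r v rho"
    "is_outflux lam T r v (\<lambda>t. rho t 1 * lam 1 (total_mass rho t))"
proof -
  have nn: "0 \<le> total_mass rho t" if "t \<in> {0..T}" for t
    unfolding total_mass_def using rho_bounds[OF that] by (intro integral_nonneg_AE) auto
  have eq: "(\<integral>t. (\<integral>x. rho t x * (\<phi>t t x + lam x (total_mass rho t) * \<phi>x t x) \<partial>I01) \<partial>lebesgue_on {0<..<\<sigma>})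
        + (\<integral>t. v t * \<phi> t 0 \<partial>lebesgue_on {0<..<\<sigma>}) + (\<integral>x. r x * \<phi> 0 x \<partial>I01) = 0"
    if \<sigma>: "\<sigma> \<in> {0..T}" and C1: "C1_partials ({0..\<sigma>} \<times> {0..1}) \<phi> \<phi>t \<phi>x"
      and bc: "\<forall>x\<in>{0..1}. \<phi> \<sigma> x = 0" "\<forall>t\<in>{0..\<sigma>}. \<phi> t 1 = 0" for \<sigma> \<phi> \<phi>t \<phi>x
  proof -
    have \<phi>c: "continuous_on ({0..\<sigma>} \<times> {0..1}) (\<lambda>(t, x). \<phi> t x)"
      unfolding continuous_on_eq_continuous_within
    proof
      fix p assume "p \<in> {0..\<sigma>} \<times> {0..1::real}"
      then obtain a b where p: "p = (a, b)" "(a, b) \<in> {0..\<sigma>} \<times> {0..1::real}" by (cases p) auto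
      then have "((\<lambda>(s, y). \<phi> s y) has_derivative (\<lambda>(h, k). \<phi>t a b * h + \<phi>x a b * k)) (at (a, b) within {0..\<sigma>} \<times> {0..1})"
        using C1 unfolding C1_partials_def by blast
      then show "continuous (at p within {0..\<sigma>} \<times> {0..1}) (\<lambda>(t, x). \<phi> t x)"
        unfolding p(1) by (rule has_derivative_continuous)
    qed
    have \<phi>0m: "(\<lambda>t. \<phi> t 0) \<in> borel_measurable (lebesgue_on {0<..<\<sigma>})"
      by (rule continuous_on_imp_measurable_lebesgue_on[OF continuous_on_pair_slices(2)[OF \<phi>c]]) auto
    have \<phi>1m: "\<phi> 0 \<in> borel_measurable I01"
      by (rule continuous_on_imp_measurable_lebesgue_on[OF continuous_on_pair_slices(1)[OF \<phi>c]]) (use \<sigma> in auto)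
    have vm: "v \<in> borel_measurable (lebesgue_on {0<..<\<sigma>})"
      by (rule measurable_lebesgue_on_Ioo_mono[OF v(2)]) (use \<sigma> in auto)
    have vae: "AE t in lebesgue_on {0<..<\<sigma>}. v t = u t"
      by (rule AE_lebesgue_on_Ioo_mono[OF v(1)]) (use \<sigma> in auto)
    have "(\<integral>t. (\<integral>x. rho t x * (\<phi>t t x + l x (W t) * \<phi>x t x) \<partial>I01) \<partial>lebesgue_on {0<..<\<sigma>})
        + (\<integral>t. u t * \<phi> t 0 \<partial>lebesgue_on {0<..<\<sigma>}) + (\<integral>x. \<rho>0 x * \<phi> 0 x \<partial>I01) = 0"
      by (rule rho_weak_equation[OF \<sigma> C1]) (use bc in auto)
    moreover have "(\<integral>t. (\<integral>x. rho t x * (\<phi>t t x + lam x (total_mass rho t) * \<phi>x t x) \<partial>I01) \<partial>lebesgue_on {0<..<\<sigma>})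
        = (\<integral>t. (\<integral>x. rho t x * (\<phi>t t x + l x (W t) * \<phi>x t x) \<partial>I01) \<partial>lebesgue_on {0<..<\<sigma>})"
      by (intro Bochner_Integration.integral_cong refl) (use \<sigma> in \<open>simp_all add: agree W\<close>)
    moreover have "(\<integral>t. v t * \<phi> t 0 \<partial>lebesgue_on {0<..<\<sigma>}) = (\<integral>t. u t * \<phi> t 0 \<partial>lebesgue_on {0<..<\<sigma>})"
    proof (rule integral_cong_AE)
      show "(\<lambda>t. v t * \<phi> t 0) \<in> borel_measurable (lebesgue_on {0<..<\<sigma>})"
        by (intro borel_measurable_times vm \<phi>0m)
      show "(\<lambda>t. u t * \<phi> t 0) \<in> borel_measurable (lebesgue_on {0<..<\<sigma>})"
        by (intro borel_measurable_times borel_imp_measurable_lebesgue_on u_borel \<phi>0m)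
      show "AE t in lebesgue_on {0<..<\<sigma>}. v t * \<phi> t 0 = u t * \<phi> t 0"
        using vae by eventually_elim simp
    qed
    moreover have "(\<integral>x. r x * \<phi> 0 x \<partial>I01) = (\<integral>x. \<rho>0 x * \<phi> 0 x \<partial>I01)"
    proof (rule integral_cong_AE)
      show "(\<lambda>t. r t * \<phi> 0 t) \<in> borel_measurable I01"
        by (intro borel_measurable_times r \<phi>1m)
      show "(\<lambda>t. \<rho>0 t * \<phi> 0 t) \<in> borel_measurable I01"
        by (intro borel_measurable_times borel_imp_measurable_lebesgue_on \<rho>0_borel \<phi>1m)
      show "AE x in I01. r x * \<phi> 0 x = \<rho>0 x * \<phi> 0 x"
        using r(1) by eventually_elim simp
    qed
    ultimately show ?thesis by simp
  qed
  show ws: "weak_solution lam T r v rho"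
    unfolding weak_solution_def
  proof (intro conjI ballI allI impI)
    show "Lp_continuous_on {0..T} I01 1 rho" by (rule rho_Lp_space) simp
    show "(\<lambda>(t, x). rho t x) \<in> Linf (lebesgue_on ({0<..<T} \<times> {0<..<1}))" by (rule rho_Linf)
  qed (use nn eq in blast)+
  show "is_outflux lam T r v (\<lambda>t. rho t 1 * lam 1 (total_mass rho t))"
    unfolding is_outflux_def
  proof (intro exI conjI allI impI)
    show "weak_solution lam T r v rho" by (rule ws)
    show "AE (t, x) in lebesgue_on ({0<..<T} \<times> {0<..<1}). rho t x = rho t x" by simp
    show "Lp_continuous_on {0..1} (lebesgue_on {0<..<T}) q (\<lambda>x t. rho t x)" if "1 \<le> q" for q
      by (rule rho_Lp_time[OF that])
  qed simp
qed

section \<open>The total mass as a fixed point, and the resulting out-flux\<close>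

context speed
begin

lemma transportI:
  assumes "continuous_on {0..T} W" "u \<in> borel_measurable borel" "\<And>t. 0 \<le> u t" "\<And>t. u t \<le> Lu"
    "\<rho>0 \<in> borel_measurable borel" "\<And>x. 0 \<le> \<rho>0 x" "\<And>x. \<rho>0 x \<le> R0"
  shows "transport l lx K c C T W u \<rho>0 Lu R0"
  by (intro transport.intro transport_axioms.intro flowI assms)

text \<open>By \<open>total_mass_rho\<close> and \<open>mass_functional_Lipschitz\<close> the mass
  of the density transported by \<open>W\<close> depends on \<open>W\<close> through its past only,
  so a fixed point exists on all of \<open>[0, T]\<close>.\<close>

lemma mass_fixed_point:
  assumes u: "u \<in> borel_measurable borel" "\<And>t. 0 \<le> u t" "\<And>t. u t \<le> Lu"
    and \<rho>0: "\<rho>0 \<in> borel_measurable borel" "\<And>x. 0 \<le> \<rho>0 x" "\<And>x. \<rho>0 x \<le> R0"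
  obtains W where "continuous_on {0..T} W" "\<And>t. t \<in> {0..T} \<Longrightarrow> total_mass (transport.rho l lx T W u \<rho>0) t = W t"
proof -
  have L0: "0 \<le> Lu" "0 \<le> R0" using u(2,3)[of 0] \<rho>0(2,3)[of 0] by linarith+
  show thesis
  proof (rule volterra_fixed_point[of "QC Lu R0" T "\<lambda>W. total_mass (transport.rho l lx T W u \<rho>0)"])
    show "0 \<le> QC Lu R0" by (rule QC_nonneg[OF L0])
    show "continuous_on {0..T} (total_mass (transport.rho l lx T W u \<rho>0))" if "continuous_on {0..T} W" for W
    proof -
      interpret transport l lx K c C T W u \<rho>0 Lu R0 by (rule transportI[OF that u \<rho>0])
      show ?thesis by (rule total_mass_continuous_on[OF rho_Lp_space]) simp
    qed
    show "\<bar>total_mass (transport.rho l lx T W1 u \<rho>0) t - total_mass (transport.rho l lx T W2 u \<rho>0) t\<bar>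
        \<le> QC Lu R0 * integral {0..t} (\<lambda>s. \<bar>W1 s - W2 s\<bar>)"
      if W: "continuous_on {0..T} W1" "continuous_on {0..T} W2" and t: "t \<in> {0..T}" for W1 W2 t
    proof -
      interpret F1: transport l lx K c C T W1 u \<rho>0 Lu R0 by (rule transportI[OF W(1) u \<rho>0])
      interpret F2: transport l lx K c C T W2 u \<rho>0 Lu R0 by (rule transportI[OF W(2) u \<rho>0])
      have p1: "path W1 t (\<lambda>s. F1.X s (F1.Z t 1))" by (rule path_subset[OF F1.X_path]) (use t in auto)
      have p2: "path W2 t (\<lambda>s. F2.X s (F2.Z t 1))" by (rule path_subset[OF F2.X_path]) (use t in auto)
      have "\<bar>(\<integral>s. u s * (if 0 < F1.X s (F1.Z t 1) then 1 else 0) \<partial>lebesgue_on {0<..<t})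
            + (\<integral>x. \<rho>0 x * (if x < F1.X 0 (F1.Z t 1) then 1 else 0) \<partial>I01)
          - ((\<integral>s. u s * (if 0 < F2.X s (F2.Z t 1) then 1 else 0) \<partial>lebesgue_on {0<..<t})
            + (\<integral>x. \<rho>0 x * (if x < F2.X 0 (F2.Z t 1) then 1 else 0) \<partial>I01))\<bar>
          \<le> QC Lu R0 * integral {0..t} (\<lambda>s. \<bar>W1 s - W2 s\<bar>)"
        by (rule mass_functional_Lipschitz[OF _ _ L0(1) _ _ L0(2) p1 p2 _ _ _ _ W])
           (use t u \<rho>0 in \<open>auto intro!: borel_imp_measurable_lebesgue_on\<close>)
      then show ?thesis using F1.total_mass_rho[OF t] F2.total_mass_rho[OF t] by simp
    qed
  qed (use that in blast)
qed

text \<open>Clamping between \<open>0\<close> and \<open>L\<close> gives the bounds at every point,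
  as the locale \<open>transport\<close> demands.\<close>

lemma Linf_plus_Borel_version:
  fixes a b :: real
  assumes u: "u \<in> Linf_plus (lebesgue_on {a<..<b})" "AE x in lebesgue_on {a<..<b}. \<bar>u x\<bar> \<le> L" and L: "0 \<le> L"
  obtains v where "v \<in> borel_measurable borel" "\<And>x. 0 \<le> v x" "\<And>x. v x \<le> L" "AE x in lebesgue_on {a<..<b}. u x = v x"
proof -
  have um: "u \<in> borel_measurable (lebesgue_on {a<..<b})" and u0: "AE x in lebesgue_on {a<..<b}. 0 \<le> u x"
    using u by (auto simp: Linf_plus_def Linf_def)
  obtain w where w: "w \<in> borel_measurable borel" "AE x in lebesgue. x \<in> {a<..<b} \<longrightarrow> u x = w x"
    by (rule lebesgue_on_Borel_version[OF um]) auto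
  define v where "v x = max 0 (min L (w x))" for x
  show thesis
  proof (rule that)
    show "v \<in> borel_measurable borel" unfolding v_def[abs_def] using w(1) by simp
    have "AE x in lebesgue_on {a<..<b}. u x = w x" using w(2) by (simp add: AE_restrict_space_iff)
    then show "AE x in lebesgue_on {a<..<b}. u x = v x"
      using u0 u(2) by eventually_elim (auto simp: v_def)
  qed (use L in \<open>auto simp: v_def\<close>)
qed

text \<open>The constant is \<open>Mg * E * C\<close>, the product of the bounds for the label
  density, the Jacobian and the speed. The bound concerns the explicit out-flux; any other one is
  identified with it later.\<close>

lemma outflux_exists:
  assumes agree: "\<And>x w. x \<in> {0..1} \<Longrightarrow> 0 \<le> w \<Longrightarrow> w \<le> Wm \<Longrightarrow> lam x w = l x w"
    and u: "u \<in> Linf_plus (lebesgue_on {0<..<T})" "AE x in lebesgue_on {0<..<T}. \<bar>u x\<bar> \<le> Lu" "0 \<le> Lu"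
    and \<rho>0: "\<rho>0 \<in> Linf_plus I01" "AE x in I01. \<bar>\<rho>0 x\<bar> \<le> R0" "0 \<le> R0"
    and Wm: "R0 + Lu * T \<le> Wm"
  shows "\<exists>y. is_outflux lam T \<rho>0 u y \<and> (\<forall>t\<in>{0<..<T}. \<bar>y t\<bar> \<le> max R0 (Lu * E / c) * E * C)"
proof -
  obtain u' where u': "u' \<in> borel_measurable borel" "\<And>x. 0 \<le> u' x" "\<And>x. u' x \<le> Lu" "AE x in lebesgue_on {0<..<T}. u x = u' x"
    using Linf_plus_Borel_version[OF u] by blast
  obtain r where r: "r \<in> borel_measurable borel" "\<And>x. 0 \<le> r x" "\<And>x. r x \<le> R0" "AE x in I01. \<rho>0 x = r x"
    using Linf_plus_Borel_version[OF \<rho>0] by blast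
  obtain W where W: "continuous_on {0..T} W" "\<And>t. t \<in> {0..T} \<Longrightarrow> total_mass (transport.rho l lx T W u' r) t = W t"
    using mass_fixed_point[OF u'(1-3) r(1-3)] by blast
  interpret transport l lx K c C T W u' r Lu R0 by (rule transportI[OF W(1) u'(1-3) r(1-3)])
  \<comment> \<open>The fixed point belongs to the extended velocity; the bound on its mass shows
    that \<open>l\<close> is evaluated only where it agrees with \<open>lam\<close>.\<close>
  have W0: "0 \<le> W t \<and> W t \<le> Wm" if t: "t \<in> {0..T}" for t
  proof
    have "0 \<le> total_mass rho t"
      unfolding total_mass_def using rho_bounds[OF t] by (intro integral_nonneg_AE) auto
    then show "0 \<le> W t" using W(2)[OF t] by simp
    have b: "(\<integral>x. f x * p x \<partial>lebesgue_on {0<..<b}) \<le> B * b"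
      if "f \<in> borel_measurable borel" "p \<in> borel_measurable (lebesgue_on {0<..<b})" "\<And>x. 0 \<le> f x" "\<And>x. f x \<le> B" "\<And>x. p x \<in> {0..1}" "0 \<le> b"
      for f p :: "real \<Rightarrow> real" and B b
    proof -
      interpret finite_measure "lebesgue_on {0<..<b}" by (rule finite_measure_lebesgue_on_Ioo)
      have le: "0 \<le> f x * p x" "f x * p x \<le> B" for x
        using mult_mono[of "f x" B "p x" 1] that(3,4,5)[of x] by auto
      have "(\<integral>x. f x * p x \<partial>lebesgue_on {0<..<b}) \<le> (\<integral>x. B \<partial>lebesgue_on {0<..<b})"
      proof (rule integral_mono)
        show "integrable (lebesgue_on {0<..<b}) (\<lambda>x. f x * p x)"
          by (rule integrable_lebesgue_on_Ioo_bounded[where C = B])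
             (use le borel_measurable_times[OF borel_imp_measurable_lebesgue_on[OF that(1)] that(2)] in auto)
      qed (use le in auto)
      then show ?thesis using that(6) by (simp add: measure_restrict_space mult.commute)
    qed
    have "(\<lambda>s. X s (Z t 1)) \<in> borel_measurable (lebesgue_on {0<..<t})"
      by (rule continuous_on_imp_measurable_lebesgue_on[OF path_cont[OF X_path]]) (use t in auto)
    then have m: "(\<lambda>s. if 0 < X s (Z t 1) then 1 else (0::real)) \<in> borel_measurable (lebesgue_on {0<..<t})" by simp
    have "W t \<le> Lu * t + R0 * 1"
      unfolding W(2)[OF t, symmetric] total_mass_rho[OF t]
      by (intro add_mono b u' r m borel_imp_measurable_lebesgue_on) (use t in auto)
    also have "\<dots> \<le> Wm" using Wm mult_left_mono[of t T Lu] t u(3) by auto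
    finally show "W t \<le> Wm" .
  qed
  have ag: "lam x (W t) = l x (W t)" if "x \<in> {0..1}" "t \<in> {0..T}" for x t
    using agree[of x "W t"] W0[OF that(2)] that by blast
  have "is_outflux lam T \<rho>0 u (\<lambda>t. rho t 1 * lam 1 (total_mass rho t))"
    by (rule rho_weak_solution(2)[OF W(2) ag u'(4) _ r(4)]) (use u \<rho>0 in \<open>auto simp: Linf_plus_def Linf_def\<close>)
  moreover have "\<bar>rho t 1 * lam 1 (total_mass rho t)\<bar> \<le> max R0 (Lu * E / c) * E * C" if t: "t \<in> {0<..<T}" for t
  proof -
    have t': "t \<in> {0..T}" using t by auto
    have "\<bar>lam 1 (total_mass rho t)\<bar> \<le> C"
      using ag[of 1 t] W(2)[OF t'] t' l_hi[of 1 "W t"] l_lo[of 1 "W t"] c_pos by simp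
    then show ?thesis
      unfolding abs_mult using rho_bounds[OF t', of 1] Mg_nonneg E_pos
      by (intro mult_mono) (auto simp: Mg_def)
  qed
  ultimately show ?thesis by blast
qed

end

subsection \<open>Extension of the velocity\<close>

lemma has_real_derivative_within_Un:
  "(f has_real_derivative d) (at x within S) \<Longrightarrow> (f has_real_derivative d) (at x within U) \<Longrightarrow>
    (f has_real_derivative d) (at x within S \<union> U)"
  unfolding has_field_derivative_iff by (rule Lim_Un)

lemma has_real_derivative_within_closed_notin:
  "closed S \<Longrightarrow> x \<notin> S \<Longrightarrow> (f has_real_derivative d) (at x within S)"
  using not_in_closure_trivial_limitI[of x S] by (simp add: has_field_derivative_iff trivial_limit_def[symmetric])

text \<open>Outside \<open>[0, 1]\<close> the velocity is continued by a bounded odd reflection, which keeps it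
  \<open>C\<^sup>1\<close> in \<open>x\<close>, positive and Lipschitz in \<open>w\<close>.\<close>

lemma speed_extension:
  assumes C1: "C1_on ({0..1} \<times> {0..}) lam"
    and pos: "\<And>x w. x \<in> {0..1} \<Longrightarrow> 0 \<le> w \<Longrightarrow> 0 < lam x w" and T: "0 < T" and Wm: "0 \<le> Wm"
  obtains l lx K c C where "speed l lx K c C T"
    "\<And>x w. x \<in> {0..1} \<Longrightarrow> 0 \<le> w \<Longrightarrow> w \<le> Wm \<Longrightarrow> lam x w = l x w"
proof -
  let ?S = "{0..1} \<times> {0..} :: (real \<times> real) set" and ?R = "{0..1} \<times> {0..Wm} :: (real \<times> real) set"
  obtain l1 l2 where c1: "continuous_on ?S (\<lambda>(a, b). l1 a b)" and c2: "continuous_on ?S (\<lambda>(a, b). l2 a b)"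
    and d: "\<And>a b. (a, b) \<in> ?S \<Longrightarrow> ((\<lambda>(s, y). lam s y) has_derivative (\<lambda>(h, k). l1 a b * h + l2 a b * k)) (at (a, b) within ?S)"
    using C1 unfolding C1_on_def C1_partials_def by blast
  have R: "compact ?R" "?R \<subseteq> ?S" by (auto intro: compact_Times)
  have cl: "continuous_on ?S (\<lambda>(a, b). lam a b)"
    unfolding continuous_on_eq_continuous_within
  proof
    fix p assume "p \<in> ?S"
    then show "continuous (at p within ?S) (\<lambda>(a, b). lam a b)"
      using has_derivative_continuous[OF d] by (cases p) auto
  qed
  have bd: "\<exists>B>0. \<forall>a\<in>{0..1}. \<forall>b\<in>{0..Wm}. \<bar>f a b\<bar> \<le> B" if "continuous_on ?S (\<lambda>(a, b). f a b)" for f :: "real \<Rightarrow> real \<Rightarrow> real"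
  proof -
    have "bounded ((\<lambda>(a, b). f a b) ` ?R)"
      by (intro compact_imp_bounded compact_continuous_image continuous_on_subset[OF that R(2)] R)
    then show ?thesis by (fastforce simp: bounded_pos)
  qed
  obtain L1 where L1: "0 < L1" "\<And>a b. a \<in> {0..1} \<Longrightarrow> b \<in> {0..Wm} \<Longrightarrow> \<bar>l1 a b\<bar> \<le> L1" using bd[OF c1] by blast
  obtain L2 where L2: "0 < L2" "\<And>a b. a \<in> {0..1} \<Longrightarrow> b \<in> {0..Wm} \<Longrightarrow> \<bar>l2 a b\<bar> \<le> L2" using bd[OF c2] by blast
  obtain C0 where C0: "0 < C0" "\<And>a b. a \<in> {0..1} \<Longrightarrow> b \<in> {0..Wm} \<Longrightarrow> \<bar>lam a b\<bar> \<le> C0" using bd[OF cl] by blast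
  obtain c0 where c0: "0 < c0" "\<And>a b. a \<in> {0..1} \<Longrightarrow> b \<in> {0..Wm} \<Longrightarrow> c0 \<le> lam a b"
  proof -
    have "?R \<noteq> {}" using Wm by auto
    from continuous_attains_inf[OF R(1) this continuous_on_subset[OF cl R(2)]]
    obtain a b where ab: "(a, b) \<in> ?R" "\<And>p. p \<in> ?R \<Longrightarrow> lam a b \<le> (case p of (a, b) \<Rightarrow> lam a b)" by force
    show thesis
    proof (rule that[of "lam a b"])
      show "0 < lam a b" using ab(1) by (intro pos) auto
      show "lam a b \<le> lam x w" if "x \<in> {0..1}" "w \<in> {0..Wm}" for x w using ab(2)[of "(x, w)"] that by auto
    qed
  qed
  define L where "L = max L1 L2"
  have L: "0 < L" "L1 \<le> L" "L2 \<le> L" using L1 by (auto simp: L_def)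
  have dx: "((\<lambda>x. lam x w) has_real_derivative l1 x w) (at x within {0..1})" if "x \<in> {0..1}" "0 \<le> w" for x w
  proof -
    have g: "((\<lambda>x. (x, w)) has_derivative (\<lambda>h. (h, 0))) (at x within {0..1})"
      by (intro has_derivative_Pair has_derivative_ident has_derivative_const)
    have "((\<lambda>(s, y). lam s y) has_derivative (\<lambda>(h, k). l1 x w * h + l2 x w * k)) (at (x, w) within (\<lambda>x. (x, w)) ` {0..1})"
      by (rule has_derivative_subset[OF d]) (use that in auto)
    from has_derivative_in_compose[OF g this]
    show ?thesis by (simp add: has_field_derivative_def)
  qed
  have dw: "((\<lambda>w. lam x w) has_real_derivative l2 x w) (at w within {0..Wm})" if "x \<in> {0..1}" "w \<in> {0..Wm}" for x w
  proof -
    have g: "((\<lambda>w. (x, w)) has_derivative (\<lambda>h. (0, h))) (at w within {0..Wm})"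
      by (intro has_derivative_Pair has_derivative_ident has_derivative_const)
    have "((\<lambda>(s, y). lam s y) has_derivative (\<lambda>(h, k). l1 x w * h + l2 x w * k)) (at (x, w) within (\<lambda>w. (x, w)) ` {0..Wm})"
      by (rule has_derivative_subset[OF d]) (use that in auto)
    from has_derivative_in_compose[OF g this]
    show ?thesis by (simp add: has_field_derivative_def)
  qed
  have Lx: "\<bar>lam x w - lam x' w\<bar> \<le> L * \<bar>x - x'\<bar>" if "x \<in> {0..1}" "x' \<in> {0..1}" "w \<in> {0..Wm}" for x x' w
  proof -
    have "norm (lam x w - lam x' w) \<le> L * norm (x - x')"
    proof (rule field_differentiable_bound[where S = "{0..1}" and f = "\<lambda>x. lam x w" and f' = "\<lambda>x. l1 x w"])
      show "((\<lambda>x. lam x w) has_field_derivative l1 z w) (at z within {0..1})" if "z \<in> {0..1}" for z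
        using dx[OF that, of w] \<open>w \<in> {0..Wm}\<close> by simp
      show "norm (l1 z w) \<le> L" if "z \<in> {0..1}" for z
        using L1(2)[OF that \<open>w \<in> {0..Wm}\<close>] L(2) by simp
    qed (use that in auto)
    then show ?thesis by simp
  qed
  have Lw: "\<bar>lam x w - lam x w'\<bar> \<le> L * \<bar>w - w'\<bar>" if "x \<in> {0..1}" "w \<in> {0..Wm}" "w' \<in> {0..Wm}" for x w w'
  proof -
    have "norm (lam x w - lam x w') \<le> L * norm (w - w')"
    proof (rule field_differentiable_bound[where S = "{0..Wm}" and f = "\<lambda>w. lam x w" and f' = "\<lambda>w. l2 x w"])
      show "((\<lambda>w. lam x w) has_field_derivative l2 x z) (at z within {0..Wm})" if "z \<in> {0..Wm}" for z
        by (rule dw[OF \<open>x \<in> {0..1}\<close> that])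
      show "norm (l2 x z) \<le> L" if "z \<in> {0..Wm}" for z
        using L2(2)[OF \<open>x \<in> {0..1}\<close> that] L(3) by simp
    qed (use that in auto)
    then show ?thesis by simp
  qed
  \<comment> \<open>A reflection depth so small that the velocity varies by at most
    \<open>c0 / 2\<close> over it, which keeps the continuation above \<open>c0 / 2\<close>.\<close>
  define \<delta> where "\<delta> = min 1 (c0 / (2 * L))"
  have \<delta>: "0 < \<delta>" "\<delta> \<le> 1" "L * \<delta> \<le> c0 / 2"
  proof -
    have "L * \<delta> \<le> L * (c0 / (2 * L))" unfolding \<delta>_def using L by (intro mult_left_mono) auto
    then show "L * \<delta> \<le> c0 / 2" using L by simp
  qed (use c0 L in \<open>auto simp: \<delta>_def\<close>)
  \<comment> \<open>Clamping the mass keeps the Lipschitz bound in \<open>w\<close>, though not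
    differentiability; the locale \<open>speed\<close> asks only for the former.\<close>
  define cw where "cw w = max 0 (min Wm w)" for w
  have cw: "cw w \<in> {0..Wm}" "0 \<le> cw w" "\<bar>cw w - cw w'\<bar> \<le> \<bar>w - w'\<bar>" for w w' using Wm by (auto simp: cw_def)
  \<comment> \<open>The identity on \<open>[0, 1]\<close>; outside, the argument is folded back into
    the interval to a depth of at most \<open>\<delta>\<close>, with outer slope \<open>-1\<close>
    at both end points.\<close>
  define refl where "refl x = \<delta> * (1 - exp (min x 0 / \<delta>)) + max 0 (min 1 x) - \<delta> * (1 - exp (min (1 - x) 0 / \<delta>))" for x
  \<comment> \<open>The absolute value of the slope of \<open>refl\<close> on each piece. The minus
    sign of the odd reflection cancels that of the slope, so \<open>lx\<close> has one formula for
    all \<open>x\<close>.\<close>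
  define decay where "decay x = exp (min x 0 / \<delta>) * exp (min (1 - x) 0 / \<delta>)" for x
  have refl_cases: "x \<le> 0 \<Longrightarrow> refl x = \<delta> * (1 - exp (x / \<delta>))" "x \<in> {0..1} \<Longrightarrow> refl x = x"
    "1 \<le> x \<Longrightarrow> refl x = 1 - \<delta> * (1 - exp ((1 - x) / \<delta>))" for x
    by (auto simp: refl_def)
  have decay_cases: "x \<le> 0 \<Longrightarrow> decay x = exp (x / \<delta>)" "x \<in> {0..1} \<Longrightarrow> decay x = 1"
    "1 \<le> x \<Longrightarrow> decay x = exp ((1 - x) / \<delta>)" for x
    by (auto simp: decay_def)
  have ex: "0 \<le> \<delta> * (1 - exp (y / \<delta>))" "\<delta> * (1 - exp (y / \<delta>)) \<le> \<delta>"
    "\<delta> * (1 - exp (y / \<delta>)) \<le> 1" if "y \<le> 0" for y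
  proof -
    have "y / \<delta> \<le> 0" using that \<delta> by (simp add: divide_le_0_iff)
    then show "0 \<le> \<delta> * (1 - exp (y / \<delta>))" using \<delta> by simp
    show "\<delta> * (1 - exp (y / \<delta>)) \<le> \<delta>" using \<delta> by (simp add: algebra_simps)
    then show "\<delta> * (1 - exp (y / \<delta>)) \<le> 1" using \<delta> by linarith
  qed
  have refl01: "refl x \<in> {0..1}" for x
  proof -
    consider "x \<le> 0" | "x \<in> {0..1}" | "1 \<le> x" by fastforce
    then show ?thesis
      by cases (use refl_cases[of x] ex[of x] ex[of "1 - x"] \<delta> in auto)
  qed
  have decay01: "0 \<le> decay x" "decay x \<le> 1" for x
  proof -
    have "min x 0 / \<delta> \<le> 0" "min (1 - x) 0 / \<delta> \<le> 0" using \<delta> by (auto simp: divide_le_0_iff)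
    then show "0 \<le> decay x" "decay x \<le> 1" unfolding decay_def by (auto intro: mult_le_one)
  qed
  \<comment> \<open>Odd reflection about the boundary value, so that values and slopes match at
    \<open>0\<close> and \<open>1\<close>.\<close>
  define l where "l x w = (if x < 0 then 2 * lam 0 (cw w) - lam (refl x) (cw w)
      else if x \<le> 1 then lam x (cw w) else 2 * lam 1 (cw w) - lam (refl x) (cw w))" for x w
  define lx where "lx x w = l1 (refl x) (cw w) * decay x" for x w
  have chain: "((\<lambda>x. lam (refl x) (cw w)) has_real_derivative l1 (refl x) (cw w) * r) (at x within A)"
    if r: "(refl has_real_derivative r) (at x within A)" for x w r A
  proof -
    have "((\<lambda>x. lam x (cw w)) has_real_derivative l1 (refl x) (cw w)) (at (refl x) within refl ` A)"
      by (rule has_field_derivative_subset[OF dx[OF refl01 cw(2)]]) (use refl01 in blast)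
    from DERIV_image_chain[OF this r] show ?thesis by (simp add: o_def)
  qed
  \<comment> \<open>The derivative is verified within three closed pieces: away from a piece the
    claim is vacuous, and at \<open>0\<close> and \<open>1\<close> two pieces meet.\<close>
  have deriv: "((\<lambda>x. l x w) has_real_derivative lx x w) (at x)" for x w
  proof -
    have a: "((\<lambda>x. l x w) has_real_derivative lx x w) (at x within {..0})"
    proof (cases "x \<le> 0")
      case True
      have "((\<lambda>x. \<delta> * (1 - exp (x / \<delta>))) has_real_derivative - exp (x / \<delta>)) (at x within {..0})"
        using \<delta> by (auto intro!: derivative_eq_intros)
      then have "(refl has_real_derivative - exp (x / \<delta>)) (at x within {..0})"
        by (rule has_field_derivative_transform_within[OF _ zero_less_one]) (use True refl_cases in auto)
      from DERIV_diff[OF DERIV_const[of "2 * lam 0 (cw w)"] chain[OF this, of w]]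
      have "((\<lambda>x. 2 * lam 0 (cw w) - lam (refl x) (cw w)) has_real_derivative lx x w) (at x within {..0})"
        using True by (simp add: lx_def decay_cases)
      then show ?thesis
        by (rule has_field_derivative_transform_within[OF _ zero_less_one])
           (use True refl_cases(2)[of 0] in \<open>auto simp: l_def not_less\<close>)
    qed (rule has_real_derivative_within_closed_notin, auto)
    have b: "((\<lambda>x. l x w) has_real_derivative lx x w) (at x within {0..1})"
    proof (cases "x \<in> {0..1}")
      case True
      have "lx x w = l1 x (cw w)" using True by (simp add: lx_def refl_cases decay_cases)
      then have "((\<lambda>x. lam x (cw w)) has_real_derivative lx x w) (at x within {0..1})"
        using dx[OF True cw(2)[of w]] by simp
      then show ?thesis
        by (rule has_field_derivative_transform_within[OF _ zero_less_one])
           (use True in \<open>auto simp: l_def\<close>)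
    qed (rule has_real_derivative_within_closed_notin, auto)
    have c: "((\<lambda>x. l x w) has_real_derivative lx x w) (at x within {1..})"
    proof (cases "1 \<le> x")
      case True
      have "((\<lambda>x. 1 - \<delta> * (1 - exp ((1 - x) / \<delta>))) has_real_derivative - exp ((1 - x) / \<delta>)) (at x within {1..})"
        using \<delta> by (auto intro!: derivative_eq_intros)
      then have "(refl has_real_derivative - exp ((1 - x) / \<delta>)) (at x within {1..})"
        by (rule has_field_derivative_transform_within[OF _ zero_less_one]) (use True refl_cases in auto)
      from DERIV_diff[OF DERIV_const[of "2 * lam 1 (cw w)"] chain[OF this, of w]]
      have "((\<lambda>x. 2 * lam 1 (cw w) - lam (refl x) (cw w)) has_real_derivative lx x w) (at x within {1..})"
        using True by (simp add: lx_def decay_cases)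
      then show ?thesis
        by (rule has_field_derivative_transform_within[OF _ zero_less_one])
           (use True refl_cases(2)[of 1] in \<open>auto simp: l_def\<close>)
    qed (rule has_real_derivative_within_closed_notin, auto)
    have "{..0} \<union> {0..1} \<union> {1..} = (UNIV :: real set)" by auto
    then show ?thesis
      using has_real_derivative_within_Un[OF has_real_derivative_within_Un[OF a b] c] by simp
  qed
  \<comment> \<open>A value of \<open>l\<close> combines values of \<open>lam\<close> with
    coefficients of total size at most three, hence \<open>3 * L\<close> and
    \<open>3 * C0\<close>.\<close>
  have "speed l lx (3 * L) (c0 / 2) (3 * C0) T"
  proof
    show "((\<lambda>x. l x w) has_real_derivative lx x w) (at x)" for x w by (rule deriv)
    show "continuous_on UNIV (\<lambda>(x, w). lx x w)"
    proof -
      have "continuous_on UNIV (\<lambda>p. (refl (fst p), cw (snd p)))"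
        unfolding refl_def cw_def using \<delta> by (intro continuous_intros) auto
      moreover have "(\<lambda>p. (refl (fst p), cw (snd p))) ` UNIV \<subseteq> ?S" using refl01 cw by auto
      ultimately have "continuous_on UNIV (\<lambda>p. case (refl (fst p), cw (snd p)) of (a, b) \<Rightarrow> l1 a b)"
        by (rule continuous_on_compose2[OF c1])
      moreover have "continuous_on UNIV (\<lambda>p :: real \<times> real. decay (fst p))"
        unfolding decay_def using \<delta> by (intro continuous_intros) auto
      ultimately have "continuous_on UNIV (\<lambda>p. (case (refl (fst p), cw (snd p)) of (a, b) \<Rightarrow> l1 a b) * decay (fst p))"
        by (rule continuous_on_mult)
      then show ?thesis by (simp add: lx_def split_beta)
    qed
    show "\<bar>lx x w\<bar> \<le> 3 * L" for x w
    proof -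
      have "\<bar>l1 (refl x) (cw w)\<bar> * \<bar>decay x\<bar> \<le> L * 1"
        using L1(2)[OF refl01 cw(1), of x w] L decay01[of x] by (intro mult_mono) auto
      then show ?thesis using L by (simp add: lx_def abs_mult)
    qed
    show "\<bar>l x w - l x w'\<bar> \<le> 3 * L * \<bar>w - w'\<bar>" for x w w'
    proof -
      have e: "\<bar>lam y (cw w) - lam y (cw w')\<bar> \<le> L * \<bar>w - w'\<bar>" if "y \<in> {0..1}" for y
        using Lw[OF that cw(1) cw(1), of w w'] mult_left_mono[OF cw(3)[of w w'], of L] L by linarith
      have "0 \<le> L * \<bar>w - w'\<bar>" using L by simp
      then show ?thesis
        using e[of 0] e[of 1] e[of x] e[OF refl01[of x]] unfolding l_def
        by (cases "x < 0"; cases "x \<le> 1") (auto simp: abs_le_iff)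
    qed
    have near: "lam (refl x) (cw w) \<le> lam 0 (cw w) + c0 / 2" if "x < 0" for x w
    proof -
      have "\<bar>refl x - 0\<bar> \<le> \<delta>" using refl_cases(1)[of x] ex[of x] that by auto
      then have "L * \<bar>refl x - 0\<bar> \<le> L * \<delta>" using L by (intro mult_left_mono) auto
      moreover have "\<bar>lam (refl x) (cw w) - lam 0 (cw w)\<bar> \<le> L * \<bar>refl x - 0\<bar>"
        by (rule Lx[OF refl01 _ cw(1)]) simp
      ultimately show ?thesis using \<delta>(3) by linarith
    qed
    have near1: "lam (refl x) (cw w) \<le> lam 1 (cw w) + c0 / 2" if "1 < x" for x w
    proof -
      have "\<bar>refl x - 1\<bar> \<le> \<delta>" using refl_cases(3)[of x] ex[of "1 - x"] that by auto
      then have "L * \<bar>refl x - 1\<bar> \<le> L * \<delta>" using L by (intro mult_left_mono) auto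
      moreover have "\<bar>lam (refl x) (cw w) - lam 1 (cw w)\<bar> \<le> L * \<bar>refl x - 1\<bar>"
        by (rule Lx[OF refl01 _ cw(1)]) simp
      ultimately show ?thesis using \<delta>(3) by linarith
    qed
    show "c0 / 2 \<le> l x w" for x w
      using c0(2)[of 0 "cw w"] c0(2)[of 1 "cw w"] c0(2)[of x "cw w"] near[of x w] near1[of x w] cw(1)[of w] c0(1)
      by (auto simp: l_def abs_le_iff not_less not_le)
    show "l x w \<le> 3 * C0" for x w
      using C0(2)[of 0 "cw w"] C0(2)[of 1 "cw w"] C0(2)[of x "cw w"] C0(2)[OF refl01[of x] cw(1)[of w]] cw(1)[of w] C0(1)
      by (auto simp: l_def abs_le_iff not_less not_le)
  qed (use c0 T in auto)
  moreover have "lam x w = l x w" if "x \<in> {0..1}" "0 \<le> w" "w \<le> Wm" for x w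
    using that by (simp add: l_def cw_def)
  ultimately show thesis by (rule that)
qed

subsection \<open>Dependence of the out-flux on the in-flux\<close>

text \<open>Let \<open>h\<close> be a Borel version of \<open>f\<close>. In \<open>ennreal\<close>,
  where negative values become zero, \<open>h\<close> and \<open>- h\<close> are densities of two
  measures that agree and are finite on half-lines, because the integrals of \<open>h\<close> over
  half-lines vanish. So \<open>ennreal (h x) = ennreal (- h x)\<close> almost everywhere, which
  forces \<open>h x = 0\<close>.\<close>

lemma AE_zero_of_primitive_zero:
  fixes f :: "real \<Rightarrow> real"
  assumes f: "integrable (lebesgue_on {0<..<T}) f" and T: "0 \<le> T"
    and prim: "\<And>s. s \<in> {0..T} \<Longrightarrow> integral\<^sup>L (lebesgue_on {0<..<s}) f = 0"
  shows "AE x in lebesgue_on {0<..<T}. f x = 0"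
proof -
  let ?M = "lebesgue_on {0<..<T}"
  have S: "{0<..<T} \<in> sets lebesgue" by simp
  obtain g where g: "g \<in> borel_measurable borel" "AE x in lebesgue. x \<in> {0<..<T} \<longrightarrow> f x = g x"
    by (rule lebesgue_on_Borel_version[OF borel_measurable_integrable[OF f] S])
  define h where "h x = indicat_real {0<..<T} x * g x" for x
  have hm: "h \<in> borel_measurable borel" unfolding h_def[abs_def] using g(1) by simp
  have fh: "AE x in lborel. x \<in> {0<..<T} \<longrightarrow> f x = h x"
    using g(2) unfolding AE_completion_iff by eventually_elim (simp add: h_def)
  have hi: "integrable lborel h"
  proof -
    have "integrable lebesgue (\<lambda>x. indicat_real {0<..<T} x * f x)"
      using f by (simp add: integrable_restrict_space)
    then have "integrable lebesgue h"
    proof (rule Bochner_Integration.integrable_cong_AE_imp)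
      show "AE x in lebesgue. indicat_real {0<..<T} x * f x = h x"
        using g(2) by eventually_elim (simp add: h_def split: split_indicator)
    qed (use hm in \<open>simp add: measurable_completion\<close>)
    then show ?thesis using hm by (simp add: integrable_completion)
  qed
  have below: "(\<integral>x. indicat_real {..<s} x * h x \<partial>lborel) = 0" for s
  proof -
    define r where "r = max 0 (min s T)"
    have r: "r \<in> {0..T}" using T by (auto simp: r_def)
    have "integral\<^sup>L (lebesgue_on {0<..<r}) f = (\<integral>x. indicat_real {..<s} x * h x \<partial>lborel)"
    proof (rule integral_lebesgue_on_eq_lborel)
      show "f \<in> borel_measurable (lebesgue_on {0<..<r})"
        by (rule measurable_lebesgue_on_Ioo_mono[OF borel_measurable_integrable[OF f]]) (use r in auto)
      show "AE x in lborel. x \<in> {0<..<r} \<longrightarrow> f x = indicat_real {..<s} x * h x"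
        using fh by eventually_elim (auto simp: r_def)
      show "indicat_real {..<s} x * h x = 0" if "x \<notin> {0<..<r}" for x
        using that by (auto simp: r_def h_def split: split_indicator)
    qed (use hm in auto)
    then show ?thesis using prim[OF r] by simp
  qed
  have hT: "(\<integral>x. h x \<partial>lborel) = 0"
  proof -
    have "(\<integral>x. indicat_real {..<T} x * h x \<partial>lborel) = (\<integral>x. h x \<partial>lborel)"
      by (intro Bochner_Integration.integral_cong refl) (simp add: h_def split: split_indicator)
    then show ?thesis using below[of T] by simp
  qed
  have hs: "integrable lborel (\<lambda>x. indicat_real {s<..} x * h x)" for s
    using integrable_mult_indicator[of "{s<..}" lborel h] hi by simp
  have above: "(\<integral>x. indicat_real {s<..} x * h x \<partial>lborel) = 0" for s
  proof -
    have hb: "integrable lborel (\<lambda>x. indicat_real {..<s} x * h x)"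
      using integrable_mult_indicator[of "{..<s}" lborel h] hi by simp
    have "(\<integral>x. indicat_real {s<..} x * h x \<partial>lborel) = (\<integral>x. h x - indicat_real {..<s} x * h x \<partial>lborel)"
    proof (rule integral_cong_AE)
      show "AE x in lborel. indicat_real {s<..} x * h x = h x - indicat_real {..<s} x * h x"
        using AE_lborel_singleton[of s] by eventually_elim (auto split: split_indicator)
    qed (use hm in auto)
    also have "\<dots> = 0" using hi hb below hT by simp
    finally show ?thesis .
  qed
  have fin: "(\<integral>\<^sup>+x. ennreal (k x) \<partial>lborel) < \<infinity>" if "integrable lborel k" for k :: "real \<Rightarrow> real"
  proof -
    have "(\<integral>\<^sup>+x. ennreal (k x) \<partial>lborel) \<le> (\<integral>\<^sup>+x. ennreal (norm (k x)) \<partial>lborel)"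
      by (intro nn_integral_mono ennreal_leI) simp
    also have "\<dots> < \<infinity>" using that by (simp add: integrable_iff_bounded)
    finally show ?thesis .
  qed
  have dens: "emeasure (density lborel (\<lambda>x. ennreal (c * h x))) {s<..} = (\<integral>\<^sup>+x. ennreal (c * (indicat_real {s<..} x * h x)) \<partial>lborel)" for c s
    using hm by (subst emeasure_density) (auto intro!: nn_integral_cong split: split_indicator)
  have "density lborel (\<lambda>x. ennreal (1 * h x)) = density lborel (\<lambda>x. ennreal (- 1 * h x))"
  proof (rule measure_eqI_lessThan)
    fix s :: real
    show "emeasure (density lborel (\<lambda>x. ennreal (1 * h x))) {s<..} < \<infinity>"
      unfolding dens using fin[OF hs[of s]] by simp
    have f1: "(\<integral>\<^sup>+x. ennreal (indicat_real {s<..} x * h x) \<partial>lborel) < \<infinity>" by (rule fin[OF hs])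
    have "integrable lborel (\<lambda>x. - (indicat_real {s<..} x * h x))" using hs by (rule Bochner_Integration.integrable_minus)
    then have f2: "(\<integral>\<^sup>+x. ennreal (- (indicat_real {s<..} x * h x)) \<partial>lborel) < \<infinity>" by (rule fin)
    have "enn2real (\<integral>\<^sup>+x. ennreal (indicat_real {s<..} x * h x) \<partial>lborel)
        - enn2real (\<integral>\<^sup>+x. ennreal (- (indicat_real {s<..} x * h x)) \<partial>lborel) = 0"
      using real_lebesgue_integral_def[OF hs[of s]] above[of s] by simp
    then have "(\<integral>\<^sup>+x. ennreal (indicat_real {s<..} x * h x) \<partial>lborel)
        = (\<integral>\<^sup>+x. ennreal (- (indicat_real {s<..} x * h x)) \<partial>lborel)"
      using f1 f2 by (metis diff_eq_eq add_0 ennreal_enn2real infinity_ennreal_def)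
    then show "emeasure (density lborel (\<lambda>x. ennreal (1 * h x))) {s<..} = emeasure (density lborel (\<lambda>x. ennreal (- 1 * h x))) {s<..}"
      unfolding dens by simp
  qed auto
  then have "AE x in lborel. ennreal (1 * h x) = ennreal (- 1 * h x)"
    using hm by (intro sigma_finite_measure.density_unique[OF sigma_finite_lborel]) auto
  then have "AE x in lborel. x \<in> {0<..<T} \<longrightarrow> f x = 0"
    using fh
  proof eventually_elim
    case (elim x)
    have "h x = 0"
    proof (cases "0 \<le> h x")
      case True
      then have "ennreal (h x) = 0" using elim(1) by (simp add: ennreal_neg)
      then show ?thesis using True by simp
    next
      case False
      then have "ennreal (- h x) = 0" using elim(1) by (simp add: ennreal_neg)
      then show ?thesis using False by simp
    qed
    then show ?case using elim(2) by simp
  qed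
  then have "AE x in lebesgue. x \<in> {0<..<T} \<longrightarrow> f x = 0" by (rule AE_completion)
  then show ?thesis by (simp add: AE_restrict_space_iff)
qed

lemma integral_primitive_bounds:
  assumes v: "v \<in> Linf_plus (lebesgue_on {0<..<T})" "AE x in lebesgue_on {0<..<T}. \<bar>v x\<bar> \<le> L" and L: "0 \<le> L"
    and st: "0 \<le> s" "s \<le> t" "t \<le> T"
  shows "integral\<^sup>L (lebesgue_on {0<..<s}) v \<le> integral\<^sup>L (lebesgue_on {0<..<t}) v"
    "integral\<^sup>L (lebesgue_on {0<..<t}) v - integral\<^sup>L (lebesgue_on {0<..<s}) v \<le> L * (t - s)"
proof -
  have vi: "integrable (lebesgue_on {0<..<T}) v" and v0: "AE x in lebesgue_on {0<..<T}. 0 \<le> v x"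
    using v(1) LinfD by (auto simp: Linf_plus_def)
  have i: "integrable (lebesgue_on {0<..<b}) v" if "b \<le> T" for b
    by (rule integrable_lebesgue_on_Ioo_mono[OF vi]) (use that in auto)
  have i': "integrable lebesgue (\<lambda>x. indicat_real {0<..<b} x * v x)" if "b \<le> T" for b
    using i[OF that] by (simp add: integrable_restrict_space)
  have eq: "integral\<^sup>L (lebesgue_on {0<..<b}) v = (\<integral>x. indicat_real {0<..<b} x * v x \<partial>lebesgue)" for b
    by (simp add: integral_restrict_space)
  have ae: "AE x in lebesgue. x \<in> {0<..<T} \<longrightarrow> 0 \<le> v x \<and> v x \<le> L"
    using v0 v(2) by (auto simp: AE_restrict_space_iff)
  have sT: "s \<le> T" using st by simp
  show "integral\<^sup>L (lebesgue_on {0<..<s}) v \<le> integral\<^sup>L (lebesgue_on {0<..<t}) v"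
    unfolding eq
  proof (rule integral_mono_AE[OF i'[OF sT] i'[OF st(3)]])
    show "AE x in lebesgue. indicat_real {0<..<s} x * v x \<le> indicat_real {0<..<t} x * v x"
      using ae by eventually_elim (use st in \<open>auto split: split_indicator\<close>)
  qed
  have "integral\<^sup>L (lebesgue_on {0<..<t}) v - integral\<^sup>L (lebesgue_on {0<..<s}) v
      = (\<integral>x. indicat_real {0<..<t} x * v x - indicat_real {0<..<s} x * v x \<partial>lebesgue)"
    unfolding eq by (rule Bochner_Integration.integral_diff[OF i'[OF st(3)] i'[OF sT], symmetric])
  also have "\<dots> \<le> (\<integral>x. L * indicat_real {s..t} x \<partial>lebesgue)"
  proof (rule integral_mono_AE)
    show "integrable lebesgue (\<lambda>x. L * indicat_real {s..t} x)"
      using lmeasurable_interval(1)[of s t] by (intro integrable_mult_right) (simp add: fmeasurable_def)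
    show "AE x in lebesgue. indicat_real {0<..<t} x * v x - indicat_real {0<..<s} x * v x \<le> L * indicat_real {s..t} x"
      using ae by eventually_elim (use st L in \<open>auto split: split_indicator\<close>)
  qed (use i'[OF st(3)] i'[OF sT] in simp)
  also have "\<dots> = L * (t - s)" using st by simp
  finally show "integral\<^sup>L (lebesgue_on {0<..<t}) v - integral\<^sup>L (lebesgue_on {0<..<s}) v \<le> L * (t - s)" .
qed

lemma C1_on_continuous:
  assumes "C1_on S f"
  shows "continuous_on S (\<lambda>(a, b). f a b)"
  unfolding continuous_on_eq_continuous_within
proof
  fix p assume p: "p \<in> S"
  obtain a b where ab: "p = (a, b)" by (cases p)
  have "\<exists>D. ((\<lambda>(s, y). f s y) has_derivative D) (at (a, b) within S)"
    using assms p ab unfolding C1_on_def C1_partials_def by fast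
  then show "continuous (at p within S) (\<lambda>(a, b). f a b)"
    unfolding ab using has_derivative_continuous by blast
qed

lemma integral_cutoff_le:
  assumes v: "v \<in> Linf_plus (lebesgue_on {0<..<b})" "AE x in lebesgue_on {0<..<b}. \<bar>v x\<bar> \<le> L" and L: "0 \<le> L" and b: "0 \<le> b"
    and p: "p \<in> borel_measurable (lebesgue_on {0<..<b})" "\<And>x. p x \<in> {0..1}"
  shows "(\<integral>x. v x * p x \<partial>lebesgue_on {0<..<b}) \<le> L * b"
proof -
  let ?M = "lebesgue_on {0<..<b}"
  interpret finite_measure ?M by (rule finite_measure_lebesgue_on_Ioo)
  have vi: "integrable ?M v" and v0: "AE x in ?M. 0 \<le> v x"
    using v(1) LinfD by (auto simp: Linf_plus_def)
  have "(\<integral>x. v x * p x \<partial>?M) \<le> (\<integral>x. L \<partial>?M)"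
  proof (rule integral_mono_AE)
    show "integrable ?M (\<lambda>x. v x * p x)"
      by (rule integrable_mult_bounded(1)[OF vi p(1), where B = 1]) (use p(2) in auto)
    show "AE x in ?M. v x * p x \<le> L"
      using v(2) v0
    proof eventually_elim
      case (elim x)
      then show ?case using mult_mono[of "v x" L "p x" 1] p(2)[of x] L by simp
    qed
  qed simp
  then show ?thesis using b by (simp add: measure_restrict_space mult.commute)
qed

section \<open>A priori bound on the mass of an arbitrary solution\<close>

context speed
begin

text \<open>The identity along the exit path bounds the mass by initial mass plus in-flux. The
  constants of the extended velocity do not appear, which permits an extension chosen in terms of
  the solution.\<close>

lemma total_mass_le_agree:
  assumes ws: "weak_solution lam T \<rho>0 v \<rho>"
    and agree: "\<And>x t. x \<in> {0..1} \<Longrightarrow> t \<in> {0..T} \<Longrightarrow> lam x (total_mass \<rho> t) = l x (total_mass \<rho> t)"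
    and v: "v \<in> Linf_plus (lebesgue_on {0<..<T})" "AE x in lebesgue_on {0<..<T}. \<bar>v x\<bar> \<le> Lu" "0 \<le> Lu"
    and \<rho>0: "\<rho>0 \<in> Linf_plus I01" "AE x in I01. \<bar>\<rho>0 x\<bar> \<le> R0" "0 \<le> R0"
    and t: "0 < t" "t \<le> T"
  shows "total_mass \<rho> t \<le> R0 + Lu * T"
proof -
  have Wc: "continuous_on {0..T} (total_mass \<rho>)"
    using ws by (intro total_mass_continuous_on) (simp add: weak_solution_def)
  interpret F: flow l lx K c C T "total_mass \<rho>" by (rule flowI[OF Wc])
  define \<xi> where "\<xi> s = F.X s (F.Z t 1)" for s
  have p: "path (total_mass \<rho>) t \<xi>" "\<xi> t = 1"
    unfolding \<xi>_def[abs_def] using path_subset[OF F.X_path t(2)] t by auto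
  have vtb: "AE x in lebesgue_on {0<..<t}. \<bar>v x\<bar> \<le> Lu" and "AE x in lebesgue_on {0<..<t}. 0 \<le> v x"
    and "v \<in> borel_measurable (lebesgue_on {0<..<t})"
    by (rule AE_lebesgue_on_Ioo_mono[OF v(2)], use t in simp_all)
       (rule AE_lebesgue_on_Ioo_mono measurable_lebesgue_on_Ioo_mono; use t v in \<open>auto simp: Linf_plus_def Linf_def\<close>)+
  then have vt: "v \<in> Linf_plus (lebesgue_on {0<..<t})"
    by (auto simp: Linf_plus_def Linf_def)
  have "total_mass \<rho> t = (\<integral>s. v s * (if 0 < \<xi> s then 1 else 0) \<partial>lebesgue_on {0<..<t}) + (\<integral>x. \<rho>0 x * (if x < \<xi> 0 then 1 else 0) \<partial>I01)"
    by (rule mass_behind_path[OF ws agree _ _ p(1) t p(2)]) (use v \<rho>0 in \<open>auto simp: Linf_plus_def\<close>)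
  also have "\<dots> \<le> Lu * t + R0 * 1"
  proof (intro add_mono integral_cutoff_le vt vtb \<rho>0 v)
    have "\<xi> \<in> borel_measurable (lebesgue_on {0<..<t})"
      by (rule continuous_on_imp_measurable_lebesgue_on[OF path_cont[OF p(1)]]) auto
    then show "(\<lambda>s. if 0 < \<xi> s then 1 else (0::real)) \<in> borel_measurable (lebesgue_on {0<..<t})" by simp
    show "(\<lambda>x. if x < \<xi> 0 then 1 else (0::real)) \<in> borel_measurable I01"
      by (rule borel_imp_measurable_lebesgue_on) simp
  qed (use t in auto)
  also have "\<dots> \<le> R0 + Lu * T" using mult_left_mono[OF t(2) v(3)] by simp
  finally show ?thesis .
qed

end

text \<open>An arbitrary solution is compared with a velocity extended up to the supremum of its own mass;
  the resulting bound on the mass no longer depends on that extension.\<close>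

lemma total_mass_le:
  assumes C1: "C1_on ({0..1} \<times> {0..}) lam"
    and pos: "\<And>x w. x \<in> {0..1} \<Longrightarrow> 0 \<le> w \<Longrightarrow> 0 < lam x w" and T: "0 < T"
    and ws: "weak_solution lam T \<rho>0 v \<rho>"
    and v: "v \<in> Linf_plus (lebesgue_on {0<..<T})" "AE x in lebesgue_on {0<..<T}. \<bar>v x\<bar> \<le> Lu" "0 \<le> Lu"
    and \<rho>0: "\<rho>0 \<in> Linf_plus I01" "AE x in I01. \<bar>\<rho>0 x\<bar> \<le> R0" "0 \<le> R0"
    and t: "0 < t" "t \<le> T"
  shows "total_mass \<rho> t \<le> R0 + Lu * T"
proof -
  let ?W = "total_mass \<rho>"
  have \<rho>c: "Lp_continuous_on {0..T} I01 1 \<rho>" and W0: "\<And>t. t \<in> {0..T} \<Longrightarrow> 0 \<le> ?W t"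
    using ws by (auto simp: weak_solution_def)
  have Wc: "continuous_on {0..T} ?W" by (rule total_mass_continuous_on[OF \<rho>c])
  have "bounded (?W ` {0..T})" by (intro compact_imp_bounded compact_continuous_image Wc) auto
  then obtain Wm where Wm: "\<And>t. t \<in> {0..T} \<Longrightarrow> \<bar>?W t\<bar> \<le> Wm" "0 < Wm" by (fastforce simp: bounded_pos)
  show ?thesis
  proof (rule speed_extension[OF C1 _ T less_imp_le[OF Wm(2)]])
    show "0 < lam x w" if "x \<in> {0..1}" "0 \<le> w" for x w by (rule pos[OF that])
    fix l lx K c C
    assume sp: "speed l lx K c C T"
      and agree: "\<And>x w. x \<in> {0..1} \<Longrightarrow> 0 \<le> w \<Longrightarrow> w \<le> Wm \<Longrightarrow> lam x w = l x w"
    have "lam x (?W s) = l x (?W s)" if "x \<in> {0..1}" "s \<in> {0..T}" for x s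
      using agree[of x "?W s"] that W0[of s] Wm(1)[of s] by auto
    then show ?thesis by (rule speed.total_mass_le_agree[OF sp ws _ v \<rho>0 t])
  qed
qed

text \<open>Forgets the density: the comparison of solutions works with a continuous
  \<open>W\<close> that satisfies conservation of mass with \<open>y\<close> and the identity along
  exit paths.\<close>

lemma outflux_mass:
  assumes C1: "C1_on ({0..1} \<times> {0..}) lam"
    and pos: "\<And>x w. x \<in> {0..1} \<Longrightarrow> 0 \<le> w \<Longrightarrow> 0 < lam x w"
    and sp: "speed l lx K c C T"
    and agree: "\<And>x w. x \<in> {0..1} \<Longrightarrow> 0 \<le> w \<Longrightarrow> w \<le> R0 + Lu * T \<Longrightarrow> lam x w = l x w"
    and v: "v \<in> Linf_plus (lebesgue_on {0<..<T})" "AE x in lebesgue_on {0<..<T}. \<bar>v x\<bar> \<le> Lu" "0 \<le> Lu"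
    and \<rho>0: "\<rho>0 \<in> Linf_plus I01" "AE x in I01. \<bar>\<rho>0 x\<bar> \<le> R0" "0 \<le> R0"
    and y: "is_outflux lam T \<rho>0 v y"
  shows "integrable (lebesgue_on {0<..<T}) y \<and> (\<exists>W. continuous_on {0..T} W \<and>
    (\<forall>\<tau>\<in>{0..T}. W \<tau> = (\<integral>x. \<rho>0 x \<partial>I01) + (\<integral>t. v t \<partial>lebesgue_on {0<..<\<tau>}) - (\<integral>t. y t \<partial>lebesgue_on {0<..<\<tau>})) \<and>
    (\<forall>\<tau> \<xi>. 0 < \<tau> \<longrightarrow> \<tau> \<le> T \<longrightarrow> speed.path l W \<tau> \<xi> \<longrightarrow> \<xi> \<tau> = 1 \<longrightarrow>
      W \<tau> = (\<integral>t. v t * (if 0 < \<xi> t then 1 else 0) \<partial>lebesgue_on {0<..<\<tau>}) + (\<integral>x. \<rho>0 x * (if x < \<xi> 0 then 1 else 0) \<partial>I01)))"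
proof -
  obtain \<rho> r where ws: "weak_solution lam T \<rho>0 v \<rho>"
    and ae: "AE (t, x) in lebesgue_on ({0<..<T} \<times> {0<..<1}). r t x = \<rho> t x"
    and r: "\<forall>q\<ge>1. Lp_continuous_on {0..1} (lebesgue_on {0<..<T}) q (\<lambda>x t. r t x)"
    and y: "y = (\<lambda>t. r t 1 * lam 1 (total_mass \<rho> t))"
    using y unfolding is_outflux_def by blast
  have T: "0 < T" by (rule speed.T_pos[OF sp])
  have \<rho>c: "Lp_continuous_on {0..T} I01 1 \<rho>" and W0: "\<And>t. t \<in> {0..T} \<Longrightarrow> 0 \<le> total_mass \<rho> t"
    using ws by (auto simp: weak_solution_def)
  have vL: "v \<in> Linf (lebesgue_on {0<..<T})" and \<rho>L: "\<rho>0 \<in> Linf I01"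
    using v \<rho>0 by (auto simp: Linf_plus_def)
  have r1: "Lp_continuous_on {0..1} (lebesgue_on {0<..<T}) 1 (\<lambda>x t. r t x)" using r by simp
  note bal = outflux_balance[OF ws C1_on_continuous[OF C1] vL \<rho>L T ae r1]
  \<comment> \<open>Time zero is treated through conservation of mass, since
    \<open>total_mass_le\<close> speaks of positive times.\<close>
  have "(\<integral>x. \<rho>0 x * 1 \<partial>I01) \<le> R0 * 1"
    by (rule integral_cutoff_le[OF \<rho>0]) auto
  then have "total_mass \<rho> 0 \<le> R0" using bal(2)[of 0] T by simp
  moreover have "0 \<le> Lu * T" using v(3) T by simp
  ultimately have Wle: "total_mass \<rho> t \<le> R0 + Lu * T" if "t \<in> {0..T}" for t
    using total_mass_le[OF C1 pos T ws v \<rho>0, of t] that by (cases "t = 0") auto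
  have ag: "lam x (total_mass \<rho> t) = l x (total_mass \<rho> t)" if "x \<in> {0..1}" "t \<in> {0..T}" for x t
    by (rule agree[OF that(1) W0[OF that(2)] Wle[OF that(2)]])
  show ?thesis
  proof (intro conjI exI[of _ "total_mass \<rho>"] ballI allI impI)
    show "integrable (lebesgue_on {0<..<T}) y" unfolding y by (rule bal(1))
    show "continuous_on {0..T} (total_mass \<rho>)" by (rule total_mass_continuous_on[OF \<rho>c])
    show "total_mass \<rho> \<tau> = (\<integral>x. \<rho>0 x \<partial>I01) + (\<integral>t. v t \<partial>lebesgue_on {0<..<\<tau>}) - (\<integral>t. y t \<partial>lebesgue_on {0<..<\<tau>})"
      if "\<tau> \<in> {0..T}" for \<tau> unfolding y by (rule bal(2)[OF that])
    show "total_mass \<rho> \<tau> = (\<integral>t. v t * (if 0 < \<xi> t then 1 else 0) \<partial>lebesgue_on {0<..<\<tau>}) + (\<integral>x. \<rho>0 x * (if x < \<xi> 0 then 1 else 0) \<partial>I01)"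
      if "0 < \<tau>" "\<tau> \<le> T" "speed.path l (total_mass \<rho>) \<tau> \<xi>" "\<xi> \<tau> = 1" for \<tau> \<xi>
      by (rule speed.mass_behind_path[OF sp ws ag vL \<rho>L that(3,1,2,4)])
  qed
qed

text \<open>The primitive of the out-flux is the initial mass plus that of the in-flux minus
  \<open>W\<close>: the in-flux contributes \<open>\<delta>\<close>, the mass the exponential term.
  With \<open>\<delta> = 0\<close> this is uniqueness of the out-flux.\<close>

lemma outflux_stability:
  assumes C1: "C1_on ({0..1} \<times> {0..}) lam"
    and pos: "\<And>x w. x \<in> {0..1} \<Longrightarrow> 0 \<le> w \<Longrightarrow> 0 < lam x w"
    and sp: "speed l lx K c C T"
    and agree: "\<And>x w. x \<in> {0..1} \<Longrightarrow> 0 \<le> w \<Longrightarrow> w \<le> R0 + Lu * T \<Longrightarrow> lam x w = l x w"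
    and u: "u \<in> Linf_plus (lebesgue_on {0<..<T})" "AE x in lebesgue_on {0<..<T}. \<bar>u x\<bar> \<le> Lu"
    and v: "v \<in> Linf_plus (lebesgue_on {0<..<T})" "AE x in lebesgue_on {0<..<T}. \<bar>v x\<bar> \<le> Lu" and Lu: "0 \<le> Lu"
    and \<rho>0: "\<rho>0 \<in> Linf_plus I01" "AE x in I01. \<bar>\<rho>0 x\<bar> \<le> R0" "0 \<le> R0"
    and y: "is_outflux lam T \<rho>0 u y" and z: "is_outflux lam T \<rho>0 v z"
    and \<delta>: "\<And>t. t \<in> {0..T} \<Longrightarrow> \<bar>(\<integral>s. u s \<partial>lebesgue_on {0<..<t}) - (\<integral>s. v s \<partial>lebesgue_on {0<..<t})\<bar> \<le> \<delta>"
    and t: "t \<in> {0..T}"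
  shows "\<bar>(\<integral>s. y s \<partial>lebesgue_on {0<..<t}) - (\<integral>s. z s \<partial>lebesgue_on {0<..<t})\<bar>
    \<le> \<delta> * (1 + 2 * exp (speed.QC K c T Lu R0 * T))"
proof -
  obtain W1 where W1: "continuous_on {0..T} W1"
    "\<And>\<tau>. \<tau> \<in> {0..T} \<Longrightarrow> W1 \<tau> = (\<integral>x. \<rho>0 x \<partial>I01) + (\<integral>t. u t \<partial>lebesgue_on {0<..<\<tau>}) - (\<integral>t. y t \<partial>lebesgue_on {0<..<\<tau>})"
    "\<And>\<tau> \<xi>. 0 < \<tau> \<Longrightarrow> \<tau> \<le> T \<Longrightarrow> speed.path l W1 \<tau> \<xi> \<Longrightarrow> \<xi> \<tau> = 1 \<Longrightarrow>
      W1 \<tau> = (\<integral>t. u t * (if 0 < \<xi> t then 1 else 0) \<partial>lebesgue_on {0<..<\<tau>}) + (\<integral>x. \<rho>0 x * (if x < \<xi> 0 then 1 else 0) \<partial>I01)"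
    using outflux_mass[OF C1 pos sp agree u Lu \<rho>0 y] by blast
  obtain W2 where W2: "continuous_on {0..T} W2"
    "\<And>\<tau>. \<tau> \<in> {0..T} \<Longrightarrow> W2 \<tau> = (\<integral>x. \<rho>0 x \<partial>I01) + (\<integral>t. v t \<partial>lebesgue_on {0<..<\<tau>}) - (\<integral>t. z t \<partial>lebesgue_on {0<..<\<tau>})"
    "\<And>\<tau> \<xi>. 0 < \<tau> \<Longrightarrow> \<tau> \<le> T \<Longrightarrow> speed.path l W2 \<tau> \<xi> \<Longrightarrow> \<xi> \<tau> = 1 \<Longrightarrow>
      W2 \<tau> = (\<integral>t. v t * (if 0 < \<xi> t then 1 else 0) \<partial>lebesgue_on {0<..<\<tau>}) + (\<integral>x. \<rho>0 x * (if x < \<xi> 0 then 1 else 0) \<partial>I01)"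
    using outflux_mass[OF C1 pos sp agree v Lu \<rho>0 z] by blast
  have L: "u \<in> Linf (lebesgue_on {0<..<T})" "v \<in> Linf (lebesgue_on {0<..<T})" "\<rho>0 \<in> borel_measurable I01"
    using u v \<rho>0 by (auto simp: Linf_plus_def Linf_def)
  have W0: "W1 0 = W2 0" using W1(2)[of 0] W2(2)[of 0] speed.T_pos[OF sp] by simp
  have "\<bar>W1 t - W2 t\<bar> \<le> 2 * \<delta> * exp (speed.QC K c T Lu R0 * T)"
    by (rule speed.mass_stability[OF sp L(1) u(2) Lu L(2,3) \<rho>0(2,3) W1(1) W2(1) W0 W1(3) W2(3) \<delta> t])
  then show ?thesis using W1(2)[OF t] W2(2)[OF t] \<delta>[OF t] by (simp add: algebra_simps)
qed

text \<open>\<open>outflux\<close> is an arbitrary choice. Existence makes it a genuine out-flux,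
  and stability with \<open>\<delta> = 0\<close> identifies it almost everywhere with the explicit
  one, whose bound it inherits.\<close>

lemma outflux_is_outflux_bounded:
  assumes C1: "C1_on ({0..1} \<times> {0..}) lam"
    and pos: "\<And>x w. x \<in> {0..1} \<Longrightarrow> 0 \<le> w \<Longrightarrow> 0 < lam x w"
    and sp: "speed l lx K c C T"
    and agree: "\<And>x w. x \<in> {0..1} \<Longrightarrow> 0 \<le> w \<Longrightarrow> w \<le> R0 + Lu * T \<Longrightarrow> lam x w = l x w"
    and u: "u \<in> Linf_plus (lebesgue_on {0<..<T})" "AE x in lebesgue_on {0<..<T}. \<bar>u x\<bar> \<le> Lu" "0 \<le> Lu"
    and \<rho>0: "\<rho>0 \<in> Linf_plus I01" "AE x in I01. \<bar>\<rho>0 x\<bar> \<le> R0" "0 \<le> R0"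
  shows "is_outflux lam T \<rho>0 u (outflux lam T \<rho>0 u)"
    "integrable (lebesgue_on {0<..<T}) (outflux lam T \<rho>0 u)"
    "AE t in lebesgue_on {0<..<T}. \<bar>outflux lam T \<rho>0 u t\<bar> \<le> max R0 (Lu * speed.E K T / c) * speed.E K T * C"
proof -
  obtain y where y: "is_outflux lam T \<rho>0 u y"
    "\<And>t. t \<in> {0<..<T} \<Longrightarrow> \<bar>y t\<bar> \<le> max R0 (Lu * speed.E K T / c) * speed.E K T * C"
    using speed.outflux_exists[OF sp agree u \<rho>0 order_refl] by blast
  show 1: "is_outflux lam T \<rho>0 u (outflux lam T \<rho>0 u)"
    unfolding outflux_def by (rule someI[of "is_outflux lam T \<rho>0 u", OF y(1)])
  show i: "integrable (lebesgue_on {0<..<T}) (outflux lam T \<rho>0 u)"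
    using outflux_mass[OF C1 pos sp agree u \<rho>0 1] by blast
  have yi: "integrable (lebesgue_on {0<..<T}) y"
    using outflux_mass[OF C1 pos sp agree u \<rho>0 y(1)] by blast
  have T: "0 \<le> T" using speed.T_pos[OF sp] by simp
  have "AE t in lebesgue_on {0<..<T}. outflux lam T \<rho>0 u t - y t = 0"
  proof (rule AE_zero_of_primitive_zero[OF Bochner_Integration.integrable_diff[OF i yi] T])
    fix s assume s: "s \<in> {0..T}"
    have si: "integrable (lebesgue_on {0<..<s}) (outflux lam T \<rho>0 u)" "integrable (lebesgue_on {0<..<s}) y"
      by (rule integrable_lebesgue_on_Ioo_mono[OF i], use s in simp_all)
         (rule integrable_lebesgue_on_Ioo_mono[OF yi], use s in simp_all)
    have "\<bar>(\<integral>t. outflux lam T \<rho>0 u t \<partial>lebesgue_on {0<..<s}) - (\<integral>t. y t \<partial>lebesgue_on {0<..<s})\<bar> \<le> 0 * (1 + 2 * exp (speed.QC K c T Lu R0 * T))"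
      by (rule outflux_stability[OF C1 pos sp agree u(1,2) u \<rho>0 1 y(1) _ s]) auto
    then show "(\<integral>t. outflux lam T \<rho>0 u t - y t \<partial>lebesgue_on {0<..<s}) = 0" using si by simp
  qed
  then show "AE t in lebesgue_on {0<..<T}. \<bar>outflux lam T \<rho>0 u t\<bar> \<le> max R0 (Lu * speed.E K T / c) * speed.E K T * C"
    using AE_space[of "lebesgue_on {0<..<T}"]
  proof eventually_elim
    case (elim t)
    then show ?case using y(2)[of t] by simp
  qed
qed

subsection \<open>Minimizing sequences\<close>

text \<open>Arzela and Ascoli, with the uniform distances returned as one null sequence
  \<open>\<delta>\<close>, the form in which \<open>outflux_stability\<close> takes them.\<close>

lemma Lipschitz_subsequence:
  fixes U :: "nat \<Rightarrow> real \<Rightarrow> real"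
  assumes U0: "\<And>n. U n 0 = 0" and T: "0 \<le> T" and L: "0 \<le> L"
    and U: "\<And>n s t. 0 \<le> s \<Longrightarrow> s \<le> t \<Longrightarrow> t \<le> T \<Longrightarrow> \<bar>U n t - U n s\<bar> \<le> L * (t - s)"
  obtains V k \<delta> where "strict_mono (k :: nat \<Rightarrow> nat)" "\<delta> \<longlonglongrightarrow> (0::real)"
    "\<And>n t. t \<in> {0..T} \<Longrightarrow> \<bar>U (k n) t - V t\<bar> \<le> \<delta> n"
proof -
  have Lip: "\<bar>U n s - U n t\<bar> \<le> L * \<bar>s - t\<bar>" if "s \<in> {0..T}" "t \<in> {0..T}" for n s t
    using U[of s t n] U[of t s n] that by (cases "s \<le> t") (auto simp: abs_minus_commute)
  obtain V k where k: "strict_mono (k :: nat \<Rightarrow> nat)"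
    "\<And>e. 0 < e \<Longrightarrow> \<exists>N. \<forall>n x. n \<ge> N \<and> x \<in> {0..T} \<longrightarrow> norm (U (k n) x - V x) < e"
  proof (rule Arzela_Ascoli[of "{0..T}" U "L * T"])
    show "norm (U n x) \<le> L * T" if "x \<in> {0..T}" for n x
      using Lip[OF that, of 0 n] that T mult_left_mono[of x T L] L by (auto simp: U0)
    show "\<exists>d>0. \<forall>n y. y \<in> {0..T} \<and> norm (x - y) < d \<longrightarrow> norm (U n x - U n y) < e"
      if x: "x \<in> {0..T}" and e: "0 < e" for x e
    proof (intro exI[of _ "e / (L + 1)"] conjI allI impI)
      fix n y assume y: "y \<in> {0..T} \<and> norm (x - y) < e / (L + 1)"
      have "\<bar>U n x - U n y\<bar> \<le> (L + 1) * \<bar>x - y\<bar>"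
        using Lip[OF x, of y n] y by (smt (verit) mult_right_mono abs_ge_zero)
      also have "\<dots> < e" using y L by (simp add: pos_less_divide_eq mult.commute)
      finally show "norm (U n x - U n y) < e" by simp
    qed (use e L in simp)
  qed auto
  define \<delta> where "\<delta> n = (SUP t\<in>{0..T}. \<bar>U (k n) t - V t\<bar>)" for n
  have conv: "(\<lambda>n. U (k n) t) \<longlonglongrightarrow> V t" if "t \<in> {0..T}" for t
    using k(2) that by (intro LIMSEQ_I) blast
  \<comment> \<open>The limit inherits the bound \<open>L * T\<close> of the sequence, so the
    supremum defining \<open>\<delta>\<close> is over a bounded set.\<close>
  have bdd: "bdd_above ((\<lambda>t. \<bar>U (k n) t - V t\<bar>) ` {0..T})" for n
  proof (rule bdd_aboveI2)
    fix t assume t: "t \<in> {0..T}"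
    have U: "\<bar>U j t\<bar> \<le> L * T" for j
      using Lip[OF t, of 0 j] t T mult_left_mono[of t T L] L by (auto simp: U0)
    have "\<bar>V t\<bar> \<le> L * T"
      by (rule LIMSEQ_le_const2[OF tendsto_rabs[OF conv[OF t]]]) (use U in auto)
    then show "\<bar>U (k n) t - V t\<bar> \<le> 2 * (L * T)" using U[of "k n"] by linarith
  qed
  have ub: "\<bar>U (k n) t - V t\<bar> \<le> \<delta> n" if "t \<in> {0..T}" for n t
    unfolding \<delta>_def by (rule cSUP_upper[OF that bdd])
  have "\<delta> \<longlonglongrightarrow> 0"
  proof (rule LIMSEQ_I)
    fix e :: real assume "0 < e"
    then obtain N where N: "\<And>n x. n \<ge> N \<Longrightarrow> x \<in> {0..T} \<Longrightarrow> \<bar>U (k n) x - V x\<bar> < e / 2"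
      using k(2)[of "e / 2"] by auto
    have "norm (\<delta> n - 0) < e" if "n \<ge> N" for n
    proof -
      have "\<delta> n \<le> e / 2"
        unfolding \<delta>_def using N[OF that] T by (intro cSUP_least) (auto intro: less_imp_le)
      moreover have "0 \<le> \<delta> n" using ub[of 0 n] T by simp
      ultimately show ?thesis using \<open>0 < e\<close> by simp
    qed
    then show "\<exists>N. \<forall>n\<ge>N. norm (\<delta> n - 0) < e" by blast
  qed
  then show thesis using that[OF k(1)] ub by blast
qed

text \<open>The common bound \<open>Lu\<close> allows one extension of the velocity, with one set of
  constants, for the whole sequence and its limit. Convergence of in-flux primitives passes to the
  out-flux primitives with the factor \<open>Q\<close>, and the uniform bound \<open>B\<close>
  upgrades it to weak convergence.\<close>

lemma outflux_cost_lsc: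
  assumes C1: "C1_on ({0..1} \<times> {0..}) lam"
    and pos: "\<And>x w. x \<in> {0..1} \<Longrightarrow> 0 \<le> w \<Longrightarrow> 0 < lam x w" and T: "0 < T" and p: "1 \<le> p"
    and yd: "yd \<in> Linf (lebesgue_on {0<..<T})" and \<rho>0: "\<rho>0 \<in> Linf_plus I01"
    and u: "\<And>n. u n \<in> Linf_plus (lebesgue_on {0<..<T})" "\<And>n. AE x in lebesgue_on {0<..<T}. \<bar>u n x\<bar> \<le> Lu"
    and v: "v \<in> Linf_plus (lebesgue_on {0<..<T})" "AE x in lebesgue_on {0<..<T}. \<bar>v x\<bar> \<le> Lu" and Lu: "0 \<le> Lu"
    and \<delta>: "\<And>n t. t \<in> {0..T} \<Longrightarrow> \<bar>(\<integral>s. u n s \<partial>lebesgue_on {0<..<t}) - (\<integral>s. v s \<partial>lebesgue_on {0<..<t})\<bar> \<le> \<delta> n"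
      "\<delta> \<longlonglongrightarrow> 0"
    and lim: "(\<lambda>n. Lp_norm (lebesgue_on {0<..<T}) p (\<lambda>t. outflux lam T \<rho>0 (u n) t - yd t)) \<longlonglongrightarrow> \<beta>"
  shows "Lp_norm (lebesgue_on {0<..<T}) p (\<lambda>t. outflux lam T \<rho>0 v t - yd t) \<le> \<beta>"
proof -
  let ?M = "lebesgue_on {0<..<T}" and ?y = "outflux lam T \<rho>0"
  obtain R where "AE x in I01. \<bar>\<rho>0 x\<bar> \<le> R" using \<rho>0 by (auto simp: Linf_plus_def Linf_def)
  then have R0: "AE x in I01. \<bar>\<rho>0 x\<bar> \<le> max 0 R" "0 \<le> max 0 R" by (auto elim: eventually_mono)
  define R0 where "R0 = max 0 R"
  note r = \<rho>0 R0[folded R0_def]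
  obtain Cd where Cd: "AE x in ?M. \<bar>yd x\<bar> \<le> Cd" and ydm: "yd \<in> borel_measurable ?M"
    using yd by (auto simp: Linf_def)
  have Wm: "0 \<le> R0 + Lu * T" using r(3) Lu T by simp
  show ?thesis
  proof (rule speed_extension[OF C1 _ T Wm])
    show "0 < lam x w" if "x \<in> {0..1}" "0 \<le> w" for x w by (rule pos[OF that])
    fix l lx K c C
    assume sp: "speed l lx K c C T"
      and agree: "\<And>x w. x \<in> {0..1} \<Longrightarrow> 0 \<le> w \<Longrightarrow> w \<le> R0 + Lu * T \<Longrightarrow> lam x w = l x w"
    define B where "B = max R0 (Lu * speed.E K T / c) * speed.E K T * C"
    define Q where "Q = 1 + 2 * exp (speed.QC K c T Lu R0 * T)"
    have b: "is_outflux lam T \<rho>0 w (?y w)" "integrable ?M (?y w)" "AE t in ?M. \<bar>?y w t\<bar> \<le> B"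
      if "w \<in> Linf_plus ?M" "AE x in ?M. \<bar>w x\<bar> \<le> Lu" for w
      using outflux_is_outflux_bounded[OF C1 pos sp agree that Lu r] by (simp_all add: B_def)
    note bu = b[OF u] and bv = b[OF v]
    have meas: "?y (u n) \<in> borel_measurable ?M" "?y v \<in> borel_measurable ?M" for n
      using bu(2) bv(2) by (auto intro: borel_measurable_integrable)
    have prim: "(\<lambda>n. \<integral>t. ?y (u n) t - ?y v t \<partial>lebesgue_on {0<..<s}) \<longlonglongrightarrow> 0" if s: "s \<in> {0..T}" for s
    proof (rule Lim_null_comparison[where g = "\<lambda>n. \<delta> n * Q"])
      have "\<bar>\<integral>t. ?y (u n) t - ?y v t \<partial>lebesgue_on {0<..<s}\<bar> \<le> \<delta> n * Q" for n
      proof -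
        have "integrable (lebesgue_on {0<..<s}) (?y (u n))" "integrable (lebesgue_on {0<..<s}) (?y v)"
          by (rule integrable_lebesgue_on_Ioo_mono[OF bu(2)], use s in simp_all)
             (rule integrable_lebesgue_on_Ioo_mono[OF bv(2)], use s in simp_all)
        then show ?thesis
          using outflux_stability[OF C1 pos sp agree u v Lu r bu(1) bv(1) \<delta>(1) s] by (simp add: Q_def)
      qed
      then show "\<forall>\<^sub>F n in sequentially. norm (\<integral>t. ?y (u n) t - ?y v t \<partial>lebesgue_on {0<..<s}) \<le> \<delta> n * Q" by simp
      show "(\<lambda>n. \<delta> n * Q) \<longlonglongrightarrow> 0" using \<delta>(2) by (rule tendsto_mult_left_zero)
    qed
    show ?thesis
    proof (rule Lp_norm_weak_lsc[OF finite_measure_lebesgue_on_Ioo p _ _ _ _ _ lim, where B = "B + Cd"])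
      show "(\<lambda>t. ?y (u n) t - yd t) \<in> borel_measurable ?M" for n using meas ydm by simp
      show "(\<lambda>t. ?y v t - yd t) \<in> borel_measurable ?M" using meas ydm by simp
      show "AE x in ?M. \<bar>?y (u n) x - yd x\<bar> \<le> B + Cd" for n
        using bu(3)[of n] Cd by eventually_elim linarith
      show "AE x in ?M. \<bar>?y v x - yd x\<bar> \<le> B + Cd"
        using bv(3) Cd by eventually_elim linarith
      show "(\<lambda>n. \<integral>x. k x * (?y (u n) x - yd x - (?y v x - yd x)) \<partial>?M) \<longlonglongrightarrow> 0" if "integrable ?M k" for k
      proof -
        have "(\<lambda>n. \<integral>x. k x * (?y (u n) x - ?y v x) \<partial>?M) \<longlonglongrightarrow> 0"
        proof (rule primitives_tendsto_imp_weakly_tendsto[OF _ _ prim T that, where B = "2 * B"])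
          show "(\<lambda>x. ?y (u n) x - ?y v x) \<in> borel_measurable ?M" for n using meas by simp
          show "AE x in ?M. \<bar>?y (u n) x - ?y v x\<bar> \<le> 2 * B" for n
            using bu(3)[of n] bv(3) by eventually_elim linarith
        qed
        then show ?thesis by simp
      qed
    qed
  qed
qed

theorem theorem5p1:
  fixes lam :: "real \<Rightarrow> real \<Rightarrow> real" and T p :: real and yd \<rho>0 :: "real \<Rightarrow> real"
  assumes "C1_on ({0..1} \<times> {0..}) lam"
    and "\<And>x w. x \<in> {0..1} \<Longrightarrow> 0 \<le> w \<Longrightarrow> 0 < lam x w"
    and "0 < T" and "1 \<le> p"
    and "yd \<in> Linf (lebesgue_on {0<..<T})"
    and "\<rho>0 \<in> Linf_plus (lebesgue_on {0<..<1})"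
  shows "\<exists>u_inf \<in> Linf_plus (lebesgue_on {0<..<T}).
    cost lam T \<rho>0 yd p u_inf = (INF u \<in> Linf_plus (lebesgue_on {0<..<T}). cost lam T \<rho>0 yd p u)"
proof -
  let ?M = "lebesgue_on {0<..<T}"
  let ?S = "Linf_plus ?M" and ?J = "cost lam T \<rho>0 yd p"
  define a where "a v = Linf_norm ?M v" for v
  define b where "b v = Lp_norm ?M p (\<lambda>t. outflux lam T \<rho>0 v t - yd t)" for v
  define m where "m = (INF v\<in>?S. ?J v)"
  have J: "?J v = (a v)\<^sup>2 + (b v)\<^sup>2" for v by (simp add: cost_def a_def b_def)
  have M: "emeasure ?M (space ?M) \<noteq> 0" using assms(3) by (simp add: emeasure_restrict_space)
  have ne: "?S \<noteq> {}"
  proof -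
    have "(\<lambda>_. 0) \<in> ?S" by (auto simp: Linf_plus_def Linf_def intro!: exI[of _ 0])
    then show ?thesis by blast
  qed
  have bdd: "bdd_below (?J ` ?S)" by (rule bdd_belowI2[of _ 0]) (simp add: J)
  have m0: "0 \<le> m" unfolding m_def by (rule cINF_greatest[OF ne]) (simp add: J)
  note norms = Linf_norm_bounds[OF _ M, folded a_def]
  have b0: "0 \<le> b v" for v by (simp add: b_def Lp_norm_def)
  have "\<exists>v\<in>?S. ?J v < m + 1 / Suc n" for n
    using cINF_less_iff[OF ne bdd, of "m + 1 / Suc n"] by (simp add: m_def)
  then obtain u where u: "\<And>n. u n \<in> ?S" "\<And>n. ?J (u n) < m + 1 / Suc n" by metis
  have uL: "u n \<in> Linf ?M" for n using u(1) by (simp add: Linf_plus_def)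
  \<comment> \<open>All costs in the sequence are below \<open>m + 1\<close>, and each squared norm
    is at most the cost.\<close>
  define Lu where "Lu = sqrt (m + 1)"
  have Lu0: "0 \<le> Lu" using m0 by (simp add: Lu_def)
  have ab: "a (u n) \<le> Lu" "b (u n) \<le> Lu" for n
  proof -
    have "1 / real (Suc n) \<le> 1" by simp
    then have "(a (u n))\<^sup>2 \<le> m + 1" "(b (u n))\<^sup>2 \<le> m + 1"
      using u(2)[of n] zero_le_power2[of "a (u n)"] zero_le_power2[of "b (u n)"] unfolding J by linarith+
    then show "a (u n) \<le> Lu" "b (u n) \<le> Lu" unfolding Lu_def by (auto intro: real_le_rsqrt)
  qed
  define U where "U n t = (\<integral>s. u n s \<partial>lebesgue_on {0<..<t})" for n t
  have U: "U n s \<le> U n t \<and> U n t - U n s \<le> a (u n) * (t - s)" if "0 \<le> s" "s \<le> t" "t \<le> T" for n s t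
    unfolding U_def
    using integral_primitive_bounds[OF u(1) norms(2)[OF uL] norms(1)[OF uL] that, of n] by blast
  obtain V k \<delta> where k: "strict_mono (k :: nat \<Rightarrow> nat)" "\<delta> \<longlonglongrightarrow> 0"
    and V: "\<And>n t. t \<in> {0..T} \<Longrightarrow> \<bar>U (k n) t - V t\<bar> \<le> \<delta> n"
  proof (rule Lipschitz_subsequence[of U T Lu])
    show "\<bar>U n t - U n s\<bar> \<le> Lu * (t - s)" if "0 \<le> s" "s \<le> t" "t \<le> T" for n s t
      using U[OF that, of n] mult_right_mono[OF ab(1)[of n], of "t - s"] that by linarith
  qed (use assms(3) Lu0 in \<open>auto simp: U_def\<close>)
  \<comment> \<open>A further subsequence, taken for the pair, makes both norms converge; the limit
    of the cost can then be split into its two terms.\<close>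
  have "bounded (range (\<lambda>n. (a (u (k n)), b (u (k n)))))"
  proof (rule bounded_subset)
    show "bounded ({0..Lu} \<times> {0..Lu})" by (intro bounded_Times) auto
    show "range (\<lambda>n. (a (u (k n)), b (u (k n)))) \<subseteq> {0..Lu} \<times> {0..Lu}"
      using norms(1)[OF uL] b0 ab by auto
  qed
  then obtain q j where j: "strict_mono (j :: nat \<Rightarrow> nat)" and q: "((\<lambda>n. (a (u (k n)), b (u (k n)))) \<circ> j) \<longlonglongrightarrow> q"
    using bounded_imp_convergent_subsequence by blast
  define \<sigma> where "\<sigma> n = k (j n)" for n
  obtain \<alpha> \<beta> where "q = (\<alpha>, \<beta>)" by (cases q)
  then have lims: "(\<lambda>n. a (u (\<sigma> n))) \<longlonglongrightarrow> \<alpha>" "(\<lambda>n. b (u (\<sigma> n))) \<longlonglongrightarrow> \<beta>"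
    using tendsto_fst[OF q] tendsto_snd[OF q] by (simp_all add: \<sigma>_def o_def)
  have \<delta>: "\<bar>U (\<sigma> n) t - V t\<bar> \<le> \<delta> (j n)" "(\<lambda>n. \<delta> (j n)) \<longlonglongrightarrow> 0" if "t \<in> {0..T}" for n t
    using V[OF that] LIMSEQ_subseq_LIMSEQ[OF k(2) j] by (auto simp: \<sigma>_def o_def)
  have UV: "(\<lambda>n. U (\<sigma> n) t) \<longlonglongrightarrow> V t" if "t \<in> {0..T}" for t
    using Lim_null_comparison[of "\<lambda>n. U (\<sigma> n) t - V t" "\<lambda>n. \<delta> (j n)" sequentially] \<delta>[OF that]
    by (simp add: LIM_zero_iff)
  \<comment> \<open>The Lipschitz constant of the limit is the limit \<open>\<alpha>\<close> of the
    norms, not the cruder \<open>Lu\<close>; this is the lower semicontinuity of the first term of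
    the cost.\<close>
  have "V s \<le> V t \<and> V t - V s \<le> \<alpha> * (t - s)" if st: "0 \<le> s" "s \<le> t" "t \<le> T" for s t
  proof
    have s: "s \<in> {0..T}" "t \<in> {0..T}" using st by auto
    show "V s \<le> V t"
      by (rule LIMSEQ_le[OF UV[OF s(1)] UV[OF s(2)]]) (use U[OF st] in auto)
    show "V t - V s \<le> \<alpha> * (t - s)"
      by (rule LIMSEQ_le[OF tendsto_diff[OF UV[OF s(2)] UV[OF s(1)]] tendsto_mult_right[OF lims(1)]]) (use U[OF st] in auto)
  qed
  moreover have "V 0 = 0"
    using LIMSEQ_unique[OF UV[of 0]] assms(3) by (simp add: U_def)
  ultimately obtain v where v: "v \<in> borel_measurable borel" "\<And>x. 0 \<le> v x \<and> v x \<le> \<alpha>"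
    "\<And>t. t \<in> {0..T} \<Longrightarrow> integral\<^sup>L (lebesgue_on {0<..<t}) v = V t"
    using Lipschitz_mono_density[OF _ _ assms(3), of V \<alpha>] by blast
  have vm: "v \<in> borel_measurable ?M" by (rule borel_imp_measurable_lebesgue_on[OF v(1)])
  have vS: "v \<in> ?S" using vm v(2) by (auto simp: Linf_plus_def Linf_def intro!: exI[of _ \<alpha>])
  have a\<alpha>: "a v \<le> \<alpha>"
    by (rule norms(3)) (use vS v(2) in \<open>auto simp: Linf_plus_def\<close>)
  have \<alpha>Lu: "\<alpha> \<le> Lu" by (rule LIMSEQ_le_const2[OF lims(1)]) (use ab in auto)
  have b\<beta>: "b v \<le> \<beta>"
    unfolding b_def
  proof (rule outflux_cost_lsc[OF assms _ _ vS _ Lu0 _ \<delta>(2) lims(2)[unfolded b_def]])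
    show "u (\<sigma> n) \<in> ?S" for n by (rule u)
    show "AE x in ?M. \<bar>u (\<sigma> n) x\<bar> \<le> Lu" for n
      using norms(2)[OF uL, of "\<sigma> n"] by eventually_elim (use ab(1)[of "\<sigma> n"] in linarith)
    show "AE x in ?M. \<bar>v x\<bar> \<le> Lu"
    proof (rule AE_I2)
      show "\<bar>v x\<bar> \<le> Lu" for x using v(2)[of x] \<alpha>Lu by simp
    qed
    show "\<bar>(\<integral>s. u (\<sigma> n) s \<partial>lebesgue_on {0<..<t}) - (\<integral>s. v s \<partial>lebesgue_on {0<..<t})\<bar> \<le> \<delta> (j n)" if "t \<in> {0..T}" for n t
      using \<delta>(1)[OF that] v(3)[OF that] by (simp add: U_def)
    show "0 \<in> {0..T}" using assms(3) by simp
  qed auto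
  \<comment> \<open>The costs along the subsequence are below
    \<open>m + 1 / Suc (\<sigma> n)\<close>, which tends to \<open>m\<close>; as both norms of
    \<open>v\<close> are at most the limits, \<open>v\<close> is a minimizer.\<close>
  have "\<alpha>\<^sup>2 + \<beta>\<^sup>2 \<le> m + 0"
  proof (rule LIMSEQ_le[OF tendsto_add[OF tendsto_power[OF lims(1)] tendsto_power[OF lims(2)]]])
    have "strict_mono \<sigma>" using strict_mono_o[OF k(1) j] by (simp add: \<sigma>_def[abs_def] o_def)
    from LIMSEQ_subseq_LIMSEQ[OF LIMSEQ_inverse_real_of_nat this]
    show "(\<lambda>n. m + 1 / Suc (\<sigma> n)) \<longlonglongrightarrow> m + 0"
      by (intro tendsto_add tendsto_const) (simp add: o_def inverse_eq_divide)
    show "\<exists>N. \<forall>n\<ge>N. (a (u (\<sigma> n)))\<^sup>2 + (b (u (\<sigma> n)))\<^sup>2 \<le> m + 1 / Suc (\<sigma> n)"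
      using u(2) unfolding J by (auto intro: less_imp_le)
  qed
  moreover have "?J v \<le> \<alpha>\<^sup>2 + \<beta>\<^sup>2"
    unfolding J using a\<alpha> b\<beta> b0[of v] norms(1)[of v] vS by (intro add_mono power_mono) (auto simp: Linf_plus_def)
  moreover have "m \<le> ?J v" unfolding m_def by (rule cINF_lower[OF bdd vS])
  ultimately have "?J v = m" by simp
  then show ?thesis using vS unfolding m_def by blast
qed

end
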